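(* Let $\mathfrak A$ be a (unital) commutative, separated, sequentially complete polymetric ring. Then $\mathcal G_{\mathbb N}(\mathfrak A)$ with the operations $\tilde+,\tilde-,\tilde0,\tilde\otimes$ (and $\tilde1$ in the unital case) defined in the context is a (unital) commutative "strong polynomial" algebraic $H$-ring. That is: (1) the following identities hold up to smooth algebraic homotopy $\simeq_{\mathrm{sm\,alg}}$, as relations between maps $\mathcal G_{\mathbb N}(\mathfrak A)\times\dots\times\mathcal G_{\mathbb N}(\mathfrak A)\to\mathcal G_{\mathbb N}(\mathfrak A)$ in the variables $x,y,z$: $(x\tilde+y)\tilde+z\simeq x\tilde+(y\tilde+z)$, $x\tilde+y\simeq y\tilde+x$, $x\tilde+\tilde0\simeq x$, $x\tilde+(\tilde-x)\simeq\tilde0$, $(x\tilde\otimes y)\tilde\otimes z\simeq x\tilde\otimes(y\tilde\otimes z)$, $x\tilde\otimes y\simeq y\tilde\otimes x$, $x\tilde\otimes(y\tilde+z)\simeq(x\tilde\otimes y)\tilde+(x\tilde\otimes z)$, $(x\tilde+y)\tilde\otimes z\simeq(x\tilde\otimes z)\tilde+(y\tilde\otimes z)$, and, if $\mathfrak A$ is unital, $x\tilde\otimes\tilde1\simeq x\simeq\tilde1\tilde\otimes x$; (2) the operations are compatible with smooth algebraic homotopy: for each operation $\mathrm{Op}$, if $f_i\simeq_{\mathrm{sm\,alg}}f_i'$ for all $i$ then $\mathrm{Op}(f_1,\dots)\simeq_{\mathrm{sm\,alg}}\mathrm{Op}(f_1',\dots)$; (3) ("strong polynomial") the algebraic homotopies,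 for the identities and compatibilities, are induced by maps $$\mathcal G_{\mathbb N}(\mathfrak A)\times\dots\times\mathcal G_{\mathbb N}(\mathfrak A)\to\mathcal K_{\{0,1\}\times\{0,1\}\times\mathbb N}(\mathfrak A)^\star$$ assembled polynomially.
   Context: **Sets of polynomial growth (spg).** $\mathcal S^{-\infty}_{\mathbb N}$ is the set of real functions on $\mathbb N$ of at most polynomial growth. An infinite spg is a set $\Omega$ with a set of real functions $\mathcal S^{-\infty}_\Omega$ such that $\mathcal S^{-\infty}_\Omega=q^*\mathcal S^{-\infty}_{\mathbb N}$ for some bijection $q:\Omega\to\mathbb N$. A finite spg is a finite set with all real functions. Disjoint unions and products of spg's are naturally spg's. A relabeling map $r:\Omega\to\Omega'$ is an injection such that $r(\Omega)$ and $\Omega'\setminus r(\Omega)$ decompose $\Omega'$ as spg's (i.e. $\Omega'=r(\Omega)\,\dot\cup\,(\Omega'\setminus r(\Omega))$ as spg's), and $r$ is an isomorphism of spg's onto $r(\Omega)$. For a matrix $A$ over $\Omega$, $r_*A$ is the matrix over $\Omega'$ with entry $a_{n,m}$ at $(r(n),r(m))$ and zeros elsewhere; on pairs, $r_*$ acts componentwise. **Polymetric rings.** A topological ring $\mathfrak A$ is polymetric if its topology is induced by a family of "seminorms" $p:\mathfrak A\to[0,\infty)$ with $p(0)=0$, $p(-X)=p(X)$, $p(X+Y)\le p(X)+p(Y)$, such that for each $p$ there is a seminorm $\tilde p$ with $p(XY)\le\tilde p(X)\tilde p(Y)$. $\mathfrak A^+$ is the unital extension $\mathbb Z\oplus\mathfrak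 A$ (or $\mathbb K\oplus\mathfrak A$ for a locally convex algebra over $\mathbb K$). **Matrices.** $\mathcal K_\Omega(\mathfrak A)$ is the algebra of rapidly decreasing $\Omega\times\Omega$ matrices and $\Psi_\Omega(\mathfrak A)$ the algebra of $\Omega\times\Omega$ matrices of pseudodifferential size. In the usual meaning of these terms: in $\mathcal K$, $\sup_{n,m}|f(n)h(m)|\,p(a_{n,m})<\infty$ for all seminorms $p$ and $f,h\in\mathcal S^{-\infty}_{\Omega}$; in $\Psi$, for every $p$ and $f\in\mathcal S^{-\infty}_{\Omega}$ there is $g\in\mathcal S^{-\infty}_\Omega$ with $|f(n)|p(a_{n,m})\le g(m)$ and $|f(m)|p(a_{n,m})\le g(n)$ for all $n,m$. (If $\mathfrak A$ is discrete, $\mathcal K$ consists of the matrices with finitely many nonzero entries and $\Psi$ of those whose rows and columns each have finitely many nonzero entries.) $1_\Omega,0_\Omega$ are the unit and zero matrices, $\bar a=1_\Omega-a$, and $a\approx b$ means $b-a\in\mathcal K(\mathfrak A)$. $\mathcal K_\Omega(\mathfrak A)^\star$ is the group of invertible elements $1_\Omega+A\in\Psi_\Omega(\mathfrak A^+)$ with $A\in\mathcal K_\Omega(\mathfrak A)$, with topology induced from $\mathcal K_\Omega(\mathfrak A)$. $\mathcal G^{(2)}_\Omega(\mathfrak A)$ is the space of pairs $\langle b,a\rangle$ of idempotents in $\Psi_\Omega(\mathfrak A^+)$ with $b\approx a$. **Operations on pairs.** $\langle b,a\rangle\oplus\langle d,c\rangle=\langle b\oplus d,a\oplus c\rangle$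 (over the disjoint union of index sets); $\langle b,a\rangle^{\mathrm{inv}}=\langle\bar b,\bar a\rangle$; $\mathbf 1=\langle1,0\rangle$ ($1\times1$ matrices). With the multiplication of the commutative ring $\mathfrak A$ considered as tensor product (so $\otimes$ is the Kronecker product of matrices), there are two products, over the product of the index sets: $\langle b,a\rangle\overleftarrow\otimes\langle d,c\rangle=\langle b\otimes d+\bar b\otimes c,\,a\otimes d+\bar a\otimes c\rangle$ and $\langle b,a\rangle\overrightarrow\otimes\langle d,c\rangle=\langle b\otimes d+a\otimes\bar d,\,b\otimes c+a\otimes\bar c\rangle$; below $\otimes$ on pairs is either (fixed) one of them. Regularization: for $\langle b,a\rangle\in\mathcal G^{(2)}_\Omega(\mathfrak A)$, over the index set $\{0,1\}\times\Omega$, $$\mathbf R\langle b,a\rangle=\left\langle\begin{bmatrix}\bar a & a \\ {a} & \bar a\end{bmatrix}\begin{bmatrix}b & \\ & \bar a\end{bmatrix}\begin{bmatrix}\bar a & a \\ {a} & \bar a\end{bmatrix},\;0_\Omega\oplus1_\Omega\right\rangle.$$ **The single-space Grassmannian.** Put $e=0_{\mathbb N}\oplus1_{\mathbb N}$ (over $\{0,1\}\times\mathbb N$) and $\mathbf R\mathbf 0_{\mathbb N}=\langle e,e\rangle$. $\mathcal G_{\mathbb N}(\mathfrak A)=\{\langle b,e\rangle: b\in\Psi_{\{0,1\}\times\mathbb N}(\mathfrak A^+),\ b^2=b,\ b\approx e\}$. Fix (not necessarily bijective) relabeling maps $\theta_1:(\{0,1\}\times\mathbb N)\dot\cup(\{0,1\}\times\mathbb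 N)\to\mathbb N$, $\theta_2:\{0,1\}\times\mathbb N\to\mathbb N$, $\theta_3:\{0,1\}\times\mathbb N\times\{0,1\}\times\mathbb N\to\mathbb N$, $\theta_4:\{0\}\to\mathbb N$, and set $$x\tilde+y=\mathbf R\theta_{1*}(x\oplus y),\quad\tilde-x=\mathbf R\theta_{2*}(x^{\mathrm{inv}}),\quad\tilde0=\mathbf R\mathbf 0_{\mathbb N},\quad x\tilde\otimes y=\mathbf R\theta_{3*}(x\otimes y),$$ and, if $\mathfrak A$ is unital, $\tilde1=\mathbf R\theta_{4*}\mathbf 1$. **Smooth algebraic homotopy.** Maps $f_1,f_2:X\to\mathcal G_{\mathbb N}(\mathfrak A)$, $f_i=\langle b_i,e\rangle$, satisfy $f_1\simeq_{\mathrm{sm\,alg}}f_2$ if there is a map $g:X\to\mathcal K_{\{0,1\}\times\{0,1\}\times\mathbb N}(\mathfrak A)^\star$ conjugating $f_2\oplus\mathbf R\mathbf 0_{\mathbb N}$ to $f_1\oplus\mathbf R\mathbf 0_{\mathbb N}$, i.e. $g\,(b_2\oplus e)\,g^{-1}=b_1\oplus e$ (on the leading terms; the base terms are unchanged). **Assembled polynomially** means: given by matrix polynomials in terms of the initial data, in the extended sense that tensor products and constant relabeling matrices are also allowed in the notion of polynomiality.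
   Formalization: In (3), the homotopies for compatibilities are polynomial in the arguments and also in the given conjugating elements and their inverses, not in the arguments alone; the unital extension is taken as ℤ⊕𝔄 (the 𝕂⊕𝔄 variant gives the same 𝒢 and 𝒦* ). *)

theory Defs
  imports "HOL-Analysis.Infinite_Sum" "HOL-Library.Nat_Bijection"
begin

section \<open>Sets of polynomial growth\<close>

definition poly_growth :: "(nat \<Rightarrow> real) set" where
  "poly_growth = {f. \<exists>C k. \<forall>n. \<bar>f n\<bar> \<le> C * (1 + real n) ^ k}"

text \<open>
  A function on a subset \<open>\<Omega>\<close> of a type is represented by a total function whose values
  outside \<open>\<Omega>\<close> are irrelevant.  Accordingly a set of functions on \<open>\<Omega>\<close> is represented by a set of
  total functions, membership in which depends only on the values on \<open>\<Omega>\<close>.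
\<close>

definition spg_on :: "'i set \<Rightarrow> ('i \<Rightarrow> real) set \<Rightarrow> bool" where
  "spg_on \<Omega> S \<longleftrightarrow>
     (if finite \<Omega> then S = UNIV
      else \<exists>q. bij_betw q \<Omega> (UNIV :: nat set) \<and>
               S = {f. \<exists>g\<in>poly_growth. \<forall>x\<in>\<Omega>. f x = g (q x)})"

definition restrict_growth :: "'i set \<Rightarrow> ('i \<Rightarrow> real) set \<Rightarrow> ('i \<Rightarrow> real) set" where
  "restrict_growth \<Omega> S = {f. \<exists>g\<in>S. \<forall>x\<in>\<Omega>. f x = g x}"

text \<open>
  In the following definition \<open>S1 \<inter> S2\<close> is the growth structure of the disjoint union of
  \<open>(r ` \<Omega>, S1)\<close> and \<open>(\<Omega>' - r ` \<Omega>, S2)\<close>.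
\<close>

definition relabeling_on ::
  "'i set \<Rightarrow> ('i \<Rightarrow> real) set \<Rightarrow> 'j set \<Rightarrow> ('j \<Rightarrow> real) set \<Rightarrow> ('i \<Rightarrow> 'j) \<Rightarrow> bool" where
  "relabeling_on \<Omega> S \<Omega>' S' r \<longleftrightarrow>
     inj_on r \<Omega> \<and> r ` \<Omega> \<subseteq> \<Omega>' \<and>
     (\<exists>S1 S2. spg_on (r ` \<Omega>) S1 \<and> spg_on (\<Omega>' - r ` \<Omega>) S2 \<and> S' = S1 \<inter> S2 \<and>
              S = {f. \<exists>g\<in>S1. \<forall>x\<in>\<Omega>. f x = g (r x)})"

text \<open>
  Types that are index sets.  The map \<open>code\<close> embeds each of them into \<open>nat\<close>, compatibly with the
  growth structures; it is only used to compare matrices over different index sets when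
  polynomial expressions are formed.
\<close>

class spg =
  fixes growth :: "('a \<Rightarrow> real) set"
    and code :: "'a \<Rightarrow> nat"
  assumes spg_growth: "spg_on UNIV growth"
    and inj_code: "inj code"
    and growth_code: "growth = {f. \<exists>g\<in>poly_growth. \<forall>x. f x = g (code x)}"

definition relabeling :: "('i::spg \<Rightarrow> 'j::spg) \<Rightarrow> bool" where
  "relabeling r \<longleftrightarrow> relabeling_on UNIV growth UNIV growth r"

subsection \<open>The index sets used below\<close>

definition bounded_by :: "('i \<Rightarrow> nat) \<Rightarrow> ('i \<Rightarrow> real) set" where
  "bounded_by w = {f. \<exists>C k. \<forall>x. \<bar>f x\<bar> \<le> C * (1 + real (w x)) ^ k}"

lemma bounded_byI: "(\<And>x. \<bar>f x\<bar> \<le> C * (1 + real (w x)) ^ k) \<Longrightarrow> f \<in> bounded_by w"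
  unfolding bounded_by_def by blast

lemma bounded_byE:
  assumes "f \<in> bounded_by w"
  obtains C k where "C \<ge> 0" "\<And>x. \<bar>f x\<bar> \<le> C * (1 + real (w x)) ^ k"
proof -
  from assms obtain C k where *: "\<And>x. \<bar>f x\<bar> \<le> C * (1 + real (w x)) ^ k"
    unfolding bounded_by_def by blast
  have "\<bar>f x\<bar> \<le> \<bar>C\<bar> * (1 + real (w x)) ^ k" for x
    using *[of x] by (rule order_trans) (intro mult_right_mono, auto)
  with that[of "\<bar>C\<bar>" k] show thesis by simp
qed

lemma bounded_by_mono:
  assumes "\<And>x. 1 + real (v x) \<le> D * (1 + real (w x)) ^ m" and "D \<ge> 0"
  shows "bounded_by v \<subseteq> bounded_by w"
proof
  fix f assume "f \<in> bounded_by v"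
  then obtain C k where C: "C \<ge> 0" "\<And>x. \<bar>f x\<bar> \<le> C * (1 + real (v x)) ^ k"
    by (rule bounded_byE) blast
  show "f \<in> bounded_by w"
  proof (rule bounded_byI)
    fix x
    have "\<bar>f x\<bar> \<le> C * (1 + real (v x)) ^ k" by (rule C)
    also have "\<dots> \<le> C * (D * (1 + real (w x)) ^ m) ^ k"
      by (intro mult_left_mono power_mono assms C) auto
    also have "\<dots> = (C * D ^ k) * (1 + real (w x)) ^ (m * k)"
      by (simp add: power_mult_distrib power_mult)
    finally show "\<bar>f x\<bar> \<le> (C * D ^ k) * (1 + real (w x)) ^ (m * k)" .
  qed
qed

lemma pullback_eq_bounded_by:
  assumes "inj c"
  shows "{f. \<exists>g\<in>poly_growth. \<forall>x. f x = g (c x)} = bounded_by c"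
proof (intro set_eqI iffI)
  fix f assume "f \<in> {f. \<exists>g\<in>poly_growth. \<forall>x. f x = g (c x)}"
  then obtain g C k where "\<And>x. f x = g (c x)" "\<And>n. \<bar>g n\<bar> \<le> C * (1 + real n) ^ k"
    unfolding poly_growth_def by blast
  then show "f \<in> bounded_by c" by (intro bounded_byI[of f C c k]) simp
next
  fix f assume "f \<in> bounded_by c"
  then obtain C k where C: "C \<ge> 0" "\<And>x. \<bar>f x\<bar> \<le> C * (1 + real (c x)) ^ k"
    by (rule bounded_byE) blast
  define g where "g n = (if n \<in> range c then f (inv c n) else 0)" for n
  have "\<bar>g n\<bar> \<le> C * (1 + real n) ^ k" for n
    using C by (auto simp: g_def assms)
  then have "g \<in> poly_growth" unfolding poly_growth_def by blast
  moreover have "\<forall>x. f x = g (c x)" by (simp add: g_def assms)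
  ultimately show "f \<in> {f. \<exists>g\<in>poly_growth. \<forall>x. f x = g (c x)}" by blast
qed

lemma bounded_by_finite: "finite (UNIV :: 'i set) \<Longrightarrow> bounded_by (w :: 'i \<Rightarrow> nat) = UNIV"
proof (intro set_eqI iffI UNIV_I)
  fix f :: "'i \<Rightarrow> real"
  assume "finite (UNIV :: 'i set)"
  then have "\<bar>f x\<bar> \<le> (\<Sum>y\<in>UNIV. \<bar>f y\<bar>)" for x
    by (intro member_le_sum) auto
  then show "f \<in> bounded_by w" by (intro bounded_byI[where k = 0]) simp
qed

lemma spg_onD:
  assumes "spg_on (UNIV :: 'i set) S"
  obtains w :: "'i \<Rightarrow> nat" and c where "inj w" "S = bounded_by w" "range w = UNIV"
        | w :: "'i \<Rightarrow> nat" and c where "inj w" "S = bounded_by w" "range w = {..<c}"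
proof (cases "finite (UNIV :: 'i set)")
  case True
  then obtain w :: "'i \<Rightarrow> nat" where w: "bij_betw w UNIV {..<card (UNIV :: 'i set)}"
    using ex_bij_betw_finite_nat[of "UNIV :: 'i set"] by (auto simp: atLeast0LessThan)
  show ?thesis
    using True assms w by (intro that(2)[of w]) (auto simp: bij_betw_def spg_on_def bounded_by_finite)
next
  case False
  with assms obtain q :: "'i \<Rightarrow> nat" where "bij_betw q UNIV UNIV"
      "S = {f. \<exists>g\<in>poly_growth. \<forall>x. f x = g (q x)}"
    by (auto simp: spg_on_def)
  then show ?thesis
    by (intro that(1)[of q]) (auto simp: bij_betw_def pullback_eq_bounded_by)
qed

lemma spg_onI:
  assumes "inj w" "S = bounded_by w" "range w = UNIV \<or> finite (range w)"
  shows "spg_on UNIV S"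
proof (cases "finite (range w)")
  case True
  then have "finite (UNIV :: 'a set)" using assms(1) by (simp add: finite_image_iff)
  with assms show ?thesis by (simp add: spg_on_def bounded_by_finite)
next
  case False
  with assms have "bij w" by (auto simp: bij_def)
  moreover have "infinite (UNIV :: 'a set)" using False finite_imageI by blast
  ultimately show ?thesis
    using pullback_eq_bounded_by[OF assms(1)] assms(2) by (auto simp: spg_on_def)
qed

lemma bounded_by_cong:
  assumes "\<And>x. 1 + real (v x) \<le> D * (1 + real (w x)) ^ m" "D \<ge> 0"
    and "\<And>x. 1 + real (w x) \<le> D' * (1 + real (v x)) ^ m'" "D' \<ge> 0"
  shows "bounded_by v = bounded_by w"
  using bounded_by_mono[of v D w m] bounded_by_mono[of w D' v m'] assms by blast

instantiation nat :: spg
begin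
definition "growth_nat = poly_growth"
definition "code_nat = (id :: nat \<Rightarrow> nat)"
instance
proof
  have eq: "(growth :: (nat \<Rightarrow> real) set) = bounded_by id"
    by (simp add: growth_nat_def poly_growth_def bounded_by_def)
  then show "spg_on UNIV (growth :: (nat \<Rightarrow> real) set)"
    by (intro spg_onI[of id]) auto
  show "inj (code :: nat \<Rightarrow> nat)" by (simp add: code_nat_def)
  show "growth = {f. \<exists>g\<in>poly_growth. \<forall>x :: nat. f x = g (code x)}"
    by (subst pullback_eq_bounded_by) (simp_all add: eq code_nat_def)
qed
end

instantiation bool :: spg
begin
definition "growth_bool = (UNIV :: (bool \<Rightarrow> real) set)"
definition "code_bool = (of_bool :: bool \<Rightarrow> nat)"
instance
proof
  show "spg_on UNIV (growth :: (bool \<Rightarrow> real) set)"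
    by (simp add: spg_on_def growth_bool_def)
  show *: "inj (code :: bool \<Rightarrow> nat)" by (simp add: code_bool_def inj_def)
  show "growth = {f. \<exists>g\<in>poly_growth. \<forall>x :: bool. f x = g (code x)}"
    by (subst pullback_eq_bounded_by[OF *]) (simp add: growth_bool_def bounded_by_finite)
qed
end

instantiation unit :: spg
begin
definition "growth_unit = (UNIV :: (unit \<Rightarrow> real) set)"
definition "code_unit = (\<lambda>_ :: unit. 0 :: nat)"
instance
proof
  show "spg_on UNIV (growth :: (unit \<Rightarrow> real) set)"
    by (simp add: spg_on_def growth_unit_def)
  show *: "inj (code :: unit \<Rightarrow> nat)" by (simp add: code_unit_def inj_def)
  show "growth = {f. \<exists>g\<in>poly_growth. \<forall>x :: unit. f x = g (code x)}"
    by (subst pullback_eq_bounded_by[OF *]) (simp add: growth_unit_def bounded_by_finite)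
qed
end

lemma growth_bounded_by_code: "growth = bounded_by (code :: 'i::spg \<Rightarrow> nat)"
  by (subst growth_code, rule pullback_eq_bounded_by, rule inj_code)

lemma bounded_by_sum:
  "{f. f \<circ> Inl \<in> bounded_by u \<and> f \<circ> Inr \<in> bounded_by v} = bounded_by (case_sum u v)"
proof (intro set_eqI iffI)
  fix f assume "f \<in> {f. f \<circ> Inl \<in> bounded_by u \<and> f \<circ> Inr \<in> bounded_by v}"
  then have "f \<circ> Inl \<in> bounded_by u" "f \<circ> Inr \<in> bounded_by v" by auto
  then obtain C k D l where
    C: "C \<ge> 0" "\<And>x. \<bar>(f \<circ> Inl) x\<bar> \<le> C * (1 + real (u x)) ^ k" and
    D: "D \<ge> 0" "\<And>x. \<bar>(f \<circ> Inr) x\<bar> \<le> D * (1 + real (v x)) ^ l"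
    by (elim bounded_byE) blast
  show "f \<in> bounded_by (case_sum u v)"
  proof (rule bounded_byI)
    fix z
    have p: "(1 + real n) ^ k \<le> (1 + real n) ^ (k + l)"
            "(1 + real n) ^ l \<le> (1 + real n) ^ (k + l)" for n
      by (intro power_increasing; simp)+
    show "\<bar>f z\<bar> \<le> (C + D) * (1 + real (case_sum u v z)) ^ (k + l)"
    proof (cases z)
      case (Inl x)
      have "\<bar>f z\<bar> \<le> C * (1 + real (u x)) ^ k" using C(2)[of x] Inl by simp
      also have "\<dots> \<le> (C + D) * (1 + real (u x)) ^ (k + l)"
        using C D p by (intro mult_mono) auto
      finally show ?thesis using Inl by simp
    next
      case (Inr x)
      have "\<bar>f z\<bar> \<le> D * (1 + real (v x)) ^ l" using D(2)[of x] Inr by simp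
      also have "\<dots> \<le> (C + D) * (1 + real (v x)) ^ (k + l)"
        using C D p by (intro mult_mono) auto
      finally show ?thesis using Inr by simp
    qed
  qed
next
  fix f assume "f \<in> bounded_by (case_sum u v)"
  then obtain C k where C: "\<And>x. \<bar>f x\<bar> \<le> C * (1 + real (case_sum u v x)) ^ k"
    by (rule bounded_byE) blast
  have "f \<circ> Inl \<in> bounded_by u" using C[of "Inl _"] by (intro bounded_byI[of _ C _ k]) auto
  moreover have "f \<circ> Inr \<in> bounded_by v" using C[of "Inr _"] by (intro bounded_byI[of _ C _ k]) auto
  ultimately show "f \<in> {f. f \<circ> Inl \<in> bounded_by u \<and> f \<circ> Inr \<in> bounded_by v}" by simp
qed

lemma bounded_by_prod:
  "{f. \<exists>g\<in>bounded_by u. \<exists>h\<in>bounded_by v. \<forall>x y. \<bar>f (x, y)\<bar> \<le> g x * h y} =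
   bounded_by (\<lambda>(x, y). u x + v y)"
proof (intro set_eqI iffI)
  fix f assume "f \<in> {f. \<exists>g\<in>bounded_by u. \<exists>h\<in>bounded_by v. \<forall>x y. \<bar>f (x, y)\<bar> \<le> g x * h y}"
  then obtain g h where g: "g \<in> bounded_by u" and h: "h \<in> bounded_by v"
    and f: "\<And>x y. \<bar>f (x, y)\<bar> \<le> g x * h y" by blast
  from g h obtain C k D l where
    C: "C \<ge> 0" "\<And>x. \<bar>g x\<bar> \<le> C * (1 + real (u x)) ^ k" and
    D: "D \<ge> 0" "\<And>x. \<bar>h x\<bar> \<le> D * (1 + real (v x)) ^ l"
    by (elim bounded_byE) blast
  show "f \<in> bounded_by (\<lambda>(x, y). u x + v y)"
  proof (rule bounded_byI)
    fix z :: "'a \<times> 'b"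
    obtain x y where z: "z = (x, y)" by (cases z)
    have "\<bar>f z\<bar> \<le> \<bar>g x\<bar> * \<bar>h y\<bar>"
      using f[of x y] by (simp add: z abs_mult[symmetric])
    also have "\<dots> \<le> (C * (1 + real (u x)) ^ k) * (D * (1 + real (v y)) ^ l)"
      using C D by (intro mult_mono) auto
    also have "\<dots> \<le> (C * (1 + real (u x + v y)) ^ k) * (D * (1 + real (u x + v y)) ^ l)"
      using C D by (intro mult_mono mult_left_mono power_mono mult_nonneg_nonneg) auto
    also have "\<dots> = (C * D) * (1 + real (u x + v y)) ^ (k + l)"
      by (simp add: power_add)
    finally show "\<bar>f z\<bar> \<le> (C * D) * (1 + real (case z of (x, y) \<Rightarrow> u x + v y)) ^ (k + l)"
      by (simp add: z)
  qed
next
  fix f assume "f \<in> bounded_by (\<lambda>(x, y). u x + v y)"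
  then obtain C k where C: "C \<ge> 0" "\<And>z. \<bar>f z\<bar> \<le> C * (1 + real ((\<lambda>(x, y). u x + v y) z)) ^ k"
    by (rule bounded_byE) blast
  define g h where "g = (\<lambda>x. C * (1 + real (u x)) ^ k)" and "h = (\<lambda>y. 1 * (1 + real (v y)) ^ k)"
  have "g \<in> bounded_by u" "h \<in> bounded_by v"
    using C(1) bounded_byI[of g C u k] bounded_byI[of h 1 v k] by (auto simp: g_def h_def)
  moreover have "\<bar>f (x, y)\<bar> \<le> g x * h y" for x y
  proof -
    have "\<bar>f (x, y)\<bar> \<le> C * (1 + real (u x + v y)) ^ k" using C(2)[of "(x, y)"] by simp
    also have "\<dots> \<le> C * ((1 + real (u x)) * (1 + real (v y))) ^ k"
      using C(1) by (intro mult_left_mono power_mono) (auto simp: algebra_simps)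
    finally show ?thesis by (simp add: g_def h_def power_mult_distrib mult.assoc)
  qed
  ultimately show "f \<in> {f. \<exists>g\<in>bounded_by u. \<exists>h\<in>bounded_by v. \<forall>x y. \<bar>f (x, y)\<bar> \<le> g x * h y}"
    by blast
qed

lemma case_sum_comparable:
  "bounded_by (case_sum (\<lambda>a. 2 * u a) (\<lambda>b. Suc (2 * v b))) = bounded_by (case_sum u v)"
  by (rule bounded_by_cong[where D = 2 and m = 1 and D' = 1 and m' = 1]) (auto split: sum.splits)

lemma case_sum_shift_comparable:
  "bounded_by (case_sum u (\<lambda>b. v b + c)) = bounded_by (case_sum u v)"
  "bounded_by (case_sum (\<lambda>a. u a + c) v) = bounded_by (case_sum u v)"
  by (rule bounded_by_cong[where D = "1 + real c" and m = 1 and D' = 1 and m' = 1];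
      auto split: sum.splits simp: algebra_simps)+

lemma inj_case_sum:
  assumes "inj u" "inj v" "\<And>a b. u a \<noteq> v b"
  shows "inj (case_sum u v)"
proof (rule injI)
  fix x y assume "case_sum u v x = case_sum u v y"
  with assms assms(3)[symmetric] show "x = y"
    by (cases x; cases y) (simp_all add: inj_eq)
qed

lemma map_sum_surj:
  assumes "surj f" "surj g"
  shows "surj (map_sum f g)"
proof -
  have "z \<in> range (map_sum f g)" for z
  proof (cases z)
    case (Inl x)
    moreover obtain y where "x = f y" using assms(1) by blast
    ultimately show ?thesis by (intro range_eqI[of _ _ "Inl y"]) simp
  next
    case (Inr x)
    moreover obtain y where "x = g y" using assms(2) by blast
    ultimately show ?thesis by (intro range_eqI[of _ _ "Inr y"]) simp
  qed
  then show ?thesis by blast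
qed

instantiation sum :: (spg, spg) spg
begin
definition "growth_sum = {f :: 'a + 'b \<Rightarrow> real. f \<circ> Inl \<in> growth \<and> f \<circ> Inr \<in> growth}"
definition "code_sum = (\<lambda>z :: 'a + 'b. sum_encode (map_sum code code z))"
instance
proof
  show inj: "inj (code :: 'a + 'b \<Rightarrow> nat)"
    unfolding code_sum_def
    by (intro inj_compose[unfolded o_def, OF inj_sum_encode] sum.inj_map inj_code)
  have code: "code = case_sum (\<lambda>a :: 'a. 2 * code a) (\<lambda>b :: 'b. Suc (2 * code b))"
    by (auto simp: code_sum_def sum_encode_def split: sum.splits)
  show "growth = {f. \<exists>g\<in>poly_growth. \<forall>x :: 'a + 'b. f x = g (code x)}"
    unfolding pullback_eq_bounded_by[OF inj] growth_sum_def growth_bounded_by_code bounded_by_sum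
    by (simp add: code case_sum_comparable)
  show "spg_on UNIV (growth :: ('a + 'b \<Rightarrow> real) set)"
  proof (rule spg_onD[OF spg_growth[where 'a = 'a]]; rule spg_onD[OF spg_growth[where 'a = 'b]])
    fix u :: "'a \<Rightarrow> nat" and v :: "'b \<Rightarrow> nat"
    assume u: "inj u" "growth = bounded_by u" "range u = UNIV"
      and v: "inj v" "growth = bounded_by v" "range v = UNIV"
    have eq: "case_sum (\<lambda>a. 2 * u a) (\<lambda>b. Suc (2 * v b)) = sum_encode \<circ> map_sum u v"
      by (auto simp: sum_encode_def fun_eq_iff split: sum.splits)
    have "surj (map_sum u v)" using u v by (intro map_sum_surj) auto
    then have "bij (sum_encode \<circ> map_sum u v)"
      using u v by (intro bij_comp[OF _ bij_sum_encode] bijI sum.inj_map) auto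
    then show ?thesis
      by (intro spg_onI[of "case_sum (\<lambda>a. 2 * u a) (\<lambda>b. Suc (2 * v b))"])
         (auto simp: eq[symmetric] bij_def case_sum_comparable growth_sum_def u(2) v(2) bounded_by_sum)
  next
    fix u :: "'a \<Rightarrow> nat" and v :: "'b \<Rightarrow> nat" and c
    assume u: "inj u" "growth = bounded_by u" "range u = UNIV"
      and v: "inj v" "growth = bounded_by v" "range v = {..<c}"
    have vc: "v b < c" for b using v(3) by blast
    have "n \<in> range (case_sum (\<lambda>a. u a + c) v)" for n
    proof (cases "n < c")
      case True
      then obtain b where "n = v b" using v(3) by blast
      then show ?thesis by (intro range_eqI[of _ _ "Inr b"]) simp
    next
      case False
      obtain a where "n - c = u a" using u(3) by blast
      with False show ?thesis by (intro range_eqI[of _ _ "Inl a"]) simp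
    qed
    then have rng: "range (case_sum (\<lambda>a. u a + c) v) = UNIV" by blast
    have "u a + c \<noteq> v b" for a b using vc[of b] by linarith
    then have inj': "inj (case_sum (\<lambda>a. u a + c) v)"
      using u(1) v(1) by (intro inj_case_sum) (auto simp: inj_def)
    have gr: "growth = bounded_by (case_sum (\<lambda>a. u a + c) v)"
      by (simp only: growth_sum_def u(2) v(2) bounded_by_sum case_sum_shift_comparable)
    show ?thesis by (rule spg_onI[OF inj' gr]) (simp add: rng)
  next
    fix u :: "'a \<Rightarrow> nat" and v :: "'b \<Rightarrow> nat" and c
    assume u: "inj u" "growth = bounded_by u" "range u = {..<c}"
      and v: "inj v" "growth = bounded_by v" "range v = UNIV"
    have uc: "u a < c" for a using u(3) by blast
    have "n \<in> range (case_sum u (\<lambda>b. v b + c))" for n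
    proof (cases "n < c")
      case True
      then obtain a where "n = u a" using u(3) by blast
      then show ?thesis by (intro range_eqI[of _ _ "Inl a"]) simp
    next
      case False
      obtain b where "n - c = v b" using v(3) by blast
      with False show ?thesis by (intro range_eqI[of _ _ "Inr b"]) simp
    qed
    then have rng: "range (case_sum u (\<lambda>b. v b + c)) = UNIV" by blast
    have "u a \<noteq> v b + c" for a b using uc[of a] by linarith
    then have inj': "inj (case_sum u (\<lambda>b. v b + c))"
      using u(1) v(1) by (intro inj_case_sum) (auto simp: inj_def)
    have gr: "growth = bounded_by (case_sum u (\<lambda>b. v b + c))"
      by (simp only: growth_sum_def u(2) v(2) bounded_by_sum case_sum_shift_comparable)
    show ?thesis by (rule spg_onI[OF inj' gr]) (simp add: rng)
  next
    fix u :: "'a \<Rightarrow> nat" and v :: "'b \<Rightarrow> nat" and c d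
    assume u: "inj u" "growth = bounded_by u" "range u = {..<c}"
      and v: "inj v" "growth = bounded_by v" "range v = {..<d}"
    have "finite (UNIV :: 'a set)" "finite (UNIV :: 'b set)"
      using u v finite_image_iff[of u UNIV] finite_image_iff[of v UNIV] by auto
    then have "finite (UNIV :: ('a + 'b) set)" by (simp add: finite_Plus_UNIV_iff)
    then show ?thesis
      by (simp add: spg_on_def growth_sum_def u(2) v(2) bounded_by_sum bounded_by_finite)
  qed
qed
end

lemma prod_encode_le: "prod_encode (m, n) \<le> (m + n + 1) ^ 2"
proof -
  have "triangle (m + n) \<le> (m + n) * (m + n + 1)" by (simp add: triangle_def)
  moreover have "m \<le> m + n + 1" by simp
  ultimately have "triangle (m + n) + m \<le> (m + n) * (m + n + 1) + (m + n + 1)"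
    by (rule add_mono)
  also have "\<dots> = (m + n + 1) ^ 2" by (simp add: power2_eq_square)
  finally show ?thesis by (simp add: prod_encode_def)
qed

lemma prod_encode_comparable:
  "bounded_by (\<lambda>(a, b). prod_encode (u a, v b)) = bounded_by (\<lambda>(a, b). u a + v b)"
proof (rule bounded_by_cong[where D = 2 and m = 2 and D' = 2 and m' = 1])
  fix z :: "'a \<times> 'b"
  obtain a b where z: "z = (a, b)" by (cases z)
  have "real (prod_encode (u a, v b)) \<le> real ((u a + v b + 1) ^ 2)"
    using prod_encode_le of_nat_le_iff by blast
  then have "real (prod_encode (u a, v b)) \<le> (1 + real (u a + v b)) ^ 2"
    by (simp add: add.commute)
  moreover have "1 \<le> (1 + real (u a + v b)) ^ 2" by (rule one_le_power) simp
  ultimately show "1 + real ((\<lambda>(a, b). prod_encode (u a, v b)) z)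
      \<le> 2 * (1 + real ((\<lambda>(a, b). u a + v b) z)) ^ 2"
    unfolding z prod.case by linarith
  show "1 + real ((\<lambda>(a, b). u a + v b) z)
      \<le> 2 * (1 + real ((\<lambda>(a, b). prod_encode (u a, v b)) z)) ^ 1"
    using le_prod_encode_1[of "u a" "v b"] le_prod_encode_2[of "v b" "u a"] by (simp add: z)
qed auto

lemma radix_comparable:
  assumes "\<And>b. v b < c"
  shows "bounded_by (\<lambda>(a, b). u a * c + v b) = bounded_by (\<lambda>(a, b). u a + v b)"
    and "bounded_by (\<lambda>(b, a). u a * c + v b) = bounded_by (\<lambda>(b, a). v b + u a)"
proof -
  have c: "c \<ge> 1" using assms[of undefined] by simp
  have 1: "1 + real (u a * c + v b) \<le> real c * (1 + real (u a + v b)) ^ 1" for a b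
  proof -
    have "v b + 1 \<le> c * (1 + v b)" using mult_le_mono1[OF c, of "1 + v b"] by simp
    then have "1 + (u a * c + v b) \<le> c * (1 + (u a + v b))"
      by (simp add: distrib_left mult.commute)
    then have "real (1 + (u a * c + v b)) \<le> real (c * (1 + (u a + v b)))"
      by (rule of_nat_mono)
    then show ?thesis by (simp only: of_nat_add of_nat_mult of_nat_1 power_one_right)
  qed
  have 2: "1 + real (u a + v b) \<le> 1 * (1 + real (u a * c + v b)) ^ 1" for a b
  proof -
    have "u a + v b \<le> u a * c + v b" using mult_le_mono2[OF c, of "u a"] by simp
    then have "real (u a + v b) \<le> real (u a * c + v b)" by (rule of_nat_mono)
    then show ?thesis by (simp only: power_one_right mult_1 add_left_mono)
  qed
  show "bounded_by (\<lambda>(a, b). u a * c + v b) = bounded_by (\<lambda>(a, b). u a + v b)"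
    by (rule bounded_by_cong[where D = "real c" and m = 1 and D' = 1 and m' = 1])
       (simp_all only: case_prod_beta 1 2 of_nat_0_le_iff zero_le_one)
  have 3: "1 + real (u a * c + v b) \<le> real c * (1 + real (v b + u a)) ^ 1" for a b
    using 1[of a b] by (simp only: add.commute)
  have 4: "1 + real (v b + u a) \<le> 1 * (1 + real (u a * c + v b)) ^ 1" for a b
    using 2[of a b] by (simp only: add.commute)
  show "bounded_by (\<lambda>(b, a). u a * c + v b) = bounded_by (\<lambda>(b, a). v b + u a)"
    by (rule bounded_by_cong[where D = "real c" and m = 1 and D' = 1 and m' = 1])
       (simp_all only: case_prod_beta 3 4 of_nat_0_le_iff zero_le_one)
qed

lemma radix_inj:
  fixes n m c i j :: nat
  assumes "n * c + i = m * c + j" "i < c" "j < c"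
  shows "n = m \<and> i = j"
proof -
  have "n = (n * c + i) div c" using assms(2) by simp
  also have "\<dots> = (m * c + j) div c" by (simp only: assms(1))
  also have "\<dots> = m" using assms(3) by simp
  finally show ?thesis using assms(1) by simp
qed

instantiation prod :: (spg, spg) spg
begin
definition "growth_prod =
  {f :: 'a \<times> 'b \<Rightarrow> real. \<exists>g\<in>growth. \<exists>h\<in>growth. \<forall>x y. \<bar>f (x, y)\<bar> \<le> g x * h y}"
definition "code_prod = (\<lambda>z :: 'a \<times> 'b. prod_encode (map_prod code code z))"
instance
proof
  show inj: "inj (code :: 'a \<times> 'b \<Rightarrow> nat)"
    unfolding code_prod_def
    by (intro inj_compose[unfolded o_def, OF inj_prod_encode] prod.inj_map inj_code)
  have code: "code = (\<lambda>(a :: 'a, b :: 'b). prod_encode (code a, code b))"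
    by (auto simp: code_prod_def)
  show "growth = {f. \<exists>g\<in>poly_growth. \<forall>x :: 'a \<times> 'b. f x = g (code x)}"
    unfolding pullback_eq_bounded_by[OF inj] growth_prod_def growth_bounded_by_code bounded_by_prod
    by (simp add: code prod_encode_comparable)
  show "spg_on UNIV (growth :: ('a \<times> 'b \<Rightarrow> real) set)"
  proof (rule spg_onD[OF spg_growth[where 'a = 'a]]; rule spg_onD[OF spg_growth[where 'a = 'b]])
    fix u :: "'a \<Rightarrow> nat" and v :: "'b \<Rightarrow> nat"
    assume u: "inj u" "growth = bounded_by u" "range u = UNIV"
      and v: "inj v" "growth = bounded_by v" "range v = UNIV"
    have eq: "(\<lambda>(a, b). prod_encode (u a, v b)) = prod_encode \<circ> map_prod u v"
      by (auto simp: fun_eq_iff)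
    have "surj (map_prod u v)" using u v by (intro map_prod_surj) auto
    then have "bij (prod_encode \<circ> map_prod u v)"
      using u v by (intro bij_comp[OF _ bij_prod_encode] bijI prod.inj_map) auto
    then show ?thesis
      by (intro spg_onI[of "\<lambda>(a, b). prod_encode (u a, v b)"])
         (auto simp: eq[symmetric] bij_def prod_encode_comparable growth_prod_def u(2) v(2)
                     bounded_by_prod)
  next
    fix u :: "'a \<Rightarrow> nat" and v :: "'b \<Rightarrow> nat" and c
    assume u: "inj u" "growth = bounded_by u" "range u = UNIV"
      and v: "inj v" "growth = bounded_by v" "range v = {..<c}"
    have vc: "v b < c" for b using v(3) by blast
    have c: "c > 0" using vc[of undefined] by simp
    have "n \<in> range (\<lambda>(a, b). u a * c + v b)" for n
    proof -
      obtain a where a: "n div c = u a" using u(3) by blast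
      have "n mod c \<in> range v" using c v(3) by simp
      then obtain b where b: "n mod c = v b" by blast
      show ?thesis using div_mult_mod_eq[of n c] a b by (intro range_eqI[of _ _ "(a, b)"]) simp
    qed
    then have rng: "range (\<lambda>(a, b). u a * c + v b) = UNIV" by blast
    have inj': "inj (\<lambda>(a, b). u a * c + v b)"
    proof (rule injI)
      fix x y assume "(\<lambda>(a, b). u a * c + v b) x = (\<lambda>(a, b). u a * c + v b) y"
      then have "u (fst x) * c + v (snd x) = u (fst y) * c + v (snd y)"
        by (simp add: case_prod_beta)
      from radix_inj[OF this vc vc] show "x = y"
        using u(1) v(1) by (simp add: inj_eq prod_eq_iff)
    qed
    have gr: "growth = bounded_by (\<lambda>(a, b). u a * c + v b)"
      by (simp only: growth_prod_def u(2) v(2) bounded_by_prod radix_comparable(1)[OF vc])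
    show ?thesis by (rule spg_onI[OF inj' gr]) (simp add: rng)
  next
    fix u :: "'a \<Rightarrow> nat" and v :: "'b \<Rightarrow> nat" and c
    assume u: "inj u" "growth = bounded_by u" "range u = {..<c}"
      and v: "inj v" "growth = bounded_by v" "range v = UNIV"
    have uc: "u a < c" for a using u(3) by blast
    have c: "c > 0" using uc[of undefined] by simp
    have "n \<in> range (\<lambda>(a, b). v b * c + u a)" for n
    proof -
      obtain b where b: "n div c = v b" using v(3) by blast
      have "n mod c \<in> range u" using c u(3) by simp
      then obtain a where a: "n mod c = u a" by blast
      show ?thesis using div_mult_mod_eq[of n c] a b by (intro range_eqI[of _ _ "(a, b)"]) simp
    qed
    then have rng: "range (\<lambda>(a, b). v b * c + u a) = UNIV" by blast
    have inj': "inj (\<lambda>(a, b). v b * c + u a)"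
    proof (rule injI)
      fix x y assume "(\<lambda>(a, b). v b * c + u a) x = (\<lambda>(a, b). v b * c + u a) y"
      then have "v (snd x) * c + u (fst x) = v (snd y) * c + u (fst y)"
        by (simp add: case_prod_beta)
      from radix_inj[OF this uc uc] show "x = y"
        using u(1) v(1) by (simp add: inj_eq prod_eq_iff)
    qed
    have gr: "growth = bounded_by (\<lambda>(a, b). v b * c + u a)"
      by (simp only: growth_prod_def u(2) v(2) bounded_by_prod radix_comparable(2)[OF uc])
    show ?thesis by (rule spg_onI[OF inj' gr]) (simp add: rng)
  next
    fix u :: "'a \<Rightarrow> nat" and v :: "'b \<Rightarrow> nat" and c d
    assume u: "inj u" "growth = bounded_by u" "range u = {..<c}"
      and v: "inj v" "growth = bounded_by v" "range v = {..<d}"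
    have "finite (UNIV :: 'a set)" "finite (UNIV :: 'b set)"
      using u v finite_image_iff[of u UNIV] finite_image_iff[of v UNIV] by auto
    then have "finite (UNIV :: ('a \<times> 'b) set)" by (simp add: finite_prod)
    then show ?thesis
      by (simp add: spg_on_def growth_prod_def u(2) v(2) bounded_by_prod bounded_by_finite)
  qed
qed
end

section \<open>Polymetric rings and the unital extension\<close>

text \<open>
  The class \<open>comm_ring\<close> does not assume a unit.  The growth conditions on matrices below depend on
  the family \<open>P\<close> itself and not only on the topology that it induces, so \<open>P\<close> is kept as a parameter.
\<close>

definition polymetric :: "('a::{comm_ring, topological_space} \<Rightarrow> real) set \<Rightarrow> bool" where
  "polymetric P \<longleftrightarrow>
     (\<forall>p\<in>P. (\<forall>x. 0 \<le> p x) \<and> p 0 = 0 \<and> (\<forall>x. p (- x) = p x) \<and>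
            (\<forall>x y. p (x + y) \<le> p x + p y) \<and>
            (\<exists>q\<in>P. \<forall>x y. p (x * y) \<le> q x * q y)) \<and>
     (\<forall>U. open U \<longleftrightarrow>
        (\<forall>x\<in>U. \<exists>F \<epsilon>. finite F \<and> F \<subseteq> P \<and> \<epsilon> > 0 \<and>
                     (\<forall>y. (\<forall>p\<in>F. p (y - x) < \<epsilon>) \<longrightarrow> y \<in> U)))"

definition sequentially_complete :: "'a::{ab_group_add, topological_space} itself \<Rightarrow> bool" where
  "sequentially_complete _ \<longleftrightarrow>
     (\<forall>s :: nat \<Rightarrow> 'a.
        (\<forall>U. open U \<and> 0 \<in> U \<longrightarrow> (\<exists>N. \<forall>m\<ge>N. \<forall>n\<ge>N. s m - s n \<in> U)) \<longrightarrow> convergent s)"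

definition int_scale :: "int \<Rightarrow> 'a::ab_group_add \<Rightarrow> 'a" where
  "int_scale k a = (if 0 \<le> k then (\<Sum>i<nat k. a) else - (\<Sum>i<nat (- k). a))"

lemma int_scale_neg: "int_scale (- int n) a = - (\<Sum>i<n. a)"
  by (cases "n = 0") (simp_all add: int_scale_def)

lemma int_scale_Suc: "int_scale (k + 1) a = int_scale k a + a"
proof (cases k rule: int_cases)
  case (nonneg n)
  then have "nat (k + 1) = Suc n" by simp
  then show ?thesis using nonneg by (simp add: int_scale_def add.commute)
next
  case (neg n)
  then have "k + 1 = - int n" by simp
  then have "int_scale (k + 1) a = - (\<Sum>i<n. a)" by (simp only: int_scale_neg)
  moreover have "int_scale k a = - (\<Sum>i<Suc n. a)" by (simp only: neg int_scale_neg)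
  ultimately show ?thesis by simp
qed

lemma int_scale_pred: "int_scale (k - 1) a = int_scale k a - a"
  using int_scale_Suc[of "k - 1" a] by simp

lemma int_scale_0 [simp]: "int_scale 0 a = 0" by (simp add: int_scale_def)

lemma int_scale_1 [simp]: "int_scale 1 a = a" using int_scale_Suc[of 0 a] by simp

lemma int_scale_add_left: "int_scale (k + l) a = int_scale k a + int_scale l a"
proof (induction l rule: int_induct[where k = 0])
  case (step1 i)
  have "int_scale (k + (i + 1)) a = int_scale (k + i) a + a"
    using int_scale_Suc[of "k + i" a] by (simp add: add.assoc)
  with step1 show ?case by (simp add: int_scale_Suc add.assoc)
next
  case (step2 i)
  have "int_scale (k + (i - 1)) a = int_scale (k + i) a - a"
    using int_scale_pred[of "k + i" a] by (simp only: add_diff_eq)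
  with step2 show ?case by (simp add: int_scale_pred add_diff_eq)
qed simp

lemma int_scale_diff_left: "int_scale (k - l) a = int_scale k a - int_scale l a"
  using int_scale_add_left[of "k - l" l a] by (simp add: eq_diff_eq)

lemma int_scale_add_right: "int_scale k (a + b) = int_scale k a + int_scale k b"
  by (induction k rule: int_induct[where k = 0]) (simp_all add: int_scale_Suc int_scale_pred)

lemma int_scale_0_right [simp]: "int_scale k 0 = 0"
  using int_scale_add_right[of k 0 0] by simp

lemma int_scale_minus_right: "int_scale k (- a) = - int_scale k a"
  using int_scale_add_right[of k a "- a"] by (simp add: eq_neg_iff_add_eq_0 add.commute)

lemma int_scale_mult: "int_scale (k * l) a = int_scale k (int_scale l a)"
  by (induction k rule: int_induct[where k = 0])
     (simp_all add: int_scale_Suc int_scale_pred distrib_right left_diff_distrib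
                    int_scale_add_left int_scale_diff_left)

lemma int_scale_mult_left: "int_scale k a * (b :: 'a::comm_ring) = int_scale k (a * b)"
  by (induction k rule: int_induct[where k = 0])
     (simp_all add: int_scale_Suc int_scale_pred distrib_right left_diff_distrib)

text \<open>The unital extension \<open>\<int> \<oplus> \<AA>\<close>, with \<open>\<int>\<close> discrete.\<close>

datatype 'a unitization = Unitization (scal: int) (part: 'a)

instantiation unitization :: (comm_ring) comm_ring_1
begin
definition "0 = Unitization 0 0"
definition "1 = Unitization 1 0"
definition "x + y = Unitization (scal x + scal y) (part x + part y)"
definition "x - y = Unitization (scal x - scal y) (part x - part y)"
definition "- x = Unitization (- scal x) (- part x)"
definition "x * y =
  Unitization (scal x * scal y)
    (int_scale (scal x) (part y) + int_scale (scal y) (part x) + part x * part y)"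
instance
proof
  fix a b c :: "'a unitization"
  obtain k x l y m z where abc: "a = Unitization k x" "b = Unitization l y" "c = Unitization m z"
    by (metis unitization.exhaust)
  have scale_mult: "x * int_scale n y = int_scale n (x * y)" for n and x y :: 'a
    using int_scale_mult_left[of n y x] by (simp add: mult.commute)
  have swap: "int_scale i (int_scale j x) = int_scale (i * j) x" for i j and x :: 'a
    by (simp add: int_scale_mult)
  show "a * b * c = a * (b * c)"
    by (simp add: abc times_unitization_def int_scale_add_right int_scale_mult_left scale_mult swap
          distrib_left distrib_right mult.assoc)
       (simp add: mult.commute mult.left_commute add.commute add.left_commute)
  show "a * b = b * a"
    by (simp add: abc times_unitization_def mult.commute add.commute)
  show "1 * a = a"
    by (simp add: abc times_unitization_def one_unitization_def)
  show "(a + b) * c = a * c + b * c"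
    by (simp add: abc times_unitization_def plus_unitization_def int_scale_add_left
          int_scale_add_right distrib_right)
  show "a + b + c = a + (b + c)" "a + b = b + a"
    by (simp_all add: abc plus_unitization_def add.assoc add.commute)
  show "0 + a = a" "- a + a = 0" "a - b = a + - b" "(0 :: 'a unitization) \<noteq> 1"
    by (simp_all add: abc plus_unitization_def zero_unitization_def one_unitization_def
          uminus_unitization_def minus_unitization_def)
qed
end

instantiation unitization :: (topological_space) topological_space
begin
definition "open U \<longleftrightarrow> (\<forall>k. open {a. Unitization k a \<in> U})"
instance
proof
  show "open (UNIV :: 'a unitization set)" by (simp add: open_unitization_def)
  fix S T :: "'a unitization set"
  assume "open S" "open T"
  then have "open ({a. Unitization k a \<in> S} \<inter> {a. Unitization k a \<in> T})" for k
    by (intro open_Int) (auto simp: open_unitization_def)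
  moreover have "{a. Unitization k a \<in> S} \<inter> {a. Unitization k a \<in> T} = {a. Unitization k a \<in> S \<inter> T}" for k
    by auto
  ultimately show "open (S \<inter> T)" by (simp add: open_unitization_def)
next
  fix K :: "'a unitization set set"
  assume "\<forall>S\<in>K. open S"
  then have "open (\<Union>S\<in>K. {a. Unitization k a \<in> S})" for k
    by (intro open_UN) (auto simp: open_unitization_def)
  moreover have "(\<Union>S\<in>K. {a. Unitization k a \<in> S}) = {a. Unitization k a \<in> \<Union>K}" for k
    by auto
  ultimately show "open (\<Union>K)" by (simp add: open_unitization_def)
qed
end

instance unitization :: (t2_space) t2_space
proof
  fix x y :: "'a unitization"
  assume "x \<noteq> y"
  show "\<exists>U V. open U \<and> open V \<and> x \<in> U \<and> y \<in> V \<and> U \<inter> V = {}"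
  proof (cases "scal x = scal y")
    case True
    with \<open>x \<noteq> y\<close> have "part x \<noteq> part y" using unitization.expand by blast
    from hausdorff[OF this] obtain U V
      where "open U" "open V" "part x \<in> U" "part y \<in> V" "U \<inter> V = {}" by blast
    then show ?thesis
      by (intro exI[of _ "{z. part z \<in> U}"] exI[of _ "{z. part z \<in> V}"])
         (auto simp: open_unitization_def)
  next
    case False
    then show ?thesis
      by (intro exI[of _ "{z. scal z = scal x}"] exI[of _ "{z. scal z = scal y}"])
         (auto simp: open_unitization_def)
  qed
qed

text \<open>
  This family induces the product topology on \<open>\<int> \<oplus> \<AA>\<close>.  The seminorms \<open>\<bar>k\<bar> + p x\<close> are finite sums
  of its members; as membership in \<open>pseudo\<close> below can be checked on summands, adding them changes
  nothing.
\<close>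

definition unitization_seminorms :: "('a \<Rightarrow> real) set \<Rightarrow> ('a unitization \<Rightarrow> real) set" where
  "unitization_seminorms P =
     insert (\<lambda>x. real_of_int \<bar>scal x\<bar>) ((\<lambda>p x. p (part x)) ` P)"


section \<open>Matrices\<close>

text \<open>Rectangular matrices with possibly infinite index sets; the entries of a product are
  unconditional sums.\<close>

type_synonym ('i, 'j, 'r) matrix = "'i \<Rightarrow> 'j \<Rightarrow> 'r"

definition mat_mult :: "('i, 'k, 'r) matrix \<Rightarrow> ('k, 'j, 'r) matrix \<Rightarrow>
    ('i, 'j, 'r::{comm_ring, t2_space}) matrix"  (infixl \<open>\<odot>\<close> 70) where
  "A \<odot> B = (\<lambda>i j. \<Sum>\<^sub>\<infinity>k. A i k * B k j)"

definition mat_zero :: "('i, 'j, 'r::zero) matrix" where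
  "mat_zero = (\<lambda>i j. 0)"

definition mat_one :: "('i, 'i, 'r::zero_neq_one) matrix" where
  "mat_one = (\<lambda>i j. if i = j then 1 else 0)"

definition mat_add :: "('i, 'j, 'r::plus) matrix \<Rightarrow> ('i, 'j, 'r) matrix \<Rightarrow> ('i, 'j, 'r) matrix"
    (infixl \<open>\<boxplus>\<close> 65) where
  "A \<boxplus> B = (\<lambda>i j. A i j + B i j)"

definition mat_compl :: "('i, 'i, 'r::comm_ring_1) matrix \<Rightarrow> ('i, 'i, 'r) matrix" where
  "mat_compl a = (\<lambda>i j. mat_one i j - a i j)"

definition kron :: "('i, 'j, 'r::times) matrix \<Rightarrow> ('k, 'l, 'r) matrix \<Rightarrow> ('i \<times> 'k, 'j \<times> 'l, 'r) matrix"
    (infixl \<open>\<otimes>\<^sub>m\<close> 70) where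
  "A \<otimes>\<^sub>m B = (\<lambda>(i, k) (j, l). A i j * B k l)"

definition dsum :: "('i, 'i, 'r::zero) matrix \<Rightarrow> ('j, 'j, 'r) matrix \<Rightarrow> ('i + 'j, 'i + 'j, 'r) matrix" where
  "dsum A B = (\<lambda>s t. case (s, t) of (Inl i, Inl j) \<Rightarrow> A i j | (Inr i, Inr j) \<Rightarrow> B i j | _ \<Rightarrow> 0)"

text \<open>Block matrices over \<open>{0,1} \<times> \<Omega>\<close>, where \<open>{0,1}\<close> is \<open>bool\<close> and \<open>False\<close> stands for 0.\<close>

definition block :: "('i, 'i, 'r) matrix \<Rightarrow> ('i, 'i, 'r) matrix \<Rightarrow> ('i, 'i, 'r) matrix \<Rightarrow>
    ('i, 'i, 'r) matrix \<Rightarrow> (bool \<times> 'i, bool \<times> 'i, 'r) matrix" where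
  "block A B C D =
     (\<lambda>(s, i) (t, j). if s then (if t then D i j else C i j) else (if t then B i j else A i j))"

definition block_diag :: "('i, 'i, 'r::zero) matrix \<Rightarrow> ('i, 'i, 'r) matrix \<Rightarrow>
    (bool \<times> 'i, bool \<times> 'i, 'r) matrix" where
  "block_diag A B = block A mat_zero mat_zero B"

definition relabel :: "('i \<Rightarrow> 'j) \<Rightarrow> ('i, 'i, 'r::zero) matrix \<Rightarrow> ('j, 'j, 'r) matrix" where
  "relabel r A =
     (\<lambda>k l. if k \<in> range r \<and> l \<in> range r then A (inv r k) (inv r l) else 0)"

text \<open>\<open>rapid\<close> is \<open>\<K>\<^sub>\<Omega>\<close>, and \<open>pseudo\<close> is \<open>\<Psi>\<^sub>\<Omega>\<close> (matrices of pseudodifferential size).\<close>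

definition rapid :: "('a \<Rightarrow> real) set \<Rightarrow> ('i::spg, 'i, 'a) matrix set" where
  "rapid P = {A. \<forall>p\<in>P. \<forall>f\<in>growth. \<forall>h\<in>growth. \<exists>C. \<forall>n m. \<bar>f n * h m\<bar> * p (A n m) \<le> C}"

definition pseudo :: "('r \<Rightarrow> real) set \<Rightarrow> ('i::spg, 'i, 'r) matrix set" where
  "pseudo Q = {A. \<forall>p\<in>Q. \<forall>f\<in>growth. \<exists>g\<in>growth. \<forall>n m.
      \<bar>f n\<bar> * p (A n m) \<le> g m \<and> \<bar>f m\<bar> * p (A n m) \<le> g n}"

abbreviation Psi :: "('a \<Rightarrow> real) set \<Rightarrow> ('i::spg, 'i, 'a unitization) matrix set" where
  "Psi P \<equiv> pseudo (unitization_seminorms P)"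

definition embed :: "('i, 'j, 'a) matrix \<Rightarrow> ('i, 'j, 'a unitization) matrix" where
  "embed A = (\<lambda>i j. Unitization 0 (A i j))"

definition mat_approx :: "('a::comm_ring \<Rightarrow> real) set \<Rightarrow> ('i::spg, 'i, 'a unitization) matrix \<Rightarrow>
    ('i, 'i, 'a unitization) matrix \<Rightarrow> bool" where
  "mat_approx P a b \<longleftrightarrow> (\<lambda>i j. b i j - a i j) \<in> embed ` rapid P"

definition mat_inverse :: "('a::{comm_ring, t2_space} \<Rightarrow> real) set \<Rightarrow>
    ('i::spg, 'i, 'a unitization) matrix \<Rightarrow> ('i, 'i, 'a unitization) matrix \<Rightarrow> bool" where
  "mat_inverse P g h \<longleftrightarrow> g \<in> Psi P \<and> h \<in> Psi P \<and> g \<odot> h = mat_one \<and> h \<odot> g = mat_one"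

definition mat_inv :: "('a::{comm_ring, t2_space} \<Rightarrow> real) set \<Rightarrow>
    ('i::spg, 'i, 'a unitization) matrix \<Rightarrow> ('i, 'i, 'a unitization) matrix" where
  "mat_inv P g = (THE h. mat_inverse P g h)"

definition K_star :: "('a::{comm_ring, t2_space} \<Rightarrow> real) set \<Rightarrow>
    ('i::spg, 'i, 'a unitization) matrix set" where
  "K_star P = {g. (\<exists>A\<in>rapid P. g = mat_one \<boxplus> embed A) \<and> (\<exists>h. mat_inverse P g h)}"


section \<open>Pairs of idempotents\<close>

type_synonym ('i, 'a) mpair = "('i, 'i, 'a unitization) matrix \<times> ('i, 'i, 'a unitization) matrix"

definition pair_sum :: "('i, 'a::comm_ring) mpair \<Rightarrow> ('j, 'a) mpair \<Rightarrow> ('i + 'j, 'a) mpair" where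
  "pair_sum = (\<lambda>(b, a) (d, c). (dsum b d, dsum a c))"

definition pair_inv :: "('i, 'a::comm_ring) mpair \<Rightarrow> ('i, 'a) mpair" where
  "pair_inv = (\<lambda>(b, a). (mat_compl b, mat_compl a))"

definition pair_tensor_left :: "('i, 'a::comm_ring) mpair \<Rightarrow> ('j, 'a) mpair \<Rightarrow> ('i \<times> 'j, 'a) mpair" where
  "pair_tensor_left = (\<lambda>(b, a) (d, c).
     (b \<otimes>\<^sub>m d \<boxplus> mat_compl b \<otimes>\<^sub>m c, a \<otimes>\<^sub>m d \<boxplus> mat_compl a \<otimes>\<^sub>m c))"

definition pair_tensor_right :: "('i, 'a::comm_ring) mpair \<Rightarrow> ('j, 'a) mpair \<Rightarrow> ('i \<times> 'j, 'a) mpair" where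
  "pair_tensor_right = (\<lambda>(b, a) (d, c).
     (b \<otimes>\<^sub>m d \<boxplus> a \<otimes>\<^sub>m mat_compl d, b \<otimes>\<^sub>m c \<boxplus> a \<otimes>\<^sub>m mat_compl c))"

text \<open>The unit of \<open>\<AA>\<close>, not that of the unital extension, is the entry of \<open>\<one>\<close>: the two components
  of a pair have to agree modulo matrices over \<open>\<AA>\<close>.\<close>

definition pair_one :: "'a::comm_ring \<Rightarrow> (unit, 'a) mpair" where
  "pair_one u = ((\<lambda>_ _. Unitization 0 u), (\<lambda>_ _. 0))"

definition pair_relabel :: "('i \<Rightarrow> 'j) \<Rightarrow> ('i, 'a::comm_ring) mpair \<Rightarrow> ('j, 'a) mpair" where
  "pair_relabel r = (\<lambda>(b, a). (relabel r b, relabel r a))"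

definition regularize :: "('i, 'a::{comm_ring, t2_space}) mpair \<Rightarrow> (bool \<times> 'i, 'a) mpair" where
  "regularize = (\<lambda>(b, a).
     let U = block (mat_compl a) a a (mat_compl a)
     in (U \<odot> block_diag b (mat_compl a) \<odot> U, block_diag mat_zero mat_one))"


section \<open>The single-space Grassmannian\<close>

definition base :: "(bool \<times> nat, bool \<times> nat, 'a::comm_ring unitization) matrix" where
  "base = block_diag mat_zero mat_one"

definition grassmannian :: "('a::{comm_ring, t2_space} \<Rightarrow> real) set \<Rightarrow> (bool \<times> nat, 'a) mpair set" where
  "grassmannian P = {(b, base) | b. b \<in> Psi P \<and> b \<odot> b = b \<and> mat_approx P b base}"

definition gr_add :: "((bool \<times> nat) + (bool \<times> nat) \<Rightarrow> nat) \<Rightarrow>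
    (bool \<times> nat, 'a::{comm_ring, t2_space}) mpair \<Rightarrow> (bool \<times> nat, 'a) mpair \<Rightarrow> (bool \<times> nat, 'a) mpair" where
  "gr_add \<theta> x y = regularize (pair_relabel \<theta> (pair_sum x y))"

definition gr_neg :: "(bool \<times> nat \<Rightarrow> nat) \<Rightarrow>
    (bool \<times> nat, 'a::{comm_ring, t2_space}) mpair \<Rightarrow> (bool \<times> nat, 'a) mpair" where
  "gr_neg \<theta> x = regularize (pair_relabel \<theta> (pair_inv x))"

definition gr_zero :: "(bool \<times> nat, 'a::comm_ring) mpair" where
  "gr_zero = (base, base)"

definition gr_mult ::
  "((bool \<times> nat, 'a) mpair \<Rightarrow> (bool \<times> nat, 'a) mpair \<Rightarrow> ((bool \<times> nat) \<times> (bool \<times> nat), 'a) mpair) \<Rightarrow>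
    ((bool \<times> nat) \<times> (bool \<times> nat) \<Rightarrow> nat) \<Rightarrow>
    (bool \<times> nat, 'a::{comm_ring, t2_space}) mpair \<Rightarrow> (bool \<times> nat, 'a) mpair \<Rightarrow> (bool \<times> nat, 'a) mpair" where
  "gr_mult tensor \<theta> x y = regularize (pair_relabel \<theta> (tensor x y))"

definition gr_one :: "(unit \<Rightarrow> nat) \<Rightarrow> 'a \<Rightarrow> (bool \<times> nat, 'a::{comm_ring, t2_space}) mpair" where
  "gr_one \<theta> u = regularize (pair_relabel \<theta> (pair_one u))"


section \<open>Smooth algebraic homotopy\<close>

definition conjugates :: "('a::{comm_ring, t2_space} \<Rightarrow> real) set \<Rightarrow>
    (bool \<times> bool \<times> nat, bool \<times> bool \<times> nat, 'a unitization) matrix \<Rightarrow>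
    (bool \<times> nat, 'a) mpair \<Rightarrow> (bool \<times> nat, 'a) mpair \<Rightarrow> bool" where
  "conjugates P g x2 x1 \<longleftrightarrow>
     g \<in> K_star P \<and>
     g \<odot> block_diag (fst x2) base \<odot> mat_inv P g = block_diag (fst x1) base"

definition sm_alg :: "('a::{comm_ring, t2_space} \<Rightarrow> real) set \<Rightarrow> 'x set \<Rightarrow>
    ('x \<Rightarrow> (bool \<times> nat, 'a) mpair) \<Rightarrow> ('x \<Rightarrow> (bool \<times> nat, 'a) mpair) \<Rightarrow> bool" where
  "sm_alg P X f1 f2 \<longleftrightarrow>
     f1 ` X \<subseteq> grassmannian P \<and> f2 ` X \<subseteq> grassmannian P \<and>
     (\<exists>g. \<forall>x\<in>X. conjugates P (g x) (f2 x) (f1 x))"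


section \<open>Polynomial assembly\<close>

definition relabel_matrix :: "'i set \<Rightarrow> ('i \<Rightarrow> 'j) \<Rightarrow> ('j, 'i, 'r::zero_neq_one) matrix" where
  "relabel_matrix \<Omega> r = (\<lambda>k i. if i \<in> \<Omega> \<and> k = r i then 1 else 0)"

definition kron_nat :: "(nat, nat, 'r::times) matrix \<Rightarrow> (nat, nat, 'r) matrix \<Rightarrow> (nat, nat, 'r) matrix" where
  "kron_nat A B = (\<lambda>m n. (A \<otimes>\<^sub>m B) (prod_decode m) (prod_decode n))"

text \<open>
  Matrix polynomials pass through matrices over various index sets.  To have them in one
  inductive definition, every index set is regarded as a set of natural numbers with the
  restricted growth structure, and products of index sets are formed with \<open>prod_encode\<close>.  A matrix
  over subsets \<open>\<Omega>'\<close> and \<open>\<Omega>\<close> is extended by zeros.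
  Relabeling matrices act on both sides, \<open>r\<^sub>* A = R A R\<^sup>T\<close>, hence their transposes are admitted too.
  The unit matrix of an index set \<open>\<Omega>\<close> is the relabeling matrix of the identity of \<open>\<Omega>\<close>, and direct
  sums are sums of relabeled matrices.  The set \<open>D\<close> consists of the initial data,
  as functions of a parameter.
\<close>

inductive_set assembled_nat ::
    "('x \<Rightarrow> (nat, nat, 'r::{comm_ring_1, t2_space}) matrix) set \<Rightarrow>
     ('x \<Rightarrow> (nat, nat, 'r) matrix) set"
  for D where
  data: "F \<in> D \<Longrightarrow> F \<in> assembled_nat D"
| relab: "\<lbrakk>spg_on \<Omega> (restrict_growth \<Omega> poly_growth); spg_on \<Omega>' (restrict_growth \<Omega>' poly_growth);
    relabeling_on \<Omega> (restrict_growth \<Omega> poly_growth) \<Omega>' (restrict_growth \<Omega>' poly_growth) r\<rbrakk>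
    \<Longrightarrow> (\<lambda>_. relabel_matrix \<Omega> r) \<in> assembled_nat D"
| relab_transpose:
   "\<lbrakk>spg_on \<Omega> (restrict_growth \<Omega> poly_growth); spg_on \<Omega>' (restrict_growth \<Omega>' poly_growth);
    relabeling_on \<Omega> (restrict_growth \<Omega> poly_growth) \<Omega>' (restrict_growth \<Omega>' poly_growth) r\<rbrakk>
    \<Longrightarrow> (\<lambda>_ i k. relabel_matrix \<Omega> r k i) \<in> assembled_nat D"
| add: "\<lbrakk>F \<in> assembled_nat D; G \<in> assembled_nat D\<rbrakk> \<Longrightarrow> (\<lambda>x. F x \<boxplus> G x) \<in> assembled_nat D"
| neg: "F \<in> assembled_nat D \<Longrightarrow> (\<lambda>x i j. - F x i j) \<in> assembled_nat D"
| mult: "\<lbrakk>F \<in> assembled_nat D; G \<in> assembled_nat D\<rbrakk> \<Longrightarrow> (\<lambda>x. F x \<odot> G x) \<in> assembled_nat D"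
| tensor: "\<lbrakk>F \<in> assembled_nat D; G \<in> assembled_nat D\<rbrakk>
    \<Longrightarrow> (\<lambda>x. kron_nat (F x) (G x)) \<in> assembled_nat D"

definition coded :: "('x \<Rightarrow> ('i::spg, 'i, 'r::zero) matrix) \<Rightarrow> 'x \<Rightarrow> (nat, nat, 'r) matrix" where
  "coded F = (\<lambda>x. relabel code (F x))"

definition assembled :: "('x \<Rightarrow> (nat, nat, 'r::{comm_ring_1, t2_space}) matrix) set \<Rightarrow>
    ('x \<Rightarrow> ('i::spg, 'i, 'r) matrix) \<Rightarrow> bool" where
  "assembled D F \<longleftrightarrow> coded F \<in> assembled_nat D"


section \<open>Operations and identities\<close>

text \<open>An operation, or a side of an identity, of arity \<open>n\<close> is a function on lists of length \<open>n\<close>.\<close>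

definition tuples :: "'b set \<Rightarrow> nat \<Rightarrow> 'b list set" where
  "tuples G n = {v. length v = n \<and> set v \<subseteq> G}"

definition hring_operations ::
  "('b \<Rightarrow> 'b \<Rightarrow> 'b) \<Rightarrow> ('b \<Rightarrow> 'b) \<Rightarrow> 'b \<Rightarrow> ('b \<Rightarrow> 'b \<Rightarrow> 'b) \<Rightarrow> (nat \<times> ('b list \<Rightarrow> 'b)) set" where
  "hring_operations add neg zero prd =
     {(2, \<lambda>v. add (v!0) (v!1)), (1, \<lambda>v. neg (v!0)), (0, \<lambda>v. zero), (2, \<lambda>v. prd (v!0) (v!1))}"

definition hring_identities ::
  "('b \<Rightarrow> 'b \<Rightarrow> 'b) \<Rightarrow> ('b \<Rightarrow> 'b) \<Rightarrow> 'b \<Rightarrow> ('b \<Rightarrow> 'b \<Rightarrow> 'b) \<Rightarrow>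
    (nat \<times> ('b list \<Rightarrow> 'b) \<times> ('b list \<Rightarrow> 'b)) set" where
  "hring_identities add neg zero prd =
     {(3, \<lambda>v. add (add (v!0) (v!1)) (v!2), \<lambda>v. add (v!0) (add (v!1) (v!2))),
      (2, \<lambda>v. add (v!0) (v!1), \<lambda>v. add (v!1) (v!0)),
      (1, \<lambda>v. add (v!0) zero, \<lambda>v. v!0),
      (1, \<lambda>v. add (v!0) (neg (v!0)), \<lambda>v. zero),
      (3, \<lambda>v. prd (prd (v!0) (v!1)) (v!2), \<lambda>v. prd (v!0) (prd (v!1) (v!2))),
      (2, \<lambda>v. prd (v!0) (v!1), \<lambda>v. prd (v!1) (v!0)),
      (3, \<lambda>v. prd (v!0) (add (v!1) (v!2)), \<lambda>v. add (prd (v!0) (v!1)) (prd (v!0) (v!2))),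
      (3, \<lambda>v. prd (add (v!0) (v!1)) (v!2), \<lambda>v. add (prd (v!0) (v!2)) (prd (v!1) (v!2)))}"

definition hring_unit_identities ::
  "('b \<Rightarrow> 'b \<Rightarrow> 'b) \<Rightarrow> 'b \<Rightarrow> (nat \<times> ('b list \<Rightarrow> 'b) \<times> ('b list \<Rightarrow> 'b)) set" where
  "hring_unit_identities prd one =
     {(1, \<lambda>v. prd (v!0) one, \<lambda>v. v!0), (1, \<lambda>v. v!0, \<lambda>v. prd one (v!0))}"

definition respects_sm_alg :: "('a::{comm_ring, t2_space} \<Rightarrow> real) set \<Rightarrow> 'x set \<Rightarrow> nat \<Rightarrow>
    ((bool \<times> nat, 'a) mpair list \<Rightarrow> (bool \<times> nat, 'a) mpair) \<Rightarrow> bool" where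
  "respects_sm_alg P X n Op \<longleftrightarrow>
     (\<forall>f f'. (\<forall>i<n. sm_alg P X (f i) (f' i)) \<longrightarrow>
        sm_alg P X (\<lambda>x. Op (map (\<lambda>i. f i x) [0..<n])) (\<lambda>x. Op (map (\<lambda>i. f' i x) [0..<n])))"

text \<open>
  Polynomial homotopies.  The set \<open>C\<close> consists of constant initial data (the \<open>1 \<times> 1\<close> matrix of the
  unit of \<open>\<AA>\<close> where \<open>\<one>\<close> is involved).  Base terms are the constant \<open>base\<close> and need not be listed.
\<close>

definition poly_identity :: "('a::{comm_ring, t2_space} \<Rightarrow> real) set \<Rightarrow>
    (nat, nat, 'a unitization) matrix set \<Rightarrow> nat \<Rightarrow>
    ((bool \<times> nat, 'a) mpair list \<Rightarrow> (bool \<times> nat, 'a) mpair) \<Rightarrow>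
    ((bool \<times> nat, 'a) mpair list \<Rightarrow> (bool \<times> nat, 'a) mpair) \<Rightarrow> bool" where
  "poly_identity P C n l r \<longleftrightarrow>
     (\<exists>g. assembled ({coded (\<lambda>v. fst (v!i)) | i. i < n} \<union> {\<lambda>_. c | c. c \<in> C}) g \<and>
          (\<forall>v\<in>tuples (grassmannian P) n. conjugates P (g v) (r v) (l v)))"

text \<open>
  For a compatibility the initial data are the arguments \<open>v\<close>, \<open>v'\<close> and the given conjugating
  elements \<open>h\<close> of the group, together with their inverses.
\<close>

definition poly_compatible :: "('a::{comm_ring, t2_space} \<Rightarrow> real) set \<Rightarrow>
    (nat, nat, 'a unitization) matrix set \<Rightarrow> nat \<Rightarrow>
    ((bool \<times> nat, 'a) mpair list \<Rightarrow> (bool \<times> nat, 'a) mpair) \<Rightarrow> bool" where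
  "poly_compatible P C n Op \<longleftrightarrow>
     (\<exists>g. assembled
            ({coded (\<lambda>(v, v', h). fst (v!i)) | i. i < n} \<union>
             {coded (\<lambda>(v, v', h). fst (v'!i)) | i. i < n} \<union>
             {coded (\<lambda>(v, v', h). h!i) | i. i < n} \<union>
             {coded (\<lambda>(v, v', h). mat_inv P (h!i)) | i. i < n} \<union>
             {\<lambda>_. c | c. c \<in> C}) g \<and>
          (\<forall>v\<in>tuples (grassmannian P) n. \<forall>v'\<in>tuples (grassmannian P) n. \<forall>h.
             length h = n \<and> (\<forall>i<n. conjugates P (h!i) (v'!i) (v!i)) \<longrightarrow>
             conjugates P (g (v, v', h)) (Op v') (Op v)))"

text \<open>
  The clauses are: the operations are defined on the Grassmannian; the identities hold up to
  homotopy; the operations are compatible with homotopy; the homotopies of the identities and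
  those of the compatibilities are given by polynomially assembled maps.
\<close>

definition homotopy_hring :: "('a::{comm_ring, t2_space} \<Rightarrow> real) set \<Rightarrow> 'x set \<Rightarrow>
    (nat, nat, 'a unitization) matrix set \<Rightarrow>
    (nat \<times> ((bool \<times> nat, 'a) mpair list \<Rightarrow> (bool \<times> nat, 'a) mpair)) set \<Rightarrow>
    (nat \<times> ((bool \<times> nat, 'a) mpair list \<Rightarrow> (bool \<times> nat, 'a) mpair) \<times>
           ((bool \<times> nat, 'a) mpair list \<Rightarrow> (bool \<times> nat, 'a) mpair)) set \<Rightarrow> bool" where
  "homotopy_hring P X C ops ids \<longleftrightarrow>
     (\<forall>(n, Op)\<in>ops. Op ` tuples (grassmannian P) n \<subseteq> grassmannian P) \<and>
     (\<forall>(n, l, r)\<in>ids. sm_alg P (tuples (grassmannian P) n) l r) \<and>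
     (\<forall>(n, Op)\<in>ops. respects_sm_alg P X n Op) \<and>
     (\<forall>(n, l, r)\<in>ids. poly_identity P C n l r) \<and>
     (\<forall>(n, Op)\<in>ops. poly_compatible P C n Op)"

end

theory Submission
  imports Defs "HOL-Analysis.Summation_Tests"
begin

text \<open>
  On pairs of matrices congruent modulo \<open>\<K>\<close>, \<open>\<delta> \<langle>b, a\<rangle> = \<langle>a, a\<rangle>\<close> is a ring endomorphism.  A splitting
  of \<open>\<nat>\<close> into two copies of itself turns direct sums into an inner operation, by way of elements
  with \<open>s\<^sub>0 t\<^sub>0 + s\<^sub>1 t\<^sub>1 = 1\<close>, \<open>t\<^sub>i s\<^sub>i = 1\<close> and \<open>t\<^sub>0 s\<^sub>1 = t\<^sub>1 s\<^sub>0 = 0\<close>.  Call idempotent pairs \<open>P\<close>, \<open>Q\<close>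
  similar if \<open>P \<oplus> (1 - \<delta> P) \<oplus> e\<close> and \<open>Q \<oplus> (1 - \<delta> Q) \<oplus> e\<close> are conjugate.  A pair is similar to its
  regularization and to its relabelings, so up to similarity the operations are direct sum, complement
  and tensor product, for which the identities are short computations.  If \<open>P\<close> and \<open>Q\<close> are similar
  and \<open>\<delta> P = \<delta> Q = e\<close>, a lift of the image under \<open>\<delta>\<close> of the conjugating element, obtained as in the
  Whitehead lemma, corrects it to an element \<open>g\<close> with \<open>\<delta> g = 1\<close>, which is an algebraic homotopy.  All
  this takes place in the ring of polynomially assembled families of matrices, so the homotopies are
  polynomial in the data.
\<close>

section \<open>Stable conjugacy of idempotents\<close>

text \<open>The homotopies have to be polynomial in the data, so mere existence of conjugating
  elements, as in an argument with isomorphism classes, is not enough. Therefore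
  \<open>conjug\<close> asks for the element and its inverse inside a prescribed subring
  \<open>D\<close>, and every later step forms new elements from old ones by ring operations. The
  condition \<open>\<delta> g = 1\<close> on a homotopy is deferred to the very end: until then
  relabelings, flips and Murray-von Neumann equivalences may move the base term as well, which is
  what makes similarity flexible. Among the identities, commutativity of the product is the hard
  one, since \<open>b \<otimes> d + (1 - b) \<otimes> c\<close> treats its factors differently. It
  reduces to a comparison of the two products, each being the flip of the other, and it also turns
  congruence in the second factor, which is easy, into congruence in the first. On the analytic side
  the data make sense only for the given seminorms and for admissible parameters, whereas equations
  of the ring concern all of them; the data are continued by constants elsewhere.\<close>

locale cuntz =
  fixes s0 s1 t0 t1 :: "'r::{ring,monoid_mult}"
  assumes cuntz_orth [simp]: "t0 * s0 = 1" "t1 * s1 = 1" "t0 * s1 = 0" "t1 * s0 = 0"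
    and cuntz_sum: "s0 * t0 + s1 * t1 = 1"
begin

lemma inv_cancel: "w' * w = (1::'r) \<Longrightarrow> w' * (w * x) = x"
  by (simp add: mult.assoc[symmetric])

lemma cuntz_orth' [simp]:
  "t0 * (s0 * x) = x" "t1 * (s1 * x) = x" "t0 * (s1 * x) = 0" "t1 * (s0 * x) = 0"
  by (simp_all add: mult.assoc[symmetric])

lemma cuntz_last: "s1 * t1 = 1 - s0 * t0" "s1 * (t1 * x) = x - s0 * (t0 * x)"
proof -
  show *: "s1 * t1 = 1 - s0 * t0" using cuntz_sum by (simp add: eq_diff_eq add.commute)
  show "s1 * (t1 * x) = x - s0 * (t0 * x)"
    using arg_cong[OF *, of "\<lambda>z. z * x"] by (simp add: algebra_simps)
qed

text \<open>The ring is isomorphic to the ring of two-by-two matrices over itself, and this is the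
  element with the given four entries; \<open>blk_mult\<close> is matrix multiplication.\<close>

definition blk :: "'r \<Rightarrow> 'r \<Rightarrow> 'r \<Rightarrow> 'r \<Rightarrow> 'r" where
  "blk a b c d = s0 * a * t0 + s0 * b * t1 + s1 * c * t0 + s1 * d * t1"

lemma blk_mult [simp]:
  "blk a b c d * blk a' b' c' d' =
     blk (a * a' + b * c') (a * b' + b * d') (c * a' + d * c') (c * b' + d * d')"
  by (simp add: blk_def algebra_simps)

lemma blk_add [simp]: "blk a b c d + blk a' b' c' d' = blk (a + a') (b + b') (c + c') (d + d')"
  by (simp add: blk_def algebra_simps)

lemma blk_diff [simp]: "blk a b c d - blk a' b' c' d' = blk (a - a') (b - b') (c - c') (d - d')"
  by (simp add: blk_def algebra_simps)

lemma blk_one [simp]: "blk 1 0 0 1 = 1"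
  by (simp add: blk_def cuntz_sum)

lemma blk_zero [simp]: "blk 0 0 0 0 = 0"
  by (simp add: blk_def)

abbreviation dsm :: "'r \<Rightarrow> 'r \<Rightarrow> 'r"  (infixr \<open>\<oplus>\<close> 65) where
  "x \<oplus> y \<equiv> blk x 0 0 y"

text \<open>For idempotent \<open>a\<close> this interchanges the two copies on the range of
  \<open>a\<close> and fixes both on the range of \<open>1 - a\<close>. With \<open>a\<close> the
  base term it is the outer matrix of the regularization.\<close>

definition swp :: "'r \<Rightarrow> 'r" where
  "swp a = blk (1 - a) a a (1 - a)"

lemma swp_swp: "a * a = a \<Longrightarrow> swp a * swp a = 1"
  by (simp add: swp_def algebra_simps)

definition e :: 'r where "e = s1 * t1"

lemma e_eq: "e = 0 \<oplus> 1" by (simp add: e_def blk_def)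

lemma e_e [simp]: "e * e = e" by (simp add: e_eq)

end

text \<open>\<open>D\<close> stands for the pairs with polynomially assembled components that are
  congruent modulo \<K>, and \<open>\<delta>\<close> replaces the leading term by the base term. The
  generators are diagonal pairs, hence fixed by \<open>\<delta>\<close>; so is every word in
  them.\<close>

locale graded_cuntz = cuntz s0 s1 t0 t1 for s0 s1 t0 t1 :: "'r::{ring,monoid_mult}" +
  fixes D :: "'r set" and \<delta> :: "'r \<Rightarrow> 'r"
  assumes one_D: "1 \<in> D"
    and add_D: "x \<in> D \<Longrightarrow> y \<in> D \<Longrightarrow> x + y \<in> D"
    and uminus_D: "x \<in> D \<Longrightarrow> - x \<in> D"
    and mult_D: "x \<in> D \<Longrightarrow> y \<in> D \<Longrightarrow> x * y \<in> D"
    and gen_D: "s0 \<in> D" "s1 \<in> D" "t0 \<in> D" "t1 \<in> D"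
    and \<delta>_D: "x \<in> D \<Longrightarrow> \<delta> x \<in> D"
    and \<delta>_one [simp]: "\<delta> 1 = 1"
    and \<delta>_add [simp]: "\<delta> (x + y) = \<delta> x + \<delta> y"
    and \<delta>_mult [simp]: "\<delta> (x * y) = \<delta> x * \<delta> y"
    and \<delta>_\<delta> [simp]: "\<delta> (\<delta> x) = \<delta> x"
    and \<delta>_gen [simp]: "\<delta> s0 = s0" "\<delta> s1 = s1" "\<delta> t0 = t0" "\<delta> t1 = t1"
begin

lemma \<delta>_zero [simp]: "\<delta> 0 = 0"
  using \<delta>_add[of 0 0] by (metis add_cancel_right_right)

lemma \<delta>_uminus [simp]: "\<delta> (- x) = - \<delta> x"
  using \<delta>_add[of x "- x"] by (simp add: eq_neg_iff_add_eq_0 add.commute)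

lemma \<delta>_diff [simp]: "\<delta> (x - y) = \<delta> x - \<delta> y"
  using \<delta>_add[of x "- y"] by simp

lemma zero_D: "0 \<in> D"
  using add_D[OF one_D uminus_D[OF one_D]] by simp

lemma diff_D: "x \<in> D \<Longrightarrow> y \<in> D \<Longrightarrow> x - y \<in> D"
  using add_D[OF _ uminus_D] by (metis diff_conv_add_uminus)

lemmas closed_D = one_D zero_D add_D uminus_D diff_D mult_D gen_D \<delta>_D

lemma \<delta>_blk [simp]: "\<delta> (blk a b c d) = blk (\<delta> a) (\<delta> b) (\<delta> c) (\<delta> d)"
  by (simp add: blk_def)

lemma blk_D: "a \<in> D \<Longrightarrow> b \<in> D \<Longrightarrow> c \<in> D \<Longrightarrow> d \<in> D \<Longrightarrow> blk a b c d \<in> D"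
  unfolding blk_def by (intro closed_D)

lemma swp_D: "a \<in> D \<Longrightarrow> swp a \<in> D"
  unfolding swp_def by (intro blk_D closed_D)

lemma e_D: "e \<in> D" unfolding e_eq by (intro blk_D closed_D)

lemma \<delta>_e [simp]: "\<delta> e = e" by (simp add: e_eq)

section \<open>Conjugacy of idempotents inside the subring \<open>D\<close>\<close>

definition conjug :: "'r \<Rightarrow> 'r \<Rightarrow> bool" where
  "conjug x y \<longleftrightarrow> (\<exists>W\<in>D. \<exists>W'\<in>D. W * W' = 1 \<and> W' * W = 1 \<and> W * x * W' = y)"

lemma conjugI: "W \<in> D \<Longrightarrow> W' \<in> D \<Longrightarrow> W * W' = 1 \<Longrightarrow> W' * W = 1 \<Longrightarrow> W * x * W' = y \<Longrightarrow> conjug x y"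
  unfolding conjug_def by blast

lemma conjugE:
  assumes "conjug x y"
  obtains W W' where "W \<in> D" "W' \<in> D" "W * W' = 1" "W' * W = 1" "W * x * W' = y"
  using assms unfolding conjug_def by blast

lemma conjug_refl: "conjug x x"
  by (rule conjugI[of 1 1]) (auto simp: closed_D)

lemma conjug_sym: assumes "conjug x y" shows "conjug y x"
proof -
  from assms obtain W W' where "W \<in> D" "W' \<in> D" "W * W' = 1" "W' * W = 1" "W * x * W' = y"
    by (rule conjugE)
  then show ?thesis
    by (intro conjugI[of W' W]) (auto simp: mult.assoc inv_cancel)
qed

lemma conjug_trans [trans]: assumes "conjug x y" "conjug y z" shows "conjug x z"
proof -
  from assms(1) obtain W W' where 1: "W \<in> D" "W' \<in> D" "W * W' = 1" "W' * W = 1" "W * x * W' = y"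
    by (rule conjugE)
  from assms(2) obtain V V' where 2: "V \<in> D" "V' \<in> D" "V * V' = 1" "V' * V = 1" "V * y * V' = z"
    by (rule conjugE)
  show ?thesis
    using 1 2 by (intro conjugI[of "V * W" "W' * V'"] mult_D) (auto simp: mult.assoc inv_cancel)
qed

lemma conjug_dsm: assumes "conjug x x'" "conjug y y'" shows "conjug (x \<oplus> y) (x' \<oplus> y')"
proof -
  from assms(1) obtain W W' where 1: "W \<in> D" "W' \<in> D" "W * W' = 1" "W' * W = 1" "W * x * W' = x'"
    by (rule conjugE)
  from assms(2) obtain V V' where 2: "V \<in> D" "V' \<in> D" "V * V' = 1" "V' * V = 1" "V * y * V' = y'"
    by (rule conjugE)
  show ?thesis
    using 1 2 by (intro conjugI[of "W \<oplus> V" "W' \<oplus> V'"] blk_D zero_D) auto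
qed

lemma conjug_\<delta>: assumes "conjug x y" shows "conjug (\<delta> x) (\<delta> y)"
proof -
  from assms obtain W W' where 1: "W \<in> D" "W' \<in> D" "W * W' = 1" "W' * W = 1" "W * x * W' = y"
    by (rule conjugE)
  then show ?thesis
    by (intro conjugI[of "\<delta> W" "\<delta> W'"] \<delta>_D) (auto simp flip: \<delta>_mult)
qed

lemma conjug_invol: "W \<in> D \<Longrightarrow> W * W = 1 \<Longrightarrow> W * x * W = y \<Longrightarrow> conjug x y"
  by (rule conjugI)

definition Idm :: "'r set" where "Idm = {x \<in> D. x * x = x}"

lemma Idm_D: "x \<in> Idm \<Longrightarrow> x \<in> D" and Idm_idem: "x \<in> Idm \<Longrightarrow> x * x = x"
  by (auto simp: Idm_def)

lemma Idm_idem': "x \<in> Idm \<Longrightarrow> x * (x * y) = x * y"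
  by (simp add: mult.assoc[symmetric] Idm_idem)

lemma Idm_zero: "0 \<in> Idm" and Idm_one: "1 \<in> Idm" and Idm_e: "e \<in> Idm"
  by (auto simp: Idm_def closed_D e_D)

lemma Idm_dsm: "x \<in> Idm \<Longrightarrow> y \<in> Idm \<Longrightarrow> x \<oplus> y \<in> Idm"
  by (auto simp: Idm_def intro!: blk_D zero_D)

lemma Idm_compl: "x \<in> Idm \<Longrightarrow> 1 - x \<in> Idm"
  by (auto simp: Idm_def algebra_simps closed_D)

lemma Idm_\<delta>: "x \<in> Idm \<Longrightarrow> \<delta> x \<in> Idm"
  by (auto simp: Idm_def \<delta>_D simp flip: \<delta>_mult)

lemma Idm_iso: "t' * t = 1 \<Longrightarrow> t \<in> D \<Longrightarrow> t' \<in> D \<Longrightarrow> x \<in> Idm \<Longrightarrow> t * x * t' \<in> Idm"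
  by (auto simp: Idm_def closed_D mult.assoc inv_cancel) (simp add: mult.assoc[symmetric])

lemma Idm_conjug:
  assumes "x \<in> Idm" "conjug x y" shows "y \<in> Idm"
proof -
  from assms(2) obtain W W' where "W \<in> D" "W' \<in> D" "W * W' = 1" "W' * W = 1" "W * x * W' = y"
    by (rule conjugE)
  with Idm_iso[of W' W x] assms(1) show ?thesis by simp
qed

section \<open>Similarity and its behaviour under direct sums and complements\<close>

definition stab :: "'r \<Rightarrow> 'r" where
  "stab P = (P \<oplus> (1 - \<delta> P)) \<oplus> e"

text \<open>In \<open>stab P\<close> the summand \<open>1 - \<delta> P\<close> complements the base
  term, so that summands fixed by \<open>\<delta>\<close> can be moved in and out of
  \<open>P\<close>; the summand \<open>e\<close> is a reservoir of zeros and ones that makes room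
  for reindexing.\<close>

definition sim :: "'r \<Rightarrow> 'r \<Rightarrow> bool"  (infix \<open>\<simeq>\<close> 50) where
  "P \<simeq> Q \<longleftrightarrow> conjug (stab P) (stab Q)"

lemma sim_refl: "P \<simeq> P" unfolding sim_def by (rule conjug_refl)
lemma sim_sym: "P \<simeq> Q \<Longrightarrow> Q \<simeq> P" unfolding sim_def by (rule conjug_sym)
lemma sim_trans [trans]: "P \<simeq> Q \<Longrightarrow> Q \<simeq> R \<Longrightarrow> P \<simeq> R" unfolding sim_def by (rule conjug_trans)

lemma sim_conjug: assumes "conjug P Q" shows "P \<simeq> Q"
proof -
  have "conjug (1 - \<delta> P) (1 - \<delta> Q)"
  proof -
    from assms[THEN conjug_\<delta>] obtain W W' where "W \<in> D" "W' \<in> D" "W * W' = 1" "W' * W = 1" "W * \<delta> P * W' = \<delta> Q"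
      by (rule conjugE)
    then show ?thesis by (intro conjugI[of W W']) (auto simp: algebra_simps)
  qed
  then show ?thesis
    unfolding sim_def stab_def by (intro conjug_dsm assms conjug_refl)
qed

lemma sim_swap: "P \<oplus> Q \<simeq> Q \<oplus> P"
  by (intro sim_conjug conjug_invol[of "blk 0 1 1 0"] blk_D closed_D) auto

text \<open>The summand \<open>0 \<oplus> 1\<close> absorbs \<open>0\<close> and \<open>1\<close>: a permutation of the words in the generators.\<close>

lemma sim_corner: "P \<oplus> 0 \<simeq> P"
proof -
  define W where "W = s0 * s0 * s0 * t0 * t0 + s0 * s1 * s0 * t1 * t0 + s0 * s0 * s1 * t0 * t0 * t1
    + s1 * s0 * t1 * t0 * t1 + s0 * s1 * s1 * t0 * t1 * t1 + s1 * s1 * t1 * t1 * t1"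
  define W' where "W' = s0 * s0 * t0 * t0 * t0 + s0 * s1 * t0 * t1 * t0 + s1 * s0 * s0 * t1 * t0 * t0
    + s1 * s0 * s1 * t0 * t1 + s1 * s1 * s0 * t1 * t1 * t0 + s1 * s1 * s1 * t1 * t1"
  have D: "W \<in> D" "W' \<in> D" unfolding W_def W'_def by (intro closed_D)+
  have 1: "W' * W = 1" "W * W' = 1"
    by (simp_all add: W_def W'_def algebra_simps cuntz_last)
  have "W * stab P * W' = stab (P \<oplus> 0)"
    by (simp add: stab_def e_def blk_def W_def W'_def algebra_simps cuntz_last)
  with D 1 have "P \<simeq> P \<oplus> 0" unfolding sim_def by (intro conjugI[of W W'])
  then show ?thesis by (rule sim_sym)
qed

text \<open>Murray-von Neumann equivalence becomes conjugacy once there is room for a second block: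
  an involution made of the two partial isometries carries \<open>P \<oplus> 0\<close> to
  \<open>0 \<oplus> Q\<close>.\<close>

lemma sim_mvn:
  assumes "P \<in> Idm" "Q \<in> Idm" "T \<in> D" "S \<in> D" "T * S = P" "S * T = Q"
  shows "P \<simeq> Q"
proof -
  \<comment> \<open>\<open>T\<close> and \<open>S\<close> are cut down so that also
    \<open>P * T' = T' = T' * Q\<close> and \<open>Q * S' = S' = S' * P\<close>; these relations
    make the off-diagonal entries of \<open>Z * Z\<close> below vanish.\<close>
  define T' S' where "T' = P * T" and "S' = Q * S"
  have TQ: "P * T = T * Q" and SP: "Q * S = S * P"
    using assms(5,6) by (auto simp: mult.assoc)
  have id: "P * P = P" "Q * Q = Q" "P * (P * x) = P * x" "Q * (Q * x) = Q * x" for x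
    using assms(1,2) by (auto simp: Idm_idem Idm_idem')
  have TS: "T' * S' = P"
    unfolding T'_def S'_def TQ by (simp add: mult.assoc id) (simp add: SP mult.assoc[symmetric] assms id)
  have ST: "S' * T' = Q"
    unfolding T'_def S'_def SP by (simp add: mult.assoc id) (simp add: TQ mult.assoc[symmetric] assms id)
  have a: "P * T' = T'" "Q * S' = S'" by (simp_all add: T'_def S'_def id)
  have b: "T' * Q = T'" "S' * P = S'" unfolding T'_def S'_def TQ SP by (simp_all add: mult.assoc id)
  define Z where "Z = blk (1 - P) T' S' (1 - Q)"
  have "T' \<in> D" "S' \<in> D" using assms(1-4) by (auto simp: T'_def S'_def closed_D Idm_D)
  then have Z: "Z \<in> D"
    using Idm_D[OF assms(1)] Idm_D[OF assms(2)] unfolding Z_def by (auto intro!: blk_D one_D diff_D)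
  have "Z * Z = 1"
    by (simp add: Z_def algebra_simps id TS ST a b)
  moreover have "Z * (P \<oplus> 0) * Z = 0 \<oplus> Q"
    by (simp add: Z_def algebra_simps id TS ST a b)
  ultimately have *: "P \<oplus> 0 \<simeq> 0 \<oplus> Q"
    using Z by (intro sim_conjug conjug_invol[of Z])
  have "P \<simeq> P \<oplus> 0" by (rule sim_sym[OF sim_corner])
  also note *
  also have "0 \<oplus> Q \<simeq> Q \<oplus> 0" by (rule sim_swap)
  also have "Q \<oplus> 0 \<simeq> Q" by (rule sim_corner)
  finally show ?thesis .
qed

lemma sim_iso:
  assumes "P \<in> Idm" "t' * t = 1" "t \<in> D" "t' \<in> D"
  shows "t * P * t' \<simeq> P"
proof (rule sim_mvn[of _ _ "t * P" "P * t'"])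
  show "t * P * t' \<in> Idm" using assms by (intro Idm_iso)
  show "t * P * (P * t') = t * P * t'" "P * t' * (t * P) = P"
    using assms by (simp_all add: mult.assoc Idm_idem Idm_idem' inv_cancel)
qed (use assms in \<open>auto simp: closed_D Idm_D\<close>)

text \<open>Adding \<open>c\<close> to \<open>P\<close> takes it away from
  \<open>1 - \<delta> P\<close>, because \<open>\<delta> c = c\<close>. So \<open>c\<close> has only
  changed its block within \<open>stab\<close>, and \<open>swp c\<close> moves it back.\<close>

lemma sim_add:
  assumes "P \<in> D" "c \<in> Idm" "\<delta> c = c" "P * c = 0" "c * P = 0"
  shows "P + c \<simeq> P"
proof -
  have c: "c * c = c" "c * (c * x) = c * x" for x using assms by (simp_all add: Idm_idem Idm_idem')
  have d: "\<delta> P * c = 0" "c * \<delta> P = 0"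
    using arg_cong[OF assms(4), of \<delta>] arg_cong[OF assms(5), of \<delta>] assms(3) by auto
  have z: "c * (P * x) = 0" "P * (c * x) = 0" "c * (\<delta> P * x) = 0" "\<delta> P * (c * x) = 0" for x
    using assms(4,5) d by (simp_all add: mult.assoc[symmetric])
  have U: "swp c \<in> D" using assms by (intro swp_D Idm_D)
  have "swp c * ((P + c) \<oplus> (1 - \<delta> (P + c))) * swp c = P \<oplus> (1 - \<delta> P)"
    using assms by (simp add: swp_def algebra_simps c d z)
  then have "conjug ((P + c) \<oplus> (1 - \<delta> (P + c))) (P \<oplus> (1 - \<delta> P))"
    using U swp_swp[OF c(1)] by (intro conjug_invol)
  from conjug_dsm[OF this conjug_refl[of e]] show ?thesis unfolding sim_def stab_def .
qed

lemma sim_diag: "c \<in> Idm \<Longrightarrow> \<delta> c = c \<Longrightarrow> c \<simeq> 0"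
  using sim_add[of 0 c] by (simp add: closed_D)

lemma sim_dsm_diag:
  assumes "P \<in> Idm" "c \<in> Idm" "\<delta> c = c"
  shows "P \<oplus> c \<simeq> P"
proof -
  have "P \<oplus> c = (P \<oplus> 0) + (0 \<oplus> c)" by simp
  also have "\<dots> \<simeq> P \<oplus> 0"
    using assms by (intro sim_add blk_D zero_D Idm_dsm Idm_zero Idm_D) auto
  also have "\<dots> \<simeq> P" by (rule sim_corner)
  finally show ?thesis .
qed

text \<open>The added summands \<open>1 - \<delta> P\<close> and \<open>e\<close> are fixed by
  \<open>\<delta>\<close>, so \<open>sim_add\<close> drops them, and what remains is
  \<open>P\<close> displaced by the isometry \<open>s0 * s0\<close>. This is the tool for
  congruence: similarity of \<open>P\<close> and \<open>P'\<close> is conjugacy of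
  \<open>stab P\<close> and \<open>stab P'\<close>, which passes to direct sums at once.\<close>

lemma stab_dsm:
  assumes "P \<in> Idm" "Q \<in> Idm"
  shows "stab P \<oplus> Q \<simeq> P \<oplus> Q"
proof -
  have iso: "(s0 * s0 \<oplus> 1) * (P \<oplus> Q) * (t0 * t0 \<oplus> 1) = ((P \<oplus> 0) \<oplus> 0) \<oplus> Q"
    by (simp add: mult.assoc) (simp add: blk_def mult.assoc)
  have split: "stab P \<oplus> Q = (((P \<oplus> 0) \<oplus> 0) \<oplus> Q) + (((0 \<oplus> (1 - \<delta> P)) \<oplus> e) \<oplus> 0)"
    by (simp add: stab_def)
  have "stab P \<oplus> Q \<simeq> ((P \<oplus> 0) \<oplus> 0) \<oplus> Q"
    unfolding split using assms
    by (intro sim_add Idm_D[of "((P \<oplus> 0) \<oplus> 0) \<oplus> Q"] Idm_dsm Idm_zero Idm_compl Idm_\<delta> Idm_e)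
       (simp_all)
  also have "\<dots> \<simeq> P \<oplus> Q"
    unfolding iso[symmetric]
  proof (rule sim_iso)
    show "s0 * s0 \<oplus> 1 \<in> D" "t0 * t0 \<oplus> 1 \<in> D" by (intro blk_D closed_D)+
    show "(t0 * t0 \<oplus> 1) * (s0 * s0 \<oplus> 1) = 1" by (simp add: mult.assoc)
    show "P \<oplus> Q \<in> Idm" using assms by (rule Idm_dsm)
  qed
  finally show ?thesis .
qed

lemma sim_dsm_left:
  assumes "P \<in> Idm" "P' \<in> Idm" "Q \<in> Idm" "P \<simeq> P'"
  shows "P \<oplus> Q \<simeq> P' \<oplus> Q"
proof -
  have "P \<oplus> Q \<simeq> stab P \<oplus> Q" using assms by (intro sim_sym[OF stab_dsm])
  also have "\<dots> \<simeq> stab P' \<oplus> Q"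
    using assms(4) unfolding sim_def[of P P'] by (intro sim_conjug conjug_dsm conjug_refl)
  also have "\<dots> \<simeq> P' \<oplus> Q" using assms by (intro stab_dsm)
  finally show ?thesis .
qed

lemma sim_dsm:
  assumes "P \<in> Idm" "P' \<in> Idm" "Q \<in> Idm" "Q' \<in> Idm" "P \<simeq> P'" "Q \<simeq> Q'"
  shows "P \<oplus> Q \<simeq> P' \<oplus> Q'"
proof -
  have "P \<oplus> Q \<simeq> P' \<oplus> Q" using assms by (intro sim_dsm_left)
  also have "\<dots> \<simeq> Q \<oplus> P'" by (rule sim_swap)
  also have "\<dots> \<simeq> Q' \<oplus> P'" using assms by (intro sim_dsm_left)
  also have "\<dots> \<simeq> P' \<oplus> Q'" by (rule sim_swap)
  finally show ?thesis .
qed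

lemma sim_dsm_assoc: "(P \<oplus> Q) \<oplus> R \<simeq> P \<oplus> (Q \<oplus> R)"
proof -
  define W where "W = s0 * t0 * t0 + s1 * s0 * t1 * t0 + s1 * s1 * t1"
  define W' where "W' = s0 * s0 * t0 + s0 * s1 * t0 * t1 + s1 * t1 * t1"
  have D: "W \<in> D" "W' \<in> D" unfolding W_def W'_def by (intro closed_D)+
  have "W' * W = 1" "W * W' = 1" "W * ((P \<oplus> Q) \<oplus> R) * W' = P \<oplus> (Q \<oplus> R)"
    by (simp_all add: blk_def W_def W'_def algebra_simps cuntz_last)
  with D show ?thesis by (intro sim_conjug conjugI[of W W'])
qed

lemma sim_dsm_compl: assumes "P \<in> Idm" shows "P \<oplus> (1 - P) \<simeq> 0"
proof -
  have U: "swp P * swp P = 1" "swp P \<in> D" using assms by (simp_all add: swp_swp swp_D Idm_D Idm_idem)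
  have "swp P * (P \<oplus> (1 - P)) * swp P = 0 \<oplus> 1"
    using assms by (simp add: swp_def algebra_simps Idm_idem)
  then have "P \<oplus> (1 - P) \<simeq> 0 \<oplus> 1" using U by (intro sim_conjug conjug_invol)
  also have "\<dots> \<simeq> 0" by (intro sim_dsm_diag Idm_zero Idm_one) auto
  finally show ?thesis .
qed

text \<open>Up to similarity \<open>1 - P\<close> is an inverse of \<open>P\<close> for the direct
  sum, and inverses in a commutative monoid are unique.\<close>

lemma sim_compl: assumes "P \<in> Idm" "Q \<in> Idm" "P \<simeq> Q" shows "1 - P \<simeq> 1 - Q"
proof -
  note I = assms(1,2) Idm_compl[OF assms(1)] Idm_compl[OF assms(2)] Idm_zero Idm_dsm
  have "1 - P \<simeq> (1 - P) \<oplus> 0" by (rule sim_sym[OF sim_corner])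
  also have "\<dots> \<simeq> (1 - P) \<oplus> (Q \<oplus> (1 - Q))"
    by (intro sim_dsm sim_refl sim_sym[OF sim_dsm_compl] I)
  also have "\<dots> \<simeq> (1 - P) \<oplus> (P \<oplus> (1 - Q))"
    by (intro sim_dsm sim_refl sim_sym[OF assms(3)] I)
  also have "\<dots> \<simeq> ((1 - P) \<oplus> P) \<oplus> (1 - Q)" by (rule sim_sym[OF sim_dsm_assoc])
  also have "\<dots> \<simeq> (P \<oplus> (1 - P)) \<oplus> (1 - Q)"
    by (intro sim_dsm sim_refl sim_swap I)
  also have "\<dots> \<simeq> 0 \<oplus> (1 - Q)"
    by (intro sim_dsm sim_refl sim_dsm_compl I)
  also have "\<dots> \<simeq> (1 - Q) \<oplus> 0" by (rule sim_swap)
  also have "\<dots> \<simeq> 1 - Q" by (rule sim_corner)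
  finally show ?thesis .
qed

definition reg :: "'r \<Rightarrow> 'r" where
  "reg P = swp (\<delta> P) * (P \<oplus> (1 - \<delta> P)) * swp (\<delta> P)"

lemma conjug_reg: "P \<in> Idm \<Longrightarrow> conjug (P \<oplus> (1 - \<delta> P)) (reg P)"
  unfolding reg_def using Idm_\<delta>[of P]
  by (intro conjug_invol[of "swp (\<delta> P)"]) (auto simp: swp_swp swp_D Idm_D Idm_idem)

lemma Idm_reg: "P \<in> Idm \<Longrightarrow> reg P \<in> Idm"
  by (rule Idm_conjug[OF _ conjug_reg]) (auto intro!: Idm_dsm Idm_compl Idm_\<delta>)

lemma sim_reg: assumes "P \<in> Idm" shows "reg P \<simeq> P"
proof -
  have "reg P \<simeq> P \<oplus> (1 - \<delta> P)" using assms by (intro sim_sym[OF sim_conjug] conjug_reg)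
  also have "\<dots> \<simeq> P" using assms by (intro sim_dsm_diag Idm_compl Idm_\<delta>) auto
  finally show ?thesis .
qed

text \<open>With \<open>a = \<delta> P\<close> the involution \<open>swp a\<close> takes
  \<open>a \<oplus> (1 - a)\<close> to \<open>0 \<oplus> 1\<close>: regularization normalizes the
  base term.\<close>

lemma \<delta>_reg: "P \<in> Idm \<Longrightarrow> \<delta> (reg P) = e"
  using Idm_\<delta>[of P] by (simp add: reg_def swp_def e_eq algebra_simps Idm_idem)

section \<open>Correction of a conjugating element by a lift as in the Whitehead lemma\<close>

definition upper :: "'r \<Rightarrow> 'r" where "upper x = blk 1 x 0 1"
definition lower :: "'r \<Rightarrow> 'r" where "lower x = blk 1 0 x 1"

text \<open>
  The invertible diagonal matrix with entries \<open>w'\<close> and \<open>w\<close> is a product of elementary matrices,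
  and these lift to the commutant of \<open>\<beta> \<oplus> \<delta> \<beta>\<close>.
\<close>

lemma whitehead_lift:
  assumes \<beta>: "\<beta> \<in> Idm" and w: "w \<in> D" "w' \<in> D" "w * w' = 1" "w' * w = 1"
    "\<delta> w = w" "\<delta> w' = w'" "w * \<delta> \<beta> = \<delta> \<beta> * w"
  obtains C C' where "C \<in> D" "C' \<in> D" "C * C' = 1" "C' * C = 1" "\<delta> C = w' \<oplus> w" "\<delta> C' = w \<oplus> w'"
    "C * (\<beta> \<oplus> \<delta> \<beta>) * C' = \<beta> \<oplus> \<delta> \<beta>"
proof -
  define E where "E = \<delta> \<beta>"
  have E: "E * E = E" "\<delta> E = E" "E * (E * x) = E * x" "\<beta> * \<beta> = \<beta>" "\<beta> * (\<beta> * x) = \<beta> * x" for x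
    using \<beta> Idm_\<delta>[OF \<beta>] by (auto simp: E_def Idm_idem Idm_idem')
  have D: "\<beta> \<in> D" "E \<in> D" using \<beta> by (auto simp: E_def Idm_D \<delta>_D)
  have w'E: "w' * E = E * w'"
  proof -
    have "w' * E = w' * E * (w * w')" using w by simp
    also have "\<dots> = w' * (w * E) * w'" using w(7) by (simp add: mult.assoc E_def)
    also have "\<dots> = E * w'" using w(4) by (simp add: mult.assoc[symmetric])
    finally show ?thesis .
  qed
  \<comment> \<open>Cutting \<open>x\<close> down in this way gives
    \<open>\<beta> * X x = X x * E\<close>, which is the condition for \<open>upper (X x)\<close> to
    commute with \<open>\<beta> \<oplus> E\<close>. Under \<open>\<delta>\<close> the idempotent
    \<open>\<beta>\<close> becomes \<open>E\<close>, so \<open>X x\<close> goes to \<open>x\<close>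
    whenever \<open>\<delta> x = x\<close> and \<open>x\<close> commutes with \<open>E\<close>.
    \<open>Y\<close> is the mirror image.\<close>
  define X where "X x = \<beta> * x * E + (1 - \<beta>) * x * (1 - E)" for x
  define Y where "Y x = E * x * \<beta> + (1 - E) * x * (1 - \<beta>)" for x
  have XD: "x \<in> D \<Longrightarrow> upper (X x) \<in> D" and YD: "x \<in> D \<Longrightarrow> lower (Y x) \<in> D" for x
    using D unfolding X_def Y_def upper_def lower_def by (auto intro!: blk_D closed_D)
  have comm: "upper (X x) * (\<beta> \<oplus> E) = (\<beta> \<oplus> E) * upper (X x)"
    "lower (Y x) * (\<beta> \<oplus> E) = (\<beta> \<oplus> E) * lower (Y x)" for x
    by (simp_all add: X_def Y_def upper_def lower_def algebra_simps E)
  have inv: "upper (X x) * upper (X (- x)) = 1" "lower (Y x) * lower (Y (- x)) = 1"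
    "upper (X (- x)) * upper (X x) = 1" "lower (Y (- x)) * lower (Y x) = 1" for x
    by (simp_all add: upper_def lower_def X_def Y_def algebra_simps)
  note inv' = inv[THEN inv_cancel]
  have \<delta>X: "\<delta> (upper (X x)) = upper x" "\<delta> (lower (Y x)) = lower x" if "\<delta> x = x" "x * E = E * x" for x
  proof -
    have "E * (x * E) = E * x" using that E by simp
    then show "\<delta> (upper (X x)) = upper x" "\<delta> (lower (Y x)) = lower x"
      using that by (simp_all add: upper_def lower_def X_def Y_def algebra_simps E E_def[symmetric])
  qed
  \<comment> \<open>Without \<open>X\<close> and \<open>Y\<close>, the first three factors multiply
    to the matrix with rows \<open>0, w'\<close> and \<open>- w, 0\<close>, and the last three to
    the one with rows \<open>0, - 1\<close> and \<open>1, 0\<close>; their product is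
    \<open>w' \<oplus> w\<close>.\<close>
  define C where "C = upper (X w') * lower (Y (- w)) * upper (X w') * upper (X (- 1)) * lower (Y 1) * upper (X (- 1))"
  define C' where "C' = upper (X 1) * lower (Y (- 1)) * upper (X 1) * upper (X (- w')) * lower (Y w) * upper (X (- w'))"
  have CD: "C \<in> D" "C' \<in> D" unfolding C_def C'_def using w
    by (auto intro!: mult_D XD YD uminus_D one_D)
  have CC: "C * C' = 1" "C' * C = 1"
    unfolding C_def C'_def
    using inv'[of 1] inv'[of w] inv'[of w'] inv[of 1] inv[of w] inv[of w']
    by (simp_all add: mult.assoc)
  have \<delta>C: "\<delta> C = w' \<oplus> w" "\<delta> C' = w \<oplus> w'"
    unfolding C_def C'_def using w w'E
    by (simp_all add: \<delta>X E_def[symmetric]) (simp_all add: upper_def lower_def w)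
  define B where "B = \<beta> \<oplus> E"
  note comm = comm[folded B_def]
  have comm': "upper (X x) * (B * y) = B * (upper (X x) * y)"
    "lower (Y x) * (B * y) = B * (lower (Y x) * y)" for x y
    using comm by (simp_all add: mult.assoc[symmetric])
  have "C * B = B * C"
    unfolding C_def by (simp add: mult.assoc comm comm')
  then have "C * B * C' = B" using CC by (simp add: mult.assoc)
  then show thesis using that CD CC \<delta>C by (simp add: B_def E_def)
qed

text \<open>Words in the generators are addresses: a summand such as
  \<open>s1 * s0 * s0 * t0 * t1 * t0\<close> carries block 010 (read off the \<open>t\<close>s from
  right to left) to block 100. The three zeros of the copies of \<open>e\<close> are packed into
  block 10 and the three ones into block 11. \<open>V\<close> does not involve
  \<open>\<beta>\<close> and consists of generators, so conjugation by it preserves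
  \<open>\<delta> g = 1\<close>.\<close>

lemma absorb:
  obtains V V' where "V \<in> D" "V' \<in> D" "V * V' = 1" "V' * V = 1" "\<delta> V = V" "\<delta> V' = V'"
    "\<And>\<beta>. V * ((\<beta> \<oplus> e) \<oplus> (e \<oplus> e)) * V' = \<beta> \<oplus> e"
proof -
  define V where "V = s0 * t0 * t0 + s1 * s0 * s0 * t0 * t1 * t0 + s1 * s0 * s1 * s0 * t0 * t0 * t1
    + s1 * s0 * s1 * s1 * t0 * t1 * t1 + s1 * s1 * s0 * t1 * t1 * t0 + s1 * s1 * s1 * s0 * t1 * t0 * t1
    + s1 * s1 * s1 * s1 * t1 * t1 * t1"
  define V' where "V' = s0 * s0 * t0 + s0 * s1 * s0 * t0 * t0 * t1 + s1 * s0 * s0 * t0 * t1 * t0 * t1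
    + s1 * s1 * s0 * t1 * t1 * t0 * t1 + s0 * s1 * s1 * t0 * t1 * t1 + s1 * s0 * s1 * t0 * t1 * t1 * t1
    + s1 * s1 * s1 * t1 * t1 * t1 * t1"
  have "V \<in> D" "V' \<in> D" unfolding V_def V'_def by (intro closed_D)+
  moreover have "V * V' = 1" "V' * V = 1" by (simp_all add: V_def V'_def algebra_simps cuntz_last)
  moreover have "\<delta> V = V" "\<delta> V' = V'" by (simp_all add: V_def V'_def)
  moreover have "V * ((\<beta> \<oplus> e) \<oplus> (e \<oplus> e)) * V' = \<beta> \<oplus> e" for \<beta>
    by (simp add: blk_def e_def V_def V'_def algebra_simps cuntz_last)
  ultimately show thesis using that by blast
qed

text \<open>Here the middle summand of \<open>stab \<beta>\<close> is
  \<open>1 - e = 1 \<oplus> 0\<close>, whose one and zero are absorbed into the summand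
  \<open>e\<close> by a permutation of blocks.\<close>

lemma conjug_stab_e: assumes "\<delta> \<beta> = e" shows "conjug (stab \<beta>) (\<beta> \<oplus> e)"
proof -
  define V where "V = s0 * t0 * t0 + s1 * s0 * s0 * t1 * t1 * t0 + s1 * s0 * s1 * t0 * t1 + s1 * s1 * s0 * t0 * t1 * t0
    + s1 * s1 * s1 * t1 * t1"
  define V' where "V' = s0 * s0 * t0 + s0 * s1 * s1 * t0 * t0 * t1 + s1 * s0 * t1 * t0 * t1 + s0 * s1 * s0 * t0 * t1 * t1
    + s1 * s1 * t1 * t1 * t1"
  have "V \<in> D" "V' \<in> D" unfolding V_def V'_def by (intro closed_D)+
  moreover have "V * V' = 1" "V' * V = 1" by (simp_all add: V_def V'_def algebra_simps cuntz_last)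
  moreover have "V * stab \<beta> * V' = \<beta> \<oplus> e"
    by (simp add: assms stab_def blk_def e_def V_def V'_def algebra_simps cuntz_last)
  ultimately show ?thesis by (rule conjugI)
qed

theorem sim_imp_homotopy:
  assumes "\<beta> \<in> Idm" "\<beta>' \<in> Idm" "\<delta> \<beta> = e" "\<delta> \<beta>' = e" "\<beta> \<simeq> \<beta>'"
  obtains g g' where "g \<in> D" "g' \<in> D" "g * g' = 1" "g' * g = 1" "\<delta> g = 1" "\<delta> g' = 1"
    "g * (\<beta> \<oplus> e) * g' = \<beta>' \<oplus> e"
proof -
  have "conjug (\<beta> \<oplus> e) (stab \<beta>)" using assms by (intro conjug_sym[OF conjug_stab_e])
  also have "conjug (stab \<beta>) (stab \<beta>')" using assms by (simp add: sim_def)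
  also have "conjug (stab \<beta>') (\<beta>' \<oplus> e)" using assms by (intro conjug_stab_e)
  finally obtain W W' where W: "W \<in> D" "W' \<in> D" "W * W' = 1" "W' * W = 1" "W * (\<beta> \<oplus> e) * W' = \<beta>' \<oplus> e"
    by (rule conjugE)
  define w w' E where "w = \<delta> W" and "w' = \<delta> W'" and "E = e \<oplus> e"
  have w: "w \<in> D" "w' \<in> D" "w * w' = 1" "w' * w = 1" "\<delta> w = w" "\<delta> w' = w'"
    using W by (auto simp: w_def w'_def \<delta>_D simp flip: \<delta>_mult)
  \<comment> \<open>Both conjugated elements have the same base term \<open>E\<close>, so the base
    part of \<open>W\<close> commutes with \<open>E\<close>; this is what
    \<open>whitehead_lift\<close> requires.\<close>
  have "w * E * w' = E"
    using arg_cong[OF W(5), of \<delta>] assms by (simp add: w_def w'_def E_def)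
  then have wE: "w * E = E * w"
    using w(4) by (metis mult.assoc mult.right_neutral)
  have E': "w' * E * w = E"
    using w(4) by (simp add: mult.assoc wE[symmetric] inv_cancel)
  have \<beta>E: "\<beta> \<oplus> e \<in> Idm" "\<delta> (\<beta> \<oplus> e) = E" using assms by (simp_all add: Idm_dsm Idm_e E_def)
  obtain C C' where C: "C \<in> D" "C' \<in> D" "C * C' = 1" "C' * C = 1" "\<delta> C = w' \<oplus> w" "\<delta> C' = w \<oplus> w'"
    "C * ((\<beta> \<oplus> e) \<oplus> E) * C' = (\<beta> \<oplus> e) \<oplus> E"
    using whitehead_lift[OF \<beta>E(1) w, unfolded \<beta>E(2), OF wE] by blast
  \<comment> \<open>\<open>W \<oplus> w'\<close> does the required conjugation, the second block
    carrying \<open>E\<close> to itself, and has base part \<open>w \<oplus> w'\<close>. The factor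
    \<open>C\<close> commutes with the element to be conjugated and has base part
    \<open>w' \<oplus> w\<close>, so it cancels the base part of \<open>Z\<close> without changing
    the effect.\<close>
  define Z Z' where "Z = (W \<oplus> w') * C" and "Z' = C' * (W' \<oplus> w)"
  have WW: "(W \<oplus> w') * (W' \<oplus> w) = 1" "(W' \<oplus> w) * (W \<oplus> w') = 1" using W w by simp_all
  have Z: "Z \<in> D" "Z' \<in> D" unfolding Z_def Z'_def using W w C by (auto intro!: mult_D blk_D zero_D)
  have ZZ: "Z * Z' = 1" "Z' * Z = 1"
    unfolding Z_def Z'_def using WW C(3,4)
    by (simp_all only: mult.assoc inv_cancel[OF WW(2)] inv_cancel[OF C(3)] inv_cancel[OF C(4)] WW)
  have \<delta>Z: "\<delta> Z = 1" "\<delta> Z' = 1" unfolding Z_def Z'_def using w by (simp_all add: C w_def[symmetric] w'_def[symmetric])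
  have "Z * ((\<beta> \<oplus> e) \<oplus> E) * Z' = (W \<oplus> w') * (C * ((\<beta> \<oplus> e) \<oplus> E) * C') * (W' \<oplus> w)"
    unfolding Z_def Z'_def by (simp only: mult.assoc)
  also have "\<dots> = (\<beta>' \<oplus> e) \<oplus> E"
    unfolding C(7) using W(5) E' by simp
  finally have Zc: "Z * ((\<beta> \<oplus> e) \<oplus> E) * Z' = (\<beta>' \<oplus> e) \<oplus> E" .
  obtain V V' where V: "V \<in> D" "V' \<in> D" "V * V' = 1" "V' * V = 1" "\<delta> V = V" "\<delta> V' = V'"
    "\<And>\<beta>. V * ((\<beta> \<oplus> e) \<oplus> E) * V' = \<beta> \<oplus> e"
    using absorb unfolding E_def by blast
  \<comment> \<open>The auxiliary block \<open>E\<close> is still present; conjugation by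
    \<open>V\<close> packs it into the summand \<open>e\<close>, so that the homotopy acts on the
    prescribed index set.\<close>
  show thesis
  proof (rule that[of "V * Z * V'" "V * Z' * V'"])
    show "V * Z * V' \<in> D" "V * Z' * V' \<in> D" using V Z by (auto intro!: mult_D)
    have "Z * (Z' * x) = x" "Z' * (Z * x) = x" for x
      using ZZ by (auto intro: inv_cancel)
    then show "V * Z * V' * (V * Z' * V') = 1" "V * Z' * V' * (V * Z * V') = 1"
      using V(3) by (simp_all add: mult.assoc inv_cancel[OF V(4)])
    show "\<delta> (V * Z * V') = 1" "\<delta> (V * Z' * V') = 1" using V(3,5,6) \<delta>Z by simp_all
    show "V * Z * V' * (\<beta> \<oplus> e) * (V * Z' * V') = \<beta>' \<oplus> e"
    proof -
      have "V * Z * V' * (V * ((\<beta> \<oplus> e) \<oplus> E) * V') * (V * Z' * V') = V * (Z * ((\<beta> \<oplus> e) \<oplus> E) * Z') * V'"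
        by (simp only: mult.assoc inv_cancel[OF V(4)])
      then show ?thesis by (simp only: V(7) Zc)
    qed
  qed
qed

end

section \<open>Pairs of a leading and a base term, and their tensor products\<close>

datatype 'q dbl = Dbl (lead: 'q) (bas: 'q)

instantiation dbl :: (ring) ring
begin
definition "0 = Dbl 0 0"
definition "x + y = Dbl (lead x + lead y) (bas x + bas y)"
definition "x - y = Dbl (lead x - lead y) (bas x - bas y)"
definition "- x = Dbl (- lead x) (- bas x)"
definition "x * y = Dbl (lead x * lead y) (bas x * bas y)"
instance
  by standard
    (auto simp: zero_dbl_def plus_dbl_def minus_dbl_def uminus_dbl_def times_dbl_def algebra_simps
       split: dbl.splits intro: dbl.expand)
end

instantiation dbl :: ("{ring,monoid_mult}") monoid_mult
begin
definition "1 = Dbl 1 1"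
instance by standard (auto simp: one_dbl_def times_dbl_def)
end

lemma dbl_simps [simp]:
  "Dbl a b + Dbl c d = Dbl (a + c) (b + d)"
  "Dbl a b - Dbl c d = Dbl (a - c) (b - d)"
  "- Dbl a b = Dbl (- a) (- b)"
  "Dbl a b * Dbl c d = Dbl (a * c) (b * d)"
  "lead 0 = 0" "bas 0 = 0" "lead 1 = 1" "bas 1 = 1"
  "lead (x + y) = lead x + lead y" "bas (x + y) = bas x + bas y"
  "lead (x - y) = lead x - lead y" "bas (x - y) = bas x - bas y"
  "lead (- x) = - lead x" "bas (- x) = - bas x"
  "lead (x * y) = lead x * lead y" "bas (x * y) = bas x * bas y"
  by (simp_all add: zero_dbl_def plus_dbl_def minus_dbl_def uminus_dbl_def times_dbl_def one_dbl_def)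

text \<open>\<open>C\<close> stands for polynomially assembled families of matrices,
  \<open>K\<close> for the rapidly decreasing ones among them. The Kronecker product is made an
  inner operation by a pairing bijection of the index set, and is therefore commutative and
  associative only up to conjugation by the permutations \<open>F\<close> and \<open>A\<close>.
  There is no rule for a product of \<open>C\<close> with \<open>K\<close>: something like
  \<open>1 \<otimes> k\<close> does not decrease along the first index.\<close>

locale tensor_cuntz =
  fixes C K :: "'q::{ring,monoid_mult} set" and s0 s1 t0 t1 :: 'q
    and ten :: "'q \<Rightarrow> 'q \<Rightarrow> 'q"  (infixl \<open>\<otimes>\<close> 75)
    and F A A' :: 'q
  assumes one_C: "1 \<in> C"
    and add_C: "x \<in> C \<Longrightarrow> y \<in> C \<Longrightarrow> x + y \<in> C"
    and uminus_C: "x \<in> C \<Longrightarrow> - x \<in> C"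
    and mult_C: "x \<in> C \<Longrightarrow> y \<in> C \<Longrightarrow> x * y \<in> C"
    and gen_C: "s0 \<in> C" "s1 \<in> C" "t0 \<in> C" "t1 \<in> C"
    and orth: "t0 * s0 = 1" "t1 * s1 = 1" "t0 * s1 = 0" "t1 * s0 = 0"
    and sum1: "s0 * t0 + s1 * t1 = 1"
    and add_K: "x \<in> K \<Longrightarrow> y \<in> K \<Longrightarrow> x + y \<in> K"
    and uminus_K: "x \<in> K \<Longrightarrow> - x \<in> K"
    and zero_K: "0 \<in> K"
    and mult_K: "x \<in> C \<Longrightarrow> y \<in> K \<Longrightarrow> x * y \<in> K" "y \<in> K \<Longrightarrow> x \<in> C \<Longrightarrow> y * x \<in> K"
    and ten_add: "(x + y) \<otimes> z = x \<otimes> z + y \<otimes> z" "x \<otimes> (y + z) = x \<otimes> y + x \<otimes> z"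
    and ten_mult: "(x \<otimes> y) * (x' \<otimes> y') = (x * x') \<otimes> (y * y')"
    and ten_one: "1 \<otimes> 1 = 1"
    and ten_C: "x \<in> C \<Longrightarrow> y \<in> C \<Longrightarrow> x \<otimes> y \<in> C"
    and ten_K: "x \<in> K \<Longrightarrow> y \<in> K \<Longrightarrow> x \<otimes> y \<in> K"
    and flip_C: "F \<in> C" and flip_flip: "F * F = 1" and flip: "F * (x \<otimes> y) * F = y \<otimes> x"
    and assoc_C: "A \<in> C" "A' \<in> C" and assoc_inv: "A * A' = 1" "A' * A = 1"
    and assoc: "A * (x \<otimes> y \<otimes> z) * A' = x \<otimes> (y \<otimes> z)"
begin

definition DD :: "'q dbl set" where
  "DD = {x. lead x \<in> C \<and> bas x \<in> C \<and> lead x - bas x \<in> K}"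

definition dlt :: "'q dbl \<Rightarrow> 'q dbl" where "dlt x = Dbl (bas x) (bas x)"

abbreviation dg :: "'q \<Rightarrow> 'q dbl" where "dg x \<equiv> Dbl x x"

sublocale q: cuntz s0 s1 t0 t1
  by unfold_locales (simp_all add: orth sum1)

lemma zero_C: "0 \<in> C"
  using add_C[OF one_C uminus_C[OF one_C]] by simp

lemma diff_C: "x \<in> C \<Longrightarrow> y \<in> C \<Longrightarrow> x - y \<in> C"
  using add_C[of x "- y"] uminus_C[of y] by simp

lemma blk_C: "a \<in> C \<Longrightarrow> b \<in> C \<Longrightarrow> c \<in> C \<Longrightarrow> d \<in> C \<Longrightarrow> q.blk a b c d \<in> C"
  unfolding q.blk_def by (intro add_C mult_C gen_C)

lemma K_diff: "x \<in> K \<Longrightarrow> y \<in> K \<Longrightarrow> x - y \<in> K"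
  using add_K[of x "- y"] uminus_K[of y] by simp

lemma DD_iff: "Dbl x y \<in> DD \<longleftrightarrow> x \<in> C \<and> y \<in> C \<and> x - y \<in> K"
  by (simp add: DD_def)

lemma dg_DD: "x \<in> C \<Longrightarrow> dg x \<in> DD"
  by (simp add: DD_iff zero_K)

lemma DD_mult: assumes "x \<in> DD" "y \<in> DD" shows "x * y \<in> DD"
proof -
  have "lead (x * y) - bas (x * y) = lead x * (lead y - bas y) + (lead x - bas x) * bas y"
    by (simp add: algebra_simps)
  also have "\<dots> \<in> K"
    using assms by (intro add_K mult_K(1)[of "lead x"] mult_K(2)[of _ "bas y"]) (auto simp: DD_def)
  finally show ?thesis using assms by (auto simp: DD_def mult_C)
qed

sublocale graded_cuntz "dg s0" "dg s1" "dg t0" "dg t1" DD dlt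
proof
  fix x y :: "'q dbl"
  show "x + y \<in> DD" if "x \<in> DD" "y \<in> DD"
  proof -
    have "lead (x + y) - bas (x + y) = (lead x - bas x) + (lead y - bas y)"
      by (simp add: algebra_simps)
    also have "\<dots> \<in> K" using that by (auto simp: DD_def intro: add_K)
    finally show ?thesis using that by (auto simp: DD_def add_C)
  qed
  show "- x \<in> DD" if "x \<in> DD"
    using that uminus_K[of "lead x - bas x"] by (auto simp: DD_def uminus_C)
  show "1 \<in> DD" by (simp add: DD_def one_C zero_K)
  show "x * y \<in> DD" if "x \<in> DD" "y \<in> DD" using that by (rule DD_mult)
  show "dlt x \<in> DD" if "x \<in> DD" using that by (auto simp: DD_def dlt_def zero_K)
qed (auto simp: dg_DD gen_C dlt_def zero_dbl_def one_dbl_def orth sum1)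

notation sim (infix \<open>\<simeq>\<close> 50)

abbreviation ddsm :: "'q dbl \<Rightarrow> 'q dbl \<Rightarrow> 'q dbl"  (infixr \<open>\<uplus>\<close> 65) where
  "x \<uplus> y \<equiv> blk x 0 0 y"

lemma blk_Dbl [simp]: "blk (Dbl a a') (Dbl b b') (Dbl c c') (Dbl d d') = Dbl (q.blk a b c d) (q.blk a' b' c' d')"
  by (simp add: blk_def q.blk_def)

lemma dsm_Dbl [simp]: "blk (Dbl a a') 0 0 (Dbl d d') = Dbl (q.blk a 0 0 d) (q.blk a' 0 0 d')"
  by (simp add: zero_dbl_def)

lemma dlt_Dbl [simp]: "dlt (Dbl a b) = dg b" by (simp add: dlt_def)

lemma Idm_Dbl: "Dbl x y \<in> Idm \<longleftrightarrow> x \<in> C \<and> y \<in> C \<and> x - y \<in> K \<and> x * x = x \<and> y * y = y"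
  by (auto simp: Idm_def DD_iff)

lemma Idm_dg: "dg x \<in> Idm \<longleftrightarrow> x \<in> C \<and> x * x = x"
  by (auto simp: Idm_Dbl zero_K)

lemma blk_K: "a \<in> K \<Longrightarrow> b \<in> K \<Longrightarrow> c \<in> K \<Longrightarrow> d \<in> K \<Longrightarrow> q.blk a b c d \<in> K"
  unfolding q.blk_def by (intro add_K mult_K gen_C)

subsection \<open>The tensor product of pairs\<close>

lemma ten_zero [simp]: "0 \<otimes> x = 0" "x \<otimes> 0 = 0"
  using ten_add(1)[of 0 0 x] ten_add(2)[of x 0 0] by auto

lemma ten_minus: "(- x) \<otimes> y = - (x \<otimes> y)" "x \<otimes> (- y) = - (x \<otimes> y)"
  using ten_add(1)[of x "- x" y] ten_add(2)[of x y "- y"]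
  by (simp_all add: eq_neg_iff_add_eq_0 add.commute)

lemma ten_diff: "(x - y) \<otimes> z = x \<otimes> z - y \<otimes> z" "x \<otimes> (y - z) = x \<otimes> y - x \<otimes> z"
  using ten_add(1)[of x "- y" z] ten_add(2)[of x y "- z"] by (simp_all add: ten_minus)

lemma ten_mult': "(x \<otimes> y) * ((x' \<otimes> y') * z) = ((x * x') \<otimes> (y * y')) * z"
  by (simp add: ten_mult mult.assoc[symmetric])

lemmas ten_simps = ten_add ten_diff ten_minus ten_mult ten_mult' algebra_simps

definition tens :: "'q dbl \<Rightarrow> 'q dbl \<Rightarrow> 'q dbl" where
  "tens P Q = Dbl (lead P \<otimes> lead Q + (1 - lead P) \<otimes> bas Q) (bas P \<otimes> lead Q + (1 - bas P) \<otimes> bas Q)"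

definition rtens :: "'q dbl \<Rightarrow> 'q dbl \<Rightarrow> 'q dbl" where
  "rtens P Q = Dbl (lead P \<otimes> lead Q + bas P \<otimes> (1 - lead Q)) (lead P \<otimes> bas Q + bas P \<otimes> (1 - bas Q))"

text \<open>The difference of the two components factors as
  \<open>(b - a) \<otimes> (d - c)\<close>, with both factors in \<open>K\<close>, so that
  \<open>ten_K\<close> suffices. This is the reason for the shape of the product.\<close>

lemma tens_DD: assumes "P \<in> DD" "Q \<in> DD" shows "tens P Q \<in> DD"
proof -
  have "lead (tens P Q) - bas (tens P Q) = (lead P - bas P) \<otimes> (lead Q - bas Q)"
    by (simp add: tens_def ten_simps)
  also have "\<dots> \<in> K" using assms by (auto simp: DD_def intro: ten_K)
  finally show ?thesis
    using assms by (auto simp: DD_def tens_def intro!: add_C ten_C diff_C one_C)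
qed

lemma tens_one: "tens P 1 = 1"
  by (simp add: tens_def ten_simps ten_one one_dbl_def)

lemma Idm_comps: assumes "P \<in> Idm"
  shows "lead P \<in> C" "bas P \<in> C" "lead P - bas P \<in> K" "lead P * lead P = lead P" "bas P * bas P = bas P"
    "lead P * (lead P * x) = lead P * x" "bas P * (bas P * x) = bas P * x"
proof -
  obtain b a where P: "P = Dbl b a" by (cases P)
  show "lead P \<in> C" "bas P \<in> C" "lead P - bas P \<in> K"
    and *: "lead P * lead P = lead P" "bas P * bas P = bas P"
    using assms by (auto simp: P Idm_Dbl)
  then show "lead P * (lead P * x) = lead P * x" "bas P * (bas P * x) = bas P * x"
    by (simp_all add: mult.assoc[symmetric])
qed

text \<open>For idempotent \<open>P\<close> the elements \<open>b\<close> and \<open>1 - b\<close>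
  are orthogonal, so \<open>tens P\<close> is a unital ring homomorphism in its second argument.
  Conjugating elements are thereby carried over to products.\<close>

lemma tens_mult: "P \<in> Idm \<Longrightarrow> tens P (Q * R) = tens P Q * tens P R"
  by (simp add: tens_def ten_simps Idm_comps)

lemma Idm_tens: "P \<in> Idm \<Longrightarrow> Q \<in> Idm \<Longrightarrow> tens P Q \<in> Idm"
  unfolding Idm_def[of ] using tens_mult[of P Q Q] by (auto simp: tens_DD Idm_def)

lemma conjug_tens: assumes "P \<in> Idm" "conjug Q Q'" shows "conjug (tens P Q) (tens P Q')"
proof -
  from assms(2) obtain W W' where "W \<in> DD" "W' \<in> DD" "W * W' = 1" "W' * W = 1" "W * Q * W' = Q'"
    by (rule conjugE)
  with assms(1) show ?thesis
    by (intro conjugI[of "tens P W" "tens P W'"])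
       (auto simp: tens_DD Idm_D tens_one simp flip: tens_mult)
qed

lemma tens_dg: "tens P (dg c) = dg (1 \<otimes> c)"
  by (simp add: tens_def ten_simps)

text \<open>The product index set is split in two ways, by \<open>1 \<otimes> s0\<close>,
  \<open>1 \<otimes> s1\<close> and by \<open>s0\<close>, \<open>s1\<close>. The element
  \<open>w\<close> is the change between these splittings; it is constant, and so acts on both
  components alike.\<close>

lemma tens_dsm: "conjug (tens P (Q \<uplus> R)) (tens P Q \<uplus> tens P R)"
proof -
  define w where "w = s0 * (1 \<otimes> t0) + s1 * (1 \<otimes> t1)"
  define w' where "w' = (1 \<otimes> s0) * t0 + (1 \<otimes> s1) * t1"
  have C: "w \<in> C" "w' \<in> C" unfolding w_def w'_def by (intro add_C mult_C ten_C one_C gen_C)+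
  have "w' * w = 1 \<otimes> (s0 * t0) + 1 \<otimes> (s1 * t1)"
    by (simp add: w_def w'_def ten_simps)
  also have "\<dots> = 1" by (simp only: ten_add[symmetric] sum1 ten_one)
  finally have 1: "w' * w = 1" .
  have 2: "w * w' = 1"
    by (simp add: w_def w'_def ten_simps ten_one orth sum1)
  have 3: "w * (x \<otimes> q.blk y 0 0 z) * w' = q.blk (x \<otimes> y) 0 0 (x \<otimes> z)" for x y z
    by (simp add: w_def w'_def q.blk_def ten_simps orth)
  obtain b a where P: "P = Dbl b a" by (cases P)
  obtain d c where Q: "Q = Dbl d c" by (cases Q)
  obtain f g where R: "R = Dbl f g" by (cases R)
  have "dg w * tens P (Q \<uplus> R) * dg w' = tens P Q \<uplus> tens P R"
    by (simp add: P Q R tens_def distrib_left distrib_right 3)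
  with C 1 2 show ?thesis
    by (intro conjugI[of "dg w" "dg w'"]) (auto simp: dg_DD one_dbl_def)
qed

lemma tens_dsm_diag:
  assumes "P \<in> Idm" "Q \<in> Idm" "c \<in> C" "c * c = c"
  shows "tens P (Q \<uplus> dg c) \<simeq> tens P Q"
proof -
  have "tens P (Q \<uplus> dg c) \<simeq> tens P Q \<uplus> tens P (dg c)" by (rule sim_conjug[OF tens_dsm])
  also have "\<dots> \<simeq> tens P Q"
    using assms by (intro sim_dsm_diag Idm_tens) (auto simp: Idm_dg tens_dg ten_C one_C ten_mult)
  finally show ?thesis .
qed

text \<open>\<open>stab Q\<close> is \<open>Q\<close> with diagonal pairs adjoined, and
  \<open>tens P\<close> maps diagonal pairs to diagonal pairs by \<open>tens_dg\<close>; such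
  summands may be dropped.\<close>

lemma tens_stab: assumes "P \<in> Idm" "Q \<in> Idm" shows "tens P (stab Q) \<simeq> tens P Q"
proof -
  obtain d c where Q: "Q = Dbl d c" by (cases Q)
  have c: "1 - c \<in> C" "(1 - c) * (1 - c) = 1 - c"
    using assms(2) by (auto simp: Q Idm_Dbl diff_C one_C algebra_simps)
  have e: "e = dg q.e" "q.e \<in> C" "q.e * q.e = q.e"
    using Idm_e by (auto simp: e_def q.e_def Idm_dg)
  have "1 - dlt Q = dg (1 - c)" by (simp add: Q one_dbl_def)
  then have "tens P (stab Q) = tens P ((Q \<uplus> dg (1 - c)) \<uplus> dg q.e)"
    by (simp add: stab_def e)
  moreover have "tens P ((Q \<uplus> dg (1 - c)) \<uplus> dg q.e) \<simeq> tens P (Q \<uplus> dg (1 - c))"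
    using assms c e by (intro tens_dsm_diag Idm_dsm) (auto simp: Idm_dg)
  moreover have "tens P (Q \<uplus> dg (1 - c)) \<simeq> tens P Q"
    using assms c by (intro tens_dsm_diag) auto
  ultimately show ?thesis using sim_trans by metis
qed

lemma tens_cong_right: assumes "P \<in> Idm" "Q \<in> Idm" "Q' \<in> Idm" "Q \<simeq> Q'" shows "tens P Q \<simeq> tens P Q'"
proof -
  have "tens P Q \<simeq> tens P (stab Q)" using assms by (intro sim_sym[OF tens_stab])
  also have "\<dots> \<simeq> tens P (stab Q')" using assms by (intro sim_conjug conjug_tens) (auto simp: sim_def)
  also have "\<dots> \<simeq> tens P Q'" using assms by (intro tens_stab)
  finally show ?thesis .
qed

text \<open>
  Both sides are compared after adding \<open>k\<close> and \<open>m\<close>.  The leading terms are interchanged by the swap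
  that is trivial on \<open>n\<close>; the base terms by way of \<open>(x + k) \<uplus> 0 = (m + y) \<uplus> 0\<close>.
\<close>

lemma exchange:
  assumes C: "n \<in> C" "m \<in> C" "k \<in> C" "x \<in> C" "y \<in> C"
    and idem: "n * n = n" "m * m = m" "k * k = k" "x * x = x" "y * y = y"
    and orth: "n * m = 0" "m * n = 0" "n * k = 0" "k * n = 0" "x * k = 0" "k * x = 0" "m * y = 0" "y * m = 0"
    and sum: "x + k = m + y"
    and K: "n + m - x \<in> K" "m * k \<in> K" "k * m \<in> K"
  shows "Dbl (n + m) x \<simeq> Dbl (n + k) y"
proof -
  have y: "y = x + k - m" using sum by (simp add: algebra_simps)
  have mx: "m * x = m - m * k" "x * m = m - k * m"
    using orth(7,8) idem(2) by (auto simp: y algebra_simps)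
  have id: "m * (m * z) = m * z" "k * (k * z) = k * z" "x * (x * z) = x * z"
    "x * (k * z) = 0" "k * (x * z) = 0" "m * (x * z) = m * z - m * (k * z)" "x * (m * z) = m * z - k * (m * z)" for z
    by (simp_all only: mult.assoc[symmetric] mx idem orth left_diff_distrib mult_zero_left)
  note rules = idem orth mx id
  \<comment> \<open>Conjugation by \<open>swp k\<close> takes \<open>x \<oplus> k\<close> to
    \<open>(x + k) \<oplus> 0\<close>, and by \<open>swp m\<close> takes
    \<open>(m + y) \<oplus> 0\<close> to \<open>y \<oplus> m\<close>. In between,
    \<open>swp j\<close> fixes \<open>(x + k) \<oplus> 0\<close>, since
    \<open>j * (x + k) = 0\<close>; it is inserted because the interchange \<open>S\<close> of the
    leading terms also acts on the remaining part, and \<open>V\<close> has to agree with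
    \<open>S\<close> modulo \<open>K\<close>.\<close>
  define j where "j = 1 - (x + k)"
  define V where "V = q.swp m * q.swp j * q.swp k"
  define V' where "V' = q.swp k * q.swp j * q.swp m"
  have V: "V = q.blk (x - m + m * k + m * k) (1 - x + m - m * k - m * k) (1 - x + m - m * k - m * k) (x - m + m * k + m * k)"
    by (simp add: V_def j_def q.swp_def algebra_simps rules)
  have V': "V' = q.blk (x - m + k * m + k * m) (1 - x + m - k * m - k * m) (1 - x + m - k * m - k * m) (x - m + k * m + k * m)"
    by (simp add: V'_def j_def q.swp_def algebra_simps rules)
  \<comment> \<open>This is \<open>swp (1 - n)\<close>, the interchange of the blocks off
    \<open>n\<close>. Since \<open>x\<close> is \<open>n + m\<close> modulo \<open>K\<close> and the
    products of \<open>m\<close> and \<open>k\<close> lie in \<open>K\<close>, the explicit forms of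
    \<open>V\<close> and \<open>V'\<close> reduce to \<open>S\<close>.\<close>
  define S where "S = q.blk n (1 - n) (1 - n) n"
  have KK: "n + m - x - m * k - m * k \<in> K" "n + m - x - k * m - k * m \<in> K"
    by (intro K_diff K)+
  have e1: "S - V = (let z = n + m - x - m * k - m * k in q.blk z (- z) (- z) z)"
    by (simp add: S_def V Let_def algebra_simps)
  have e2: "S - V' = (let z = n + m - x - k * m - k * m in q.blk z (- z) (- z) z)"
    by (simp add: S_def V' Let_def algebra_simps)
  have "S - V \<in> K" "S - V' \<in> K" unfolding e1 e2 Let_def by (intro blk_K uminus_K KK)+
  moreover have "j \<in> C" using C by (simp add: j_def add_C diff_C one_C)
  then have "S \<in> C" "V \<in> C" "V' \<in> C"
    using C unfolding S_def V_def V'_def q.swp_def by (auto intro!: blk_C diff_C add_C one_C mult_C)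
  ultimately have D: "Dbl S V \<in> DD" "Dbl S V' \<in> DD" by (auto simp: DD_iff)
  have SS: "S * S = 1" by (simp add: S_def algebra_simps idem)
  have jj: "j * j = j" by (simp add: j_def algebra_simps rules)
  note sw = q.swp_swp[OF idem(2)] q.swp_swp[OF idem(3)] q.swp_swp[OF jj]
  have VV: "V * V' = 1" "V' * V = 1"
    unfolding V_def V'_def by (simp_all only: mult.assoc q.inv_cancel[OF sw(1)] q.inv_cancel[OF sw(2)] q.inv_cancel[OF sw(3)] sw)
  have a: "S * q.blk (n + m) 0 0 k * S = q.blk (n + k) 0 0 m"
    by (simp add: S_def algebra_simps idem orth)
  have b: "V * q.blk x 0 0 k * V' = q.blk y 0 0 m"
    by (simp add: V V' y algebra_simps rules)
  have id2: "Dbl (n + m) x \<in> Idm" "Dbl (n + k) y \<in> Idm"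
    using C K idem orth K_diff[OF K(1)] by (auto simp: Idm_Dbl y add_C diff_C algebra_simps)
  have "Dbl (n + m) x \<simeq> Dbl (n + m) x \<uplus> dg k"
    using id2 C idem by (intro sim_sym[OF sim_dsm_diag]) (auto simp: Idm_dg)
  also have "\<dots> \<simeq> Dbl (n + k) y \<uplus> dg m"
    using D SS VV a b by (intro sim_conjug conjugI[of "Dbl S V" "Dbl S V'"]) (auto simp: one_dbl_def)
  also have "\<dots> \<simeq> Dbl (n + k) y"
    using id2 C idem by (intro sim_dsm_diag) (auto simp: Idm_dg)
  finally show ?thesis .
qed

lemma rtens_flip: "rtens P Q = dg F * tens Q P * dg F"
  by (simp add: rtens_def tens_def distrib_left distrib_right flip)

lemma rtens_sim: "rtens P Q \<simeq> tens Q P"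
  unfolding rtens_flip
  by (intro sim_sym[OF sim_conjug] conjug_invol[of "dg F"]) (auto simp: dg_DD flip_C flip_flip one_dbl_def)

lemma Idm_rtens: "P \<in> Idm \<Longrightarrow> Q \<in> Idm \<Longrightarrow> rtens P Q \<in> Idm"
  unfolding rtens_flip by (intro Idm_iso Idm_tens) (auto simp: dg_DD flip_C flip_flip one_dbl_def)

text \<open>An instance of \<open>exchange\<close>: the leading terms share
  \<open>n = b \<otimes> d\<close> and differ in \<open>m = (1 - b) \<otimes> c\<close> against
  \<open>k = a \<otimes> (1 - d)\<close>. Both \<open>x + k\<close> and \<open>m + y\<close> equal
  \<open>a \<otimes> 1 + (1 - a) \<otimes> c\<close>. Together with \<open>rtens_flip\<close> this
  yields commutativity.\<close>

lemma tens_sim_rtens: assumes "P \<in> Idm" "Q \<in> Idm" shows "tens P Q \<simeq> rtens P Q"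
proof -
  obtain b a where P: "P = Dbl b a" by (cases P)
  obtain d c where Q: "Q = Dbl d c" by (cases Q)
  have i: "b \<in> C" "a \<in> C" "d \<in> C" "c \<in> C" "b - a \<in> K" "d - c \<in> K"
    "b * b = b" "a * a = a" "d * d = d" "c * c = c"
    using assms by (auto simp: P Q Idm_Dbl)
  \<comment> \<open>Idempotency of \<open>a\<close> gives
    \<open>(1 - b) * a = - (b - a) * a\<close>, and likewise for the others. So \<open>m * k\<close>
    and \<open>k * m\<close> are tensor products with both factors in \<open>K\<close>.\<close>
  have k: "(1 - b) * a \<in> K" "a * (1 - b) \<in> K" "c * (1 - d) \<in> K" "(1 - d) * c \<in> K"
  proof -
    have "(1 - b) * a = - (b - a) * a" "a * (1 - b) = a * - (b - a)"
      "c * (1 - d) = c * - (d - c)" "(1 - d) * c = - (d - c) * c"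
      using i by (simp_all add: algebra_simps)
    then show "(1 - b) * a \<in> K" "a * (1 - b) \<in> K" "c * (1 - d) \<in> K" "(1 - d) * c \<in> K"
      using i by (auto intro: mult_K uminus_K simp del: minus_diff_eq)
  qed
  have "(1 - b) \<otimes> c * a \<otimes> (1 - d) \<in> K" "a \<otimes> (1 - d) * (1 - b) \<otimes> c \<in> K"
    unfolding ten_mult by (intro ten_K k)+
  moreover have "b \<otimes> d + (1 - b) \<otimes> c - (a \<otimes> d + (1 - a) \<otimes> c) = (b - a) \<otimes> (d - c)"
    by (simp add: ten_simps)
  ultimately have
    "Dbl (b \<otimes> d + (1 - b) \<otimes> c) (a \<otimes> d + (1 - a) \<otimes> c) \<simeq> Dbl (b \<otimes> d + a \<otimes> (1 - d)) (b \<otimes> c + a \<otimes> (1 - c))"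
    using i
    by (intro exchange) (auto intro!: ten_C add_C diff_C one_C ten_K, simp_all add: ten_simps)
  then show ?thesis by (simp add: P Q tens_def rtens_def)
qed

lemma tens_comm: "P \<in> Idm \<Longrightarrow> Q \<in> Idm \<Longrightarrow> tens P Q \<simeq> tens Q P"
  using sim_trans[OF tens_sim_rtens rtens_sim] .

text \<open>In the first argument \<open>tens\<close> is not a homomorphism on pairs; that argument
  is treated by commuting it into second place.\<close>

lemma tens_cong:
  assumes I: "P \<in> Idm" "Q \<in> Idm" "P' \<in> Idm" "Q' \<in> Idm" and "P \<simeq> P'" "Q \<simeq> Q'"
  shows "tens P Q \<simeq> tens P' Q'"
proof -
  have "tens P Q \<simeq> tens P Q'" using assms by (intro tens_cong_right)
  also have "\<dots> \<simeq> tens Q' P" using I by (intro tens_comm)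
  also have "\<dots> \<simeq> tens Q' P'" using assms by (intro tens_cong_right)
  also have "\<dots> \<simeq> tens P' Q'" using I by (intro tens_comm)
  finally show ?thesis .
qed

text \<open>After expansion both sides consist of the same four terms for each component, up to the
  bracketing of indices, so the constant permutation \<open>A\<close> conjugates one side exactly to
  the other.\<close>

lemma tens_assoc: "tens (tens P Q) R \<simeq> tens P (tens Q R)"
proof -
  obtain b a where P: "P = Dbl b a" by (cases P)
  obtain d c where Q: "Q = Dbl d c" by (cases Q)
  obtain f g where R: "R = Dbl f g" by (cases R)
  have a1: "A * ((x \<otimes> y \<otimes> z) * A') = x \<otimes> (y \<otimes> z)" for x y z
    using assoc by (simp add: mult.assoc)
  \<comment> \<open>The complement of a product contains the unit of the product index set, which
    has to be read as \<open>1 \<otimes> 1\<close> before rebracketing.\<close>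
  have a2: "A * ((1 \<otimes> z) * A') = 1 \<otimes> (1 \<otimes> z)" for z
    using a1[of 1 1 z] by (simp add: ten_one)
  have "dg A * tens (tens P Q) R * dg A' = tens P (tens Q R)"
    by (simp add: P Q R tens_def ten_simps a1 a2)
  then show ?thesis
    by (intro sim_conjug conjugI[of "dg A" "dg A'"]) (auto simp: dg_DD assoc_C assoc_inv one_dbl_def)
qed

lemma tens_distrib: "tens P (Q \<uplus> R) \<simeq> tens P Q \<uplus> tens P R"
  by (rule sim_conjug[OF tens_dsm])

end

subsection \<open>The operations\<close>

text \<open>\<open>r0\<close> and \<open>r1\<close> stand for the restrictions of
  \<open>\<theta>1\<close> to its two summands, \<open>r2\<close> and \<open>r3\<close> for
  \<open>\<theta>2\<close> and \<open>\<theta>3\<close>, all read as maps on a single index set.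
  Relabelings need not be surjective, so only left inverses are assumed.\<close>

locale hring_cuntz = tensor_cuntz C K s0 s1 t0 t1 ten F A A'
  for C K :: "'q::{ring,monoid_mult} set" and s0 s1 t0 t1 :: 'q
    and ten :: "'q \<Rightarrow> 'q \<Rightarrow> 'q"  (infixl \<open>\<otimes>\<close> 75) and F A A' :: 'q +
  fixes r0 r1 r2 r3 r0' r1' r2' r3' :: 'q
    and prd :: "'q dbl \<Rightarrow> 'q dbl \<Rightarrow> 'q dbl"
  assumes r_C: "r0 \<in> C" "r1 \<in> C" "r2 \<in> C" "r3 \<in> C" "r0' \<in> C" "r1' \<in> C" "r2' \<in> C" "r3' \<in> C"
    and r_orth: "r0' * r0 = 1" "r1' * r1 = 1" "r0' * r1 = 0" "r1' * r0 = 0" "r2' * r2 = 1" "r3' * r3 = 1"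
    and prd: "prd = tens \<or> prd = rtens"
begin

definition Gr :: "'q dbl set" where "Gr = {P \<in> Idm. dlt P = e}"

definition addG :: "'q dbl \<Rightarrow> 'q dbl \<Rightarrow> 'q dbl" where
  "addG P Q = reg (dg r0 * P * dg r0' + dg r1 * Q * dg r1')"

definition negG :: "'q dbl \<Rightarrow> 'q dbl" where
  "negG P = reg (dg r2 * (1 - P) * dg r2')"

definition mulG :: "'q dbl \<Rightarrow> 'q dbl \<Rightarrow> 'q dbl" where
  "mulG P Q = reg (dg r3 * prd P Q * dg r3')"

lemma Gr_Idm: "P \<in> Gr \<Longrightarrow> P \<in> Idm"
  by (simp add: Gr_def)

lemma reg_Gr: "P \<in> Idm \<Longrightarrow> reg P \<in> Gr"
  by (simp add: Gr_def Idm_reg \<delta>_reg)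

lemma Idm_dg_iso:
  assumes "P \<in> Idm" "r \<in> C" "r' \<in> C" "r' * r = 1"
  shows "dg r * P * dg r' \<in> Idm"
  using assms by (intro Idm_iso) (auto simp: dg_DD one_dbl_def)

lemma reg_iso:
  assumes "P \<in> Idm" "r \<in> C" "r' \<in> C" "r' * r = 1"
  shows "reg (dg r * P * dg r') \<in> Gr" "reg (dg r * P * dg r') \<simeq> P"
proof -
  have I: "dg r * P * dg r' \<in> Idm" using assms by (intro Idm_iso) (auto simp: dg_DD one_dbl_def)
  then show "reg (dg r * P * dg r') \<in> Gr" by (rule reg_Gr)
  have "reg (dg r * P * dg r') \<simeq> dg r * P * dg r'" using I by (rule sim_reg)
  also have "\<dots> \<simeq> P" using assms by (intro sim_iso) (auto simp: dg_DD one_dbl_def)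
  finally show "reg (dg r * P * dg r') \<simeq> P" .
qed

lemma addG:
  assumes "P \<in> Idm" "Q \<in> Idm"
  shows "addG P Q \<in> Gr" "addG P Q \<simeq> P \<uplus> Q" "dg r0 * P * dg r0' + dg r1 * Q * dg r1' \<in> Idm"
proof -
  \<comment> \<open>The sum of the two relabeled matrices is their direct sum moved by one isometry,
    assembled from \<open>r0\<close> and \<open>r1\<close> along the splitting.\<close>
  define r r' where "r = r0 * t0 + r1 * t1" and "r' = s0 * r0' + s1 * r1'"
  have C: "r \<in> C" "r' \<in> C" using r_C gen_C by (auto simp: r_def r'_def add_C mult_C)
  have o: "r0' * (r0 * x) = x" "r1' * (r1 * x) = x" "r0' * (r1 * x) = 0" "r1' * (r0 * x) = 0" for x
    using r_orth by (simp_all add: mult.assoc[symmetric])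
  have 1: "r' * r = 1"
    by (simp add: r_def r'_def algebra_simps o sum1)
  obtain b a where P: "P = Dbl b a" by (cases P)
  obtain d c where Q: "Q = Dbl d c" by (cases Q)
  have sum: "dg r0 * P * dg r0' + dg r1 * Q * dg r1' = dg r * (P \<uplus> Q) * dg r'"
    by (simp add: P Q q.blk_def r_def r'_def algebra_simps orth)
  then have eq: "addG P Q = reg (dg r * (P \<uplus> Q) * dg r')"
    by (simp only: addG_def)
  show "dg r0 * P * dg r0' + dg r1 * Q * dg r1' \<in> Idm"
    unfolding sum using assms C 1 by (intro Idm_iso Idm_dsm) (auto simp: dg_DD one_dbl_def)
  show "addG P Q \<in> Gr" "addG P Q \<simeq> P \<uplus> Q"
    unfolding eq using assms C 1 by (auto intro!: reg_iso Idm_dsm)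
qed

lemma negG:
  assumes "P \<in> Idm"
  shows "negG P \<in> Gr" "negG P \<simeq> 1 - P"
  using assms unfolding negG_def by (auto intro!: reg_iso Idm_compl r_C r_orth)

lemma Idm_prd: "P \<in> Idm \<Longrightarrow> Q \<in> Idm \<Longrightarrow> prd P Q \<in> Idm"
  using prd by (auto simp: Idm_tens Idm_rtens)

lemma mulG:
  assumes "P \<in> Idm" "Q \<in> Idm"
  shows "mulG P Q \<in> Gr" "mulG P Q \<simeq> tens P Q"
proof -
  have I: "prd P Q \<in> Idm" using prd assms by (auto simp: Idm_tens Idm_rtens)
  then show "mulG P Q \<in> Gr" unfolding mulG_def by (intro reg_iso r_C r_orth)
  have "mulG P Q \<simeq> prd P Q" using I unfolding mulG_def by (intro reg_iso r_C r_orth)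
  also have "\<dots> \<simeq> tens P Q"
    using prd assms sim_refl tens_sim_rtens[THEN sim_sym] by auto
  finally show "mulG P Q \<simeq> tens P Q" .
qed

lemma e_Gr: "e \<in> Gr"
  by (simp add: Gr_def Idm_e)

lemma e_sim: "e \<simeq> 0"
  by (intro sim_diag Idm_e \<delta>_e)

lemma addG_cong:
  assumes "P \<in> Idm" "P' \<in> Idm" "Q \<in> Idm" "Q' \<in> Idm" "P \<simeq> P'" "Q \<simeq> Q'"
  shows "addG P Q \<simeq> addG P' Q'"
  using assms sim_trans[OF addG(2) sim_trans[OF sim_dsm sim_sym[OF addG(2)]]] by blast

lemma mulG_cong:
  assumes "P \<in> Idm" "P' \<in> Idm" "Q \<in> Idm" "Q' \<in> Idm" "P \<simeq> P'" "Q \<simeq> Q'"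
  shows "mulG P Q \<simeq> mulG P' Q'"
  using assms sim_trans[OF mulG(2) sim_trans[OF tens_cong sim_sym[OF mulG(2)]]] by blast

lemma negG_cong:
  assumes "P \<in> Idm" "P' \<in> Idm" "P \<simeq> P'"
  shows "negG P \<simeq> negG P'"
  using assms sim_trans[OF negG(2) sim_trans[OF sim_compl sim_sym[OF negG(2)]]] by blast

lemmas G_Idm = addG(1)[THEN Gr_Idm] mulG(1)[THEN Gr_Idm] negG(1)[THEN Gr_Idm] Idm_tens Idm_dsm Idm_compl

lemma addG_assoc:
  assumes "P \<in> Idm" "Q \<in> Idm" "R \<in> Idm"
  shows "addG (addG P Q) R \<simeq> addG P (addG Q R)"
proof -
  have "addG (addG P Q) R \<simeq> addG P Q \<uplus> R" using assms by (intro addG G_Idm)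
  also have "\<dots> \<simeq> (P \<uplus> Q) \<uplus> R" using assms by (intro sim_dsm G_Idm addG sim_refl)
  also have "\<dots> \<simeq> P \<uplus> (Q \<uplus> R)" by (rule sim_dsm_assoc)
  also have "\<dots> \<simeq> P \<uplus> addG Q R" using assms by (intro sim_dsm G_Idm addG(2)[THEN sim_sym] sim_refl)
  also have "\<dots> \<simeq> addG P (addG Q R)" using assms by (intro addG(2)[THEN sim_sym] G_Idm)
  finally show ?thesis .
qed

lemma addG_comm:
  assumes "P \<in> Idm" "Q \<in> Idm"
  shows "addG P Q \<simeq> addG Q P"
proof -
  have "addG P Q \<simeq> P \<uplus> Q" using assms by (intro addG)
  also have "\<dots> \<simeq> Q \<uplus> P" by (rule sim_swap)
  also have "\<dots> \<simeq> addG Q P" using assms by (intro addG(2)[THEN sim_sym])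
  finally show ?thesis .
qed

lemma addG_zero:
  assumes "P \<in> Idm" shows "addG P e \<simeq> P"
proof -
  have "addG P e \<simeq> P \<uplus> e" using assms by (intro addG Idm_e)
  also have "\<dots> \<simeq> P" using assms by (intro sim_dsm_diag Idm_e \<delta>_e)
  finally show ?thesis .
qed

lemma addG_neg:
  assumes "P \<in> Idm" shows "addG P (negG P) \<simeq> e"
proof -
  have "addG P (negG P) \<simeq> P \<uplus> negG P" using assms by (intro addG G_Idm)
  also have "\<dots> \<simeq> P \<uplus> (1 - P)" using assms by (intro sim_dsm G_Idm negG sim_refl)
  also have "\<dots> \<simeq> 0" using assms by (rule sim_dsm_compl)
  also have "0 \<simeq> e" by (rule sim_sym[OF e_sim])
  finally show ?thesis .
qed

lemma mulG_assoc:
  assumes "P \<in> Idm" "Q \<in> Idm" "R \<in> Idm"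
  shows "mulG (mulG P Q) R \<simeq> mulG P (mulG Q R)"
proof -
  have "mulG (mulG P Q) R \<simeq> tens (mulG P Q) R" using assms by (intro mulG G_Idm)
  also have "\<dots> \<simeq> tens (tens P Q) R" using assms by (intro tens_cong G_Idm mulG sim_refl)
  also have "\<dots> \<simeq> tens P (tens Q R)" by (rule tens_assoc)
  also have "\<dots> \<simeq> tens P (mulG Q R)" using assms by (intro tens_cong G_Idm mulG(2)[THEN sim_sym] sim_refl)
  also have "\<dots> \<simeq> mulG P (mulG Q R)" using assms by (intro mulG(2)[THEN sim_sym] G_Idm)
  finally show ?thesis .
qed

lemma mulG_comm:
  assumes "P \<in> Idm" "Q \<in> Idm"
  shows "mulG P Q \<simeq> mulG Q P"
proof -
  have "mulG P Q \<simeq> tens P Q" using assms by (intro mulG)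
  also have "\<dots> \<simeq> tens Q P" using assms by (intro tens_comm)
  also have "\<dots> \<simeq> mulG Q P" using assms by (intro mulG(2)[THEN sim_sym])
  finally show ?thesis .
qed

lemma mulG_distrib_left:
  assumes "P \<in> Idm" "Q \<in> Idm" "R \<in> Idm"
  shows "mulG P (addG Q R) \<simeq> addG (mulG P Q) (mulG P R)"
proof -
  have "mulG P (addG Q R) \<simeq> tens P (addG Q R)" using assms by (intro mulG G_Idm)
  also have "\<dots> \<simeq> tens P (Q \<uplus> R)" using assms by (intro tens_cong G_Idm addG sim_refl)
  also have "\<dots> \<simeq> tens P Q \<uplus> tens P R" by (rule tens_distrib)
  also have "\<dots> \<simeq> mulG P Q \<uplus> mulG P R" using assms by (intro sim_dsm G_Idm mulG(2)[THEN sim_sym])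
  also have "\<dots> \<simeq> addG (mulG P Q) (mulG P R)" using assms by (intro addG(2)[THEN sim_sym] G_Idm)
  finally show ?thesis .
qed

lemma mulG_distrib_right:
  assumes "P \<in> Idm" "Q \<in> Idm" "R \<in> Idm"
  shows "mulG (addG P Q) R \<simeq> addG (mulG P R) (mulG Q R)"
proof -
  have "mulG (addG P Q) R \<simeq> mulG R (addG P Q)" using assms by (intro mulG_comm G_Idm)
  also have "\<dots> \<simeq> addG (mulG R P) (mulG R Q)" using assms by (intro mulG_distrib_left)
  also have "\<dots> \<simeq> addG (mulG P R) (mulG Q R)" using assms by (intro addG_cong G_Idm mulG_comm)
  finally show ?thesis .
qed

end

text \<open>
  Here \<open>q\<close> is a matrix unit and \<open>v\<close> is \<open>q\<close> multiplied by the unit of the ring \<open>\<AA>\<close>, which is not the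
  unit of the unital extension but acts as such on \<open>K\<close>.
\<close>

locale unital_hring_cuntz = hring_cuntz C K s0 s1 t0 t1 ten F A A' r0 r1 r2 r3 r0' r1' r2' r3' prd
  for C K :: "'q::{ring,monoid_mult} set" and s0 s1 t0 t1 :: 'q
    and ten :: "'q \<Rightarrow> 'q \<Rightarrow> 'q"  (infixl \<open>\<otimes>\<close> 75) and F A A' r0 r1 r2 r3 r0' r1' r2' r3' :: 'q
    and prd :: "'q dbl \<Rightarrow> 'q dbl \<Rightarrow> 'q dbl" +
  fixes q v r4 r4' w w' :: 'q
  assumes unit_C: "q \<in> C" "v \<in> C" "r4 \<in> C" "r4' \<in> C" "w \<in> C" "w' \<in> C" and v_K: "v \<in> K"
    and unit_mult: "q * q = q" "q * v = v" "v * q = v" "v * v = v" "r4' * r4 = q"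
    and w_inv: "w' * w = 1" and w: "w * x * w' = x \<otimes> q"
    and ten_v: "x \<in> K \<Longrightarrow> x \<otimes> v = x \<otimes> q"
begin

definition oneG :: "'q dbl" where "oneG = reg (dg r4 * Dbl v 0 * dg r4')"

lemma Idm_v: "Dbl v 0 \<in> Idm"
  using unit_C v_K unit_mult by (simp add: Idm_Dbl zero_C)

text \<open>\<open>r4\<close> comes from a one-point index set, so \<open>r4' * r4\<close> is the
  matrix unit \<open>q\<close> and not \<open>1\<close>. In place of \<open>sim_iso\<close> the
  equivalence is therefore exhibited by the pair of partial isometries \<open>r4 * v\<close> and
  \<open>v * r4'\<close>.\<close>

lemma oneG: "oneG \<in> Gr" "oneG \<simeq> Dbl v 0" "dg r4 * Dbl v 0 * dg r4' \<in> Idm"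
proof -
  have u: "r4' * (r4 * x) = q * x" "v * (v * x) = v * x" "q * (v * x) = v * x" for x
    using unit_mult by (simp_all add: mult.assoc[symmetric])
  have I: "Dbl (r4 * v * r4') 0 \<in> Idm"
    using unit_C v_K unit_mult by (auto simp: Idm_Dbl zero_C mult_C mult_K mult.assoc u)
  have eq: "dg r4 * Dbl v 0 * dg r4' = Dbl (r4 * v * r4') 0" by simp
  show "dg r4 * Dbl v 0 * dg r4' \<in> Idm" unfolding eq by (rule I)
  show "oneG \<in> Gr" unfolding oneG_def eq using I by (rule reg_Gr)
  have "oneG \<simeq> Dbl (r4 * v * r4') 0" unfolding oneG_def eq using I by (rule sim_reg)
  also have "\<dots> \<simeq> Dbl v 0"
    using unit_C v_K unit_mult I Idm_v
    by (intro sim_mvn[of _ _ "Dbl (r4 * v) 0" "Dbl (v * r4') 0"])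
       (auto simp: DD_iff zero_C mult_C mult_K mult.assoc u)
  finally show "oneG \<simeq> Dbl v 0" .
qed

text \<open>As \<open>b - a\<close> lies in \<open>K\<close>, it does not distinguish
  \<open>v\<close> from \<open>q\<close>. Hence \<open>(b \<otimes> q, a \<otimes> q)\<close>, a
  relabeled copy of \<open>P\<close>, exceeds the product by \<open>a \<otimes> (q - v)\<close> in
  both components. This is a diagonal idempotent orthogonal to the product, and
  \<open>sim_add\<close> removes it.\<close>

lemma tens_unit: assumes "P \<in> Idm" shows "tens P (Dbl v 0) \<simeq> P"
proof -
  obtain b a where P: "P = Dbl b a" by (cases P)
  have i: "b \<in> C" "a \<in> C" "b - a \<in> K" "b * b = b" "a * a = a"
    using assms by (auto simp: P Idm_Dbl)
  define z where "z = a \<otimes> (q - v)"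
  have z: "dg z \<in> Idm"
    using i unit_C unit_mult by (simp add: Idm_dg z_def ten_C diff_C ten_mult algebra_simps)
  have eq: "tens P (Dbl v 0) = Dbl (b \<otimes> v) (a \<otimes> v)"
    by (simp add: P tens_def)
  have "b \<otimes> v - a \<otimes> v = b \<otimes> q - a \<otimes> q"
    using ten_v[OF i(3)] by (simp add: ten_diff)
  moreover have "dg w * P * dg w' = Dbl (b \<otimes> q) (a \<otimes> q)" by (simp add: P w)
  ultimately have sum: "tens P (Dbl v 0) + dg z = dg w * P * dg w'"
    unfolding eq by (simp add: z_def ten_diff algebra_simps)
  have "tens P (Dbl v 0) \<in> Idm" using assms Idm_v by (intro Idm_tens)
  then have "tens P (Dbl v 0) + dg z \<simeq> tens P (Dbl v 0)"
    using z by (intro sim_add) (auto simp: Idm_D eq z_def ten_mult unit_mult algebra_simps zero_dbl_def)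
  moreover have "dg w * P * dg w' \<simeq> P"
    using assms unit_C w_inv by (intro sim_iso) (auto simp: dg_DD one_dbl_def)
  ultimately show ?thesis unfolding sum using sim_sym sim_trans by blast
qed

lemma mulG_one:
  assumes "P \<in> Idm" shows "mulG P oneG \<simeq> P"
proof -
  have "mulG P oneG \<simeq> tens P oneG" using assms by (intro mulG oneG(1)[THEN Gr_Idm])
  also have "\<dots> \<simeq> tens P (Dbl v 0)" using assms by (intro tens_cong oneG oneG(1)[THEN Gr_Idm] Idm_v sim_refl)
  also have "\<dots> \<simeq> P" using assms by (rule tens_unit)
  finally show ?thesis .
qed

lemma one_mulG:
  assumes "P \<in> Idm" shows "mulG oneG P \<simeq> P"
  using assms sim_trans[OF mulG_comm mulG_one] oneG Gr_Idm by blast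

end

section \<open>The topology of the unital extension\<close>

lemma unitization_sel [simp]:
  fixes x y :: "'a::comm_ring unitization"
  shows "scal (x + y) = scal x + scal y" "part (x + y) = part x + part y"
    "scal (x - y) = scal x - scal y" "part (x - y) = part x - part y"
    "scal (- x) = - scal x" "part (- x) = - part x"
    "scal (0 :: 'a unitization) = 0" "part (0 :: 'a unitization) = 0"
    "scal (1 :: 'a unitization) = 1" "part (1 :: 'a unitization) = 0"
    "scal (x * y) = scal x * scal y"
    "part (x * y) = int_scale (scal x) (part y) + int_scale (scal y) (part x) + part x * part y"
  by (simp_all add: plus_unitization_def minus_unitization_def uminus_unitization_def
      zero_unitization_def one_unitization_def times_unitization_def)

lemma tendsto_unitization_iff:
  fixes f :: "'x \<Rightarrow> 'a::topological_space unitization"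
  shows "(f \<longlongrightarrow> l) F \<longleftrightarrow>
    eventually (\<lambda>x. scal (f x) = scal l) F \<and> ((\<lambda>x. part (f x)) \<longlongrightarrow> part l) F"
proof (intro iffI conjI)
  assume f: "(f \<longlongrightarrow> l) F"
  have "open {z. scal z = scal l}" by (auto simp: open_unitization_def)
  from topological_tendstoD[OF f this] show "eventually (\<lambda>x. scal (f x) = scal l) F" by simp
  show "((\<lambda>x. part (f x)) \<longlongrightarrow> part l) F"
  proof (rule topological_tendstoI)
    fix U assume "open U" "part l \<in> U"
    then have "open {z. part z \<in> U}" by (auto simp: open_unitization_def)
    from topological_tendstoD[OF f this] \<open>part l \<in> U\<close> show "eventually (\<lambda>x. part (f x) \<in> U) F" by simp
  qed
next
  assume *: "eventually (\<lambda>x. scal (f x) = scal l) F \<and> ((\<lambda>x. part (f x)) \<longlongrightarrow> part l) F"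
  show "(f \<longlongrightarrow> l) F"
  proof (rule topological_tendstoI)
    fix S assume "open S" "l \<in> S"
    then have "open {a. Unitization (scal l) a \<in> S}" "part l \<in> {a. Unitization (scal l) a \<in> S}"
      by (auto simp: open_unitization_def)
    from topological_tendstoD[OF conjunct2[OF *] this]
    have "eventually (\<lambda>x. part (f x) \<in> {a. Unitization (scal l) a \<in> S}) F" .
    with * have "eventually (\<lambda>x. scal (f x) = scal l \<and> Unitization (scal l) (part (f x)) \<in> S) F"
      by (auto elim: eventually_elim2)
    then show "eventually (\<lambda>x. f x \<in> S) F"
      by (rule eventually_mono) (metis unitization.collapse)
  qed
qed

lemma tendsto_int_scale:
  fixes f :: "'x \<Rightarrow> 'a::topological_ab_group_add"
  shows "(f \<longlongrightarrow> l) F \<Longrightarrow> ((\<lambda>x. int_scale k (f x)) \<longlongrightarrow> int_scale k l) F"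
  unfolding int_scale_def by (auto intro!: tendsto_sum tendsto_minus)

instance unitization :: ("{comm_ring, topological_ab_group_add}") topological_ab_group_add
proof
  fix a b :: "'a unitization"
  have s: "eventually (\<lambda>x. scal (f x) = scal l) F" "((\<lambda>x. part (f x)) \<longlongrightarrow> part l) F"
    if "(f \<longlongrightarrow> l) F" for f :: "'b \<Rightarrow> 'a unitization" and l F
    using that by (simp_all add: tendsto_unitization_iff)
  have fst: "filterlim fst (nhds a) (nhds a \<times>\<^sub>F nhds b)" and snd: "filterlim snd (nhds b) (nhds a \<times>\<^sub>F nhds b)"
    by (rule filterlim_fst filterlim_snd)+
  have "eventually (\<lambda>x. scal (fst x + snd x) = scal (a + b)) (nhds a \<times>\<^sub>F nhds b)"
    using s(1)[OF fst] s(1)[OF snd] by eventually_elim simp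
  moreover have "((\<lambda>x. part (fst x + snd x)) \<longlongrightarrow> part (a + b)) (nhds a \<times>\<^sub>F nhds b)"
    using tendsto_add[OF s(2)[OF fst] s(2)[OF snd]] by simp
  ultimately show "((\<lambda>x. fst x + snd x) \<longlongrightarrow> a + b) (nhds a \<times>\<^sub>F nhds b)"
    by (simp add: tendsto_unitization_iff)
  have id: "((\<lambda>x. x) \<longlongrightarrow> a) (nhds a)" by (rule filterlim_ident)
  have "eventually (\<lambda>x. scal (- x) = scal (- a)) (nhds a)"
    using s(1)[OF id] by eventually_elim simp
  then show "(uminus \<longlongrightarrow> - a) (nhds a)"
    using tendsto_minus[OF s(2)[OF id]] by (simp add: tendsto_unitization_iff)
qed

instance unitization :: ("{comm_ring, topological_ab_group_add, topological_semigroup_mult}") topological_semigroup_mult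
proof
  fix a b :: "'a unitization"
  have s: "eventually (\<lambda>x. scal (f x) = scal l) F" "((\<lambda>x. part (f x)) \<longlongrightarrow> part l) F"
    if "(f \<longlongrightarrow> l) F" for f :: "'b \<Rightarrow> 'a unitization" and l F
    using that by (simp_all add: tendsto_unitization_iff)
  have fst: "filterlim fst (nhds a) (nhds a \<times>\<^sub>F nhds b)" and snd: "filterlim snd (nhds b) (nhds a \<times>\<^sub>F nhds b)"
    by (rule filterlim_fst filterlim_snd)+
  note fs = s[OF fst] s[OF snd]
  have "eventually (\<lambda>x. scal (fst x * snd x) = scal (a * b)) (nhds a \<times>\<^sub>F nhds b)"
    using fs(1,3) by eventually_elim simp
  \<comment> \<open>Scalar parts are eventually constant, the integers being discrete. They are
    replaced by their limits first, so that no joint continuity of \<open>int_scale\<close> is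
    involved.\<close>
  moreover have "((\<lambda>x. int_scale (scal a) (part (snd x)) + int_scale (scal b) (part (fst x)) + part (fst x) * part (snd x))
      \<longlongrightarrow> part (a * b)) (nhds a \<times>\<^sub>F nhds b)"
    using fs by (auto intro!: tendsto_intros tendsto_int_scale)
  then have "((\<lambda>x. part (fst x * snd x)) \<longlongrightarrow> part (a * b)) (nhds a \<times>\<^sub>F nhds b)"
  proof (rule Lim_transform_eventually)
    show "eventually (\<lambda>x. int_scale (scal a) (part (snd x)) + int_scale (scal b) (part (fst x)) + part (fst x) * part (snd x)
      = part (fst x * snd x)) (nhds a \<times>\<^sub>F nhds b)"
      using fs(1,3) by eventually_elim simp
  qed
  ultimately show "((\<lambda>x. fst x * snd x) \<longlongrightarrow> a * b) (nhds a \<times>\<^sub>F nhds b)"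
    by (simp add: tendsto_unitization_iff)
qed

text \<open>Regularity is what permits an unconditional sum over pairs to be evaluated as an
  iterated sum, and so underlies associativity of the matrix product.\<close>

lemma topological_group_regular:
  fixes y :: "'b::topological_ab_group_add"
  assumes "closed S" "y \<notin> S"
  shows "\<exists>U V. open U \<and> open V \<and> y \<in> U \<and> S \<subseteq> V \<and> U \<inter> V = {}"
proof -
  \<comment> \<open>If neighbourhoods \<open>y + A\<close> and \<open>s + B\<close> met, with
    \<open>s \<in> S\<close>, then some \<open>y + u - v\<close> would equal \<open>s\<close>;
    continuity keeps these elements off the closed set \<open>S\<close>.\<close>
  have "((\<lambda>x. (y + fst x) - snd x) \<longlongrightarrow> (y + 0) - 0) (nhds 0 \<times>\<^sub>F nhds 0)"
    by (intro tendsto_intros filterlim_fst filterlim_snd)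
  then have "eventually (\<lambda>x. (y + fst x) - snd x \<in> - S) (nhds 0 \<times>\<^sub>F nhds 0)"
    by (rule topological_tendstoD) (use assms in auto)
  then obtain P Q where P: "eventually P (nhds 0)" "eventually Q (nhds 0)"
    "\<And>u v. P u \<Longrightarrow> Q v \<Longrightarrow> y + u - v \<in> - S"
    unfolding eventually_prod_filter by auto
  obtain A where A: "open A" "0 \<in> A" "\<And>u. u \<in> A \<Longrightarrow> P u" using P(1) unfolding eventually_nhds by auto
  obtain B where B: "open B" "0 \<in> B" "\<And>u. u \<in> B \<Longrightarrow> Q u" using P(2) unfolding eventually_nhds by auto
  have tr: "open {z. z - c \<in> D}" if "open D" for c :: 'b and D
  proof -
    have "continuous_on UNIV (\<lambda>z::'b. z - c)" by (intro continuous_intros)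
    from open_vimage[OF that this] show ?thesis by (simp add: vimage_def)
  qed
  define U V where "U = {z. z - y \<in> A}" and "V = (\<Union>s\<in>S. {z. z - s \<in> B})"
  have "open U" "open V" unfolding U_def V_def by (auto intro!: tr A B)
  moreover have "y \<in> U" "S \<subseteq> V" using A B by (auto simp: U_def V_def)
  moreover have "U \<inter> V = {}"
  proof (rule ccontr)
    assume "U \<inter> V \<noteq> {}"
    then obtain z s where z: "z - y \<in> A" "s \<in> S" "z - s \<in> B" by (auto simp: U_def V_def)
    have "y + (z - y) - (z - s) \<in> - S" by (rule P(3)) (use A B z in auto)
    with z show False by simp
  qed
  ultimately show ?thesis by blast
qed

instance unitization :: ("{comm_ring, topological_ab_group_add, t2_space}") t3_space
  by standard (rule topological_group_regular)

section \<open>Seminorms and unconditional sums\<close>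

text \<open>The part of a product in the unital extension involves scalar parts and parts of both
  factors at once, so \<open>p (part (x * y))\<close> is bounded by means of a sum of several of the
  given seminorms. Closing under sums restores the multiplicative condition, and by
  \<open>Psi_iff\<close> does not change \<Psi>.\<close>

inductive_set seminorm_sums :: "('a \<Rightarrow> real) set \<Rightarrow> ('a unitization \<Rightarrow> real) set" for P where
  base: "q \<in> unitization_seminorms P \<Longrightarrow> q \<in> seminorm_sums P"
| add: "q \<in> seminorm_sums P \<Longrightarrow> r \<in> seminorm_sums P \<Longrightarrow> (\<lambda>x. q x + r x) \<in> seminorm_sums P"

definition complete_polymetric :: "('a::{comm_ring, topological_space} \<Rightarrow> real) set \<Rightarrow> bool" where
  "complete_polymetric P \<longleftrightarrow> polymetric P \<and> sequentially_complete TYPE('a)"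

lemma scal_seminorm: "(\<lambda>x. real_of_int \<bar>scal x\<bar>) \<in> seminorm_sums P"
  and part_seminorm: "p \<in> P \<Longrightarrow> (\<lambda>x. p (part x)) \<in> seminorm_sums P"
  by (auto intro!: seminorm_sums.base simp: unitization_seminorms_def)

lemma polymetricD:
  assumes "polymetric P" "p \<in> P"
  shows "0 \<le> p x" "p 0 = 0" "p (- x) = p x" "p (x + y) \<le> p x + p y" "\<exists>q\<in>P. \<forall>x y. p (x * y) \<le> q x * q y"
    "p (x - y) \<le> p x + p y"
proof -
  show *: "0 \<le> p x" "p 0 = 0" "p (- x) = p x" "p (x + y) \<le> p x + p y" "\<exists>q\<in>P. \<forall>x y. p (x * y) \<le> q x * q y" for x y
    using assms unfolding polymetric_def by blast+
  show "p (x - y) \<le> p x + p y" using *(4)[of x "- y"] *(3)[of y] by simp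
qed

lemma seminorm_int_scale:
  assumes "polymetric P" "p \<in> P" shows "p (int_scale k a) \<le> real_of_int \<bar>k\<bar> * p a"
proof -
  have *: "p (\<Sum>i<n. a) \<le> real n * p a" for n
  proof (induction n)
    case (Suc n)
    have "p ((\<Sum>i<n. a) + a) \<le> p (\<Sum>i<n. a) + p a" by (rule polymetricD[OF assms])
    with Suc show ?case by (simp add: algebra_simps)
  qed (simp add: polymetricD[OF assms])
  show ?thesis
    using *[of "nat k"] *[of "nat (- k)"] by (auto simp: int_scale_def polymetricD[OF assms])
qed

lemma seminorm_sums_props:
  fixes P :: "('a::{comm_ring, topological_space} \<Rightarrow> real) set"
  assumes P: "polymetric P" and q: "q \<in> seminorm_sums P"
  shows "0 \<le> q x" "q 0 = 0" "q (- x) = q x" "q (x + y) \<le> q x + q y"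
    "\<exists>r\<in>seminorm_sums P. \<forall>x y. q (x * y) \<le> r x * r y"
proof -
  have "0 \<le> q x \<and> q 0 = 0 \<and> q (- x) = q x \<and> q (x + y) \<le> q x + q y" for x y
    using q
  proof (induction arbitrary: x y)
    case (base q)
    then show ?case by (auto simp: unitization_seminorms_def polymetricD[OF P])
  next
    case (add q r)
    have "q (x + y) \<le> q x + q y" "r (x + y) \<le> r x + r y" using add.IH by auto
    then have "q (x + y) + r (x + y) \<le> q x + r x + (q y + r y)" by linarith
    then show ?case using add.IH by auto
  qed
  then show "0 \<le> q x" "q 0 = 0" "q (- x) = q x" "q (x + y) \<le> q x + q y" by auto
  show "\<exists>r\<in>seminorm_sums P. \<forall>x y. q (x * y) \<le> r x * r y"
    using q
  proof induction
    case (base q)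
    then consider "q = (\<lambda>x. real_of_int \<bar>scal x\<bar>)" | p where "p \<in> P" "q = (\<lambda>x. p (part x))"
      by (auto simp: unitization_seminorms_def)
    then show ?case
    proof cases
      case 1
      then show ?thesis using scal_seminorm[of P] by (intro bexI[OF _ scal_seminorm]) (auto simp: abs_mult)
    next
      case 2
      obtain r where r: "r \<in> P" "\<And>x y. p (x * y) \<le> r x * r y" using polymetricD(5)[OF P 2(1)] by blast
      \<comment> \<open>The scalar part is for the mixed terms, together with \<open>p\<close>
        itself, and \<open>r\<close> is for the product of the parts.\<close>
      define s where "s x = real_of_int \<bar>scal x\<bar> + (p (part x) + r (part x))" for x
      have s: "s \<in> seminorm_sums P"
        unfolding s_def by (intro seminorm_sums.add scal_seminorm part_seminorm 2 r)
      have "q (x * y) \<le> s x * s y" for x y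
      proof -
        have nn: "0 \<le> p (part x)" "0 \<le> p (part y)" "0 \<le> r (part x)" "0 \<le> r (part y)"
          using P 2 r by (auto intro: polymetricD)
        have "q (x * y) \<le> p (int_scale (scal x) (part y) + int_scale (scal y) (part x)) + p (part x * part y)"
          by (simp add: 2 polymetricD(4)[OF P 2(1)])
        also have "\<dots> \<le> p (int_scale (scal x) (part y)) + p (int_scale (scal y) (part x)) + p (part x * part y)"
          by (simp add: polymetricD(4)[OF P 2(1)])
        also have "\<dots> \<le> real_of_int \<bar>scal x\<bar> * p (part y) + real_of_int \<bar>scal y\<bar> * p (part x) + r (part x) * r (part y)"
          by (intro add_mono seminorm_int_scale[OF P] 2 r)
        also have "\<dots> \<le> s x * s y"
          using nn by (simp add: s_def algebra_simps add_nonneg_nonneg)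
        finally show ?thesis .
      qed
      with s show ?thesis by blast
    qed
  next
    case (add q1 q2)
    then obtain r1 r2 where r: "r1 \<in> seminorm_sums P" "r2 \<in> seminorm_sums P"
      "\<And>x y. q1 (x * y) \<le> r1 x * r1 y" "\<And>x y. q2 (x * y) \<le> r2 x * r2 y" by blast
    have nn: "0 \<le> r x" if "r \<in> seminorm_sums P" for r x
      using that
    proof (induction arbitrary: x)
      case (base q)
      then show ?case by (auto simp: unitization_seminorms_def polymetricD[OF P])
    qed auto
    have "q1 (x * y) + q2 (x * y) \<le> (r1 x + r2 x) * (r1 y + r2 y)" for x y
    proof -
      have "0 \<le> r1 x * r2 y" "0 \<le> r2 x * r1 y" using nn r by (simp_all add: mult_nonneg_nonneg)
      moreover have "(r1 x + r2 x) * (r1 y + r2 y) = r1 x * r1 y + r2 x * r2 y + (r1 x * r2 y + r2 x * r1 y)"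
        by (simp add: algebra_simps)
      ultimately show ?thesis using r(3)[of x y] r(4)[of x y] by linarith
    qed
    with seminorm_sums.add[OF r(1,2)] show ?case by (intro bexI[of _ "\<lambda>x. r1 x + r2 x"]) auto
  qed
qed

lemma seminorm_sums_diff:
  assumes "polymetric P" "q \<in> seminorm_sums P" shows "q (x - y) \<le> q x + q y"
  using seminorm_sums_props(4)[OF assms, of x "- y"] seminorm_sums_props(3)[OF assms, of y] by simp

lemma seminorm_sums_sum:
  assumes "polymetric P" "q \<in> seminorm_sums P" shows "finite F \<Longrightarrow> q (sum f F) \<le> (\<Sum>k\<in>F. q (f k))"
proof (induction F rule: finite_induct)
  case (insert x F)
  then show ?case using seminorm_sums_props(4)[OF assms, of "f x" "sum f F"] by simp
qed (simp add: seminorm_sums_props[OF assms])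

lemma polymetric_open:
  assumes "polymetric P"
  shows "open U \<longleftrightarrow> (\<forall>x\<in>U. \<exists>F \<epsilon>. finite F \<and> F \<subseteq> P \<and> \<epsilon> > 0 \<and> (\<forall>y. (\<forall>p\<in>F. p (y - x) < \<epsilon>) \<longrightarrow> y \<in> U))"
  using assms unfolding polymetric_def by (elim conjE allE[of _ U])

lemma open_seminorm_ball:
  assumes "polymetric P" "p \<in> P" shows "open {y. p (y - x) < \<epsilon>}"
proof -
  have "\<exists>F \<delta>. finite F \<and> F \<subseteq> P \<and> \<delta> > 0 \<and> (\<forall>z. (\<forall>p\<in>F. p (z - y) < \<delta>) \<longrightarrow> z \<in> {y. p (y - x) < \<epsilon>})"
    if "p (y - x) < \<epsilon>" for y
  proof (intro exI[of _ "{p}"] exI[of _ "\<epsilon> - p (y - x)"] conjI allI impI)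
    fix z assume "\<forall>p'\<in>{p}. p' (z - y) < \<epsilon> - p (y - x)"
    moreover have "p (z - x) \<le> p (z - y) + p (y - x)"
      using polymetricD(4)[OF assms, of "z - y" "y - x"] by simp
    ultimately show "z \<in> {y. p (y - x) < \<epsilon>}" by simp
  qed (use that assms in auto)
  then show ?thesis unfolding polymetric_open[OF assms(1)] by simp
qed

lemma tendsto_seminorm:
  fixes P :: "('a::{comm_ring, topological_space} \<Rightarrow> real) set"
  assumes P: "polymetric P" and q: "q \<in> seminorm_sums P" and f: "(f \<longlongrightarrow> l) F"
  shows "((\<lambda>x. q (f x - l)) \<longlongrightarrow> 0) F"
  using q
proof induction
  case (base q)
  then consider "q = (\<lambda>x. real_of_int \<bar>scal x\<bar>)" | p where "p \<in> P" "q = (\<lambda>x. p (part x))"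
    by (auto simp: unitization_seminorms_def)
  then show ?case
  proof cases
    case 1
    have "eventually (\<lambda>x. q (f x - l) = 0) F"
      using f unfolding tendsto_unitization_iff by (auto simp: 1 elim: eventually_mono)
    then show ?thesis by (rule tendsto_eventually)
  next
    case 2
    show ?thesis
    proof (rule order_tendstoI)
      fix a :: real assume "a < 0"
      then have "a < q z" for z
        using polymetricD(1)[OF P 2(1), of "part z"] by (simp add: 2(2))
      then show "eventually (\<lambda>x. a < q (f x - l)) F" by simp
    next
      fix a :: real assume "0 < a"
      have "((\<lambda>x. part (f x)) \<longlongrightarrow> part l) F" using f by (simp add: tendsto_unitization_iff)
      from topological_tendstoD[OF this open_seminorm_ball[OF P 2(1)], of "part l" a] \<open>0 < a\<close>
      show "eventually (\<lambda>x. q (f x - l) < a) F"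
        by (simp add: 2(2) polymetricD(2)[OF P 2(1)])
    qed
  qed
next
  case (add q r)
  from tendsto_add[OF add.IH] show ?case by simp
qed

definition abs_summable :: "('a::comm_ring \<Rightarrow> real) set \<Rightarrow> ('k \<Rightarrow> 'a unitization) \<Rightarrow> bool" where
  "abs_summable P f \<longleftrightarrow> (\<forall>q\<in>seminorm_sums P. (\<lambda>k. q (f k)) summable_on UNIV)"

lemma seminorm_infsum_le:
  fixes f :: "'k \<Rightarrow> 'a::{comm_ring, topological_ab_group_add, t2_space} unitization"
  assumes P: "polymetric P" and q: "q \<in> seminorm_sums P"
    and s: "(f has_sum s) UNIV" and b: "(b has_sum B) UNIV" "\<And>k. q (f k) \<le> b k"
  shows "q s \<le> B"
proof -
  have t: "((\<lambda>F. q (sum f F - s)) \<longlongrightarrow> 0) (finite_subsets_at_top UNIV)"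
    by (rule tendsto_seminorm[OF P q]) (use s in \<open>simp add: has_sum_def\<close>)
  have b': "(sum b \<longlongrightarrow> B) (finite_subsets_at_top UNIV)" using b by (simp add: has_sum_def)
  have "((\<lambda>F. q (sum f F - s) + sum b F) \<longlongrightarrow> 0 + B) (finite_subsets_at_top UNIV)"
    by (intro tendsto_add t b')
  moreover have "eventually (\<lambda>F. q s \<le> q (sum f F - s) + sum b F) (finite_subsets_at_top UNIV)"
  proof (rule eventually_finite_subsets_at_top_weakI)
    fix F :: "'k set" assume F: "finite F"
    have "q s \<le> q (sum f F) + q (sum f F - s)"
      using seminorm_sums_diff[OF P q, of "sum f F" "sum f F - s"] by simp
    also have "q (sum f F) \<le> (\<Sum>k\<in>F. q (f k))" using F by (rule seminorm_sums_sum[OF P q])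
    also have "\<dots> \<le> sum b F" by (intro sum_mono b)
    finally show "q s \<le> q (sum f F - s) + sum b F" by simp
  qed
  ultimately show ?thesis
    using tendsto_lowerbound[of _ B "finite_subsets_at_top UNIV" "q s"] by simp
qed

text \<open>Nonzero integers have absolute value at least 1, so a summable family has finite
  support; otherwise more than \<open>S\<close> of its terms could be collected.\<close>

lemma has_sum_scalars:
  fixes f :: "'k \<Rightarrow> 'a::{comm_ring, topological_ab_group_add, t2_space} unitization"
  assumes "(\<lambda>k. real_of_int \<bar>scal (f k)\<bar>) summable_on UNIV"
  shows "(\<lambda>k. Unitization (scal (f k)) (0 :: 'a)) summable_on UNIV"
proof -
  have "finite {k. scal (f k) \<noteq> 0}"
  proof (rule ccontr)
    assume inf: "infinite {k. scal (f k) \<noteq> 0}"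
    obtain S where "((\<lambda>k. real_of_int \<bar>scal (f k)\<bar>) has_sum S) UNIV" using assms by (auto simp: summable_on_def)
    then have S: "(\<Sum>k\<in>F. real_of_int \<bar>scal (f k)\<bar>) \<le> S" if "finite F" for F
      using that by (intro finite_sum_le_has_sum[where A = UNIV]) auto
    obtain F where F: "F \<subseteq> {k. scal (f k) \<noteq> 0}" "finite F" "card F = nat \<lceil>S\<rceil> + 1"
      using infinite_arbitrarily_large[OF inf] by metis
    have "real (card F) = (\<Sum>k\<in>F. 1)" by simp
    also have "\<dots> \<le> (\<Sum>k\<in>F. real_of_int \<bar>scal (f k)\<bar>)"
    proof (rule sum_mono)
      fix k assume "k \<in> F"
      then have "1 \<le> \<bar>scal (f k)\<bar>" using F(1) by auto
      then show "1 \<le> real_of_int \<bar>scal (f k)\<bar>" by (simp only: of_int_1_le_iff)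
    qed
    also have "\<dots> \<le> S" by (rule S[OF F(2)])
    finally show False using F(3) by linarith
  qed
  then have "(\<lambda>k. Unitization (scal (f k)) (0 :: 'a)) summable_on {k. scal (f k) \<noteq> 0}"
    by (rule summable_on_finite)
  then show ?thesis
    by (rule summable_on_cong_neutral[THEN iffD1, rotated -1]) (auto simp: zero_unitization_def)
qed

text \<open>Completeness speaks of sequences, and so it is applied to sums over initial segments.
  Absolute summability controls the sums over all finite sets beyond some index; this makes the
  sequence Cauchy, and then turns its limit into an unconditional sum.\<close>

lemma summable_on_parts:
  fixes f :: "nat \<Rightarrow> 'a::{comm_ring, topological_ab_group_add, t2_space}"
  assumes P: "polymetric P" and c: "sequentially_complete TYPE('a)"
    and f: "\<And>p. p \<in> P \<Longrightarrow> (\<lambda>k. p (f k)) summable_on UNIV"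
  shows "f summable_on UNIV"
proof -
  have psum: "p (sum f F) \<le> (\<Sum>k\<in>F. p (f k))" if "finite F" "p \<in> P" for p F
    using that(1)
  proof (induction F rule: finite_induct)
    case (insert x F)
    then show ?case using polymetricD(4)[OF P that(2), of "f x" "sum f F"] by simp
  qed (simp add: polymetricD[OF P that(2)])
  have tail: "\<exists>N. \<forall>F. finite F \<and> F \<inter> {..<N} = {} \<longrightarrow> p (sum f F) < \<epsilon>" if p: "p \<in> P" and "\<epsilon> > 0" for p \<epsilon>
  proof -
    obtain S where "((\<lambda>k. p (f k)) has_sum S) UNIV" using f[OF p] by (auto simp: summable_on_def)
    then have "eventually (\<lambda>F. dist (\<Sum>k\<in>F. p (f k)) S < \<epsilon> / 2) (finite_subsets_at_top UNIV)"
      using \<open>\<epsilon> > 0\<close> by (intro tendstoD) (auto simp: has_sum_def)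
    then obtain X where X: "finite X" "\<And>Y. finite Y \<Longrightarrow> X \<subseteq> Y \<Longrightarrow> dist (\<Sum>k\<in>Y. p (f k)) S < \<epsilon> / 2"
      unfolding eventually_finite_subsets_at_top by auto
    obtain N where N: "X \<subseteq> {..<N}" using finite_nat_bounded[OF X(1)] by auto
    \<comment> \<open>The sum of the seminorms over \<open>F\<close> is the difference of two sums
      over finite sets containing \<open>X\<close>, both within \<open>\<epsilon> / 2\<close> of
      \<open>S\<close>.\<close>
    have "p (sum f F) < \<epsilon>" if F: "finite F" "F \<inter> {..<N} = {}" for F
    proof -
      have XF: "X \<inter> F = {}" using N F by auto
      have "p (sum f F) \<le> (\<Sum>k\<in>F. p (f k))" using psum[OF F(1) p] .
      also have "\<dots> = (\<Sum>k\<in>X \<union> F. p (f k)) - (\<Sum>k\<in>X. p (f k))"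
        using XF X F by (simp add: sum.union_disjoint)
      also have "\<dots> < \<epsilon>" using X(2)[of "X \<union> F"] X(2)[of X] X(1) F by (auto simp: dist_real_def abs_if split: if_splits)
      finally show ?thesis .
    qed
    then show ?thesis by blast
  qed
  have tails: "\<exists>N. \<forall>F. finite F \<and> F \<inter> {..<N} = {} \<longrightarrow> (\<forall>p\<in>Q. p (sum f F) < \<epsilon>)"
    if "finite Q" "Q \<subseteq> P" and e: "\<epsilon> > 0" for Q \<epsilon>
    using that(1,2)
  proof (induction Q rule: finite_induct)
    case (insert p Q)
    have pQ: "p \<in> P" "Q \<subseteq> P" using insert.prems by auto
    from insert.IH[OF pQ(2)] obtain N
      where N: "\<forall>F. finite F \<and> F \<inter> {..<N} = {} \<longrightarrow> (\<forall>p\<in>Q. p (sum f F) < \<epsilon>)" ..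
    from tail[OF pQ(1) e] obtain M
      where M: "\<forall>F. finite F \<and> F \<inter> {..<M} = {} \<longrightarrow> p (sum f F) < \<epsilon>" ..
    show ?case
    proof (intro exI[of _ "max M N"] allI impI ballI)
      fix F r assume F: "finite F \<and> F \<inter> {..<max M N} = {}" and r: "r \<in> insert p Q"
      then have "F \<inter> {..<N} = {}" "F \<inter> {..<M} = {}" by auto
      then show "r (sum f F) < \<epsilon>" using F r N M by blast
    qed
  qed auto
  have opn: "\<exists>Q \<epsilon>. finite Q \<and> Q \<subseteq> P \<and> \<epsilon> > 0 \<and> (\<forall>y. (\<forall>p\<in>Q. p (y - x) < \<epsilon>) \<longrightarrow> y \<in> U)" if "open U" "x \<in> U" for U x
    using that unfolding polymetric_open[OF P] by simp
  define s where "s n = sum f {..<n}" for n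
  have "convergent s"
  proof -
    have "\<exists>N. \<forall>m\<ge>N. \<forall>n\<ge>N. s m - s n \<in> U" if U: "open U" "0 \<in> U" for U
    proof -
      from opn[OF U] obtain Q \<epsilon> where
        "finite Q \<and> Q \<subseteq> P \<and> \<epsilon> > 0 \<and> (\<forall>y. (\<forall>p\<in>Q. p (y - 0) < \<epsilon>) \<longrightarrow> y \<in> U)" by (elim exE)
      then have Q: "finite Q" "Q \<subseteq> P" "\<epsilon> > 0" "\<And>y. (\<And>p. p \<in> Q \<Longrightarrow> p y < \<epsilon>) \<Longrightarrow> y \<in> U"
        by simp_all
      obtain N where N: "\<And>F p. finite F \<Longrightarrow> F \<inter> {..<N} = {} \<Longrightarrow> p \<in> Q \<Longrightarrow> p (sum f F) < \<epsilon>"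
        using tails[OF Q(1-3)] by (elim exE) blast
      have le: "p (s m - s n) < \<epsilon>" if "N \<le> n" "n \<le> m" "p \<in> Q" for m n p
      proof -
        have "s m - s n = sum f {n..<m}" using that unfolding s_def
          by (metis atLeast0LessThan diff_eq_eq add.commute le0 sum.atLeastLessThan_concat)
        moreover have "{n..<m} \<inter> {..<N} = {}" using that by auto
        ultimately show ?thesis using N[of "{n..<m}" p] that by simp
      qed
      have "p (s m - s n) < \<epsilon>" if "N \<le> n" "N \<le> m" "p \<in> Q" for m n p
      proof (cases "n \<le> m")
        case False
        have "p (s m - s n) = p (s n - s m)"
          using polymetricD(3)[OF P, of p "s n - s m"] that Q(2) by auto
        then show ?thesis using le[of m n p] that False by simp
      qed (use le that in auto)
      then show ?thesis using Q(4) by blast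
    qed
    then show ?thesis using c unfolding sequentially_complete_def by blast
  qed
  then obtain l where l: "s \<longlonglongrightarrow> l" unfolding convergent_def by blast
  have "(f has_sum l) UNIV"
    unfolding has_sum_def
  proof (rule topological_tendstoI)
    fix U assume U: "open U" "l \<in> U"
    from opn[OF U] obtain Q \<epsilon> where
      "finite Q \<and> Q \<subseteq> P \<and> \<epsilon> > 0 \<and> (\<forall>y. (\<forall>p\<in>Q. p (y - l) < \<epsilon>) \<longrightarrow> y \<in> U)" by (elim exE)
    then have Q: "finite Q" "Q \<subseteq> P" "\<epsilon> > 0" "\<And>y. (\<And>p. p \<in> Q \<Longrightarrow> p (y - l) < \<epsilon>) \<Longrightarrow> y \<in> U"
      by simp_all
    obtain N where N: "\<And>F p. finite F \<Longrightarrow> F \<inter> {..<N} = {} \<Longrightarrow> p \<in> Q \<Longrightarrow> p (sum f F) < \<epsilon> / 2"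
      using tails[OF Q(1,2), of "\<epsilon> / 2"] Q(3) by auto
    have "eventually (\<lambda>n. \<forall>p\<in>Q. s n \<in> {y. p (y - l) < \<epsilon> / 2}) sequentially"
      using Q by (intro eventually_ball_finite ballI topological_tendstoD[OF l] open_seminorm_ball[OF P])
        (auto simp: polymetricD[OF P])
    then obtain M where M: "\<And>n p. n \<ge> M \<Longrightarrow> p \<in> Q \<Longrightarrow> p (s n - l) < \<epsilon> / 2"
      unfolding eventually_sequentially by auto
    define K where "K = max M N"
    show "eventually (\<lambda>F. sum f F \<in> U) (finite_subsets_at_top UNIV)"
      unfolding eventually_finite_subsets_at_top
    proof (intro exI[of _ "{..<K}"] conjI allI impI)
      fix F assume F: "finite F \<and> {..<K} \<subseteq> F \<and> F \<subseteq> (UNIV :: nat set)"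
      show "sum f F \<in> U"
      proof (rule Q(4))
        fix p assume p: "p \<in> Q"
        have eq: "sum f F - l = sum f (F - {..<K}) + (s K - l)"
          using F by (simp add: s_def sum_diff)
        have "p (sum f F - l) \<le> p (sum f (F - {..<K})) + p (s K - l)"
          unfolding eq by (rule polymetricD(4)[OF P]) (use p Q in auto)
        also have "\<dots> < \<epsilon> / 2 + \<epsilon> / 2"
        proof (rule add_strict_mono)
          have "(F - {..<K}) \<inter> {..<N} = {}" by (auto simp: K_def)
          then show "p (sum f (F - {..<K})) < \<epsilon> / 2" using N[of "F - {..<K}" p] F p by simp
          show "p (s K - l) < \<epsilon> / 2" using M[of K p] p by (simp add: K_def)
        qed
        also have "\<dots> = \<epsilon>" by simp
        finally show "p (sum f F - l) < \<epsilon>" .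
      qed
    qed auto
  qed
  then show ?thesis by (auto simp: summable_on_def)
qed

lemma abs_summable_imp_summable:
  fixes f :: "nat \<Rightarrow> 'a::{comm_ring, topological_ab_group_add, t2_space} unitization"
  assumes P: "complete_polymetric P" and f: "abs_summable P f"
  shows "f summable_on UNIV"
proof -
  have 1: "(\<lambda>k. Unitization (scal (f k)) (0 :: 'a)) summable_on UNIV"
    using f scal_seminorm[of P] by (intro has_sum_scalars) (auto simp: abs_summable_def)
  have "(\<lambda>k. part (f k)) summable_on UNIV"
    using P f part_seminorm[of _ P] by (intro summable_on_parts[of P]) (auto simp: abs_summable_def complete_polymetric_def)
  then obtain s where s: "((\<lambda>k. part (f k)) has_sum s) UNIV" by (auto simp: summable_on_def)
  have "((Unitization 0 \<circ> (\<lambda>k. part (f k))) has_sum (Unitization 0 s)) UNIV"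
  proof (rule has_sum_comm_additive[OF _ _ s])
    show "additive (Unitization 0 :: 'a \<Rightarrow> 'a unitization)"
      by standard (simp add: plus_unitization_def)
    show "Unitization 0 \<midarrow>s\<rightarrow> Unitization 0 s"
      by (simp add: tendsto_unitization_iff)
  qed
  then have "(\<lambda>k. Unitization 0 (part (f k))) summable_on UNIV" by (auto simp: summable_on_def o_def)
  from summable_on_add[OF 1 this] have "(\<lambda>k. Unitization (scal (f k)) 0 + Unitization 0 (part (f k))) summable_on UNIV" .
  then show ?thesis by (simp add: plus_unitization_def)
qed

section \<open>Size conditions on matrices in terms of weights\<close>

definition wt :: "'i::spg \<Rightarrow> real" where "wt n = 1 + real (code n)"

lemma wt_ge_1: "1 \<le> wt n" and wt_pos: "0 < wt n" and wt_nonneg: "0 \<le> wt n"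
  by (simp_all add: wt_def)

lemma wt_power: "1 \<le> wt n ^ k" "0 < wt n ^ k" "0 \<le> wt n ^ k"
  by (simp_all add: wt_ge_1 wt_pos wt_nonneg one_le_power)

lemma wt_mono: "k \<le> l \<Longrightarrow> wt n ^ k \<le> wt n ^ l"
  by (rule power_increasing[OF _ wt_ge_1])

text \<open>Powers of \<open>wt\<close> dominate all functions of polynomial growth, so they may
  serve as the test functions in \<K> and \<Psi>.\<close>

lemma growth_iff: "f \<in> growth \<longleftrightarrow> (\<exists>C k. 0 \<le> C \<and> (\<forall>n. \<bar>f n\<bar> \<le> C * wt n ^ k))"
proof
  assume "f \<in> growth"
  then have "f \<in> bounded_by code" by (simp add: growth_bounded_by_code)
  then show "\<exists>C k. 0 \<le> C \<and> (\<forall>n. \<bar>f n\<bar> \<le> C * wt n ^ k)"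
    by (rule bounded_byE) (auto simp: wt_def)
next
  assume "\<exists>C k. 0 \<le> C \<and> (\<forall>n. \<bar>f n\<bar> \<le> C * wt n ^ k)"
  then show "f \<in> growth" by (auto simp: growth_bounded_by_code bounded_by_def wt_def)
qed

text \<open>The condition of \<Psi> with powers of \<open>wt\<close> as test functions. It is stated
  for a real kernel, to be filled by \<open>q (A n m)\<close>, so that bounds for different
  seminorms and matrices can be added and multiplied.\<close>

definition psd :: "('i::spg \<Rightarrow> 'i \<Rightarrow> real) \<Rightarrow> bool" where
  "psd h \<longleftrightarrow> (\<forall>k. \<exists>C l. 0 \<le> C \<and> (\<forall>n m. wt n ^ k * h n m \<le> C * wt m ^ l \<and> wt m ^ k * h n m \<le> C * wt n ^ l))"

definition rpd :: "('i::spg \<Rightarrow> 'i \<Rightarrow> real) \<Rightarrow> bool" where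
  "rpd h \<longleftrightarrow> (\<forall>k. \<exists>C. \<forall>n m. wt n ^ k * wt m ^ k * h n m \<le> C)"

lemma psd_transpose: "psd (\<lambda>n m. h m n) \<longleftrightarrow> psd h"
  unfolding psd_def by meson

lemma psd_add: assumes "psd f" "psd g" shows "psd (\<lambda>n m. f n m + g n m)"
  unfolding psd_def
proof
  fix k
  obtain C l where C: "0 \<le> C" "\<And>n m. wt n ^ k * f n m \<le> C * wt m ^ l \<and> wt m ^ k * f n m \<le> C * wt n ^ l"
    using assms(1) unfolding psd_def by meson
  obtain D r where D: "0 \<le> D" "\<And>n m. wt n ^ k * g n m \<le> D * wt m ^ r \<and> wt m ^ k * g n m \<le> D * wt n ^ r"
    using assms(2) unfolding psd_def by meson
  have le: "C * wt m ^ l + D * wt m ^ r \<le> (C + D) * wt m ^ (l + r)" for m :: 'a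
    using mult_left_mono[OF wt_mono[of l "l + r" m] C(1)] mult_left_mono[OF wt_mono[of r "l + r" m] D(1)]
    by (simp add: distrib_right)
  show "\<exists>C l. 0 \<le> C \<and> (\<forall>n m. wt n ^ k * (f n m + g n m) \<le> C * wt m ^ l \<and> wt m ^ k * (f n m + g n m) \<le> C * wt n ^ l)"
  proof (intro exI[of _ "C + D"] exI[of _ "l + r"] conjI allI)
    show "0 \<le> C + D" using C D by simp
    fix n m
    show "wt n ^ k * (f n m + g n m) \<le> (C + D) * wt m ^ (l + r)"
      using C(2)[of n m] D(2)[of n m] le[of m] unfolding distrib_left by linarith
    show "wt m ^ k * (f n m + g n m) \<le> (C + D) * wt n ^ (l + r)"
      using C(2)[of n m] D(2)[of n m] le[of n] unfolding distrib_left by linarith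
  qed
qed

lemma psd_mono: assumes "psd g" "\<And>n m. f n m \<le> g n m" shows "psd f"
  unfolding psd_def
proof
  fix k
  obtain C l where C: "0 \<le> C" "\<And>n m. wt n ^ k * g n m \<le> C * wt m ^ l \<and> wt m ^ k * g n m \<le> C * wt n ^ l"
    using assms(1) unfolding psd_def by meson
  have "wt a ^ k * f n m \<le> wt a ^ k * g n m" for a n m :: 'a
    by (intro mult_left_mono assms wt_power)
  then show "\<exists>C l. 0 \<le> C \<and> (\<forall>n m. wt n ^ k * f n m \<le> C * wt m ^ l \<and> wt m ^ k * f n m \<le> C * wt n ^ l)"
    using C by (meson order_trans)
qed

lemma rpd_add: assumes "rpd f" "rpd g" shows "rpd (\<lambda>n m. f n m + g n m)"
  unfolding rpd_def
proof
  fix k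
  obtain C where C: "\<And>n m. wt n ^ k * wt m ^ k * f n m \<le> C" using assms(1) unfolding rpd_def by meson
  obtain D where D: "\<And>n m. wt n ^ k * wt m ^ k * g n m \<le> D" using assms(2) unfolding rpd_def by meson
  have "wt n ^ k * wt m ^ k * (f n m + g n m) \<le> C + D" for n m
    using C[of n m] D[of n m] unfolding distrib_left by linarith
  then show "\<exists>C. \<forall>n m. wt n ^ k * wt m ^ k * (f n m + g n m) \<le> C" by blast
qed

lemma rpd_mono: assumes "rpd g" "\<And>n m. f n m \<le> g n m" shows "rpd f"
  unfolding rpd_def
proof
  fix k
  obtain C where C: "\<And>n m. wt n ^ k * wt m ^ k * g n m \<le> C" using assms(1) unfolding rpd_def by meson
  have "wt n ^ k * wt m ^ k * f n m \<le> wt n ^ k * wt m ^ k * g n m" for n m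
    by (intro mult_left_mono assms mult_nonneg_nonneg wt_power)
  then show "\<exists>C. \<forall>n m. wt n ^ k * wt m ^ k * f n m \<le> C"
    using C by (meson order_trans)
qed

lemma rpd_imp_psd: assumes "rpd h" "\<And>n m. 0 \<le> h n m" shows "psd h"
  unfolding psd_def
proof
  fix k
  obtain C where C: "\<And>n m. wt n ^ k * wt m ^ k * h n m \<le> C" using assms(1) unfolding rpd_def by meson
  have *: "wt n ^ k * h n m \<le> C" "wt m ^ k * h n m \<le> C" for n m
  proof -
    have "wt n ^ k * h n m * 1 \<le> wt n ^ k * h n m * wt m ^ k" "wt m ^ k * h n m * 1 \<le> wt m ^ k * h n m * wt n ^ k"
      by (intro mult_left_mono mult_nonneg_nonneg wt_power assms(2))+
    then show "wt n ^ k * h n m \<le> C" "wt m ^ k * h n m \<le> C" using C[of n m] by (simp_all add: ac_simps)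
  qed
  have "0 \<le> wt n ^ k * h n n" for n :: 'a by (intro mult_nonneg_nonneg wt_power assms(2))
  then have "0 \<le> C" using *(1) order_trans by blast
  then show "\<exists>C l. 0 \<le> C \<and> (\<forall>n m. wt n ^ k * h n m \<le> C * wt m ^ l \<and> wt m ^ k * h n m \<le> C * wt n ^ l)"
    using * by (intro exI[of _ C] exI[of _ 0]) simp
qed

lemma pseudo_iff:
  fixes A :: "('i::spg, 'i, 'r) matrix"
  assumes "\<And>q x. q \<in> Q \<Longrightarrow> 0 \<le> q x"
  shows "A \<in> pseudo Q \<longleftrightarrow> (\<forall>q\<in>Q. psd (\<lambda>n m. q (A n m)))"
proof (intro iffI ballI)
  fix q assume A: "A \<in> pseudo Q" and q: "q \<in> Q"
  show "psd (\<lambda>n m. q (A n m))"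
    unfolding psd_def
  proof
    fix k
    have "(\<lambda>n. wt n ^ k) \<in> growth"
      unfolding growth_iff by (intro exI[of _ 1] exI[of _ k]) (simp add: wt_power)
    moreover have "\<forall>f\<in>growth. \<exists>g\<in>growth. \<forall>n m. \<bar>f n\<bar> * q (A n m) \<le> g m \<and> \<bar>f m\<bar> * q (A n m) \<le> g n"
      using A q unfolding pseudo_def by blast
    ultimately obtain g where g: "g \<in> growth" "\<And>n m. \<bar>wt n ^ k\<bar> * q (A n m) \<le> g m \<and> \<bar>wt m ^ k\<bar> * q (A n m) \<le> g n"
      by (metis (no_types, lifting))
    obtain C l where "0 \<le> C" "\<And>n. \<bar>g n\<bar> \<le> C * wt n ^ l" using g(1) unfolding growth_iff by blast
    moreover have "\<bar>wt n ^ k\<bar> = wt n ^ k" for n :: 'i by (simp add: wt_power)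
    ultimately show "\<exists>C l. 0 \<le> C \<and> (\<forall>n m. wt n ^ k * q (A n m) \<le> C * wt m ^ l \<and> wt m ^ k * q (A n m) \<le> C * wt n ^ l)"
      using g(2) by (intro exI[of _ C] exI[of _ l]) (auto, (smt (verit))+)
  qed
next
  assume *: "\<forall>q\<in>Q. psd (\<lambda>n m. q (A n m))"
  show "A \<in> pseudo Q"
    unfolding pseudo_def
  proof (intro CollectI ballI)
    fix q and f :: "'i \<Rightarrow> real" assume q: "q \<in> Q" and "f \<in> growth"
    then obtain D k where D: "0 \<le> D" "\<And>n. \<bar>f n\<bar> \<le> D * wt n ^ k" unfolding growth_iff by blast
    obtain C l where C: "0 \<le> C" "\<And>n m. wt n ^ k * q (A n m) \<le> C * wt m ^ l \<and> wt m ^ k * q (A n m) \<le> C * wt n ^ l"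
      using * q unfolding psd_def by meson
    have le: "\<bar>f a\<bar> * q (A n m) \<le> D * (wt a ^ k * q (A n m))" for a n m
      using mult_right_mono[OF D(2)[of a] assms[OF q, of "A n m"]] by (simp add: mult.assoc)
    have le2: "D * (wt n ^ k * q (A n m)) \<le> D * C * wt m ^ l" "D * (wt m ^ k * q (A n m)) \<le> D * C * wt n ^ l" for n m
      using mult_left_mono[OF conjunct1[OF C(2)[of n m]] D(1)] mult_left_mono[OF conjunct2[OF C(2)[of n m]] D(1)]
      by (simp_all add: mult.assoc)
    show "\<exists>g\<in>growth. \<forall>n m. \<bar>f n\<bar> * q (A n m) \<le> g m \<and> \<bar>f m\<bar> * q (A n m) \<le> g n"
    proof (intro bexI[of _ "\<lambda>n. D * C * wt n ^ l"] allI conjI)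
      show "(\<lambda>n. D * C * wt n ^ l) \<in> growth"
        unfolding growth_iff using C D by (intro exI[of _ "D * C"] exI[of _ l]) (auto simp: abs_mult wt_power)
      fix n m
      show "\<bar>f n\<bar> * q (A n m) \<le> D * C * wt m ^ l" by (rule order_trans[OF le le2(1)])
      show "\<bar>f m\<bar> * q (A n m) \<le> D * C * wt n ^ l" by (rule order_trans[OF le le2(2)])
    qed
  qed
qed

lemma Psi_iff:
  fixes P :: "('a::{comm_ring, topological_space} \<Rightarrow> real) set"
  assumes P: "polymetric P"
  shows "A \<in> Psi P \<longleftrightarrow> (\<forall>q\<in>seminorm_sums P. psd (\<lambda>n m. q (A n m)))"
proof -
  have "A \<in> Psi P \<longleftrightarrow> (\<forall>q\<in>unitization_seminorms P. psd (\<lambda>n m. q (A n m)))"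
    by (rule pseudo_iff) (auto simp: unitization_seminorms_def polymetricD[OF P])
  also have "\<dots> \<longleftrightarrow> (\<forall>q\<in>seminorm_sums P. psd (\<lambda>n m. q (A n m)))"
  proof (intro iffI ballI)
    fix q assume *: "\<forall>q\<in>unitization_seminorms P. psd (\<lambda>n m. q (A n m))" and "q \<in> seminorm_sums P"
    from this(2) show "psd (\<lambda>n m. q (A n m))"
      by induction (use * in \<open>auto intro: psd_add\<close>)
  qed (auto intro: seminorm_sums.base)
  finally show ?thesis .
qed

definition Kmat :: "('a::comm_ring \<Rightarrow> real) set \<Rightarrow> ('i::spg, 'i, 'a unitization) matrix set" where
  "Kmat P = embed ` rapid P"

lemma Kmat_iff:
  fixes P :: "('a::{comm_ring, topological_space} \<Rightarrow> real) set"
    and A :: "('i::spg, 'i, 'a unitization) matrix"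
  assumes P: "polymetric P"
  shows "A \<in> Kmat P \<longleftrightarrow> (\<forall>n m. scal (A n m) = 0) \<and> (\<forall>q\<in>seminorm_sums P. rpd (\<lambda>n m. q (A n m)))"
proof -
  have rap: "B \<in> rapid P \<longleftrightarrow> (\<forall>p\<in>P. rpd (\<lambda>n m. p (B n m)))" for B :: "('i, 'i, 'a) matrix"
  proof (intro iffI ballI)
    fix p assume B: "B \<in> rapid P" and p: "p \<in> P"
    show "rpd (\<lambda>n m. p (B n m))"
      unfolding rpd_def
    proof
      fix k
      have "(\<lambda>n::'i. wt n ^ k) \<in> growth"
        unfolding growth_iff by (intro exI[of _ 1] exI[of _ k]) (simp add: wt_power)
      moreover have "\<forall>f\<in>growth. \<forall>h\<in>growth. \<exists>C. \<forall>n m. \<bar>f n * h m\<bar> * p (B n m) \<le> C"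
        using B p unfolding rapid_def by blast
      ultimately have "\<exists>C. \<forall>n m. \<bar>wt n ^ k * wt m ^ k\<bar> * p (B n m) \<le> C"
        by (metis (no_types, lifting))
      then show "\<exists>C. \<forall>n m. wt n ^ k * wt m ^ k * p (B n m) \<le> C"
        by (simp add: wt_power)
    qed
  next
    assume *: "\<forall>p\<in>P. rpd (\<lambda>n m. p (B n m))"
    show "B \<in> rapid P"
      unfolding rapid_def
    proof (intro CollectI ballI)
      fix p and f h :: "'i \<Rightarrow> real" assume p: "p \<in> P" and "f \<in> growth" "h \<in> growth"
      then obtain D k E l where D: "0 \<le> D" "\<And>n. \<bar>f n\<bar> \<le> D * wt n ^ k" and E: "0 \<le> E" "\<And>n. \<bar>h n\<bar> \<le> E * wt n ^ l"
        unfolding growth_iff by metis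
      obtain C where C: "\<And>n m. wt n ^ (k + l) * wt m ^ (k + l) * p (B n m) \<le> C"
        using * p unfolding rpd_def by meson
      have "\<bar>f n * h m\<bar> * p (B n m) \<le> D * E * C" for n m
      proof -
        have "\<bar>f n * h m\<bar> \<le> (D * wt n ^ k) * (E * wt m ^ l)"
          unfolding abs_mult by (intro mult_mono D E mult_nonneg_nonneg wt_power abs_ge_zero)
        also have "\<dots> = D * E * (wt n ^ k * wt m ^ l)" by simp
        also have "\<dots> \<le> D * E * (wt n ^ (k + l) * wt m ^ (k + l))"
          by (intro mult_left_mono mult_mono wt_mono mult_nonneg_nonneg D E wt_power) auto
        finally have "\<bar>f n * h m\<bar> * p (B n m) \<le> D * E * (wt n ^ (k + l) * wt m ^ (k + l)) * p (B n m)"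
          by (rule mult_right_mono) (rule polymetricD[OF P p])
        also have "\<dots> = D * E * (wt n ^ (k + l) * wt m ^ (k + l) * p (B n m))" by simp
        also have "\<dots> \<le> D * E * C" by (intro mult_left_mono C mult_nonneg_nonneg D E)
        finally show ?thesis .
      qed
      then show "\<exists>C. \<forall>n m. \<bar>f n * h m\<bar> * p (B n m) \<le> C" by blast
    qed
  qed
  show ?thesis
  proof
    assume "A \<in> Kmat P"
    then obtain B where B: "B \<in> rapid P" "A = embed B" by (auto simp: Kmat_def)
    have "rpd (\<lambda>n m. q (A n m))" if "q \<in> seminorm_sums P" for q
      using that
    proof induction
      case (base q)
      then consider "q = (\<lambda>x. real_of_int \<bar>scal x\<bar>)" | p where "p \<in> P" "q = (\<lambda>x. p (part x))"
        by (auto simp: unitization_seminorms_def)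
      then show ?case
        using B rap[of B] by cases (auto simp: embed_def rpd_def)
    next
      case (add q r)
      then show ?case by (intro rpd_add)
    qed
    with B show "(\<forall>n m. scal (A n m) = 0) \<and> (\<forall>q\<in>seminorm_sums P. rpd (\<lambda>n m. q (A n m)))"
      by (simp add: embed_def)
  next
    assume *: "(\<forall>n m. scal (A n m) = 0) \<and> (\<forall>q\<in>seminorm_sums P. rpd (\<lambda>n m. q (A n m)))"
    have "A = embed (\<lambda>n m. part (A n m))"
      using * by (auto simp: embed_def fun_eq_iff intro!: unitization.expand)
    moreover have "(\<lambda>n m. part (A n m)) \<in> rapid P"
      unfolding rap using * by (auto intro: part_seminorm)
    ultimately show "A \<in> Kmat P" unfolding Kmat_def by blast
  qed
qed

section \<open>Products of matrices over the natural numbers\<close>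

lemma wt_nat: "wt (n::nat) = 1 + real n"
  by (simp add: wt_def code_nat_def)

text \<open>This series accounts for the factors \<open>wt j ^ 2\<close> in the estimates of
  products: an inner index pays with two powers of its weight for the convergence of the
  sum.\<close>

lemma inverse_wt_square_summable: "(\<lambda>k::nat. inverse (wt k ^ 2)) summable_on UNIV"
proof -
  have "summable (\<lambda>k. inverse (real (Suc k) ^ 2))"
    using inverse_power_summable[of 2, where 'a = real] summable_Suc_iff[of "\<lambda>k. inverse (real k ^ 2)"] by simp
  then show ?thesis
    by (subst summable_on_UNIV_nonneg_real_iff) (simp_all add: wt_nat add.commute)
qed

definition wt_sum :: real where "wt_sum = (\<Sum>\<^sub>\<infinity>k::nat. inverse (wt k ^ 2))"

lemma has_sum_wt: "((\<lambda>k::nat. inverse (wt k ^ 2)) has_sum wt_sum) UNIV"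
  unfolding wt_sum_def by (rule has_sum_infsum[OF inverse_wt_square_summable])

lemma wt_sum_nonneg: "0 \<le> wt_sum"
  unfolding wt_sum_def by (intro infsum_nonneg) (simp add: wt_power)

lemma weighted_summable:
  fixes f :: "nat \<Rightarrow> 'a::{comm_ring, topological_ab_group_add, t2_space} unitization"
  assumes P: "complete_polymetric P"
    and f: "\<And>q. q \<in> seminorm_sums P \<Longrightarrow> \<exists>c. \<forall>k. q (f k) * wt k ^ 2 \<le> c"
  shows "f summable_on UNIV"
proof (rule abs_summable_imp_summable[OF P])
  show "abs_summable P f"
    unfolding abs_summable_def
  proof
    fix q assume q: "q \<in> seminorm_sums P"
    then obtain c where c: "\<And>k. q (f k) * wt k ^ 2 \<le> c" using f by blast
    have "(\<lambda>k::nat. c * inverse (wt k ^ 2)) summable_on UNIV"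
      by (intro summable_on_cmult_right inverse_wt_square_summable)
    then show "(\<lambda>k. q (f k)) summable_on UNIV"
    proof (rule summable_on_comparison_test)
      show "q (f k) \<le> c * inverse (wt k ^ 2)" for k
        using c[of k] wt_power(2)[of k 2] by (simp add: field_simps)
      show "0 \<le> q (f k)" for k using P q seminorm_sums_props(1)[of P q] by (simp add: complete_polymetric_def)
    qed
  qed
qed

lemma weighted_sum_le:
  fixes f :: "nat \<Rightarrow> 'a::{comm_ring, topological_ab_group_add, t2_space} unitization"
  assumes P: "polymetric P" and s: "(f has_sum s) UNIV" and q: "q \<in> seminorm_sums P"
    and c: "\<And>k. q (f k) * wt k ^ 2 \<le> c"
  shows "q s \<le> c * wt_sum"
proof (rule seminorm_infsum_le[OF P q s])
  show "((\<lambda>k::nat. c * inverse (wt k ^ 2)) has_sum c * wt_sum) UNIV"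
    by (intro has_sum_cmult_right has_sum_wt)
  show "q (f k) \<le> c * inverse (wt k ^ 2)" for k
    using c[of k] wt_power(2)[of k 2] by (simp add: field_simps)
qed

lemma wt_prod_encode:
  "wt (prod_encode (m, n)) \<le> 2 * (wt m * wt n) ^ 2" "wt m \<le> wt (prod_encode (m, n))" "wt n \<le> wt (prod_encode (m, n))"
proof -
  have "real (prod_encode (m, n)) \<le> real ((m + n + 1) ^ 2)"
    using prod_encode_le[of m n] of_nat_le_iff by blast
  also have "\<dots> = (real m + real n + 1) ^ 2" by simp
  also have "\<dots> \<le> (wt m * wt n) ^ 2"
    by (intro power_mono) (auto simp: wt_nat algebra_simps)
  finally have "real (prod_encode (m, n)) \<le> (wt m * wt n) ^ 2" .
  moreover have "1 * 1 \<le> wt m * wt n" by (intro mult_mono wt_ge_1 wt_nonneg) simp_all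
  then have "1 \<le> (wt m * wt n) ^ 2" by (intro one_le_power) simp
  ultimately show "wt (prod_encode (m, n)) \<le> 2 * (wt m * wt n) ^ 2"
    unfolding wt_nat[of "prod_encode _"] by linarith
  show "wt m \<le> wt (prod_encode (m, n))" "wt n \<le> wt (prod_encode (m, n))"
    using le_prod_encode_1[of m n] le_prod_encode_2[of n m] by (simp_all add: wt_nat)
qed

text \<open>The weight of an encoded pair is at most twice the square of the product of the weights;
  two powers of it, needed for summability, cost four powers of each.\<close>

lemma weighted_summable_pairs:
  fixes f :: "nat \<times> nat \<Rightarrow> 'a::{comm_ring, topological_ab_group_add, t2_space} unitization"
  assumes P: "complete_polymetric P"
    and f: "\<And>q. q \<in> seminorm_sums P \<Longrightarrow> \<exists>c. \<forall>k l. q (f (k, l)) * (wt k ^ 4 * wt l ^ 4) \<le> c"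
  shows "f summable_on UNIV"
proof -
  have "(\<lambda>n. f (prod_decode n)) summable_on UNIV"
  proof (rule weighted_summable[OF P])
    fix q assume q: "q \<in> seminorm_sums P"
    then obtain c where c: "\<And>k l. q (f (k, l)) * (wt k ^ 4 * wt l ^ 4) \<le> c" using f by blast
    have "q (f (prod_decode n)) * wt n ^ 2 \<le> 4 * c" for n
    proof -
      obtain k l where kl: "prod_decode n = (k, l)" by (cases "prod_decode n")
      then have n: "n = prod_encode (k, l)" by (metis prod_decode_inverse)
      have "wt n ^ 2 \<le> (2 * (wt k * wt l) ^ 2) ^ 2"
        unfolding n by (intro power_mono wt_prod_encode wt_nonneg)
      also have "\<dots> = 4 * (wt k ^ 4 * wt l ^ 4)" by (simp add: power_mult_distrib flip: power_mult)
      finally have "q (f (k, l)) * wt n ^ 2 \<le> q (f (k, l)) * (4 * (wt k ^ 4 * wt l ^ 4))"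
        using P q seminorm_sums_props(1)[of P q] by (intro mult_right_mono mult_left_mono) (auto simp: complete_polymetric_def)
      also have "\<dots> \<le> 4 * c" using c[of k l] by simp
      finally show ?thesis by (simp add: kl)
    qed
    then show "\<exists>c. \<forall>k. q (f (prod_decode k)) * wt k ^ 2 \<le> c" by blast
  qed
  then show ?thesis
    using summable_on_reindex_bij_betw[OF bij_prod_decode, of f] by simp
qed

lemma psd_weight:
  assumes "psd h" shows "\<exists>C. \<forall>k. h n k * wt k ^ j \<le> C" "\<exists>C. \<forall>k. h k n * wt k ^ j \<le> C"
proof -
  obtain C l where "0 \<le> C" "\<And>n m. wt n ^ j * h n m \<le> C * wt m ^ l \<and> wt m ^ j * h n m \<le> C * wt n ^ l"
    using assms unfolding psd_def by meson
  then have "h n k * wt k ^ j \<le> C * wt n ^ l" "h k n * wt k ^ j \<le> C * wt n ^ l" for k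
    by (simp_all add: mult.commute)
  then show "\<exists>C. \<forall>k. h n k * wt k ^ j \<le> C" "\<exists>C. \<forall>k. h k n * wt k ^ j \<le> C" by blast+
qed

text \<open>The exponents are fixed in turn. \<open>l\<close> is the power of \<open>wt j\<close>
  that \<open>f\<close> leaves behind when it absorbs \<open>wt n ^ k\<close>; \<open>g\<close> then
  has to absorb this and two powers more for the convergence of the sum over
  \<open>j\<close>.\<close>

lemma psd_mult:
  assumes f: "psd f" and g: "psd g" and nn: "\<And>n m. 0 \<le> f n m" "\<And>n m. 0 \<le> g n m"
  shows "\<exists>C l. 0 \<le> C \<and> (\<forall>n j m. wt n ^ k * (f n j * g j m * wt j ^ 2) \<le> C * wt m ^ l)"
proof -
  obtain C l where C: "0 \<le> C" "\<And>n m. wt n ^ k * f n m \<le> C * wt m ^ l \<and> wt m ^ k * f n m \<le> C * wt n ^ l"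
    using f unfolding psd_def by meson
  obtain D r where D: "0 \<le> D" "\<And>n m. wt n ^ (l + 2) * g n m \<le> D * wt m ^ r \<and> wt m ^ (l + 2) * g n m \<le> D * wt n ^ r"
    using g unfolding psd_def by meson
  have "wt n ^ k * (f n j * g j m * wt j ^ 2) \<le> (C * D) * wt m ^ r" for n j m
  proof -
    have "wt n ^ k * (f n j * g j m * wt j ^ 2) = (wt n ^ k * f n j) * (g j m * wt j ^ 2)" by simp
    also have "\<dots> \<le> (C * wt j ^ l) * (g j m * wt j ^ 2)"
      using C(2)[of n j] by (intro mult_right_mono mult_nonneg_nonneg nn wt_power) auto
    also have "\<dots> = C * (wt j ^ (l + 2) * g j m)" by (simp add: power_add power2_eq_square)
    also have "\<dots> \<le> C * (D * wt m ^ r)" using D(2)[of j m] by (intro mult_left_mono C) auto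
    finally show ?thesis by simp
  qed
  then show ?thesis using C D by (intro exI[of _ "C * D"] exI[of _ r]) auto
qed

lemma psd_rpd_mult:
  assumes f: "psd f" and g: "rpd g" and nn: "\<And>n m. 0 \<le> f n m" "\<And>n m. 0 \<le> g n m"
  shows "\<exists>C. \<forall>n j m. wt n ^ k * wt m ^ k * (f n j * g j m * wt j ^ 2) \<le> C"
proof -
  obtain C l where C: "0 \<le> C" "\<And>n m. wt n ^ k * f n m \<le> C * wt m ^ l \<and> wt m ^ k * f n m \<le> C * wt n ^ l"
    using f unfolding psd_def by meson
  obtain D where D: "\<And>n m. wt n ^ (l + 2 + k) * wt m ^ (l + 2 + k) * g n m \<le> D"
    using g unfolding rpd_def by meson
  have "wt n ^ k * wt m ^ k * (f n j * g j m * wt j ^ 2) \<le> C * D" for n j m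
  proof -
    have "wt n ^ k * wt m ^ k * (f n j * g j m * wt j ^ 2) = (wt n ^ k * f n j) * (wt m ^ k * g j m * wt j ^ 2)" by simp
    also have "\<dots> \<le> (C * wt j ^ l) * (wt m ^ k * g j m * wt j ^ 2)"
      using C(2)[of n j] by (intro mult_right_mono mult_nonneg_nonneg nn wt_power) auto
    also have "\<dots> = C * (wt j ^ (l + 2) * wt m ^ k * g j m)" by (simp add: power_add power2_eq_square)
    also have "\<dots> \<le> C * (wt j ^ (l + 2 + k) * wt m ^ (l + 2 + k) * g j m)"
      by (intro mult_left_mono mult_right_mono mult_mono wt_mono mult_nonneg_nonneg nn wt_power C) auto
    also have "\<dots> \<le> C * D" by (intro mult_left_mono C D)
    finally show ?thesis .
  qed
  then show ?thesis by blast
qed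

lemma rpd_transpose: "rpd (\<lambda>n m. h m n) \<longleftrightarrow> rpd h"
  unfolding rpd_def by (metis (no_types, lifting) mult.commute)

locale cpm =
  fixes P :: "('a::{comm_ring, topological_ab_group_add, topological_semigroup_mult, t2_space} \<Rightarrow> real) set"
  assumes P: "complete_polymetric P"
begin

lemma Pp: "polymetric P" using P by (simp add: complete_polymetric_def)

lemma sn_nonneg: "q \<in> seminorm_sums P \<Longrightarrow> 0 \<le> q x"
  by (rule seminorm_sums_props[OF Pp])

lemma sn_mult:
  assumes "q \<in> seminorm_sums P"
  obtains r where "r \<in> seminorm_sums P" "\<And>x y. q (x * y) \<le> r x * r y"
  using seminorm_sums_props(5)[OF Pp assms] by blast

lemma PsiD: "A \<in> Psi P \<Longrightarrow> q \<in> seminorm_sums P \<Longrightarrow> psd (\<lambda>n m. q (A n m))"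
  by (simp add: Psi_iff[OF Pp])

lemma product_summable:
  fixes A B :: "(nat, nat, 'a unitization) matrix"
  assumes "A \<in> Psi P" "B \<in> Psi P"
  shows "(\<lambda>j. A n j * B j m) summable_on UNIV"
proof (rule weighted_summable[OF P])
  fix q assume q: "q \<in> seminorm_sums P"
  obtain r where r: "r \<in> seminorm_sums P" "\<And>x y. q (x * y) \<le> r x * r y" using sn_mult[OF q] by blast
  note psd = PsiD[OF assms(1) r(1)] PsiD[OF assms(2) r(1)]
  obtain C where C: "\<And>k. r (A n k) * wt k ^ 2 \<le> C" using psd_weight(1)[OF psd(1)] by meson
  obtain D where D: "\<And>k. r (B k m) * wt k ^ 0 \<le> D" using psd_weight(2)[OF psd(2)] by meson
  have "q (A n j * B j m) * wt j ^ 2 \<le> C * D" for j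
  proof -
    have "q (A n j * B j m) * wt j ^ 2 \<le> r (A n j) * r (B j m) * wt j ^ 2"
      by (intro mult_right_mono r wt_power)
    also have "\<dots> = (r (A n j) * wt j ^ 2) * r (B j m)" by simp
    also have "\<dots> \<le> C * D"
      using C[of j] D[of j] sn_nonneg[OF r(1)]
      by (intro mult_mono) (auto intro: order_trans[OF mult_nonneg_nonneg[OF sn_nonneg[OF r(1)] wt_power(3)]])
    finally show ?thesis .
  qed
  then show "\<exists>c. \<forall>j. q (A n j * B j m) * wt j ^ 2 \<le> c" by blast
qed

lemma product_has_sum:
  fixes A B :: "(nat, nat, 'a unitization) matrix"
  assumes "A \<in> Psi P" "B \<in> Psi P"
  shows "((\<lambda>j. A n j * B j m) has_sum (A \<odot> B) n m) UNIV"
  unfolding mat_mult_def using product_summable[OF assms] by (rule has_sum_infsum)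

text \<open>\<open>w\<close> is a product of powers of the outer weights, constant for the
  summation. Both conditions, that of \<Psi> and that of \<K>, are instances.\<close>

lemma product_seminorm_le:
  fixes A B :: "(nat, nat, 'a unitization) matrix"
  assumes A: "A \<in> Psi P" "B \<in> Psi P" and q: "q \<in> seminorm_sums P" "\<And>x y. q (x * y) \<le> r x * r y"
    and c: "0 < w" "\<And>j. w * (r (A n j) * r (B j m) * wt j ^ 2) \<le> c"
  shows "w * q ((A \<odot> B) n m) \<le> c * wt_sum"
proof -
  have "q (A n j * B j m) * wt j ^ 2 \<le> c / w" for j
  proof -
    have "w * (q (A n j * B j m) * wt j ^ 2) \<le> w * (r (A n j) * r (B j m) * wt j ^ 2)"
      using c(1) by (intro mult_left_mono mult_right_mono q wt_power) auto
    also have "\<dots> \<le> c" by (rule c)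
    finally show ?thesis using c(1) by (simp add: field_simps)
  qed
  from weighted_sum_le[OF Pp product_has_sum[OF A] q(1) this]
  show ?thesis using c(1) by (simp add: field_simps)
qed

lemma Psi_mult:
  fixes A B :: "(nat, nat, 'a unitization) matrix"
  assumes A: "A \<in> Psi P" and B: "B \<in> Psi P"
  shows "A \<odot> B \<in> Psi P"
  unfolding Psi_iff[OF Pp]
proof
  fix q assume q: "q \<in> seminorm_sums P"
  obtain r where r: "r \<in> seminorm_sums P" "\<And>x y. q (x * y) \<le> r x * r y" using sn_mult[OF q] by blast
  note p = PsiD[OF A r(1)] PsiD[OF B r(1)]
  note nn = sn_nonneg[OF r(1)]
  show "psd (\<lambda>n m. q ((A \<odot> B) n m))"
    unfolding psd_def
  proof
    fix k
    obtain C l where C: "0 \<le> C" "\<And>n j m. wt n ^ k * (r (A n j) * r (B j m) * wt j ^ 2) \<le> C * wt m ^ l"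
      using psd_mult[OF p, of k] nn by blast
    \<comment> \<open>The other half of the condition is the same estimate for the transposed
      kernels, with the factors in opposite order.\<close>
    obtain D s where D: "0 \<le> D" "\<And>m j n. wt m ^ k * (r (B j m) * r (A n j) * wt j ^ 2) \<le> D * wt n ^ s"
      using psd_mult[OF p(2)[THEN psd_transpose[THEN iffD2]] p(1)[THEN psd_transpose[THEN iffD2]], of k] nn by blast
    have 1: "wt n ^ k * q ((A \<odot> B) n m) \<le> C * wt m ^ l * wt_sum" for n m
      by (rule product_seminorm_le[OF A B q r(2)]) (use C wt_power in auto)
    have 2: "wt m ^ k * q ((A \<odot> B) n m) \<le> D * wt n ^ s * wt_sum" for n m
      by (rule product_seminorm_le[OF A B q r(2)]) (use D wt_power in \<open>auto simp: mult.commute mult.left_commute\<close>)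
    have le: "C * wt m ^ l * wt_sum \<le> (C + D) * wt_sum * wt m ^ (l + s)"
      "D * wt m ^ s * wt_sum \<le> (C + D) * wt_sum * wt m ^ (l + s)" for m :: nat
    proof -
      have "C * wt m ^ l \<le> (C + D) * wt m ^ (l + s)" "D * wt m ^ s \<le> (C + D) * wt m ^ (l + s)"
        using C D by (auto intro!: mult_mono wt_mono wt_power)
      from this[THEN mult_right_mono[OF _ wt_sum_nonneg]]
      show "C * wt m ^ l * wt_sum \<le> (C + D) * wt_sum * wt m ^ (l + s)"
        "D * wt m ^ s * wt_sum \<le> (C + D) * wt_sum * wt m ^ (l + s)" by (simp_all add: ac_simps)
    qed
    show "\<exists>C l. 0 \<le> C \<and> (\<forall>n m. wt n ^ k * q ((A \<odot> B) n m) \<le> C * wt m ^ l \<and> wt m ^ k * q ((A \<odot> B) n m) \<le> C * wt n ^ l)"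
      using C(1) D(1) wt_sum_nonneg
      by (intro exI[of _ "(C + D) * wt_sum"] exI[of _ "l + s"] conjI allI order_trans[OF 1 le(1)] order_trans[OF 2 le(2)]) simp
  qed
qed

lemma Kmat_Psi: "A \<in> Kmat P \<Longrightarrow> A \<in> Psi P"
  unfolding Kmat_iff[OF Pp] Psi_iff[OF Pp] using rpd_imp_psd sn_nonneg by blast

text \<open>The absolute value of the scalar part is one of the seminorms, so it passes through the
  infinite sum like the others.\<close>

lemma scal_product:
  fixes A B :: "(nat, nat, 'a unitization) matrix"
  assumes "A \<in> Psi P" "B \<in> Psi P" "\<And>j. scal (A n j) * scal (B j m) = 0"
  shows "scal ((A \<odot> B) n m) = 0"
proof -
  have "scal (A n j * B j m) = 0" for j using assms(3)[of j] by (simp only: unitization_sel)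
  then have "real_of_int \<bar>scal ((A \<odot> B) n m)\<bar> \<le> 0 * wt_sum"
    by (intro weighted_sum_le[OF Pp product_has_sum[OF assms(1,2)] scal_seminorm])
       (simp only: abs_zero of_int_0 mult_zero_left order_refl)
  then show ?thesis by simp
qed

lemma Kmat_mult_left:
  fixes A B :: "(nat, nat, 'a unitization) matrix"
  assumes A: "A \<in> Psi P" and BK: "B \<in> Kmat P"
  shows "A \<odot> B \<in> Kmat P"
  unfolding Kmat_iff[OF Pp]
proof (intro conjI allI ballI)
  note B = Kmat_Psi[OF BK]
  show "scal ((A \<odot> B) n m) = 0" for n m
    using BK by (intro scal_product A B) (simp add: Kmat_iff[OF Pp])
  fix q assume q: "q \<in> seminorm_sums P"
  obtain r where r: "r \<in> seminorm_sums P" "\<And>x y. q (x * y) \<le> r x * r y" using sn_mult[OF q] by blast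
  show "rpd (\<lambda>n m. q ((A \<odot> B) n m))"
    unfolding rpd_def
  proof
    fix k
    have "rpd (\<lambda>n m. r (B n m))" using BK r by (simp add: Kmat_iff[OF Pp])
    from psd_rpd_mult[OF PsiD[OF A r(1)] this, of k] sn_nonneg[OF r(1)]
    obtain C where C: "\<And>n j m. wt n ^ k * wt m ^ k * (r (A n j) * r (B j m) * wt j ^ 2) \<le> C" by blast
    have "wt n ^ k * wt m ^ k * q ((A \<odot> B) n m) \<le> C * wt_sum" for n m
      by (rule product_seminorm_le[OF A B q r(2)]) (use C in \<open>auto intro!: mult_pos_pos wt_power\<close>)
    then show "\<exists>C. \<forall>n m. wt n ^ k * wt m ^ k * q ((A \<odot> B) n m) \<le> C" by blast
  qed
qed

text \<open>Commutativity of the entries makes transposition an antihomomorphism; right-hand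
  versions of the estimates then follow from the left-hand ones.\<close>

lemma transpose_product: "(\<lambda>n m. (A \<odot> B) m n) = (\<lambda>n m. B m n) \<odot> (\<lambda>n m. A m n)"
  for A B :: "(nat, nat, 'a unitization) matrix"
  by (simp add: mat_mult_def mult.commute)

lemma Psi_transpose: "(\<lambda>n m. A m n) \<in> Psi P \<longleftrightarrow> A \<in> Psi P"
  unfolding Psi_iff[OF Pp] by (intro ball_cong refl) (rule psd_transpose)

lemma Kmat_transpose: "(\<lambda>n m. A m n) \<in> Kmat P \<longleftrightarrow> A \<in> Kmat P"
  unfolding Kmat_iff[OF Pp]
proof (intro conj_cong ball_cong refl)
  show "(\<forall>n m. scal (A m n) = 0) \<longleftrightarrow> (\<forall>n m. scal (A n m) = 0)" by blast
qed (rule rpd_transpose)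

lemma Kmat_mult_right:
  fixes A B :: "(nat, nat, 'a unitization) matrix"
  assumes "B \<in> Kmat P" "A \<in> Psi P"
  shows "B \<odot> A \<in> Kmat P"
proof -
  have "(\<lambda>n m. A m n) \<odot> (\<lambda>n m. B m n) \<in> Kmat P"
    using assms(2)[folded Psi_transpose[of A]] assms(1)[folded Kmat_transpose[of B]]
    by (rule Kmat_mult_left)
  then have "(\<lambda>n m. (B \<odot> A) m n) \<in> Kmat P" unfolding transpose_product[of B A] .
  then show ?thesis by (rule Kmat_transpose[THEN iffD1])
qed

text \<open>Both sides are iterated forms of one unconditional sum over pairs of inner indices. For
  fixed outer indices a row of \<open>A\<close> and a column of \<open>C\<close> decrease faster
  than every power, while \<open>B\<close> grows at most polynomially.\<close>

lemma product_assoc: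
  fixes A B C :: "(nat, nat, 'a unitization) matrix"
  assumes A: "A \<in> Psi P" and B: "B \<in> Psi P" and C: "C \<in> Psi P"
  shows "A \<odot> B \<odot> C = A \<odot> (B \<odot> C)"
proof (intro ext)
  fix n m
  define f where "f = (\<lambda>(k, l). A n k * B k l * C l m)"
  have "f summable_on UNIV"
  proof (rule weighted_summable_pairs[OF P])
    fix q assume q: "q \<in> seminorm_sums P"
    obtain r where r: "r \<in> seminorm_sums P" "\<And>x y. q (x * y) \<le> r x * r y" using sn_mult[OF q] by blast
    obtain s where s: "s \<in> seminorm_sums P" "\<And>x y. r (x * y) \<le> s x * s y" using sn_mult[OF r(1)] by blast
    note nn = sn_nonneg[OF r(1)] sn_nonneg[OF s(1)]
    \<comment> \<open>The order of choice matters: the growth exponent \<open>l0\<close> of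
      \<open>B\<close> has to be known before \<open>C\<close> is asked to absorb it along with the
      four powers required for pairs.\<close>
    obtain b where b: "\<And>k. s (A n k) * wt k ^ 4 \<le> b" using psd_weight(1)[OF PsiD[OF A s(1)]] by meson
    obtain c l0 where c: "0 \<le> c" "\<And>k l. wt k ^ 0 * s (B k l) \<le> c * wt l ^ l0 \<and> wt l ^ 0 * s (B k l) \<le> c * wt k ^ l0"
      using PsiD[OF B s(1)] unfolding psd_def by meson
    obtain d where d: "\<And>l. r (C l m) * wt l ^ (l0 + 4) \<le> d" using psd_weight(2)[OF PsiD[OF C r(1)]] by meson
    have b0: "0 \<le> b" by (rule order_trans[OF _ b[of 0]]) (simp add: nn wt_power)
    have "q (f (k, l)) * (wt k ^ 4 * wt l ^ 4) \<le> b * c * d" for k l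
    proof -
      have "q (f (k, l)) \<le> r (A n k * B k l) * r (C l m)" by (simp add: f_def r)
      also have "\<dots> \<le> (s (A n k) * s (B k l)) * r (C l m)" by (intro mult_right_mono s nn)
      finally have "q (f (k, l)) * (wt k ^ 4 * wt l ^ 4) \<le> (s (A n k) * s (B k l)) * r (C l m) * (wt k ^ 4 * wt l ^ 4)"
        by (intro mult_right_mono mult_nonneg_nonneg wt_power)
      also have "\<dots> = (s (A n k) * wt k ^ 4) * (s (B k l) * (r (C l m) * wt l ^ 4))" by simp
      also have "\<dots> \<le> b * ((c * wt l ^ l0) * (r (C l m) * wt l ^ 4))"
        using c(1) c(2)[of k l] by (intro mult_mono b mult_nonneg_nonneg nn wt_power b0) auto
      also have "\<dots> = b * c * (r (C l m) * wt l ^ (l0 + 4))" by (simp add: power_add)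
      also have "\<dots> \<le> b * c * d" by (intro mult_left_mono d mult_nonneg_nonneg b0 c)
      finally show ?thesis .
    qed
    then show "\<exists>c. \<forall>k l. q (f (k, l)) * (wt k ^ 4 * wt l ^ 4) \<le> c" by blast
  qed
  then obtain S where S: "(f has_sum S) (UNIV \<times> UNIV)" by (auto simp: summable_on_def)
  have "((\<lambda>k. A n k * (B \<odot> C) k m) has_sum S) UNIV"
  proof (rule has_sum_SigmaD[OF S])
    fix k
    have "((\<lambda>l. A n k * (B k l * C l m)) has_sum A n k * (B \<odot> C) k m) UNIV"
      by (intro has_sum_cmult_right product_has_sum B C)
    then show "((\<lambda>l. f (k, l)) has_sum A n k * (B \<odot> C) k m) UNIV" by (simp add: f_def mult.assoc)
  qed
  then have 1: "(A \<odot> (B \<odot> C)) n m = S" unfolding mat_mult_def[of A] by (rule infsumI)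
  have S': "((\<lambda>(l, k). f (k, l)) has_sum S) (UNIV \<times> UNIV)"
    using S by (subst has_sum_swap) simp
  have "((\<lambda>l. (A \<odot> B) n l * C l m) has_sum S) UNIV"
  proof (rule has_sum_SigmaD[OF S'])
    fix l
    have "((\<lambda>k. A n k * B k l * C l m) has_sum (A \<odot> B) n l * C l m) UNIV"
      by (intro has_sum_cmult_left product_has_sum A B)
    then show "((\<lambda>k. case (l, k) of (l, k) \<Rightarrow> f (k, l)) has_sum (A \<odot> B) n l * C l m) UNIV" by (simp add: f_def)
  qed
  then have 2: "(A \<odot> B \<odot> C) n m = S" unfolding mat_mult_def[of _ C] by (rule infsumI)
  show "(A \<odot> B \<odot> C) n m = (A \<odot> (B \<odot> C)) n m" using 1 2 by simp
qed

lemma product_distrib: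
  fixes A B C :: "(nat, nat, 'a unitization) matrix"
  assumes A: "A \<in> Psi P" and B: "B \<in> Psi P" and C: "C \<in> Psi P"
  shows "A \<odot> (B \<boxplus> C) = (A \<odot> B) \<boxplus> (A \<odot> C)" "(B \<boxplus> C) \<odot> A = (B \<odot> A) \<boxplus> (C \<odot> A)"
proof -
  have "(A \<odot> (B \<boxplus> C)) n m = ((A \<odot> B) \<boxplus> (A \<odot> C)) n m" for n m
  proof -
    have "(A \<odot> (B \<boxplus> C)) n m = (\<Sum>\<^sub>\<infinity>j. A n j * B j m + A n j * C j m)"
      by (simp only: mat_mult_def mat_add_def distrib_left)
    also have "\<dots> = (A \<odot> B) n m + (A \<odot> C) n m"
      by (intro infsumI has_sum_add product_has_sum A B C)
    finally show ?thesis by (simp only: mat_add_def)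
  qed
  moreover have "((B \<boxplus> C) \<odot> A) n m = ((B \<odot> A) \<boxplus> (C \<odot> A)) n m" for n m
  proof -
    have "((B \<boxplus> C) \<odot> A) n m = (\<Sum>\<^sub>\<infinity>j. B n j * A j m + C n j * A j m)"
      by (simp only: mat_mult_def mat_add_def distrib_right)
    also have "\<dots> = (B \<odot> A) n m + (C \<odot> A) n m"
      by (intro infsumI has_sum_add product_has_sum A B C)
    finally show ?thesis by (simp only: mat_add_def)
  qed
  ultimately show "A \<odot> (B \<boxplus> C) = (A \<odot> B) \<boxplus> (A \<odot> C)" "(B \<boxplus> C) \<odot> A = (B \<odot> A) \<boxplus> (C \<odot> A)" by blast+
qed

lemma Psi_add:
  fixes A B :: "('i::spg, 'i, 'a unitization) matrix"
  assumes "A \<in> Psi P" "B \<in> Psi P" shows "A \<boxplus> B \<in> Psi P"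
  unfolding Psi_iff[OF Pp]
proof
  fix q assume q: "q \<in> seminorm_sums P"
  show "psd (\<lambda>n m. q ((A \<boxplus> B) n m))"
    by (rule psd_mono[OF psd_add[OF PsiD[OF assms(1) q] PsiD[OF assms(2) q]]])
       (simp add: mat_add_def seminorm_sums_props(4)[OF Pp q])
qed

lemma Psi_uminus:
  fixes A :: "('i::spg, 'i, 'a unitization) matrix"
  assumes "A \<in> Psi P" shows "(\<lambda>n m. - A n m) \<in> Psi P"
  using assms unfolding Psi_iff[OF Pp] by (simp add: seminorm_sums_props(3)[OF Pp])

lemma Kmat_add:
  fixes A B :: "('i::spg, 'i, 'a unitization) matrix"
  assumes "A \<in> Kmat P" "B \<in> Kmat P" shows "A \<boxplus> B \<in> Kmat P"
  unfolding Kmat_iff[OF Pp]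
proof (intro conjI allI ballI)
  show "scal ((A \<boxplus> B) n m) = 0" for n m using assms by (simp add: Kmat_iff[OF Pp] mat_add_def)
  fix q assume q: "q \<in> seminorm_sums P"
  have "rpd (\<lambda>n m. q (A n m))" "rpd (\<lambda>n m. q (B n m))" using assms q by (simp_all add: Kmat_iff[OF Pp])
  then show "rpd (\<lambda>n m. q ((A \<boxplus> B) n m))"
    by (rule rpd_mono[OF rpd_add]) (simp add: mat_add_def seminorm_sums_props(4)[OF Pp q])
qed

lemma Kmat_uminus:
  fixes A :: "('i::spg, 'i, 'a unitization) matrix"
  assumes "A \<in> Kmat P" shows "(\<lambda>n m. - A n m) \<in> Kmat P"
  using assms unfolding Kmat_iff[OF Pp] by (simp add: seminorm_sums_props(3)[OF Pp])

lemma Kmat_zero: "mat_zero \<in> Kmat P"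
  unfolding Kmat_iff[OF Pp] by (auto simp: mat_zero_def rpd_def seminorm_sums_props(2)[OF Pp])

section \<open>The Kronecker product\<close>

lemma kron_nat_prod_encode:
  "kron_nat A B (prod_encode (i, k)) (prod_encode (j, l)) = A i j * B k l"
  by (simp add: kron_nat_def kron_def)

lemma Psi_kron:
  assumes A: "A \<in> Psi P" and B: "B \<in> Psi P"
  shows "kron_nat A B \<in> Psi P"
  unfolding Psi_iff[OF Pp]
proof
  fix q assume q: "q \<in> seminorm_sums P"
  obtain r where r: "r \<in> seminorm_sums P" "\<And>x y. q (x * y) \<le> r x * r y" using sn_mult[OF q] by blast
  note nn = sn_nonneg[OF r(1)]
  show "psd (\<lambda>n m. q (kron_nat A B n m))"
    unfolding psd_def
  proof
    fix K
    \<comment> \<open>The exponent is doubled because the weight of an encoded pair is bounded by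
      the square of the product of the weights, up to a factor 2.\<close>
    obtain C l where C: "0 \<le> C" "\<And>n m. wt n ^ (2 * K) * r (A n m) \<le> C * wt m ^ l \<and> wt m ^ (2 * K) * r (A n m) \<le> C * wt n ^ l"
      using PsiD[OF A r(1)] unfolding psd_def by meson
    obtain D s where D: "0 \<le> D" "\<And>n m. wt n ^ (2 * K) * r (B n m) \<le> D * wt m ^ s \<and> wt m ^ (2 * K) * r (B n m) \<le> D * wt n ^ s"
      using PsiD[OF B r(1)] unfolding psd_def by meson
    have le: "wt (prod_encode (i, k)) ^ K * q z \<le> 2 ^ K * (C * D) * wt (prod_encode (j, l')) ^ (l + s)"
      if z: "q z \<le> a * b" "0 \<le> a" "0 \<le> b" and a: "wt i ^ (2 * K) * a \<le> C * wt j ^ l" and b: "wt k ^ (2 * K) * b \<le> D * wt l' ^ s"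
      for i k j l' :: nat and a b z
    proof -
      have "wt (prod_encode (i, k)) ^ K * q z \<le> (2 * (wt i * wt k) ^ 2) ^ K * (a * b)"
        by (intro mult_mono power_mono wt_prod_encode z wt_nonneg sn_nonneg[OF q]) (simp add: wt_power)
      also have "\<dots> = 2 ^ K * ((wt i ^ (2 * K) * a) * (wt k ^ (2 * K) * b))"
        by (simp add: power_mult_distrib flip: power_mult)
      also have "\<dots> \<le> 2 ^ K * ((C * wt j ^ l) * (D * wt l' ^ s))"
        using z C D by (intro mult_left_mono mult_mono a b mult_nonneg_nonneg wt_power) auto
      also have "\<dots> = 2 ^ K * (C * D) * (wt j ^ l * wt l' ^ s)" by simp
      also have "\<dots> \<le> 2 ^ K * (C * D) * (wt (prod_encode (j, l')) ^ l * wt (prod_encode (j, l')) ^ s)"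
        using C D by (intro mult_left_mono mult_mono power_mono wt_prod_encode wt_power wt_nonneg) auto
      finally show ?thesis by (simp add: power_add)
    qed
    show "\<exists>C l. 0 \<le> C \<and> (\<forall>n m. wt n ^ K * q (kron_nat A B n m) \<le> C * wt m ^ l \<and> wt m ^ K * q (kron_nat A B n m) \<le> C * wt n ^ l)"
    proof (intro exI[of _ "2 ^ K * (C * D)"] exI[of _ "l + s"] conjI allI)
      show "0 \<le> 2 ^ K * (C * D)" using C D by simp
      fix n m
      obtain i k j l' where nm: "n = prod_encode (i, k)" "m = prod_encode (j, l')"
        by (metis prod_decode_inverse surj_pair)
      show "wt n ^ K * q (kron_nat A B n m) \<le> 2 ^ K * (C * D) * wt m ^ (l + s)"
        unfolding nm kron_nat_prod_encode using C D by (intro le[OF r(2) nn nn]) auto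
      show "wt m ^ K * q (kron_nat A B n m) \<le> 2 ^ K * (C * D) * wt n ^ (l + s)"
        unfolding nm kron_nat_prod_encode using C D by (intro le[OF r(2) nn nn]) auto
    qed
  qed
qed

lemma Kmat_kron:
  assumes A: "A \<in> Kmat P" and B: "B \<in> Kmat P"
  shows "kron_nat A B \<in> Kmat P"
  unfolding Kmat_iff[OF Pp]
proof (intro conjI allI ballI)
  show "scal (kron_nat A B n m) = 0" for n m
    using A by (simp add: Kmat_iff[OF Pp] kron_nat_def kron_def split: prod.splits)
  fix q assume q: "q \<in> seminorm_sums P"
  obtain r where r: "r \<in> seminorm_sums P" "\<And>x y. q (x * y) \<le> r x * r y" using sn_mult[OF q] by blast
  note nn = sn_nonneg[OF r(1)]
  show "rpd (\<lambda>n m. q (kron_nat A B n m))"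
    unfolding rpd_def
  proof
    fix K
    obtain C where C: "\<And>n m. wt n ^ (2 * K) * wt m ^ (2 * K) * r (A n m) \<le> C"
      using A r unfolding Kmat_iff[OF Pp] rpd_def by meson
    obtain D where D: "\<And>n m. wt n ^ (2 * K) * wt m ^ (2 * K) * r (B n m) \<le> D"
      using B r unfolding Kmat_iff[OF Pp] rpd_def by meson
    have "0 \<le> C" by (rule order_trans[OF _ C[of 0 0]]) (intro mult_nonneg_nonneg wt_power nn)
    have "wt n ^ K * wt m ^ K * q (kron_nat A B n m) \<le> 4 ^ K * (C * D)" for n m
    proof -
      obtain i k j l' where nm: "n = prod_encode (i, k)" "m = prod_encode (j, l')"
        by (metis prod_decode_inverse surj_pair)
      have "wt n ^ K * wt m ^ K * q (kron_nat A B n m)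
          \<le> (2 * (wt i * wt k) ^ 2) ^ K * (2 * (wt j * wt l') ^ 2) ^ K * (r (A i j) * r (B k l'))"
        unfolding nm kron_nat_prod_encode
        by (intro mult_mono power_mono wt_prod_encode r wt_nonneg sn_nonneg[OF q] mult_nonneg_nonneg wt_power)
           (auto simp: wt_power)
      also have "\<dots> = 2 ^ K * 2 ^ K * ((wt i ^ (2 * K) * wt j ^ (2 * K) * r (A i j)) * (wt k ^ (2 * K) * wt l' ^ (2 * K) * r (B k l')))"
        by (simp add: power_mult_distrib flip: power_mult)
      also have "\<dots> \<le> 2 ^ K * 2 ^ K * (C * D)"
        by (intro mult_left_mono mult_mono C D mult_nonneg_nonneg nn wt_power \<open>0 \<le> C\<close>) auto
      finally show ?thesis by (simp flip: power_mult_distrib)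
    qed
    then show "\<exists>C. \<forall>n m. wt n ^ K * wt m ^ K * q (kron_nat A B n m) \<le> C" by blast
  qed
qed

text \<open>Membership of the Kronecker products in \<Psi> supplies the summability over encoded
  pairs; performing the sum in two stages separates the factors, the entries being
  commutative.\<close>

lemma kron_product:
  assumes A: "A \<in> Psi P" and B: "B \<in> Psi P" and C: "C \<in> Psi P" and D: "D \<in> Psi P"
  shows "kron_nat A B \<odot> kron_nat C D = kron_nat (A \<odot> C) (B \<odot> D)"
proof (intro ext)
  fix n m
  obtain i k j l where nm: "n = prod_encode (i, k)" "m = prod_encode (j, l)"
    by (metis prod_decode_inverse surj_pair)
  have "((\<lambda>x. kron_nat A B n x * kron_nat C D x m) has_sum (kron_nat A B \<odot> kron_nat C D) n m) (range prod_encode)"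
    using product_has_sum[OF Psi_kron[OF A B] Psi_kron[OF C D]] by (simp add: surj_prod_encode)
  then have S: "((\<lambda>(x, y). (A i x * C x j) * (B k y * D y l)) has_sum (kron_nat A B \<odot> kron_nat C D) n m) (UNIV \<times> UNIV)"
    by (subst (asm) has_sum_reindex[OF inj_prod_encode])
       (simp add: o_def nm kron_nat_prod_encode case_prod_beta' ac_simps, simp add: kron_nat_def kron_def case_prod_beta' ac_simps)
  have "((\<lambda>x. (A i x * C x j) * (B \<odot> D) k l) has_sum (kron_nat A B \<odot> kron_nat C D) n m) UNIV"
  proof (rule has_sum_SigmaD[OF S])
    fix x
    have "((\<lambda>y. (A i x * C x j) * (B k y * D y l)) has_sum (A i x * C x j) * (B \<odot> D) k l) UNIV"
      by (intro has_sum_cmult_right product_has_sum B D)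
    then show "((\<lambda>y. case (x, y) of (x, y) \<Rightarrow> (A i x * C x j) * (B k y * D y l)) has_sum (A i x * C x j) * (B \<odot> D) k l) UNIV"
      by simp
  qed
  moreover have "((\<lambda>x. (A i x * C x j) * (B \<odot> D) k l) has_sum (A \<odot> C) i j * (B \<odot> D) k l) UNIV"
    by (intro has_sum_cmult_left product_has_sum A C)
  ultimately show "(kron_nat A B \<odot> kron_nat C D) n m = kron_nat (A \<odot> C) (B \<odot> D) n m"
    unfolding nm kron_nat_prod_encode by (rule has_sum_unique)
qed

end

section \<open>Products with relabeling matrices\<close>

lemma infsum_single:
  assumes "\<And>k. k \<noteq> i \<Longrightarrow> f k = 0"
  shows "infsum f UNIV = (f i :: 'b::{comm_monoid_add, t2_space})"
proof -
  have "infsum f UNIV = infsum f {i}"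
    by (rule infsum_cong_neutral) (use assms in auto)
  then show ?thesis by simp
qed

abbreviation (input) transp :: "('i, 'j, 'r) matrix \<Rightarrow> ('j, 'i, 'r) matrix" where
  "transp A \<equiv> (\<lambda>i j. A j i)"

text \<open>By injectivity a row of a relabeling matrix has at most one nonzero entry, and the
  infinite sum collapses to a single term.\<close>

lemma relabel_matrix_mult_left:
  fixes A :: "('i, 'm, 'r::{comm_ring_1, t2_space}) matrix"
  assumes "inj_on r S"
  shows "(relabel_matrix S r \<odot> A) k m = (if k \<in> r ` S then A (inv_into S r k) m else 0)"
proof (cases "k \<in> r ` S")
  case True
  then obtain i where i: "i \<in> S" "k = r i" by blast
  have *: "relabel_matrix S r k i' * A i' m = 0" if "i' \<noteq> i" for i'
    using that i inj_onD[OF assms, of i' i] by (auto simp: relabel_matrix_def)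
  have "(relabel_matrix S r \<odot> A) k m = relabel_matrix S r k i * A i m"
    unfolding mat_mult_def using infsum_single[of i "\<lambda>i'. relabel_matrix S r k i' * A i' m"] * by blast
  then show ?thesis using i assms by (simp add: relabel_matrix_def)
next
  case False
  then have "relabel_matrix S r k i * A i m = 0" for i by (auto simp: relabel_matrix_def)
  then show ?thesis using False by (simp add: mat_mult_def)
qed

lemma relabel_matrix_transp_mult_left:
  fixes A :: "('j, 'm, 'r::{comm_ring_1, t2_space}) matrix"
  shows "(transp (relabel_matrix S r) \<odot> A) i m = (if i \<in> S then A (r i) m else 0)"
proof (cases "i \<in> S")
  case True
  have *: "relabel_matrix S r j i * A j m = 0" if "j \<noteq> r i" for j
    using that by (simp add: relabel_matrix_def)
  have "(transp (relabel_matrix S r) \<odot> A) i m = relabel_matrix S r (r i) i * A (r i) m"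
    unfolding mat_mult_def using infsum_single[of "r i" "\<lambda>j. relabel_matrix S r j i * A j m"] * by blast
  then show ?thesis using True by (simp add: relabel_matrix_def)
qed (simp add: mat_mult_def relabel_matrix_def)

lemma mult_transp:
  fixes A :: "('i, 'k, 'r::{comm_ring, t2_space}) matrix"
  shows "A \<odot> B = transp (transp B \<odot> transp A)"
  by (simp add: mat_mult_def mult.commute)

lemma relabel_matrix_mult_right:
  fixes A :: "('m, 'j, 'r::{comm_ring_1, t2_space}) matrix"
  shows "(A \<odot> relabel_matrix S r) m i = (if i \<in> S then A m (r i) else 0)"
  by (subst mult_transp) (simp add: relabel_matrix_transp_mult_left)

lemma relabel_matrix_transp_mult_right:
  fixes A :: "('m, 'i, 'r::{comm_ring_1, t2_space}) matrix"
  assumes "inj_on r S"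
  shows "(A \<odot> transp (relabel_matrix S r)) m k = (if k \<in> r ` S then A m (inv_into S r k) else 0)"
  by (subst mult_transp) (simp add: relabel_matrix_mult_left[OF assms])

abbreviation rmat :: "('i \<Rightarrow> 'j) \<Rightarrow> ('j, 'i, 'r::zero_neq_one) matrix" where
  "rmat r \<equiv> relabel_matrix UNIV r"

lemma relabel_conj:
  fixes A :: "('i, 'i, 'r::{comm_ring_1, t2_space}) matrix"
  assumes "inj r"
  shows "rmat r \<odot> A \<odot> transp (rmat r) = relabel r A"
proof (intro ext)
  fix k l
  have "inj_on r UNIV" using assms by simp
  then show "(rmat r \<odot> A \<odot> transp (rmat r)) k l = relabel r A k l"
    unfolding relabel_matrix_transp_mult_right[OF \<open>inj_on r UNIV\<close>] relabel_matrix_mult_left[OF \<open>inj_on r UNIV\<close>]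
    by (simp add: relabel_def)
qed

text \<open>Rows and columns are encoded as natural numbers.\<close>

definition cmat :: "('i::spg \<Rightarrow> 'j::spg) \<Rightarrow> (nat, nat, 'r::zero_neq_one) matrix" where
  "cmat r = relabel_matrix (range (code :: 'i \<Rightarrow> nat)) (\<lambda>n. code (r (inv code n)))"

lemma inv_code [simp]: "inv code (code x) = x"
  by (simp add: inj_code)

lemma code_eq_iff [simp]: "code x = code y \<longleftrightarrow> x = y"
  using inj_code by (auto dest: injD)

lemma inj_on_code:
  fixes r :: "'i::spg \<Rightarrow> 'j::spg"
  assumes "inj r" shows "inj_on (\<lambda>n. code (r (inv code n))) (range (code :: 'i \<Rightarrow> nat))"
  using assms by (auto simp: inj_on_def)

lemma cmat_nat: "cmat (r :: nat \<Rightarrow> nat) = rmat r"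
proof -
  have [simp]: "(code :: nat \<Rightarrow> nat) = id" by (simp add: code_nat_def)
  show ?thesis by (simp add: cmat_def)
qed

lemma cmat_comp:
  assumes "inj r"
  shows "cmat (r \<circ> s) = (cmat r \<odot> cmat s :: (nat, nat, 'r::{comm_ring_1, t2_space}) matrix)"
proof (intro ext)
  fix k i
  show "cmat (r \<circ> s) k i = (cmat r \<odot> cmat s :: (nat, nat, 'r) matrix) k i"
    unfolding cmat_def relabel_matrix_mult_right by (auto simp: relabel_matrix_def)
qed

lemma cmat_relabel:
  fixes A :: "('i::spg, 'i, 'r::{comm_ring_1, t2_space}) matrix" and r :: "'i \<Rightarrow> 'j::spg"
  assumes "inj r"
  shows "cmat r \<odot> relabel code A \<odot> transp (cmat r) = relabel (code \<circ> r) A"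
proof (intro ext)
  fix k l
  note i = inj_on_code[OF assms]
  have img: "(\<lambda>n. code (r (inv code n))) ` range (code :: 'i \<Rightarrow> nat) = range (code \<circ> r)"
    by (auto simp: image_image)
  have inv1: "inv_into (range (code :: 'i \<Rightarrow> nat)) (\<lambda>n. code (r (inv code n))) k = code (inv (code \<circ> r) k)" if "k \<in> range (code \<circ> r)" for k
  proof -
    from that obtain x where "k = (code \<circ> r) x" by (rule rangeE)
    then have x: "k = code (r x)" by simp
    have "inj (code \<circ> r)" by (rule inj_compose[OF inj_code assms])
    then have "inv (code \<circ> r) k = x" using inv_f_f[of "code \<circ> r" x] x by simp
    moreover have "inv_into (range (code :: 'i \<Rightarrow> nat)) (\<lambda>n. code (r (inv code n))) k = code x"
      using inv_into_f_f[OF i, of "code x"] x by simp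
    ultimately show ?thesis by simp
  qed
  show "(cmat r \<odot> relabel code A \<odot> transp (cmat r)) k l = relabel (code \<circ> r) A k l"
    unfolding cmat_def relabel_matrix_transp_mult_right[OF i] relabel_matrix_mult_left[OF i] img
    by (simp add: relabel_def inv1)
qed

lemma relabel_nat_comp:
  assumes "inj r" "inj s"
  shows "relabel r (relabel s A) = relabel (r \<circ> s) A"
proof (intro ext)
  fix k l
  have i: "inj (r \<circ> s)" using assms by (rule inj_compose)
  show "relabel r (relabel s A) k l = relabel (r \<circ> s) A k l"
  proof (cases "k \<in> range (r \<circ> s) \<and> l \<in> range (r \<circ> s)")
    case True
    then obtain x y where "k = r (s x)" "l = r (s y)" by auto
    then show ?thesis using assms inv_f_f[OF i, of x] inv_f_f[OF i, of y] by (simp add: relabel_def)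
  next
    case False
    then show ?thesis using assms by (auto simp: relabel_def)
  qed
qed

section \<open>Relabeling maps\<close>

lemma spg_on_cong: "spg_on \<Omega> S \<Longrightarrow> f \<in> S \<Longrightarrow> (\<And>x. x \<in> \<Omega> \<Longrightarrow> f' x = f x) \<Longrightarrow> f' \<in> S"
  unfolding spg_on_def by (auto split: if_splits)

lemma zero_poly_growth: "(\<lambda>_. 0) \<in> poly_growth"
  unfolding poly_growth_def by (auto intro!: exI[of _ 0])

lemma spg_on_zero: "spg_on \<Omega> S \<Longrightarrow> (\<And>x. x \<in> \<Omega> \<Longrightarrow> f x = 0) \<Longrightarrow> f \<in> S"
  unfolding spg_on_def using zero_poly_growth by (auto split: if_splits)

lemma spg_on_image:
  assumes S: "spg_on \<Omega> S" and c: "inj_on c \<Omega>"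
  shows "spg_on (c ` \<Omega>) {f. (\<lambda>x. f (c x)) \<in> S}"
proof (cases "finite \<Omega>")
  case True
  then show ?thesis using S by (simp add: spg_on_def)
next
  case False
  then obtain q where q: "bij_betw q \<Omega> (UNIV :: nat set)" "S = {f. \<exists>g\<in>poly_growth. \<forall>x\<in>\<Omega>. f x = g (q x)}"
    using S by (auto simp: spg_on_def)
  have "bij_betw (q \<circ> inv_into \<Omega> c) (c ` \<Omega>) UNIV"
    using bij_betw_trans[OF bij_betw_inv_into[OF inj_on_imp_bij_betw[OF c]] q(1)] .
  moreover have "{f. (\<lambda>x. f (c x)) \<in> S} = {f. \<exists>g\<in>poly_growth. \<forall>x\<in>c ` \<Omega>. f x = g ((q \<circ> inv_into \<Omega> c) x)}"
    using c by (simp add: q(2))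
  moreover have "infinite (c ` \<Omega>)" using False c by (simp add: finite_image_iff)
  ultimately show ?thesis unfolding spg_on_def by (simp only: if_False) blast
qed

lemma restrict_growth_code: "restrict_growth (range (code :: 'i \<Rightarrow> nat)) poly_growth = {f. (\<lambda>x::'i::spg. f (code x)) \<in> growth}"
  unfolding restrict_growth_def growth_code[where 'a = 'i] by auto

lemma spg_on_range_code:
  "spg_on (range (code :: 'i::spg \<Rightarrow> nat)) (restrict_growth (range (code :: 'i \<Rightarrow> nat)) poly_growth)"
  unfolding restrict_growth_code by (rule spg_on_image[OF spg_growth inj_code])

text \<open>Polynomial assembly admits relabeling matrices between subsets of the natural numbers,
  so the splitting of the target into range and complement is transported along
  \<open>code\<close>.\<close>

lemma relabeling_on_code:
  fixes r :: "'i::spg \<Rightarrow> 'j::spg"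
  assumes "relabeling r"
  shows "relabeling_on (range (code :: 'i \<Rightarrow> nat)) (restrict_growth (range (code :: 'i \<Rightarrow> nat)) poly_growth)
    (range (code :: 'j \<Rightarrow> nat)) (restrict_growth (range (code :: 'j \<Rightarrow> nat)) poly_growth) (\<lambda>n. code (r (inv code n)))"
proof -
  let ?r = "\<lambda>n. code (r (inv code n))"
  obtain S1 S2 where r: "inj r" and S: "spg_on (range r) S1" "spg_on (UNIV - range r) S2"
      "growth = S1 \<inter> S2" "growth = {f. \<exists>g\<in>S1. \<forall>x. f x = g (r x)}"
    using assms unfolding relabeling_def relabeling_on_def by auto
  have img: "?r ` range (code :: 'i \<Rightarrow> nat) = code ` range r" by (auto simp: image_image)
  have img2: "range (code :: 'j \<Rightarrow> nat) - code ` range r = code ` (UNIV - range r)"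
    using image_set_diff[OF inj_code, of UNIV "range r"] by simp
  have ic: "inj_on code X" for X :: "'j set" using inj_code by (rule inj_on_subset) simp
  show ?thesis
    unfolding relabeling_on_def
  proof (intro conjI exI)
    show "inj_on ?r (range (code :: 'i \<Rightarrow> nat))" by (rule inj_on_code[OF r])
    show "?r ` range (code :: 'i \<Rightarrow> nat) \<subseteq> range (code :: 'j \<Rightarrow> nat)" by auto
    show "spg_on (?r ` range (code :: 'i \<Rightarrow> nat)) {f. (\<lambda>x. f (code x)) \<in> S1}"
      unfolding img by (rule spg_on_image[OF S(1) ic])
    show "spg_on (range (code :: 'j \<Rightarrow> nat) - ?r ` range (code :: 'i \<Rightarrow> nat)) {f. (\<lambda>x. f (code x)) \<in> S2}"
      unfolding img img2 by (rule spg_on_image[OF S(2) ic])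
    show "restrict_growth (range (code :: 'j \<Rightarrow> nat)) poly_growth = {f. (\<lambda>x::'j. f (code x)) \<in> S1} \<inter> {f. (\<lambda>x::'j. f (code x)) \<in> S2}"
      unfolding restrict_growth_code S(3) by auto
    show "restrict_growth (range (code :: 'i \<Rightarrow> nat)) poly_growth
        = {f. \<exists>g\<in>{f. (\<lambda>x::'j. f (code x)) \<in> S1}. \<forall>x\<in>range (code :: 'i \<Rightarrow> nat). f x = g (?r x)}"
      unfolding restrict_growth_code S(4)
    proof (intro set_eqI iffI)
      fix f assume "f \<in> {f. (\<lambda>x::'i. f (code x)) \<in> {f. \<exists>g\<in>S1. \<forall>x. f x = g (r x)}}"
      then obtain g where g: "g \<in> S1" "\<And>x::'i. f (code x) = g (r x)" by auto
      have "(\<lambda>n. g (inv code n)) \<in> {f. (\<lambda>x::'j. f (code x)) \<in> S1}" using g(1) by simp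
      moreover have "\<forall>x\<in>range (code :: 'i \<Rightarrow> nat). f x = (\<lambda>n. g (inv code n)) (?r x)" using g(2) by simp
      ultimately show "f \<in> {f. \<exists>g\<in>{f. (\<lambda>x::'j. f (code x)) \<in> S1}. \<forall>x\<in>range (code :: 'i \<Rightarrow> nat). f x = g (?r x)}"
        using g by (intro CollectI bexI[of _ "\<lambda>n. g (inv code n)"]) simp_all
    qed auto
  qed
qed

definition tame :: "('i::spg \<Rightarrow> 'j::spg) \<Rightarrow> bool" where
  "tame r \<longleftrightarrow> inj r \<and> (\<exists>D m. 0 \<le> D \<and> (\<forall>x. wt (r x) \<le> D * wt x ^ m \<and> wt x \<le> D * wt (r x) ^ m))"

lemma tame_inj: "tame r \<Longrightarrow> inj r" by (simp add: tame_def)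

lemma tameI:
  assumes "inj r" "\<And>x. wt (r x) \<le> D * wt x ^ m" "\<And>x. wt x \<le> E * wt (r x) ^ n" "0 \<le> D" "0 \<le> E"
  shows "tame r"
  unfolding tame_def
proof (intro conjI exI[of _ "D + E"] exI[of _ "m + n"] allI)
  fix x
  have "D * wt x ^ m \<le> (D + E) * wt x ^ (m + n)" "E * wt (r x) ^ n \<le> (D + E) * wt (r x) ^ (m + n)"
    using assms(4,5) by (intro mult_mono wt_mono; simp add: wt_power)+
  then show "wt (r x) \<le> (D + E) * wt x ^ (m + n)" "wt x \<le> (D + E) * wt (r x) ^ (m + n)"
    using assms(2,3)[of x] by linarith+
qed (use assms in auto)

lemma tame_comp:
  assumes "tame r" "tame s" shows "tame (r \<circ> s)"
proof -
  obtain D m where D: "0 \<le> D" "\<And>x. wt (r x) \<le> D * wt x ^ m" "\<And>x. wt x \<le> D * wt (r x) ^ m"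
    using assms(1) unfolding tame_def by blast
  obtain E n where E: "0 \<le> E" "\<And>x. wt (s x) \<le> E * wt x ^ n" "\<And>x. wt x \<le> E * wt (s x) ^ n"
    using assms(2) unfolding tame_def by blast
  show ?thesis
  proof (rule tameI)
    show "inj (r \<circ> s)" using assms by (simp add: inj_compose tame_inj)
    fix x
    have "wt ((r \<circ> s) x) \<le> D * wt (s x) ^ m" using D(2)[of "s x"] by simp
    also have "\<dots> \<le> D * (E * wt x ^ n) ^ m" by (intro mult_left_mono power_mono E D wt_nonneg)
    also have "\<dots> = (D * E ^ m) * wt x ^ (n * m)" by (simp add: power_mult_distrib power_mult)
    finally show "wt ((r \<circ> s) x) \<le> (D * E ^ m) * wt x ^ (n * m)" .
    have "wt x \<le> E * wt (s x) ^ n" by (rule E)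
    also have "\<dots> \<le> E * (D * wt (r (s x)) ^ m) ^ n" by (intro mult_left_mono power_mono E D wt_nonneg)
    also have "\<dots> = (E * D ^ n) * wt ((r \<circ> s) x) ^ (m * n)" by (simp add: power_mult_distrib power_mult)
    finally show "wt x \<le> (E * D ^ n) * wt ((r \<circ> s) x) ^ (m * n)" .
  qed (use D E in auto)
qed

lemma tame_inv: assumes "tame r" "bij r" shows "tame (inv r)"
proof -
  obtain D m where D: "0 \<le> D" "\<And>x. wt (r x) \<le> D * wt x ^ m" "\<And>x. wt x \<le> D * wt (r x) ^ m"
    using assms(1) unfolding tame_def by blast
  have "r (inv r y) = y" for y using assms(2) by (simp add: bij_is_surj surj_f_inv_f)
  then show ?thesis using D(2,3)[of "inv r _"] D(1) bij_imp_bij_inv[OF assms(2)]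
    by (intro tameI[of _ D m D m]) (auto simp: bij_is_inj)
qed

lemma wt_growth: "(wt :: 'a::spg \<Rightarrow> real) \<in> growth"
  unfolding growth_iff by (intro exI[of _ 1] exI[of _ 1]) (simp add: wt_nonneg)

text \<open>One bound comes from pulling the weight of the target back to the source. The other
  comes from pushing the weight of the source forward to the range.\<close>

lemma relabeling_tame:
  fixes r :: "'i::spg \<Rightarrow> 'j::spg"
  assumes "relabeling r" shows "tame r"
proof -
  obtain S1 S2 where r: "inj r" and S: "spg_on (range r) S1" "spg_on (UNIV - range r) S2"
      "growth = S1 \<inter> S2" "growth = {f. \<exists>g\<in>S1. \<forall>x. f x = g (r x)}"
    using assms unfolding relabeling_def relabeling_on_def by auto
  obtain g where g: "g \<in> S1" "\<And>x::'i. wt x = g (r x)" using wt_growth[where 'a = 'i] unfolding S(4) by auto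
  \<comment> \<open>Extension by zero lies in both parts of the splitting of the target, hence has
    polynomial growth there.\<close>
  have "(\<lambda>y. if y \<in> range r then g y else 0) \<in> growth"
    unfolding S(3) by (intro IntI spg_on_cong[OF S(1) g(1)] spg_on_zero[OF S(2)]) auto
  then obtain D m where D: "0 \<le> D" "\<And>y. \<bar>if y \<in> range r then g y else 0\<bar> \<le> D * wt y ^ m"
    unfolding growth_iff by blast
  have "wt \<in> S1" using wt_growth[where 'a = 'j] unfolding S(3) by blast
  then have "(\<lambda>x. wt (r x)) \<in> growth" unfolding S(4) by auto
  then obtain E n where E: "0 \<le> E" "\<And>x. \<bar>wt (r x)\<bar> \<le> E * wt x ^ n"
    unfolding growth_iff by blast
  show ?thesis
  proof (rule tameI[OF r])
    show "wt (r x) \<le> E * wt x ^ n" for x using E(2)[of x] by simp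
    show "wt x \<le> D * wt (r x) ^ m" for x using D(2)[of "r x"] g(2)[of x] by (simp add: wt_nonneg)
  qed (use D E in auto)
qed

lemma tame_growth_iff:
  assumes "tame r" "bij r" shows "f \<in> growth \<longleftrightarrow> (\<lambda>y. f (inv r y)) \<in> growth"
proof -
  have *: "(\<lambda>x. f (s x)) \<in> growth" if s: "tame s" and f: "f \<in> growth"
    for s :: "'k::spg \<Rightarrow> 'l::spg" and f
  proof -
    obtain D m where D: "0 \<le> D" "\<And>x. wt (s x) \<le> D * wt x ^ m"
      using s unfolding tame_def by blast
    obtain C k where C: "0 \<le> C" "\<And>x. \<bar>f x\<bar> \<le> C * wt x ^ k" using f unfolding growth_iff by blast
    have "\<bar>f (s x)\<bar> \<le> (C * D ^ k) * wt x ^ (m * k)" for x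
    proof -
      have "\<bar>f (s x)\<bar> \<le> C * wt (s x) ^ k" by (rule C)
      also have "\<dots> \<le> C * (D * wt x ^ m) ^ k" by (intro mult_left_mono power_mono C D wt_nonneg)
      finally show ?thesis by (simp add: power_mult_distrib power_mult)
    qed
    then show ?thesis unfolding growth_iff using C D by (intro exI[of _ "C * D ^ k"] exI[of _ "m * k"]) auto
  qed
  have "inv r (r x) = x" for x using assms(2) by (simp add: bij_is_inj)
  then show ?thesis using *[OF assms(1), of "\<lambda>y. f (inv r y)"] *[OF tame_inv[OF assms], of f] by auto
qed

text \<open>The complement of the range is empty, and as a finite set it carries all functions; only
  the two weights have to be compared.\<close>

lemma relabeling_bij: assumes "tame r" "bij r" shows "relabeling r"
  unfolding relabeling_def relabeling_on_def
proof (intro conjI exI)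
  have rng: "range r = UNIV" using assms(2) by (simp add: bij_is_surj)
  show "inj r" "range r \<subseteq> UNIV" using assms(2) by (auto simp: bij_is_inj)
  show "spg_on (range r) growth" unfolding rng by (rule spg_growth)
  show "spg_on (UNIV - range r) UNIV" unfolding rng by (simp add: spg_on_def)
  show "growth = growth \<inter> UNIV" by simp
  show "growth = {f. \<exists>g\<in>growth. \<forall>x\<in>UNIV. f x = g (r x)}"
  proof (intro set_eqI iffI)
    have i: "inv r (r x) = x" for x using assms(2) by (simp add: bij_is_inj)
    fix f :: "'a \<Rightarrow> real"
    {
      assume "f \<in> growth"
      then show "f \<in> {f. \<exists>g\<in>growth. \<forall>x\<in>UNIV. f x = g (r x)}"
        using tame_growth_iff[OF assms, of f] i by (intro CollectI bexI[of _ "\<lambda>y. f (inv r y)"]) auto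
    next
      assume "f \<in> {f. \<exists>g\<in>growth. \<forall>x\<in>UNIV. f x = g (r x)}"
      then obtain g where g: "g \<in> growth" "\<And>x. f x = g (r x)" by auto
      have "r (inv r y) = y" for y using assms(2) by (simp add: bij_is_surj surj_f_inv_f)
      then show "f \<in> growth" using g tame_growth_iff[OF assms, of f] by simp
    }
  qed
qed

lemma relabeling_Inl: "relabeling (Inl :: 'i::spg \<Rightarrow> 'i + 'j::spg)"
  unfolding relabeling_def relabeling_on_def
proof (intro conjI exI)
  have rng: "UNIV - range (Inl :: 'i \<Rightarrow> 'i + 'j) = range Inr"
    by (auto simp: image_iff) (metis sum.exhaust)
  show "inj (Inl :: 'i \<Rightarrow> 'i + 'j)" "range (Inl :: 'i \<Rightarrow> 'i + 'j) \<subseteq> UNIV" by auto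
  show "spg_on (range Inl) {f :: 'i + 'j \<Rightarrow> real. (\<lambda>x. f (Inl x)) \<in> growth}"
    by (rule spg_on_image[OF spg_growth]) simp
  show "spg_on (UNIV - range Inl) {f :: 'i + 'j \<Rightarrow> real. (\<lambda>x. f (Inr x)) \<in> growth}"
    unfolding rng by (rule spg_on_image[OF spg_growth]) simp
  show "growth = {f :: 'i + 'j \<Rightarrow> real. (\<lambda>x. f (Inl x)) \<in> growth} \<inter> {f. (\<lambda>x. f (Inr x)) \<in> growth}"
    by (auto simp: growth_sum_def o_def)
  show "growth = {f. \<exists>g\<in>{f :: 'i + 'j \<Rightarrow> real. (\<lambda>x. f (Inl x)) \<in> growth}. \<forall>x\<in>UNIV. f x = g (Inl x)}"
  proof (intro set_eqI iffI)
    fix f :: "'i \<Rightarrow> real" assume "f \<in> growth"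
    then show "f \<in> {f. \<exists>g\<in>{f :: 'i + 'j \<Rightarrow> real. (\<lambda>x. f (Inl x)) \<in> growth}. \<forall>x\<in>UNIV. f x = g (Inl x)}"
      by (intro CollectI bexI[of _ "case_sum f (\<lambda>_. 0)"]) auto
  qed (auto simp: fun_eq_iff[symmetric])
qed

lemma bij_tame_sum_swap:
  "bij (case_sum Inr Inl :: 'i::spg + 'j::spg \<Rightarrow> 'j + 'i)" "tame (case_sum Inr Inl :: 'i + 'j \<Rightarrow> 'j + 'i)"
proof -
  show b: "bij (case_sum Inr Inl :: 'i + 'j \<Rightarrow> 'j + 'i)"
    by (rule o_bij[of "case_sum Inr Inl"]) (auto simp: fun_eq_iff split: sum.splits)
  have le: "wt (case_sum Inr Inl z :: 'j + 'i) \<le> 2 * wt z ^ 1" for z :: "'i + 'j"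
    by (cases z) (simp_all add: wt_def code_sum_def sum_encode_def)
  have le': "wt (z :: 'i + 'j) \<le> 2 * wt (case_sum Inr Inl z :: 'j + 'i) ^ 1" for z :: "'i + 'j"
    by (cases z) (simp_all add: wt_def code_sum_def sum_encode_def)
  show "tame (case_sum Inr Inl :: 'i + 'j \<Rightarrow> 'j + 'i)"
    by (rule tameI[OF bij_is_inj[OF b] le le']) auto
qed

section \<open>Assembly of relabeling matrices\<close>

definition assembled_map :: "('x \<Rightarrow> (nat, nat, 'r::{comm_ring_1, t2_space}) matrix) set \<Rightarrow> ('i::spg \<Rightarrow> 'j::spg) \<Rightarrow> bool" where
  "assembled_map Dt r \<longleftrightarrow> (\<lambda>_. cmat r) \<in> assembled_nat Dt \<and> (\<lambda>_. transp (cmat r)) \<in> assembled_nat Dt"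

lemma assembled_map_relabeling:
  fixes r :: "'i::spg \<Rightarrow> 'j::spg"
  assumes "relabeling r"
  shows "assembled_map Dt r"
  unfolding assembled_map_def cmat_def
  using assembled_nat.relab[OF spg_on_range_code spg_on_range_code relabeling_on_code[OF assms]]
    assembled_nat.relab_transpose[OF spg_on_range_code spg_on_range_code relabeling_on_code[OF assms]]
  by blast

lemma assembled_map_comp:
  fixes Dt :: "('x \<Rightarrow> (nat, nat, 'r::{comm_ring_1, t2_space}) matrix) set"
  assumes "inj r" "assembled_map Dt r" "assembled_map Dt s"
  shows "assembled_map Dt (r \<circ> s)"
proof -
  have "transp (cmat r \<odot> cmat s) = transp (cmat s) \<odot> (transp (cmat r) :: (nat, nat, 'r) matrix)"
    by (simp add: mat_mult_def mult.commute)
  then show ?thesis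
    using assms(2,3) assembled_nat.mult[of "\<lambda>_. cmat r" Dt "\<lambda>_. cmat s"]
      assembled_nat.mult[of "\<lambda>_. transp (cmat s)" Dt "\<lambda>_. transp (cmat r)"]
    unfolding assembled_map_def cmat_comp[OF assms(1)] by simp
qed

section \<open>The ring of families of matrices\<close>

text \<open>
  The matrices of pseudodifferential size form a ring for each family of seminorms.  To make this a
  type, an element of the following type provides such a matrix for all complete families at once,
  and depends on a further parameter.
\<close>

typedef (overloaded) ('z, 'a::"{comm_ring, topological_ab_group_add, topological_semigroup_mult, t2_space}") psi =
  "{F :: ('a \<Rightarrow> real) set \<Rightarrow> 'z \<Rightarrow> (nat, nat, 'a unitization) matrix.
     \<forall>P z. if complete_polymetric P then F P z \<in> Psi P else F P z = mat_zero}"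
  morphisms mat Abs_psi
proof
  show "(\<lambda>_ _. mat_zero) \<in> {F :: ('a \<Rightarrow> real) set \<Rightarrow> 'z \<Rightarrow> (nat, nat, 'a unitization) matrix.
     \<forall>P z. if complete_polymetric P then F P z \<in> Psi P else F P z = mat_zero}"
    using cpm.Kmat_Psi[OF cpm.intro cpm.Kmat_zero[OF cpm.intro]] by auto
qed

lemma mat_Psi: "complete_polymetric P \<Longrightarrow> mat F P z \<in> Psi P"
  using mat[of F] by auto

lemma mat_bad: "\<not> complete_polymetric P \<Longrightarrow> mat F P z = mat_zero"
  using mat[of F] by auto

text \<open>The prescribed value \<open>mat_zero\<close> at families that are not complete is what
  reduces equality to the complete ones.\<close>

lemma psi_eqI:
  assumes "\<And>P z. complete_polymetric P \<Longrightarrow> mat F P z = mat G P z" shows "F = G"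
  unfolding mat_inject[symmetric] using assms mat_bad by (metis ext)

definition mk_psi :: "(('a::{comm_ring, topological_ab_group_add, topological_semigroup_mult, t2_space} \<Rightarrow> real) set \<Rightarrow> 'z \<Rightarrow> (nat, nat, 'a unitization) matrix) \<Rightarrow> ('z, 'a) psi" where
  "mk_psi f = Abs_psi (\<lambda>P z. if complete_polymetric P then f P z else mat_zero)"

lemma mat_mk_psi:
  assumes "\<And>P z. complete_polymetric P \<Longrightarrow> f P z \<in> Psi P"
  shows "mat (mk_psi f) P z = (if complete_polymetric P then f P z else mat_zero)"
  unfolding mk_psi_def by (subst Abs_psi_inverse) (use assms in auto)

lemma mat_one_Psi: "complete_polymetric P \<Longrightarrow> (mat_one :: ('i::spg, 'i, 'a::{comm_ring, topological_space} unitization) matrix) \<in> Psi P"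
proof -
  assume "complete_polymetric P"
  then have P: "polymetric P" by (simp add: complete_polymetric_def)
  show ?thesis
    unfolding Psi_iff[OF P]
  proof
    fix q assume q: "q \<in> seminorm_sums P"
    note q' = seminorm_sums_props(1,2)[OF P q]
    show "psd (\<lambda>(n :: 'i) m. q (mat_one n m :: 'a unitization))"
      unfolding psd_def
    proof (intro allI exI conjI)
      fix k and n m :: 'i
      show "wt n ^ k * q (mat_one n m) \<le> q 1 * wt m ^ k" "wt m ^ k * q (mat_one n m) \<le> q 1 * wt n ^ k"
        using q' by (auto simp: mat_one_def wt_power mult.commute)
    qed (rule q')
  qed
qed

lemma mat_one_mult [simp]:
  fixes A :: "('i, 'j, 'r::{comm_ring_1, t2_space}) matrix"
  shows "mat_one \<odot> A = A" "B \<odot> mat_one = (B :: ('j, 'i, 'r) matrix)"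
proof -
  have one: "mat_one = rmat (\<lambda>x. x)" by (auto simp: mat_one_def relabel_matrix_def fun_eq_iff)
  have i: "inj_on (\<lambda>x. x) UNIV" by simp
  show "mat_one \<odot> A = A"
    unfolding one by (intro ext) (simp add: relabel_matrix_mult_left[OF i])
  show "B \<odot> mat_one = B"
    unfolding one by (intro ext) (simp add: relabel_matrix_mult_right)
qed

instantiation psi :: (type, "{comm_ring, topological_ab_group_add, topological_semigroup_mult, t2_space}") ring
begin
definition "0 = mk_psi (\<lambda>_ _. mat_zero)"
definition "F + G = mk_psi (\<lambda>P z. mat F P z \<boxplus> mat G P z)"
definition "- F = mk_psi (\<lambda>P z n m. - mat F P z n m)"
definition "F - G = mk_psi (\<lambda>P z. mat F P z \<boxplus> (\<lambda>n m. - mat G P z n m))"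
definition "F * G = mk_psi (\<lambda>P z. mat F P z \<odot> mat G P z)"

lemma mat_ops:
  fixes F G :: "('a, 'b) psi"
  assumes P: "complete_polymetric P"
  shows "mat (0 :: ('a, 'b) psi) P z = mat_zero"
    "mat (F + G) P z = mat F P z \<boxplus> mat G P z"
    "mat (- F) P z = (\<lambda>n m. - mat F P z n m)"
    "mat (F - G) P z = (\<lambda>n m. mat F P z n m - mat G P z n m)"
    "mat (F * G) P z = mat F P z \<odot> mat G P z"
proof -
  note c = cpm.intro
  show "mat (0 :: ('a, 'b) psi) P z = mat_zero"
    unfolding zero_psi_def by (simp add: mat_mk_psi cpm.Kmat_Psi[OF c cpm.Kmat_zero[OF c]])
  show "mat (F + G) P z = mat F P z \<boxplus> mat G P z"
    unfolding plus_psi_def using P by (simp add: mat_mk_psi cpm.Psi_add[OF c] mat_Psi)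
  show "mat (- F) P z = (\<lambda>n m. - mat F P z n m)"
    unfolding uminus_psi_def using P by (simp add: mat_mk_psi cpm.Psi_uminus[OF c] mat_Psi)
  show "mat (F - G) P z = (\<lambda>n m. mat F P z n m - mat G P z n m)"
  proof -
    have "mat (F - G) P z = mat F P z \<boxplus> (\<lambda>n m. - mat G P z n m)"
      unfolding minus_psi_def using P by (simp add: mat_mk_psi cpm.Psi_uminus[OF c] cpm.Psi_add[OF c] mat_Psi)
    then show ?thesis by (simp add: mat_add_def)
  qed
  show "mat (F * G) P z = mat F P z \<odot> mat G P z"
    unfolding times_psi_def using P by (simp add: mat_mk_psi cpm.Psi_mult[OF c] mat_Psi)
qed

instance
proof
  fix F G H :: "('a, 'b) psi"
  note simps = mat_ops mat_add_def mat_zero_def fun_eq_iff algebra_simps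
  show "F + G + H = F + (G + H)" "F + G = G + F" "0 + F = F" "- F + F = 0" "F - G = F + - G"
    by (rule psi_eqI; simp add: simps)+
  show "F * G * H = F * (G * H)"
    by (rule psi_eqI) (simp add: mat_ops cpm.product_assoc[OF cpm.intro] mat_Psi)
  show "(F + G) * H = F * H + G * H" "F * (G + H) = F * G + F * H"
    by (rule psi_eqI; simp add: mat_ops cpm.product_distrib[OF cpm.intro] mat_Psi)+
qed
end

text \<open>The class is \<open>monoid_mult\<close> and not \<open>ring_1\<close>: if
  \<open>'a\<close> has no complete family of seminorms, the type has a single element and
  \<open>0 = 1\<close>. The abstract part is set up for the sort \<open>{ring, monoid_mult}\<close>
  accordingly.\<close>

instantiation psi :: (type, "{comm_ring, topological_ab_group_add, topological_semigroup_mult, t2_space}") monoid_mult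
begin
definition "1 = mk_psi (\<lambda>_ _. mat_one)"

lemma mat_psi_one: "complete_polymetric P \<Longrightarrow> mat (1 :: ('a, 'b) psi) P z = mat_one"
  unfolding one_psi_def by (simp add: mat_mk_psi mat_one_Psi)

instance
  by standard (rule psi_eqI; simp add: mat_ops mat_psi_one)+
end

definition tensor_psi :: "('z, 'a) psi \<Rightarrow> ('z, 'a::{comm_ring, topological_ab_group_add, topological_semigroup_mult, t2_space}) psi \<Rightarrow> ('z, 'a) psi" where
  "tensor_psi F G = mk_psi (\<lambda>P z. kron_nat (mat F P z) (mat G P z))"

lemma mat_tensor: "complete_polymetric P \<Longrightarrow> mat (tensor_psi F G) P z = kron_nat (mat F P z) (mat G P z)"
  unfolding tensor_psi_def by (simp add: mat_mk_psi cpm.Psi_kron[OF cpm.intro] mat_Psi)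

definition const_psi :: "(nat, nat, 'a unitization) matrix \<Rightarrow> ('z, 'a::{comm_ring, topological_ab_group_add, topological_semigroup_mult, t2_space}) psi" where
  "const_psi M = mk_psi (\<lambda>_ _. M)"

lemma cmat_Psi:
  fixes r :: "'i::spg \<Rightarrow> 'j::spg" and P :: "('a::{comm_ring, topological_space} \<Rightarrow> real) set"
  assumes r: "tame r" and P: "complete_polymetric P"
  shows "(cmat r :: (nat, nat, 'a unitization) matrix) \<in> Psi P" "transp (cmat r :: (nat, nat, 'a unitization) matrix) \<in> Psi P"
proof -
  have P': "polymetric P" using P by (simp add: complete_polymetric_def)
  obtain D m where D: "0 \<le> D" "\<And>x. wt (r x) \<le> D * wt x ^ m" "\<And>x. wt x \<le> D * wt (r x) ^ m"
    using r unfolding tame_def by blast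
  have wc: "wt (code x) = wt x" for x :: "'k::spg" by (simp add: wt_def code_nat_def)
  have *: "psd (\<lambda>n k. q (cmat r n k :: 'a unitization))" if q: "q \<in> seminorm_sums P" for q
    unfolding psd_def
  proof (intro allI exI conjI)
    note q' = seminorm_sums_props(1,2)[OF P' q]
    fix K and n k :: nat
    show "0 \<le> D ^ K * q 1" using D q' by simp
    have "wt n ^ K * q (cmat r n k) \<le> D ^ K * q 1 * wt k ^ (m * K) \<and> wt k ^ K * q (cmat r n k) \<le> D ^ K * q 1 * wt n ^ (m * K)"
    proof (cases "\<exists>x. k = code (x :: 'i) \<and> n = code (r x)")
      case True
      then obtain x where x: "k = code x" "n = code (r x)" by blast
      have e: "(D * y ^ m) ^ K = D ^ K * y ^ (m * K)" for y :: real
        by (simp add: power_mult_distrib flip: power_mult)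
      have "wt n ^ K \<le> (D * wt k ^ m) ^ K" "wt k ^ K \<le> (D * wt n ^ m) ^ K"
        unfolding x wc by (intro power_mono D wt_nonneg)+
      from this[unfolded e, THEN mult_right_mono[OF _ q'(1)[of 1]]]
      have "wt n ^ K * q 1 \<le> D ^ K * q 1 * wt k ^ (m * K)" "wt k ^ K * q 1 \<le> D ^ K * q 1 * wt n ^ (m * K)"
        by (simp_all only: ac_simps)
      moreover have "cmat r n k = (1 :: 'a unitization)" by (simp add: cmat_def relabel_matrix_def x)
      ultimately show ?thesis by simp
    next
      case False
      then have "cmat r n k = (0 :: 'a unitization)" by (auto simp: cmat_def relabel_matrix_def)
      then show ?thesis using D q' by (simp add: wt_power)
    qed
    then show "wt n ^ K * q (cmat r n k) \<le> D ^ K * q 1 * wt k ^ (m * K)" "wt k ^ K * q (cmat r n k) \<le> D ^ K * q 1 * wt n ^ (m * K)"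
      by auto
  qed
  then show "(cmat r :: (nat, nat, 'a unitization) matrix) \<in> Psi P" "transp (cmat r :: (nat, nat, 'a unitization) matrix) \<in> Psi P"
    unfolding Psi_iff[OF P'] by (auto intro: psd_transpose[THEN iffD2])
qed

definition rel :: "('i::spg \<Rightarrow> 'j::spg) \<Rightarrow> ('z, 'a::{comm_ring, topological_ab_group_add, topological_semigroup_mult, t2_space}) psi" where
  "rel r = const_psi (cmat r)"

definition rel' :: "('i::spg \<Rightarrow> 'j::spg) \<Rightarrow> ('z, 'a::{comm_ring, topological_ab_group_add, topological_semigroup_mult, t2_space}) psi" where
  "rel' r = const_psi (transp (cmat r))"

lemma mat_rel:
  assumes "tame r" "complete_polymetric P"
  shows "mat (rel r) P z = cmat r" "mat (rel' r) P z = transp (cmat r)"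
  using assms unfolding rel_def rel'_def const_psi_def
  by (subst mat_mk_psi; simp add: cmat_Psi)+

lemma cmat_transp_mult:
  fixes r s :: "'i::spg \<Rightarrow> 'j::spg"
  shows "(transp (cmat r) \<odot> cmat s :: (nat, nat, 'r::{comm_ring_1, t2_space}) matrix) n m =
    (if \<exists>x y. n = code x \<and> m = code y \<and> r x = s y then 1 else 0)"
proof -
  have "(transp (cmat r) \<odot> cmat s :: (nat, nat, 'r) matrix) n m
      = (if n \<in> range (code :: 'i \<Rightarrow> nat) then cmat s (code (r (inv code n))) m else 0)"
    unfolding cmat_def[of r] by (rule relabel_matrix_transp_mult_left)
  then show ?thesis by (auto simp: cmat_def relabel_matrix_def)
qed

text \<open>The source is \<open>nat\<close>, which \<open>code\<close> maps onto all indices. For a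
  smaller source the product would be the projection to the range of \<open>code\<close>.\<close>

lemma rel'_rel:
  fixes r :: "nat \<Rightarrow> 'j::spg"
  assumes "tame r" shows "rel' r * rel r = (1 :: ('z, 'a::{comm_ring, topological_ab_group_add, topological_semigroup_mult, t2_space}) psi)"
proof (rule psi_eqI)
  fix P :: "('a \<Rightarrow> real) set" and z :: 'z
  assume P: "complete_polymetric P"
  have inj: "r x = r y \<longleftrightarrow> x = y" for x y using tame_inj[OF assms] by (auto dest: injD)
  show "mat (rel' r * rel r) P z = mat 1 P z"
    by (simp add: mat_ops mat_rel mat_psi_one P assms cmat_transp_mult inj)
       (auto simp: mat_one_def cmat_transp_mult inj code_nat_def fun_eq_iff)
qed

lemma rel'_rel_disjoint:
  fixes r s :: "'i::spg \<Rightarrow> 'j::spg"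
  assumes "tame r" "tame s" "\<And>x y. r x \<noteq> s y"
  shows "rel' r * rel s = (0 :: ('z, 'a::{comm_ring, topological_ab_group_add, topological_semigroup_mult, t2_space}) psi)"
  by (rule psi_eqI) (auto simp: mat_ops mat_rel assms cmat_transp_mult mat_zero_def fun_eq_iff)

lemma rel_rel'_bij:
  fixes r :: "nat \<Rightarrow> nat"
  assumes "tame r" "bij r" shows "rel r * rel' r = (1 :: ('z, 'a::{comm_ring, topological_ab_group_add, topological_semigroup_mult, t2_space}) psi)"
proof (rule psi_eqI)
  fix P :: "('a \<Rightarrow> real) set" and z :: 'z
  assume P: "complete_polymetric P"
  have i: "inj r" "range r = UNIV" using assms(2) by (auto simp: bij_def)
  have "(cmat r \<odot> transp (cmat r) :: (nat, nat, 'a unitization) matrix) = mat_one"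
    unfolding cmat_nat
    by (intro ext, subst relabel_matrix_transp_mult_right[OF i(1)])
       (auto simp: relabel_matrix_def mat_one_def i surj_f_inv_f)
  then show "mat (rel r * rel' r) P z = mat 1 P z"
    by (simp add: mat_ops mat_rel mat_psi_one P assms)
qed

section \<open>Index maps\<close>

lemma wt_pair:
  "wt (x, y) \<le> 2 * (wt x * wt y) ^ 2" "wt x \<le> wt (x, y)" "wt y \<le> wt (x, y)"
proof -
  have *: "wt (x, y) = wt (prod_encode (code x, code y))" "wt (code x) = wt x" "wt (code y) = wt y"
    by (simp_all add: wt_def code_prod_def code_nat_def)
  show "wt (x, y) \<le> 2 * (wt x * wt y) ^ 2" "wt x \<le> wt (x, y)" "wt y \<le> wt (x, y)"
    using wt_prod_encode[where m = "code x" and n = "code y"] unfolding * by auto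
qed

lemma wt_pair_le:
  assumes "wt x \<le> E * W ^ m" "wt y \<le> E * W ^ m" "0 \<le> E" "1 \<le> W"
  shows "wt (x, y) \<le> 2 * E ^ 4 * W ^ (4 * m)"
proof -
  have "wt x * wt y \<le> (E * W ^ m) * (E * W ^ m)"
    using assms by (intro mult_mono) (auto simp: wt_nonneg)
  then have "2 * (wt x * wt y) ^ 2 \<le> 2 * ((E * W ^ m) * (E * W ^ m)) ^ 2"
    by (intro mult_left_mono power_mono) (auto simp: wt_nonneg)
  also have "\<dots> = 2 * (E * W ^ m) ^ 4" by (simp only: power4_eq_xxxx power2_eq_square mult.assoc)
  also have "\<dots> = 2 * E ^ 4 * W ^ (4 * m)"
    by (simp only: power_mult_distrib power_mult[symmetric] mult.commute[of m] mult.assoc)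
  finally show ?thesis using wt_pair(1)[of x y] by linarith
qed

lemma tame_map_prod: assumes "tame f" "tame g" shows "tame (map_prod f g)"
proof -
  obtain D m where D: "0 \<le> D" "\<And>x. wt (f x) \<le> D * wt x ^ m" "\<And>x. wt x \<le> D * wt (f x) ^ m"
    using assms(1) unfolding tame_def by blast
  obtain E n where E: "0 \<le> E" "\<And>x. wt (g x) \<le> E * wt x ^ n" "\<And>x. wt x \<le> E * wt (g x) ^ n"
    using assms(2) unfolding tame_def by blast
  have up: "D * a ^ m \<le> (D + E) * w ^ (m + n)" "E * a ^ n \<le> (D + E) * w ^ (m + n)" if "1 \<le> a" "a \<le> w" for a w :: real
    using that D(1) E(1) power_mono[of a w m] power_mono[of a w n] power_increasing[of m "m + n" w] power_increasing[of n "m + n" w]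
    by (auto intro!: mult_mono intro: order_trans)
  have "wt (map_prod f g z) \<le> 2 * (D + E) ^ 4 * wt z ^ (4 * (m + n))
      \<and> wt z \<le> 2 * (D + E) ^ 4 * wt (map_prod f g z) ^ (4 * (m + n))" for z
  proof -
    obtain x y where z: "z = (x, y)" by (cases z)
    have "wt (f x) \<le> (D + E) * wt (x, y) ^ (m + n)" "wt (g y) \<le> (D + E) * wt (x, y) ^ (m + n)"
      "wt x \<le> (D + E) * wt (f x, g y) ^ (m + n)" "wt y \<le> (D + E) * wt (f x, g y) ^ (m + n)"
      by (rule order_trans[OF D(2) up(1)] order_trans[OF E(2) up(2)] order_trans[OF D(3) up(1)] order_trans[OF E(3) up(2)];
          rule wt_ge_1 wt_pair)+
    moreover have "0 \<le> D + E" using D(1) E(1) by simp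
    ultimately show ?thesis unfolding z map_prod_simp by (intro conjI wt_pair_le wt_ge_1)
  qed
  then show ?thesis
    using D(1) E(1) assms
    by (intro tameI[of _ "2 * (D + E) ^ 4" "4 * (m + n)" "2 * (D + E) ^ 4" "4 * (m + n)"])
       (auto simp: tame_inj intro: prod.inj_map)
qed

lemma tame_id: "tame (\<lambda>x. x)"
  by (rule tameI[of _ 1 1 1 1]) auto

lemma tame_prod_decode: "tame prod_decode"
proof -
  have b: "bij prod_decode" by (rule bij_prod_decode)
  have "wt (prod_decode n) = wt n" for n
    by (cases "prod_decode n") (metis code_nat_def code_prod_def id_apply map_prod_simp prod_decode_inverse wt_def)
  then show "tame prod_decode" using b by (intro tameI[of _ 1 1 1 1]) (auto simp: bij_is_inj)
qed

lemma tame_prod_encode: "tame prod_encode"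
proof -
  have "inv prod_decode = prod_encode" by (rule inv_equality) auto
  with tame_inv[OF tame_prod_decode bij_prod_decode] show ?thesis by simp
qed

lemma tame_sum_encode: "tame sum_encode"
proof -
  have b: "bij sum_encode" by (rule bij_sum_encode)
  have "wt (sum_encode z) = wt z" for z :: "nat + nat"
    by (cases z) (simp_all add: wt_def code_sum_def code_nat_def)
  then show "tame sum_encode" using b by (intro tameI[of _ 1 1 1 1]) (auto simp: bij_is_inj)
qed

lemma tame_swap: "tame (prod.swap :: 'i::spg \<times> 'j::spg \<Rightarrow> 'j \<times> 'i)"
proof (rule tameI)
  show "inj (prod.swap :: 'i \<times> 'j \<Rightarrow> 'j \<times> 'i)" by simp
  fix z :: "'i \<times> 'j"
  obtain x y where z: "z = (x, y)" by (cases z)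
  have a: "wt x \<le> 1 * wt (x, y) ^ 1" "wt y \<le> 1 * wt (x, y) ^ 1" "wt x \<le> 1 * wt (y, x) ^ 1" "wt y \<le> 1 * wt (y, x) ^ 1"
    by (simp_all add: wt_pair)
  show "wt (prod.swap z) \<le> 2 * 1 ^ 4 * wt z ^ (4 * 1)"
    unfolding z swap_simp by (intro wt_pair_le a wt_ge_1) simp
  show "wt z \<le> 2 * 1 ^ 4 * wt (prod.swap z) ^ (4 * 1)"
    unfolding z swap_simp by (intro wt_pair_le a wt_ge_1) simp
qed auto

definition passoc :: "('i \<times> 'j) \<times> 'k \<Rightarrow> 'i \<times> ('j \<times> 'k)" where
  "passoc = (\<lambda>((x, y), z). (x, (y, z)))"

lemma bij_passoc: "bij passoc"
  by (rule o_bij[of "\<lambda>(x, (y, z)). ((x, y), z)"]) (auto simp: passoc_def)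

lemma tame_passoc: "tame (passoc :: ('i::spg \<times> 'j::spg) \<times> 'k::spg \<Rightarrow> 'i \<times> ('j \<times> 'k))"
proof (rule tameI)
  show "inj (passoc :: ('i \<times> 'j) \<times> 'k \<Rightarrow> 'i \<times> ('j \<times> 'k))" using bij_passoc by (rule bij_is_inj)
  fix t :: "('i \<times> 'j) \<times> 'k"
  obtain x y z where t: "t = ((x, y), z)" by (metis surj_pair)
  have a: "wt x \<le> wt ((x, y), z)" "wt y \<le> wt ((x, y), z)" "wt z \<le> wt ((x, y), z)"
    "wt x \<le> wt (x, (y, z))" "wt y \<le> wt (x, (y, z))" "wt z \<le> wt (x, (y, z))"
    by (meson wt_pair order_trans)+
  have b: "w \<le> 2 * W ^ 4" if "w \<le> W" "1 \<le> W" for w W :: real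
  proof -
    have "W ^ 1 \<le> W ^ 4" using that by (intro power_increasing) auto
    then show ?thesis using that by simp
  qed
  have yz: "wt (y, z) \<le> 2 * wt ((x, y), z) ^ 4"
    using wt_pair_le[of y 1 "wt ((x, y), z)" 1 z] a by (simp add: wt_ge_1)
  have xy: "wt (x, y) \<le> 2 * wt (x, (y, z)) ^ 4"
    using wt_pair_le[of x 1 "wt (x, (y, z))" 1 y] a by (simp add: wt_ge_1)
  have p: "passoc t = (x, (y, z))" by (simp add: t passoc_def)
  show "wt (passoc t) \<le> 2 * 2 ^ 4 * wt t ^ (4 * 4)"
    unfolding p unfolding t by (intro wt_pair_le yz b a wt_ge_1) simp
  show "wt t \<le> 2 * 2 ^ 4 * wt (passoc t) ^ (4 * 4)"
    unfolding p unfolding t by (intro wt_pair_le xy b a wt_ge_1) simp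
qed auto

text \<open>This differs from \<open>code\<close>, which pairs by \<open>prod_encode\<close>. Here
  the two blocks become the even and the odd numbers, in agreement with \<open>dbl_map\<close> and
  \<open>dbl_map1\<close>, so that block matrices correspond to \<open>blk\<close>.\<close>

definition cc :: "bool \<times> 'i::spg \<Rightarrow> nat" where
  "cc = (\<lambda>(s, n). 2 * code n + of_bool s)"

lemma cc_simps [simp]: "cc (False, n) = 2 * code n" "cc (True, n) = Suc (2 * code n)"
  by (simp_all add: cc_def)

definition ci :: "nat \<Rightarrow> bool \<times> nat" where "ci k = (odd k, k div 2)"

lemma ci_cc [simp]: "ci (cc z) = z"
  by (cases z; cases "fst z") (auto simp: ci_def code_nat_def)

lemma cc_ci [simp]: "cc (ci k) = k"
  by (simp add: ci_def cc_def code_nat_def)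

lemma bij_cc: "bij (cc :: bool \<times> nat \<Rightarrow> nat)"
  by (rule o_bij[of ci]) auto

lemma inv_cc: "inv (cc :: bool \<times> nat \<Rightarrow> nat) = ci"
  by (rule inv_equality) auto

lemma tame_cc: "tame (cc :: bool \<times> nat \<Rightarrow> nat)"
proof (rule tameI[OF bij_is_inj[OF bij_cc]])
  fix z :: "bool \<times> nat"
  obtain s n where z: "z = (s, n)" by (cases z)
  have "wt (cc z) \<le> 2 * wt n"
    by (cases s) (simp_all add: z wt_def code_nat_def)
  then show "wt (cc z) \<le> 2 * wt z ^ 1" using wt_pair(3)[of n s] by (simp add: z)
  have "wt s \<le> 2 * wt (cc z) ^ 1" "wt n \<le> 2 * wt (cc z) ^ 1"
    by (cases s; simp add: z wt_def code_bool_def code_nat_def)+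
  from wt_pair_le[OF this] show "wt z \<le> 2 * 2 ^ 4 * wt (cc z) ^ (4 * 1)" by (simp add: z wt_ge_1)
qed auto

lemma tame_ci: "tame ci" and bij_ci: "bij ci"
  using tame_inv[OF tame_cc bij_cc] bij_imp_bij_inv[OF bij_cc] by (simp_all add: inv_cc)

definition cc2 :: "bool \<times> bool \<times> nat \<Rightarrow> nat" where "cc2 = cc \<circ> map_prod (\<lambda>x. x) cc"

lemma tame_cc2: "tame cc2" and bij_cc2: "bij cc2"
proof -
  show "tame cc2" unfolding cc2_def by (intro tame_comp tame_cc tame_map_prod tame_id)
  have "bij (map_prod (\<lambda>x. x) cc :: bool \<times> bool \<times> nat \<Rightarrow> bool \<times> nat)"
    by (rule o_bij[of "map_prod (\<lambda>x. x) ci"]) auto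
  then show "bij cc2" unfolding cc2_def by (intro bij_comp bij_cc)
qed

lemma tame_Inl: "tame (Inl :: 'i::spg \<Rightarrow> 'i + 'j::spg)"
  by (rule relabeling_tame[OF relabeling_Inl])

text \<open>Through the interchange of the summands, tameness and assembly of the right injection
  follow from those of the left one.\<close>

lemma Inr_eq: "(Inr :: 'j \<Rightarrow> 'i + 'j) = case_sum Inr Inl \<circ> Inl"
  by auto

lemma tame_Inr: "tame (Inr :: 'j::spg \<Rightarrow> 'i::spg + 'j)"
  by (subst Inr_eq) (intro tame_comp tame_Inl bij_tame_sum_swap)

lemma assembled_map_bij: "tame r \<Longrightarrow> bij r \<Longrightarrow> assembled_map Dt r"
  by (intro assembled_map_relabeling relabeling_bij)

lemma assembled_map_Inl: "assembled_map Dt (Inl :: 'i::spg \<Rightarrow> 'i + 'j::spg)"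
  by (intro assembled_map_relabeling relabeling_Inl)

lemma assembled_map_Inr: "assembled_map Dt (Inr :: 'j::spg \<Rightarrow> 'i::spg + 'j)"
  by (subst Inr_eq)
    (intro assembled_map_comp assembled_map_bij assembled_map_Inl bij_tame_sum_swap bij_is_inj)

definition dbl_map :: "nat \<Rightarrow> nat" where "dbl_map n = 2 * n"
definition dbl_map1 :: "nat \<Rightarrow> nat" where "dbl_map1 n = Suc (2 * n)"

lemma dbl_map_comp: "dbl_map = sum_encode \<circ> Inl" "dbl_map1 = sum_encode \<circ> Inr"
  by (auto simp: sum_encode_def dbl_map_def dbl_map1_def)

lemma tame_dbl_map: "tame dbl_map" "tame dbl_map1"
  unfolding dbl_map_comp by (intro tame_comp tame_sum_encode tame_Inl tame_Inr)+

lemma assembled_dbl_map: "assembled_map Dt dbl_map" "assembled_map Dt dbl_map1"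
  unfolding dbl_map_comp
  by (intro assembled_map_comp tame_inj tame_sum_encode assembled_map_bij bij_sum_encode assembled_map_Inl assembled_map_Inr)+

definition flip_map :: "nat \<Rightarrow> nat" where "flip_map = prod_encode \<circ> (prod.swap \<circ> prod_decode)"

lemma flip_map: "tame flip_map" "bij flip_map" "flip_map (prod_encode (x, y)) = prod_encode (y, x)" "flip_map (flip_map n) = n"
proof -
  show "tame flip_map" unfolding flip_map_def by (intro tame_comp tame_prod_encode tame_swap tame_prod_decode)
  show "bij flip_map" unfolding flip_map_def by (intro bij_comp bij_prod_encode bij_swap bij_prod_decode)
  show "flip_map (prod_encode (x, y)) = prod_encode (y, x)" "flip_map (flip_map n) = n"
    by (simp_all add: flip_map_def)
qed

definition assoc_map :: "nat \<Rightarrow> nat" where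
  "assoc_map = prod_encode \<circ> (map_prod (\<lambda>x. x) prod_encode \<circ> (passoc \<circ> (map_prod prod_decode (\<lambda>x. x) \<circ> prod_decode)))"

lemma assoc_map: "tame assoc_map" "bij assoc_map"
  "assoc_map (prod_encode (prod_encode (x, y), z)) = prod_encode (x, prod_encode (y, z))"
proof -
  show "tame assoc_map" unfolding assoc_map_def
    by (intro tame_comp tame_prod_encode tame_passoc tame_prod_decode tame_map_prod tame_id)
  have 1: "bij (map_prod (\<lambda>x. x) prod_encode :: nat \<times> nat \<times> nat \<Rightarrow> nat \<times> nat)"
    by (rule o_bij[of "map_prod (\<lambda>x. x) prod_decode"]) auto
  have 2: "bij (map_prod prod_decode (\<lambda>x. x) :: nat \<times> nat \<Rightarrow> (nat \<times> nat) \<times> nat)"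
    by (rule o_bij[of "map_prod prod_encode (\<lambda>x. x)"]) auto
  show "bij assoc_map" unfolding assoc_map_def
    by (intro bij_comp bij_prod_encode bij_passoc bij_prod_decode 1 2)
  show "assoc_map (prod_encode (prod_encode (x, y), z)) = prod_encode (x, prod_encode (y, z))"
    by (simp add: assoc_map_def passoc_def)
qed

definition unit_map :: "nat \<Rightarrow> nat \<times> unit" where "unit_map n = (n, ())"

lemma unit_map: "tame unit_map" "bij unit_map"
proof -
  show b: "bij unit_map" by (rule o_bij[of fst]) (auto simp: unit_map_def)
  show "tame unit_map"
  proof (rule tameI[OF bij_is_inj[OF b]])
    fix n :: nat
    have "wt n \<le> 1 * wt n ^ 1" "wt () \<le> 1 * wt n ^ 1" by (simp_all add: wt_def code_unit_def)
    from wt_pair_le[OF this] show "wt (unit_map n) \<le> 2 * 1 ^ 4 * wt n ^ (4 * 1)" by (simp add: unit_map_def wt_ge_1)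
    show "wt n \<le> 1 * wt (unit_map n) ^ 1" using wt_pair(2)[of n "()"] by (simp add: unit_map_def)
  qed auto
qed

definition pair_map :: "nat \<Rightarrow> (bool \<times> nat) \<times> (bool \<times> nat)" where
  "pair_map = map_prod ci ci \<circ> prod_decode"

lemma pair_map: "tame pair_map" "bij pair_map"
proof -
  show "tame pair_map" unfolding pair_map_def by (intro tame_comp tame_map_prod tame_ci tame_prod_decode)
  have "bij (map_prod ci ci)" by (rule o_bij[of "map_prod cc cc"]) auto
  then show "bij pair_map" unfolding pair_map_def by (intro bij_comp bij_prod_decode)
qed

section \<open>Transport along bijections of index sets\<close>

lemma relabel_bij: "bij r \<Longrightarrow> relabel r A = (\<lambda>k l. A (inv r k) (inv r l))"
  by (simp add: relabel_def bij_is_surj fun_eq_iff)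

lemma relabel_bij_eq_iff: assumes "bij r" shows "relabel r A = relabel r B \<longleftrightarrow> A = B"
proof
  assume *: "relabel r A = relabel r B"
  have "A x y = B x y" for x y
    using fun_cong[OF fun_cong[OF *], of "r x" "r y"] assms by (simp add: relabel_bij bij_is_inj)
  then show "A = B" by blast
qed simp

lemma relabel_bij_mult:
  fixes A B :: "('i, 'i, 'r::{comm_ring, t2_space}) matrix"
  assumes "bij r" shows "relabel r (A \<odot> B) = relabel r A \<odot> relabel r B"
proof (intro ext)
  fix k l
  have "(\<Sum>\<^sub>\<infinity>x. A (inv r k) x * B x (inv r l)) = (\<Sum>\<^sub>\<infinity>y. A (inv r k) (inv r y) * B (inv r y) (inv r l))"
    using infsum_reindex_bij_betw[OF bij_imp_bij_inv[OF assms], of "\<lambda>x. A (inv r k) x * B x (inv r l)"] by simp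
  then show "relabel r (A \<odot> B) k l = (relabel r A \<odot> relabel r B) k l"
    by (simp add: relabel_bij[OF assms] mat_mult_def)
qed

lemma relabel_bij_ops:
  assumes "bij r"
  shows "relabel r (A \<boxplus> B) = relabel r A \<boxplus> relabel r B"
    "relabel r (mat_compl C) = mat_compl (relabel r C)"
    "relabel r (mat_one :: ('i, 'i, 'r::{zero_neq_one}) matrix) = mat_one"
  using assms bij_imp_bij_inv[OF assms]
  by (auto simp: relabel_bij mat_add_def mat_compl_def mat_one_def fun_eq_iff inj_eq[OF bij_is_inj])

lemma psd_reindex: assumes "tame s" "psd h" "\<And>n m. 0 \<le> h n m" shows "psd (\<lambda>x y. h (s x) (s y))"
  unfolding psd_def
proof
  fix k
  obtain D m where D: "0 \<le> D" "\<And>x. wt (s x) \<le> D * wt x ^ m" "\<And>x. wt x \<le> D * wt (s x) ^ m"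
    using assms(1) unfolding tame_def by blast
  \<comment> \<open>The exponent \<open>m * k\<close> compensates for the reindexing, which bounds
    \<open>wt x ^ k\<close> by a multiple of \<open>wt (s x) ^ (m * k)\<close>.\<close>
  obtain C l where C: "0 \<le> C" "\<And>n p. wt n ^ (m * k) * h n p \<le> C * wt p ^ l \<and> wt p ^ (m * k) * h n p \<le> C * wt n ^ l"
    using assms(2) unfolding psd_def by meson
  have *: "wt a ^ k * H \<le> D ^ k * C * D ^ l * wt b ^ (m * l)" if "wt (s a) ^ (m * k) * H \<le> C * wt (s b) ^ l" "0 \<le> H" for a b H
  proof -
    have "wt a ^ k * H \<le> (D * wt (s a) ^ m) ^ k * H"
      by (intro mult_right_mono power_mono D wt_nonneg that)
    also have "\<dots> = D ^ k * (wt (s a) ^ (m * k) * H)" by (simp add: power_mult_distrib power_mult)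
    also have "\<dots> \<le> D ^ k * (C * (D * wt b ^ m) ^ l)"
      using D C by (intro mult_left_mono order_trans[OF that(1)] power_mono wt_nonneg) auto
    finally show ?thesis by (simp add: power_mult_distrib power_mult)
  qed
  show "\<exists>C l. 0 \<le> C \<and> (\<forall>n p. wt n ^ k * h (s n) (s p) \<le> C * wt p ^ l \<and> wt p ^ k * h (s n) (s p) \<le> C * wt n ^ l)"
    using C D assms(3) by (intro exI[of _ "D ^ k * C * D ^ l"] exI[of _ "m * l"] conjI allI *) auto
qed

lemma rpd_reindex: assumes "tame s" "rpd h" "\<And>n m. 0 \<le> h n m" shows "rpd (\<lambda>x y. h (s x) (s y))"
  unfolding rpd_def
proof
  fix k
  obtain D m where D: "0 \<le> D" "\<And>x. wt x \<le> D * wt (s x) ^ m"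
    using assms(1) unfolding tame_def by blast
  obtain C where C: "\<And>n p. wt n ^ (m * k) * wt p ^ (m * k) * h n p \<le> C"
    using assms(2) unfolding rpd_def by meson
  have "wt x ^ k * wt y ^ k * h (s x) (s y) \<le> D ^ k * D ^ k * C" for x y
  proof -
    have "wt x ^ k * wt y ^ k * h (s x) (s y) \<le> (D * wt (s x) ^ m) ^ k * (D * wt (s y) ^ m) ^ k * h (s x) (s y)"
      using D by (intro mult_right_mono mult_mono power_mono D wt_nonneg wt_power assms(3)) (auto simp: wt_nonneg)
    also have "\<dots> = D ^ k * D ^ k * (wt (s x) ^ (m * k) * wt (s y) ^ (m * k) * h (s x) (s y))"
      by (simp add: power_mult_distrib power_mult)
    also have "\<dots> \<le> D ^ k * D ^ k * C" using D by (intro mult_left_mono C) auto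
    finally show ?thesis .
  qed
  then show "\<exists>C. \<forall>n p. wt n ^ k * wt p ^ k * h (s n) (s p) \<le> C" by blast
qed

lemma relabel_Psi_iff:
  fixes A :: "('i::spg, 'i, 'a::{comm_ring, topological_space} unitization) matrix" and r :: "'i \<Rightarrow> 'j::spg"
  assumes P: "polymetric P" and r: "tame r" "bij r"
  shows "relabel r A \<in> Psi P \<longleftrightarrow> A \<in> Psi P" "relabel r A \<in> Kmat P \<longleftrightarrow> A \<in> Kmat P"
proof -
  have i: "inv r (r x) = x" for x using r(2) by (simp add: bij_is_inj)
  note ti = tame_inv[OF r]
  have 1: "psd (\<lambda>n m. q (relabel r A n m)) \<longleftrightarrow> psd (\<lambda>n m. q (A n m))"
    "rpd (\<lambda>n m. q (relabel r A n m)) \<longleftrightarrow> rpd (\<lambda>n m. q (A n m))" if "q \<in> seminorm_sums P" for q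
  proof -
    note nn = seminorm_sums_props(1)[OF P that]
    show "psd (\<lambda>n m. q (relabel r A n m)) \<longleftrightarrow> psd (\<lambda>n m. q (A n m))"
      using psd_reindex[OF ti, of "\<lambda>n m. q (A n m)"] psd_reindex[OF r(1), of "\<lambda>n m. q (relabel r A n m)"] nn
      by (auto simp: relabel_bij[OF r(2)] i)
    show "rpd (\<lambda>n m. q (relabel r A n m)) \<longleftrightarrow> rpd (\<lambda>n m. q (A n m))"
      using rpd_reindex[OF ti, of "\<lambda>n m. q (A n m)"] rpd_reindex[OF r(1), of "\<lambda>n m. q (relabel r A n m)"] nn
      by (auto simp: relabel_bij[OF r(2)] i)
  qed
  show "relabel r A \<in> Psi P \<longleftrightarrow> A \<in> Psi P" unfolding Psi_iff[OF P] using 1(1) by blast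
  have "(\<forall>n m. scal (relabel r A n m) = 0) \<longleftrightarrow> (\<forall>n m. scal (A n m) = 0)"
    unfolding relabel_bij[OF r(2)] by (metis i)
  then show "relabel r A \<in> Kmat P \<longleftrightarrow> A \<in> Kmat P" unfolding Kmat_iff[OF P] using 1(2) by blast
qed

section \<open>Interpretation of the abstract ring\<close>

lemma mat_rel_conj:
  fixes r :: "nat \<Rightarrow> nat" and x :: "('z, 'a::{comm_ring, topological_ab_group_add, topological_semigroup_mult, t2_space}) psi"
  assumes "tame r" "complete_polymetric P"
  shows "mat (rel r * x * rel' r) P z = relabel r (mat x P z)"
  using relabel_conj[OF tame_inj[OF assms(1)], of "mat x P z"]
  by (simp add: mat_ops mat_rel assms cmat_nat)

lemma kron_nat_relabel:
  "kron_nat A B = relabel prod_encode (A \<otimes>\<^sub>m B)"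
proof -
  have "inv prod_encode = prod_decode" by (rule inv_equality) auto
  then show ?thesis by (simp add: kron_nat_def relabel_bij bij_prod_encode fun_eq_iff)
qed

text \<open>\<open>'z\<close> is the type of parameters: tuples of arguments for the identities,
  triples including conjugating elements for the compatibilities. \<open>Good\<close> holds the
  admissible values, \<open>Dt\<close> the initial data as functions of the parameter, and
  \<open>left\<close> selects one of the two products.\<close>

locale hring_setting =
  fixes P :: "('a::{comm_ring, topological_ab_group_add, topological_semigroup_mult, t2_space} \<Rightarrow> real) set"
    and Good :: "'z set" and Dt :: "('z \<Rightarrow> (nat, nat, 'a unitization) matrix) set"
    and \<theta>1 :: "(bool \<times> nat) + (bool \<times> nat) \<Rightarrow> nat" and \<theta>2 :: "bool \<times> nat \<Rightarrow> nat"
    and \<theta>3 :: "(bool \<times> nat) \<times> (bool \<times> nat) \<Rightarrow> nat" and left :: bool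
  assumes P: "complete_polymetric P"
    and \<theta>: "relabeling \<theta>1" "relabeling \<theta>2" "relabeling \<theta>3"
begin

lemma Pp: "polymetric P" using P by (simp add: complete_polymetric_def)

text \<open>Assembly is required only for the given family and on \<open>Good\<close>. Values
  elsewhere are left free, so that data can be continued by constants.\<close>

definition CC :: "('z, 'a) psi set" where
  "CC = {F. \<exists>G\<in>assembled_nat Dt. \<forall>z\<in>Good. mat F P z = G z}"

text \<open>Rapid decrease is required for every complete family and every parameter, because the
  relation \<open>x \<otimes> v = x \<otimes> q\<close> for the unit is an equation between all
  components.\<close>

definition KK :: "('z, 'a) psi set" where
  "KK = {F \<in> CC. \<forall>Q z. complete_polymetric Q \<longrightarrow> mat F Q z \<in> Kmat Q}"

lemma CC_I: "G \<in> assembled_nat Dt \<Longrightarrow> (\<And>z. z \<in> Good \<Longrightarrow> mat F P z = G z) \<Longrightarrow> F \<in> CC"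
  unfolding CC_def by blast

lemma CC_E:
  assumes "F \<in> CC" obtains G where "G \<in> assembled_nat Dt" "\<And>z. z \<in> Good \<Longrightarrow> mat F P z = G z"
  using assms unfolding CC_def by blast

lemma CC_add: assumes "x \<in> CC" "y \<in> CC" shows "x + y \<in> CC"
proof -
  obtain G where "G \<in> assembled_nat Dt" "\<And>z. z \<in> Good \<Longrightarrow> mat x P z = G z" using CC_E[OF assms(1)] by blast
  moreover obtain H where "H \<in> assembled_nat Dt" "\<And>z. z \<in> Good \<Longrightarrow> mat y P z = H z" using CC_E[OF assms(2)] by blast
  ultimately show ?thesis by (intro CC_I[OF assembled_nat.add[of G Dt H]]) (simp_all add: mat_ops P)
qed

lemma CC_uminus: assumes "x \<in> CC" shows "- x \<in> CC"
proof -
  obtain G where "G \<in> assembled_nat Dt" "\<And>z. z \<in> Good \<Longrightarrow> mat x P z = G z" using CC_E[OF assms] by blast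
  then show ?thesis by (intro CC_I[OF assembled_nat.neg[of G Dt]]) (simp_all add: mat_ops P)
qed

lemma CC_mult: assumes "x \<in> CC" "y \<in> CC" shows "x * y \<in> CC"
proof -
  obtain G where "G \<in> assembled_nat Dt" "\<And>z. z \<in> Good \<Longrightarrow> mat x P z = G z" using CC_E[OF assms(1)] by blast
  moreover obtain H where "H \<in> assembled_nat Dt" "\<And>z. z \<in> Good \<Longrightarrow> mat y P z = H z" using CC_E[OF assms(2)] by blast
  ultimately show ?thesis by (intro CC_I[OF assembled_nat.mult[of G Dt H]]) (simp_all add: mat_ops P)
qed

lemma CC_tensor: assumes "x \<in> CC" "y \<in> CC" shows "tensor_psi x y \<in> CC"
proof -
  obtain G where "G \<in> assembled_nat Dt" "\<And>z. z \<in> Good \<Longrightarrow> mat x P z = G z" using CC_E[OF assms(1)] by blast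
  moreover obtain H where "H \<in> assembled_nat Dt" "\<And>z. z \<in> Good \<Longrightarrow> mat y P z = H z" using CC_E[OF assms(2)] by blast
  ultimately show ?thesis by (intro CC_I[OF assembled_nat.tensor[of G Dt H]]) (simp_all add: mat_tensor P)
qed

lemma rel_CC:
  assumes "tame r" "assembled_map Dt r" shows "rel r \<in> CC" "rel' r \<in> CC"
  using assms unfolding assembled_map_def
  by (auto intro: CC_I[where G = "\<lambda>_. cmat r"] CC_I[where G = "\<lambda>_. transp (cmat r)"] simp: mat_rel P)

lemma rel_CC_bij:
  assumes "tame r" "bij r" shows "rel r \<in> CC" "rel' r \<in> CC"
  using assms by (auto intro!: rel_CC assembled_map_bij)

lemma one_CC: "1 \<in> CC"
proof -
  have "rel (\<lambda>n::nat. n) = (1 :: ('z, 'a) psi)"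
  proof (rule psi_eqI)
    fix Q :: "('a \<Rightarrow> real) set" and z :: 'z
    assume "complete_polymetric Q"
    then show "mat (rel (\<lambda>n::nat. n)) Q z = mat 1 Q z"
      by (simp add: mat_rel tame_id mat_psi_one cmat_nat) (auto simp: relabel_matrix_def mat_one_def)
  qed
  moreover have "bij (\<lambda>n::nat. n)" by (rule o_bij[of "\<lambda>n. n"]) auto
  ultimately show ?thesis using rel_CC_bij(1)[OF tame_id] by metis
qed

abbreviation "S0 \<equiv> rel dbl_map :: ('z, 'a) psi"
abbreviation "S1 \<equiv> rel dbl_map1 :: ('z, 'a) psi"
abbreviation "T0 \<equiv> rel' dbl_map :: ('z, 'a) psi"
abbreviation "T1 \<equiv> rel' dbl_map1 :: ('z, 'a) psi"

lemma even_odd_disjoint: "dbl_map x \<noteq> dbl_map1 y" "dbl_map1 y \<noteq> dbl_map x"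
  by (simp_all add: dbl_map_def dbl_map1_def) presburger+

text \<open>The bridge between the abstract and the concrete block matrices: through it
  \<open>swp\<close> and \<open>reg\<close> become the matrices in
  \<open>regularize\<close>.\<close>

lemma mat_block:
  assumes Q: "complete_polymetric Q"
  shows "mat (S0 * a * T0 + S0 * b * T1 + S1 * c * T0 + S1 * d * T1) Q z
    = relabel cc (block (mat a Q z) (mat b Q z) (mat c Q z) (mat d Q z))"
proof (intro ext)
  fix k l
  have inj: "inj_on dbl_map UNIV" "inj_on dbl_map1 UNIV" by (auto simp: inj_on_def dbl_map_def dbl_map1_def)
  have rng: "k \<in> range dbl_map \<longleftrightarrow> even k" "k \<in> range dbl_map1 \<longleftrightarrow> odd k" for k
    by (auto simp: dbl_map_def dbl_map1_def elim: evenE oddE)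
  have iv: "even k \<Longrightarrow> inv dbl_map k = k div 2" "odd k \<Longrightarrow> inv dbl_map1 k = k div 2" for k
  proof -
    show "inv dbl_map k = k div 2" if "even k"
      using inv_f_f[OF inj(1), of "k div 2"] that by (simp add: dbl_map_def)
    show "inv dbl_map1 k = k div 2" if "odd k"
      using inv_f_f[OF inj(2), of "k div 2"] that by (simp add: dbl_map1_def)
  qed
  show "mat (S0 * a * T0 + S0 * b * T1 + S1 * c * T0 + S1 * d * T1) Q z k l
    = relabel cc (block (mat a Q z) (mat b Q z) (mat c Q z) (mat d Q z)) k l"
    unfolding mat_ops[OF Q] mat_rel(1)[OF tame_dbl_map(1) Q] mat_rel(2)[OF tame_dbl_map(1) Q]
      mat_rel(1)[OF tame_dbl_map(2) Q] mat_rel(2)[OF tame_dbl_map(2) Q] cmat_nat mat_add_def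
      relabel_matrix_transp_mult_right[OF inj(1)] relabel_matrix_transp_mult_right[OF inj(2)]
      relabel_matrix_mult_left[OF inj(1)] relabel_matrix_mult_left[OF inj(2)] rng
    by (cases "even k"; cases "even l") (simp_all add: relabel_bij[OF bij_cc] inv_cc ci_def block_def iv)
qed

lemma cuntz_sum: "S0 * T0 + S1 * T1 = 1"
proof (rule psi_eqI)
  fix Q :: "('a \<Rightarrow> real) set" and z :: 'z
  assume Q: "complete_polymetric Q"
  have "mat (S0 * T0 + S1 * T1) Q z = mat (S0 * 1 * T0 + S0 * 0 * T1 + S1 * 0 * T0 + S1 * 1 * T1) Q z" by simp
  also have "\<dots> = relabel cc (block mat_one mat_zero mat_zero mat_one :: (bool \<times> nat, bool \<times> nat, 'a unitization) matrix)"
    unfolding mat_block[OF Q] mat_psi_one[OF Q] mat_ops(1)[OF Q] ..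
  also have "block mat_one mat_zero mat_zero mat_one = (mat_one :: (bool \<times> nat, bool \<times> nat, 'a unitization) matrix)"
    by (auto simp: block_def mat_one_def mat_zero_def fun_eq_iff)
  also have "relabel cc (mat_one :: (bool \<times> nat, bool \<times> nat, 'a unitization) matrix) = (mat_one :: (nat, nat, 'a unitization) matrix)" by (rule relabel_bij_ops[OF bij_cc])
  finally show "mat (S0 * T0 + S1 * T1) Q z = mat 1 Q z" by (simp only: mat_psi_one[OF Q])
qed

lemma KK_props:
  "x \<in> KK \<Longrightarrow> y \<in> KK \<Longrightarrow> x + y \<in> KK" "x \<in> KK \<Longrightarrow> - x \<in> KK"
  "c \<in> CC \<Longrightarrow> x \<in> KK \<Longrightarrow> c * x \<in> KK" "x \<in> KK \<Longrightarrow> c \<in> CC \<Longrightarrow> x * c \<in> KK"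
  "x \<in> KK \<Longrightarrow> y \<in> KK \<Longrightarrow> tensor_psi x y \<in> KK"
proof -
  show "x + y \<in> KK" if "x \<in> KK" "y \<in> KK"
    using that unfolding KK_def by (auto simp: CC_add mat_ops cpm.Kmat_add[OF cpm.intro])
  show "- x \<in> KK" if "x \<in> KK"
    using that unfolding KK_def by (auto simp: CC_uminus mat_ops cpm.Kmat_uminus[OF cpm.intro])
  show "c * x \<in> KK" if "c \<in> CC" "x \<in> KK"
    using that unfolding KK_def by (auto simp: CC_mult mat_ops cpm.Kmat_mult_left[OF cpm.intro] mat_Psi)
  show "x * c \<in> KK" if "x \<in> KK" "c \<in> CC"
    using that unfolding KK_def by (auto simp: CC_mult mat_ops cpm.Kmat_mult_right[OF cpm.intro] mat_Psi)
  show "tensor_psi x y \<in> KK" if "x \<in> KK" "y \<in> KK"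
    using that unfolding KK_def by (auto simp: CC_tensor mat_tensor cpm.Kmat_kron[OF cpm.intro])
qed

lemma CC_zero: "0 \<in> CC"
  using CC_add[OF one_CC CC_uminus[OF one_CC]] by simp

lemma KK_zero: "0 \<in> KK"
  unfolding KK_def by (auto simp: CC_zero mat_ops cpm.Kmat_zero[OF cpm.intro])

lemma kron_nat_apply: "kron_nat A B m n = A (fst (prod_decode m)) (fst (prod_decode n)) * B (snd (prod_decode m)) (snd (prod_decode n))"
  by (simp add: kron_nat_def kron_def case_prod_beta)

lemma tensor_props:
  fixes x y x' y' :: "('z, 'a) psi"
  shows "tensor_psi (x + x') y = tensor_psi x y + tensor_psi x' y"
    "tensor_psi x (y + y') = tensor_psi x y + tensor_psi x y'"
    "tensor_psi x y * tensor_psi x' y' = tensor_psi (x * x') (y * y')"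
    "tensor_psi 1 1 = (1 :: ('z, 'a) psi)"
proof -
  show "tensor_psi (x + x') y = tensor_psi x y + tensor_psi x' y"
    "tensor_psi x (y + y') = tensor_psi x y + tensor_psi x y'"
    by (rule psi_eqI; simp add: mat_tensor mat_ops; simp add: kron_nat_apply mat_add_def fun_eq_iff algebra_simps)+
  show "tensor_psi x y * tensor_psi x' y' = tensor_psi (x * x') (y * y')"
    by (rule psi_eqI) (simp add: mat_tensor mat_ops cpm.kron_product[OF cpm.intro] mat_Psi)
  show "tensor_psi 1 1 = (1 :: ('z, 'a) psi)"
  proof (rule psi_eqI)
    fix Q :: "('a \<Rightarrow> real) set" and z :: 'z
    assume "complete_polymetric Q"
    then show "mat (tensor_psi 1 1) Q z = mat 1 Q z"
      by (simp add: mat_tensor mat_psi_one)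
         (auto simp: kron_nat_apply mat_one_def fun_eq_iff, metis prod_eqI prod_decode_eq)
  qed
qed

text \<open>As the entries commute, interchanging the factors of a Kronecker product amounts to the
  permutation of pairs.\<close>

lemma flip_props:
  fixes x y :: "('z, 'a) psi"
  shows "rel flip_map * rel flip_map = (1 :: ('z, 'a) psi)"
  "rel flip_map * tensor_psi x y * rel flip_map = tensor_psi y x"
proof -
  have [simp]: "rel' flip_map = (rel flip_map :: ('z, 'a) psi)"
  proof (rule psi_eqI)
    fix Q :: "('a \<Rightarrow> real) set" and z :: 'z
    assume Q: "complete_polymetric Q"
    have "transp (rmat flip_map) = (rmat flip_map :: (nat, nat, 'a unitization) matrix)"
      by (intro ext) (auto simp: relabel_matrix_def flip_map(4))
    then show "mat (rel' flip_map) Q z = mat (rel flip_map) Q z"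
      by (simp add: mat_rel flip_map Q cmat_nat)
  qed
  show "rel flip_map * rel flip_map = (1 :: ('z, 'a) psi)"
    using rel_rel'_bij[OF flip_map(1,2), where 'z = 'z and 'a = 'a] by simp
  have iv: "inv flip_map = flip_map" by (rule inv_equality) (simp_all add: flip_map)
  have "rel flip_map * tensor_psi x y * rel' flip_map = tensor_psi y x"
  proof (rule psi_eqI)
    fix Q :: "('a \<Rightarrow> real) set" and z :: 'z
    assume Q: "complete_polymetric Q"
    have "relabel flip_map (kron_nat X Y) = kron_nat Y X" for X Y :: "(nat, nat, 'a unitization) matrix"
    proof (intro ext)
      fix m n
      obtain i k j l where mn: "m = prod_encode (i, k)" "n = prod_encode (j, l)"
        by (metis prod_decode_inverse surj_pair)
      show "relabel flip_map (kron_nat X Y) m n = kron_nat Y X m n"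
        unfolding relabel_bij[OF flip_map(2)] iv mn flip_map(3) by (simp add: kron_nat_apply mult.commute)
    qed
    then show "mat (rel flip_map * tensor_psi x y * rel' flip_map) Q z = mat (tensor_psi y x) Q z"
      by (simp only: mat_rel_conj[OF flip_map(1) Q] mat_tensor[OF Q])
  qed
  then show "rel flip_map * tensor_psi x y * rel flip_map = tensor_psi y x" by simp
qed

lemma assoc_props:
  "rel assoc_map * tensor_psi (tensor_psi x y) w * rel' assoc_map = tensor_psi x (tensor_psi y (w :: ('z, 'a) psi))"
proof (rule psi_eqI)
  fix Q :: "('a \<Rightarrow> real) set" and z :: 'z
  assume Q: "complete_polymetric Q"
  have iv: "inv assoc_map (prod_encode (i, prod_encode (j, k))) = prod_encode (prod_encode (i, j), k)" for i j k
    using assoc_map by (intro inv_f_eq) (auto simp: bij_is_inj)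
  have "relabel assoc_map (kron_nat (kron_nat X Y) W) = kron_nat X (kron_nat Y W)"
    for X Y W :: "(nat, nat, 'a unitization) matrix"
  proof (intro ext)
    fix m n
    obtain i j k i' j' k' where mn: "m = prod_encode (i, prod_encode (j, k))" "n = prod_encode (i', prod_encode (j', k'))"
      by (metis prod_decode_inverse surj_pair)
    show "relabel assoc_map (kron_nat (kron_nat X Y) W) m n = kron_nat X (kron_nat Y W) m n"
      unfolding relabel_bij[OF assoc_map(2)] mn iv by (simp add: kron_nat_apply mult.assoc)
  qed
  then show "mat (rel assoc_map * tensor_psi (tensor_psi x y) w * rel' assoc_map) Q z = mat (tensor_psi x (tensor_psi y w)) Q z"
    by (simp only: mat_rel_conj[OF assoc_map(1) Q] mat_tensor[OF Q])
qed

lemma tensor_cuntz_axioms: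
  "tensor_cuntz CC KK S0 S1 T0 T1 tensor_psi (rel flip_map) (rel assoc_map) (rel' assoc_map)"
proof (rule tensor_cuntz.intro)
  show "1 \<in> CC" by (rule one_CC)
  show "S0 \<in> CC" "S1 \<in> CC" "T0 \<in> CC" "T1 \<in> CC"
    by (rule rel_CC tame_dbl_map assembled_dbl_map)+
  show "T0 * S0 = 1" "T1 * S1 = 1" by (rule rel'_rel tame_dbl_map)+
  show "T0 * S1 = 0" "T1 * S0 = 0" by (rule rel'_rel_disjoint tame_dbl_map even_odd_disjoint)+
  show "S0 * T0 + S1 * T1 = 1" by (rule cuntz_sum)
  show "0 \<in> KK" by (rule KK_zero)
  show "rel flip_map \<in> CC" by (rule rel_CC_bij flip_map)+
  show "rel assoc_map \<in> CC" "rel' assoc_map \<in> CC" by (rule rel_CC_bij assoc_map)+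
  show "rel assoc_map * rel' assoc_map = 1" by (rule rel_rel'_bij assoc_map)+
  show "rel' assoc_map * rel assoc_map = 1" by (rule rel'_rel assoc_map)+
qed (fact CC_add CC_uminus CC_mult CC_tensor KK_props tensor_props flip_props assoc_props)+

definition prd :: "('z, 'a) psi dbl \<Rightarrow> ('z, 'a) psi dbl \<Rightarrow> ('z, 'a) psi dbl" where
  "prd = (if left then tensor_cuntz.tens tensor_psi else tensor_cuntz.rtens tensor_psi)"

text \<open>The maps \<open>\<theta>\<close> read as injections of \<open>nat\<close>, by way of
  \<open>ci\<close> and the pairing; \<open>\<theta>1\<close> is split into its restrictions to the
  two summands.\<close>

definition "\<rho>0 = \<theta>1 \<circ> (Inl \<circ> ci)"
definition "\<rho>1 = \<theta>1 \<circ> (Inr \<circ> ci)"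
definition "\<rho>2 = \<theta>2 \<circ> ci"
definition "\<rho>3 = \<theta>3 \<circ> pair_map"

lemma tame_\<rho>: "tame \<rho>0" "tame \<rho>1" "tame \<rho>2" "tame \<rho>3"
  unfolding \<rho>0_def \<rho>1_def \<rho>2_def \<rho>3_def
  by (intro tame_comp relabeling_tame \<theta> tame_Inl tame_Inr tame_ci pair_map)+

lemma assembled_\<rho>: "assembled_map Dt \<rho>0" "assembled_map Dt \<rho>1" "assembled_map Dt \<rho>2" "assembled_map Dt \<rho>3"
  unfolding \<rho>0_def \<rho>1_def \<rho>2_def \<rho>3_def
  by (intro assembled_map_comp assembled_map_relabeling[OF \<theta>(1)] assembled_map_relabeling[OF \<theta>(2)]
      assembled_map_relabeling[OF \<theta>(3)] assembled_map_Inl assembled_map_Inr assembled_map_bij tame_inj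
      relabeling_tame \<theta> tame_Inl tame_Inr tame_ci pair_map bij_ci)+

lemma hring_cuntz_axioms:
  "hring_cuntz CC KK S0 S1 T0 T1 tensor_psi (rel flip_map) (rel assoc_map) (rel' assoc_map)
    (rel \<rho>0) (rel \<rho>1) (rel \<rho>2) (rel \<rho>3) (rel' \<rho>0) (rel' \<rho>1) (rel' \<rho>2) (rel' \<rho>3) prd"
proof (intro hring_cuntz.intro hring_cuntz_axioms.intro tensor_cuntz_axioms)
  have "\<rho>0 x \<noteq> \<rho>1 y" "\<rho>1 y \<noteq> \<rho>0 x" for x y
    using tame_inj[OF relabeling_tame[OF \<theta>(1)]] by (auto simp: \<rho>0_def \<rho>1_def dest: injD)
  then show "rel' \<rho>0 * rel \<rho>1 = (0 :: ('z, 'a) psi)" "rel' \<rho>1 * rel \<rho>0 = (0 :: ('z, 'a) psi)"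
    by (auto intro!: rel'_rel_disjoint tame_\<rho>)
qed (auto simp: prd_def intro!: rel_CC rel'_rel tame_\<rho> assembled_\<rho>)

sublocale hring_cuntz CC KK S0 S1 T0 T1 tensor_psi "rel flip_map" "rel assoc_map" "rel' assoc_map"
    "rel \<rho>0" "rel \<rho>1" "rel \<rho>2" "rel \<rho>3" "rel' \<rho>0" "rel' \<rho>1" "rel' \<rho>2" "rel' \<rho>3" prd
  by (rule hring_cuntz_axioms)

end

section \<open>Representation of the concrete operations by those of the abstract ring\<close>

lemma relabel_dsum:
  assumes "inj \<theta>"
  shows "relabel \<theta> (dsum A B) = relabel (\<theta> \<circ> Inl) A \<boxplus> (relabel (\<theta> \<circ> Inr) B :: ('k, 'k, 'r::monoid_add) matrix)"
proof (intro ext)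
  fix k l
  have i: "inj (\<theta> \<circ> Inl)" "inj (\<theta> \<circ> Inr)" using assms by (auto simp: inj_def)
  have eq: "\<theta> x = \<theta> y \<longleftrightarrow> x = y" for x y using assms by (auto dest: injD)
  have iv: "inv (\<theta> \<circ> Inl) (\<theta> (Inl x)) = x" "inv (\<theta> \<circ> Inr) (\<theta> (Inr y)) = y" "inv \<theta> (\<theta> w) = w" for x y w
    using inv_f_f[OF i(1), of x] inv_f_f[OF i(2), of y] assms by auto
  have cases: "(\<exists>x. k = \<theta> (Inl x)) \<or> (\<exists>x. k = \<theta> (Inr x)) \<or> k \<notin> range \<theta>" for k
    by (metis rangeE sum.exhaust)
  show "relabel \<theta> (dsum A B) k l = (relabel (\<theta> \<circ> Inl) A \<boxplus> relabel (\<theta> \<circ> Inr) B) k l"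
    using cases[of k] cases[of l]
    by (elim disjE exE) (auto simp: relabel_def mat_add_def dsum_def iv image_iff eq)
qed

lemma relabel_add: "relabel r (A \<boxplus> B) = relabel r A \<boxplus> (relabel r B :: ('k, 'k, 'r::monoid_add) matrix)"
  by (auto simp: relabel_def mat_add_def fun_eq_iff)

lemma map_prod_cc: "bij (map_prod cc cc :: (bool \<times> nat) \<times> (bool \<times> nat) \<Rightarrow> nat \<times> nat)"
    "inv (map_prod cc cc :: (bool \<times> nat) \<times> (bool \<times> nat) \<Rightarrow> nat \<times> nat) = map_prod ci ci"
  by (rule o_bij[of "map_prod ci ci"], auto, rule inv_equality, auto)

lemma relabel_kron:
  fixes A B :: "(bool \<times> nat, bool \<times> nat, 'r::comm_ring_1) matrix"
  shows "relabel (map_prod cc cc) (A \<otimes>\<^sub>m B) = relabel cc A \<otimes>\<^sub>m relabel cc B"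
  by (auto simp: relabel_bij[OF map_prod_cc(1)] map_prod_cc(2) relabel_bij[OF bij_cc] inv_cc kron_def fun_eq_iff)

context hring_setting
begin

definition rep :: "(bool \<times> nat, 'a) mpair \<Rightarrow> ('z, 'a) psi dbl \<Rightarrow> 'z \<Rightarrow> bool" where
  "rep x B z \<longleftrightarrow> relabel cc (fst x) = mat (lead B) P z \<and> relabel cc (snd x) = mat (bas B) P z"

text \<open>This serves the stage between relabeling and regularization, when the index set is
  already \<open>nat\<close>.\<close>

definition nrep :: "(nat, 'a) mpair \<Rightarrow> ('z, 'a) psi dbl \<Rightarrow> 'z \<Rightarrow> bool" where
  "nrep y B z \<longleftrightarrow> fst y = mat (lead B) P z \<and> snd y = mat (bas B) P z"

lemma mat_compl_rep: "mat (1 - a) P z = mat_compl (mat a P z)"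
  by (simp add: mat_ops P mat_psi_one mat_compl_def)

lemma mat_qblk: "mat (q.blk a b c d) P z = relabel cc (block (mat a P z) (mat b P z) (mat c P z) (mat d P z))"
  unfolding q.blk_def by (rule mat_block[OF P])

lemma relabel_base: "relabel cc base = mat q.e P z"
  unfolding q.e_eq mat_qblk base_def block_diag_def by (simp add: mat_ops P mat_psi_one)

lemma e_eq_dg: "e = dg q.e"
  by (simp add: e_def q.e_def)

lemma swp_dg: "swp (dg a) = dg (q.swp a)"
  by (simp add: swp_def q.swp_def one_dbl_def)

lemma rep_regularize:
  assumes "nrep y B z" "B \<in> Idm"
  shows "rep (regularize y) (reg B) z"
proof -
  obtain b a where B: "B = Dbl b a" by (cases B)
  obtain y1 y2 where y: "y = (y1, y2)" by (cases y)
  have m: "y1 = mat b P z" "y2 = mat a P z" using assms(1) by (simp_all add: nrep_def y B)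
  have "reg B = dg (q.swp a) * blk (Dbl b a) 0 0 (dg (1 - a)) * dg (q.swp a)"
    by (simp add: reg_def B swp_dg one_dbl_def del: dbl_simps(4))
  then have lead: "lead (reg B) = q.swp a * q.blk b 0 0 (1 - a) * q.swp a"
    by simp
  have "dlt (reg B) = e" using assms(2) by (rule \<delta>_reg)
  then have bas: "bas (reg B) = q.e" by (simp add: e_eq_dg dlt_def)
  have U: "mat (q.swp a) P z = relabel cc (block (mat_compl y2) y2 y2 (mat_compl y2))"
    unfolding q.swp_def mat_qblk mat_compl_rep m ..
  have V: "mat (q.blk b 0 0 (1 - a)) P z = relabel cc (block_diag y1 (mat_compl y2))"
    unfolding mat_qblk mat_compl_rep m block_diag_def by (simp add: mat_ops P)
  have "relabel cc (fst (regularize y)) = mat (lead (reg B)) P z"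
    unfolding lead mat_ops(5)[OF P] U V by (simp add: regularize_def y Let_def relabel_bij_mult[OF bij_cc])
  moreover have "snd (regularize y) = base" by (simp add: regularize_def y Let_def base_def)
  ultimately show ?thesis using relabel_base[of z] by (simp add: rep_def bas)
qed

lemma relabel_cc_relabel:
  fixes A :: "(bool \<times> nat, bool \<times> nat, 'a unitization) matrix" and r :: "nat \<Rightarrow> nat"
  assumes "tame r" shows "relabel r (relabel cc A) = relabel (r \<circ> cc) A"
  by (rule relabel_nat_comp[OF tame_inj[OF assms] tame_inj[OF tame_cc]])

lemma inj_\<theta>: "inj \<theta>1" "inj \<theta>2" "inj \<theta>3"
  using \<theta>[THEN relabeling_tame, THEN tame_inj] by auto

lemma \<rho>_cc: "\<rho>0 \<circ> cc = \<theta>1 \<circ> Inl" "\<rho>1 \<circ> cc = \<theta>1 \<circ> Inr" "\<rho>2 \<circ> cc = \<theta>2"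
  by (auto simp: \<rho>0_def \<rho>1_def \<rho>2_def fun_eq_iff)

lemma rep_add:
  assumes "rep x A z" "rep y B z" "A \<in> Idm" "B \<in> Idm"
  shows "rep (gr_add \<theta>1 x y) (addG A B) z"
proof -
  define N where "N = dg (rel \<rho>0) * A * dg (rel' \<rho>0) + dg (rel \<rho>1) * B * dg (rel' \<rho>1)"
  obtain x1 x2 where x: "x = (x1, x2)" by (cases x)
  obtain y1 y2 where y: "y = (y1, y2)" by (cases y)
  have *: "relabel \<theta>1 (dsum X Y) = mat (rel \<rho>0 * a * rel' \<rho>0 + rel \<rho>1 * b * rel' \<rho>1) P z"
    if "relabel cc X = mat a P z" "relabel cc Y = mat b P z" for X Y a b
    using that relabel_cc_relabel[OF tame_\<rho>(1), of X] relabel_cc_relabel[OF tame_\<rho>(2), of Y]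
    unfolding mat_ops(2)[OF P] mat_rel_conj[OF tame_\<rho>(1) P] mat_rel_conj[OF tame_\<rho>(2) P] relabel_dsum[OF inj_\<theta>(1)]
    by (simp add: \<rho>_cc)
  have "nrep (pair_relabel \<theta>1 (pair_sum x y)) N z"
    using assms(1,2) *[of x1 "lead A" y1 "lead B"] *[of x2 "bas A" y2 "bas B"]
    by (simp add: nrep_def rep_def x y pair_relabel_def pair_sum_def N_def)
  moreover have "N \<in> Idm"
    unfolding N_def using assms(3,4) by (rule addG(3))
  ultimately show ?thesis unfolding gr_add_def addG_def N_def[symmetric] by (rule rep_regularize)
qed

lemma rep_neg:
  assumes "rep x A z" "A \<in> Idm"
  shows "rep (gr_neg \<theta>2 x) (negG A) z"
proof -
  define N where "N = dg (rel \<rho>2) * (1 - A) * dg (rel' \<rho>2)"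
  obtain x1 x2 where x: "x = (x1, x2)" by (cases x)
  have *: "relabel \<theta>2 (mat_compl X) = mat (rel \<rho>2 * (1 - a) * rel' \<rho>2) P z" if "relabel cc X = mat a P z"
    for X :: "(bool \<times> nat, bool \<times> nat, 'a unitization) matrix" and a
    unfolding mat_rel_conj[OF tame_\<rho>(3) P] mat_compl_rep that[symmetric] relabel_bij_ops(2)[OF bij_cc, of X, symmetric]
      relabel_cc_relabel[OF tame_\<rho>(3)] \<rho>_cc ..
  have "nrep (pair_relabel \<theta>2 (pair_inv x)) N z"
    using assms(1) *[of x1 "lead A"] *[of x2 "bas A"]
    by (simp add: nrep_def rep_def x pair_relabel_def pair_inv_def N_def)
  moreover have "N \<in> Idm"
    unfolding N_def using assms(2) by (intro Idm_dg_iso Idm_compl r_C r_orth)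
  ultimately show ?thesis unfolding gr_neg_def negG_def N_def[symmetric] by (rule rep_regularize)
qed

definition tens_pair :: "(bool \<times> nat, 'a) mpair \<Rightarrow> (bool \<times> nat, 'a) mpair \<Rightarrow> ((bool \<times> nat) \<times> (bool \<times> nat), 'a) mpair" where
  "tens_pair = (if left then pair_tensor_left else pair_tensor_right)"

lemma relabel_\<theta>3_kron:
  assumes "relabel cc X = mat a P z" "relabel cc Y = mat b P z"
  shows "relabel \<theta>3 (X \<otimes>\<^sub>m Y) = mat (rel \<rho>3 * tensor_psi a b * rel' \<rho>3) P z"
proof -
  have i: "inj \<rho>3" "inj prod_encode" "inj (map_prod cc cc :: (bool \<times> nat) \<times> (bool \<times> nat) \<Rightarrow> nat \<times> nat)"
    using tame_\<rho>(4) bij_prod_encode map_prod_cc(1) by (auto simp: tame_inj bij_is_inj)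
  have eq: "\<rho>3 \<circ> prod_encode \<circ> map_prod cc cc = \<theta>3"
    by (auto simp: \<rho>3_def pair_map_def fun_eq_iff)
  have "mat (rel \<rho>3 * tensor_psi a b * rel' \<rho>3) P z = relabel \<rho>3 (relabel prod_encode (relabel (map_prod cc cc) (X \<otimes>\<^sub>m Y)))"
    unfolding mat_rel_conj[OF tame_\<rho>(4) P] mat_tensor[OF P] kron_nat_relabel relabel_kron assms ..
  also have "\<dots> = relabel (\<rho>3 \<circ> prod_encode \<circ> map_prod cc cc) (X \<otimes>\<^sub>m Y)"
    unfolding relabel_nat_comp[OF i(1,2)] relabel_nat_comp[OF inj_compose[OF i(1,2)] i(3)] ..
  finally show ?thesis by (simp only: eq)
qed

lemma rep_mul:
  assumes "rep x A z" "rep y B z" "A \<in> Idm" "B \<in> Idm"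
  shows "rep (gr_mult tens_pair \<theta>3 x y) (mulG A B) z"
proof -
  define N where "N = dg (rel \<rho>3) * prd A B * dg (rel' \<rho>3)"
  obtain x1 x2 where x: "x = (x1, x2)" by (cases x)
  obtain y1 y2 where y: "y = (y1, y2)" by (cases y)
  have r: "relabel cc x1 = mat (lead A) P z" "relabel cc x2 = mat (bas A) P z"
    "relabel cc y1 = mat (lead B) P z" "relabel cc y2 = mat (bas B) P z"
    using assms(1,2) by (simp_all add: rep_def x y)
  have c: "relabel cc (mat_compl X) = mat (1 - a) P z" if "relabel cc X = mat a P z"
    for X :: "(bool \<times> nat, bool \<times> nat, 'a unitization) matrix" and a
    unfolding mat_compl_rep that[symmetric] by (rule relabel_bij_ops(2)[OF bij_cc])
  note t = relabel_\<theta>3_kron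
  have "nrep (pair_relabel \<theta>3 (tens_pair x y)) N z"
  proof (cases left)
    case True
    then show ?thesis
      unfolding nrep_def tens_pair_def prd_def N_def
      by (simp add: pair_tensor_left_def tens_def x y pair_relabel_def relabel_add
          t[OF r(1) r(3)] t[OF c[OF r(1)] r(4)] t[OF r(2) r(3)] t[OF c[OF r(2)] r(4)] distrib_left distrib_right mat_ops(2)[OF P])
  next
    case False
    then show ?thesis
      unfolding nrep_def tens_pair_def prd_def N_def
      by (simp add: pair_tensor_right_def rtens_def x y pair_relabel_def relabel_add
          t[OF r(1) r(3)] t[OF r(2) c[OF r(3)]] t[OF r(1) r(4)] t[OF r(2) c[OF r(4)]] distrib_left distrib_right mat_ops(2)[OF P])
  qed
  moreover have "N \<in> Idm"
    unfolding N_def using assms(3,4) by (intro Idm_dg_iso Idm_prd r_C r_orth)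
  ultimately show ?thesis unfolding gr_mult_def mulG_def N_def[symmetric] by (rule rep_regularize)
qed

lemma rep_zero: "rep gr_zero e z"
  using relabel_base[of z] by (simp add: rep_def gr_zero_def e_eq_dg)

text \<open>Closedness of the Grassmannian under the operations follows from \<open>Gr\<close>,
  where idempotency and congruence to \<open>e\<close> modulo \<open>KK\<close> are already
  contained.\<close>

lemma rep_grassmannian:
  assumes "rep x B z" "B \<in> Gr"
  shows "x \<in> grassmannian P"
proof -
  have B: "B \<in> DD" "B * B = B" "bas B = q.e"
    using assms(2) by (auto simp: Gr_def Idm_def e_eq_dg dlt_def)
  obtain b a where x: "x = (b, a)" by (cases x)
  have b: "relabel cc b = mat (lead B) P z" and a: "relabel cc a = mat q.e P z"
    using assms(1) B by (simp_all add: rep_def x)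
  have "a = base" using a relabel_base[of z] by (metis relabel_bij_eq_iff[OF bij_cc])
  moreover have "b \<in> Psi P"
    using mat_Psi[OF P, of "lead B" z] relabel_Psi_iff(1)[OF Pp tame_cc bij_cc, of b] by (simp add: b)
  moreover have "b \<odot> b = b"
  proof -
    have "relabel cc (b \<odot> b) = mat (lead (B * B)) P z"
      by (simp add: relabel_bij_mult[OF bij_cc] b mat_ops P)
    then show ?thesis unfolding B(2) b[symmetric] relabel_bij_eq_iff[OF bij_cc] .
  qed
  moreover have "mat_approx P b base"
  proof -
    have "bas B - lead B \<in> KK" using B(1) uminus_K[of "lead B - bas B"] by (simp add: DD_def)
    then have "mat (q.e - lead B) P z \<in> Kmat P" using P by (simp add: KK_def B(3))
    moreover have "mat (q.e - lead B) P z = relabel cc (\<lambda>i j. base i j - b i j)"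
      unfolding mat_ops(4)[OF P] b[symmetric] a[symmetric] \<open>a = base\<close> by (simp add: relabel_bij[OF bij_cc])
    ultimately have "relabel cc (\<lambda>i j. base i j - b i j) \<in> Kmat P" by (simp only:)
    then have "(\<lambda>i j. base i j - b i j) \<in> Kmat P" unfolding relabel_Psi_iff(2)[OF Pp tame_cc bij_cc] .
    then show ?thesis by (simp add: mat_approx_def Kmat_def)
  qed
  ultimately show ?thesis by (auto simp: grassmannian_def x)
qed

lemma grassmannianD:
  assumes "x \<in> grassmannian P"
  shows "snd x = base" "relabel cc (fst x) \<in> Psi P" "relabel cc (fst x) \<odot> relabel cc (fst x) = relabel cc (fst x)"
    "(\<lambda>n m. relabel cc (fst x) n m - mat q.e P z n m) \<in> Kmat P"
proof -
  obtain b where x: "x = (b, base)" and b: "b \<in> Psi P" "b \<odot> b = b" "mat_approx P b base"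
    using assms by (auto simp: grassmannian_def)
  show "snd x = base" by (simp add: x)
  show "relabel cc (fst x) \<in> Psi P" using b(1) relabel_Psi_iff(1)[OF Pp tame_cc bij_cc, of b] by (simp add: x)
  show "relabel cc (fst x) \<odot> relabel cc (fst x) = relabel cc (fst x)"
    by (simp add: x b(2) flip: relabel_bij_mult[OF bij_cc])
  have "(\<lambda>i j. base i j - b i j) \<in> Kmat P" using b(3) by (simp add: mat_approx_def Kmat_def)
  then have "relabel cc (\<lambda>i j. - (base i j - b i j)) \<in> Kmat P"
    unfolding relabel_Psi_iff(2)[OF Pp tame_cc bij_cc] by (rule cpm.Kmat_uminus[OF cpm.intro[OF P]])
  then show "(\<lambda>n m. relabel cc (fst x) n m - mat q.e P z n m) \<in> Kmat P"
    unfolding relabel_base[symmetric] by (simp add: x relabel_bij[OF bij_cc])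
qed

text \<open>\<open>d\<close> is the continuation off the admissible data: \<open>q.e\<close> for
  idempotents and \<open>1\<close> for conjugating elements, so that the equations satisfied by the
  data persist everywhere.\<close>

definition family :: "('z \<Rightarrow> (nat, nat, 'a unitization) matrix) \<Rightarrow> ('z, 'a) psi \<Rightarrow> ('z, 'a) psi" where
  "family f d = mk_psi (\<lambda>Q z. if Q = P \<and> z \<in> Good then f z else mat d Q z)"

lemma mat_family:
  assumes "\<And>z. z \<in> Good \<Longrightarrow> f z \<in> Psi P" "complete_polymetric Q"
  shows "mat (family f d) Q z = (if Q = P \<and> z \<in> Good then f z else mat d Q z)"
  unfolding family_def using assms by (subst mat_mk_psi) (auto simp: mat_Psi)

text \<open>Initial data are coded by \<open>code\<close>, but enter the ring by way of
  \<open>r\<close>; the passage is conjugation with a constant relabeling matrix.\<close>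

lemma family_CC:
  assumes "\<And>z. z \<in> Good \<Longrightarrow> relabel r (f z) \<in> Psi P" "tame r" "bij r" "coded f \<in> Dt"
  shows "family (\<lambda>z. relabel r (f z)) d \<in> CC"
proof (rule CC_I)
  have "assembled_map Dt r" using assms(2,3) by (rule assembled_map_bij)
  then have r: "(\<lambda>_. cmat r) \<in> assembled_nat Dt" "(\<lambda>_. transp (cmat r)) \<in> assembled_nat Dt"
    unfolding assembled_map_def by auto
  show "(\<lambda>z. cmat r \<odot> coded f z \<odot> transp (cmat r)) \<in> assembled_nat Dt"
    by (rule assembled_nat.mult[OF assembled_nat.mult[OF r(1) assembled_nat.data[OF assms(4)]] r(2)])
  fix z assume "z \<in> Good"
  have "(code :: nat \<Rightarrow> nat) \<circ> r = r" by (simp add: code_nat_def)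
  then show "mat (family (\<lambda>z. relabel r (f z)) d) P z = cmat r \<odot> coded f z \<odot> transp (cmat r)"
    using \<open>z \<in> Good\<close> assms(1) P by (simp add: mat_family coded_def cmat_relabel[OF tame_inj[OF assms(2)]])
qed

definition gfam :: "('z \<Rightarrow> (bool \<times> nat, 'a) mpair) \<Rightarrow> ('z, 'a) psi dbl" where
  "gfam x = Dbl (family (\<lambda>z. relabel cc (fst (x z))) q.e) q.e"

lemma gfam:
  assumes x: "\<And>z. z \<in> Good \<Longrightarrow> x z \<in> grassmannian P" and Dt: "coded (\<lambda>z. fst (x z)) \<in> Dt"
  shows "gfam x \<in> Gr" "z \<in> Good \<Longrightarrow> rep (x z) (gfam x) z"
proof -
  let ?l = "family (\<lambda>z. relabel cc (fst (x z))) q.e"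
  note g = grassmannianD[OF x]
  have m: "mat ?l Q z = (if Q = P \<and> z \<in> Good then relabel cc (fst (x z)) else mat q.e Q z)"
    if "complete_polymetric Q" for Q z
    using g(2) that by (rule mat_family)
  have e: "q.e \<in> CC" "q.e * q.e = q.e" using e_D by (auto simp: e_eq_dg DD_def)
  have C: "?l \<in> CC" by (rule family_CC[OF g(2) tame_cc bij_cc Dt])
  have em: "mat q.e Q z \<odot> mat q.e Q z = mat q.e Q z" if "complete_polymetric Q" for Q z
    using mat_ops(5)[OF that, of q.e q.e z] e(2) by simp
  have idem: "?l * ?l = ?l"
    by (rule psi_eqI) (simp add: mat_ops m g(3) em)
  have K: "?l - q.e \<in> KK"
    unfolding KK_def using C e
    by (auto simp: diff_C mat_ops m g(4) mat_zero_def[symmetric] cpm.Kmat_zero[OF cpm.intro])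
  show "gfam x \<in> Gr"
    using C K e idem by (simp add: Gr_def gfam_def Idm_Dbl e_eq_dg)
  show "rep (x z) (gfam x) z" if "z \<in> Good"
    using that g(1)[OF that] relabel_base[of z] P by (simp add: rep_def gfam_def m)
qed

section \<open>Homotopies\<close>

lemma relabel_cc2_block:
  fixes X Y :: "(bool \<times> nat, bool \<times> nat, 'a unitization) matrix"
  shows "relabel cc2 (block_diag X Y) = relabel cc (block_diag (relabel cc X) (relabel cc Y))"
proof -
  have b: "bij (map_prod (\<lambda>x. x) cc :: bool \<times> bool \<times> nat \<Rightarrow> bool \<times> nat)"
    by (rule o_bij[of "map_prod (\<lambda>x. x) ci"]) auto
  have iv: "inv (map_prod (\<lambda>x. x) cc :: bool \<times> bool \<times> nat \<Rightarrow> bool \<times> nat) = map_prod (\<lambda>x. x) ci"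
    by (rule inv_equality) auto
  have "relabel (map_prod (\<lambda>x. x) cc) (block_diag X Y) = block_diag (relabel cc X) (relabel cc Y)"
    by (auto simp: relabel_bij[OF b] iv relabel_bij[OF bij_cc] inv_cc block_diag_def block_def mat_zero_def fun_eq_iff)
  then show ?thesis
    unfolding cc2_def by (simp flip: relabel_nat_comp[OF bij_is_inj[OF bij_cc] bij_is_inj[OF b]])
qed

lemma mat_dsm_rep:
  assumes "rep x B z" shows "mat (q.blk (lead B) 0 0 q.e) P z = relabel cc2 (block_diag (fst x) base)"
  using assms relabel_base[of z] unfolding mat_qblk relabel_cc2_block
  by (simp add: rep_def block_diag_def mat_ops P)

text \<open>Uniqueness rests on associativity, which is available over \<open>nat\<close>;
  \<open>cc2\<close> carries the products there.\<close>

lemma mat_inverse_unique: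
  fixes g h :: "(bool \<times> bool \<times> nat, bool \<times> bool \<times> nat, 'a unitization) matrix"
  assumes "mat_inverse P g h" shows "mat_inv P g = h"
  unfolding mat_inv_def
proof (rule the_equality)
  fix h' assume h': "mat_inverse P g h'"
  note c = cpm.intro[OF P]
  let ?r = "relabel cc2"
  have Psi: "?r g \<in> Psi P" "?r h \<in> Psi P" "?r h' \<in> Psi P"
    using assms h' by (simp_all add: mat_inverse_def relabel_Psi_iff[OF Pp tame_cc2 bij_cc2])
  have inv: "?r h' \<odot> ?r g = mat_one" "?r g \<odot> ?r h = mat_one"
    using assms h' by (simp_all add: mat_inverse_def relabel_bij_ops[OF bij_cc2] flip: relabel_bij_mult[OF bij_cc2])
  have "?r h' = ?r h' \<odot> (?r g \<odot> ?r h)" by (simp add: inv)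
  also have "\<dots> = ?r h' \<odot> ?r g \<odot> ?r h" by (rule cpm.product_assoc[OF c Psi(3,1,2), symmetric])
  also have "\<dots> = ?r h" by (simp add: inv)
  finally show "h' = h" by (simp add: relabel_bij_eq_iff[OF bij_cc2])
qed (rule assms)

text \<open>Base part \<open>1\<close> means \<open>lead g - 1 \<in> KK\<close>, which puts the
  leading part into \<open>K_star\<close>. The matrix in \<open>conjugates\<close> leads from
  \<open>r\<close> to \<open>l\<close>, hence the order in \<open>sim R L\<close>.\<close>

lemma homotopy_of_sim:
  assumes "L \<in> Gr" "R \<in> Gr" "sim R L"
    and "\<And>z. z \<in> Good \<Longrightarrow> rep (l z) L z" "\<And>z. z \<in> Good \<Longrightarrow> rep (r z) R z"
  shows "\<exists>g. assembled Dt g \<and> (\<forall>z\<in>Good. conjugates P (g z) (r z) (l z))"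
proof -
  have G: "R \<in> Idm" "L \<in> Idm" "dlt R = e" "dlt L = e" using assms(1,2) by (auto simp: Gr_def)
  obtain g g' where g: "g \<in> DD" "g' \<in> DD" "g * g' = 1" "g' * g = 1" "dlt g = 1" "dlt g' = 1"
    "g * blk R 0 0 e * g' = blk L 0 0 e"
    using sim_imp_homotopy[OF G assms(3)] by blast
  have bas: "bas g = 1" using g(5) by (simp add: dlt_def one_dbl_def)
  obtain G where G: "G \<in> assembled_nat Dt" "\<And>z. z \<in> Good \<Longrightarrow> mat (lead g) P z = G z"
    using g(1) CC_E[of "lead g"] unfolding DD_def by blast
  \<comment> \<open>The ring element is indexed by \<open>nat\<close>, a homotopy by pairs of bits
    and a number. Coding \<open>h\<close> again is a constant relabeling of \<open>G\<close>, so it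
    remains assembled.\<close>
  define h where "h z = relabel (inv cc2) (G z)" for z
  have rh: "relabel cc2 (relabel (inv cc2) X) = X" for X :: "(nat, nat, 'a unitization) matrix"
    by (simp add: relabel_bij bij_cc2 bij_imp_bij_inv inv_inv_eq surj_f_inv_f[OF bij_is_surj[OF bij_cc2]])
  have "assembled Dt h"
  proof -
    have "assembled_map Dt (inv cc2)" by (intro assembled_map_bij tame_inv tame_cc2 bij_cc2 bij_imp_bij_inv)
    then have "(\<lambda>z. cmat (inv cc2) \<odot> G z \<odot> transp (cmat (inv cc2))) \<in> assembled_nat Dt"
      unfolding assembled_map_def using assembled_nat.mult[OF assembled_nat.mult[OF _ G(1)]] by blast
    moreover have "cmat (inv cc2) \<odot> G z \<odot> transp (cmat (inv cc2)) = coded h z" for z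
    proof -
      have i: "inj (inv cc2)" using bij_imp_bij_inv[OF bij_cc2] by (rule bij_is_inj)
      have "relabel code (G z) = G z" by (simp add: relabel_def code_nat_def)
      then show ?thesis
        using cmat_relabel[OF i, of "G z"] relabel_nat_comp[OF inj_code i, of "G z"] by (simp add: coded_def h_def)
    qed
    ultimately show ?thesis unfolding assembled_def by (simp only:)
  qed
  moreover have "conjugates P (h z) (r z) (l z)" if z: "z \<in> Good" for z
  proof -
    define k where "k = relabel (inv cc2) (mat (lead g') P z)"
    have hk: "relabel cc2 (h z) = mat (lead g) P z" "relabel cc2 k = mat (lead g') P z"
      by (simp_all add: h_def k_def rh G(2)[OF z])
    have m: "mat (lead (x * y)) P z = mat (lead x) P z \<odot> mat (lead y) P z" for x y :: "('z, 'a) psi dbl"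
      by (simp add: mat_ops P)
    have one: "mat (lead (1 :: ('z, 'a) psi dbl)) P z = mat_one" by (simp add: mat_psi_one P)
    have inv: "mat_inverse P (h z) k"
      unfolding mat_inverse_def
    proof (intro conjI)
      show "h z \<in> Psi P" "k \<in> Psi P"
        using mat_Psi[OF P, of "lead g" z] mat_Psi[OF P, of "lead g'" z]
        unfolding hk[symmetric] relabel_Psi_iff(1)[OF Pp tame_cc2 bij_cc2] .
      show "h z \<odot> k = mat_one" "k \<odot> h z = mat_one"
        using m[of g g'] m[of g' g] g(3,4) one
        by (simp_all add: relabel_bij_eq_iff[OF bij_cc2, symmetric] relabel_bij_mult[OF bij_cc2] relabel_bij_ops[OF bij_cc2] hk)
    qed
    have "lead g - 1 \<in> KK" using g(1) bas by (simp add: DD_def)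
    then have "mat (lead g - 1) P z \<in> Kmat P" using P by (simp add: KK_def)
    moreover have "mat (lead g - 1) P z = relabel cc2 (\<lambda>x y. h z x y - mat_one x y)"
      unfolding mat_ops(4)[OF P] hk(1)[symmetric] mat_psi_one[OF P]
      by (auto simp: relabel_bij[OF bij_cc2] mat_one_def fun_eq_iff inj_eq[OF bij_is_inj[OF bij_imp_bij_inv[OF bij_cc2]]])
    ultimately have "relabel cc2 (\<lambda>x y. h z x y - mat_one x y) \<in> Kmat P" by (simp only:)
    then have "(\<lambda>x y. h z x y - mat_one x y) \<in> Kmat P" unfolding relabel_Psi_iff(2)[OF Pp tame_cc2 bij_cc2] .
    then obtain A where A: "A \<in> rapid P" "(\<lambda>x y. h z x y - mat_one x y) = embed A" by (auto simp: Kmat_def)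
    have "h z = mat_one \<boxplus> embed A" unfolding A(2)[symmetric] by (simp add: mat_add_def)
    then have "h z \<in> K_star P" using A(1) inv unfolding K_star_def by blast
    moreover have "h z \<odot> block_diag (fst (r z)) base \<odot> mat_inv P (h z) = block_diag (fst (l z)) base"
    proof -
      have dsm: "lead (blk X 0 0 e) = q.blk (lead X) 0 0 q.e" for X
        by (cases X) (simp add: e_eq_dg)
      have "relabel cc2 (h z \<odot> block_diag (fst (r z)) base \<odot> k) = mat (lead (g * blk R 0 0 e * g')) P z"
        unfolding m relabel_bij_mult[OF bij_cc2] hk dsm mat_dsm_rep[OF assms(5)[OF z]] ..
      also have "\<dots> = relabel cc2 (block_diag (fst (l z)) base)"
        unfolding g(7) dsm mat_dsm_rep[OF assms(4)[OF z]] ..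
      finally show ?thesis unfolding mat_inverse_unique[OF inv] by (simp add: relabel_bij_eq_iff[OF bij_cc2])
    qed
    ultimately show ?thesis unfolding conjugates_def by blast
  qed
  ultimately show ?thesis by blast
qed

end

context hring_setting
begin

lemma conjugatesD:
  assumes "conjugates P h x' x"
  shows "mat_inverse P h (mat_inv P h)" "(\<lambda>n m. h n m - mat_one n m) \<in> Kmat P"
    "h \<odot> block_diag (fst x') base \<odot> mat_inv P h = block_diag (fst x) base"
proof -
  obtain A k where A: "A \<in> rapid P" "h = mat_one \<boxplus> embed A" and k: "mat_inverse P h k"
    using assms by (auto simp: conjugates_def K_star_def)
  show "mat_inverse P h (mat_inv P h)" unfolding mat_inverse_unique[OF k] by (rule k)
  have "(\<lambda>n m. h n m - mat_one n m) = embed A" by (simp add: A(2) mat_add_def)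
  then show "(\<lambda>n m. h n m - mat_one n m) \<in> Kmat P" using A(1) by (simp add: Kmat_def)
  show "h \<odot> block_diag (fst x') base \<odot> mat_inv P h = block_diag (fst x) base"
    using assms by (simp add: conjugates_def)
qed

lemma mat_family_outside:
  assumes "\<And>z. z \<in> Good \<Longrightarrow> x z \<in> grassmannian P" "complete_polymetric Q" "\<not> (Q = P \<and> z \<in> Good)"
  shows "mat (family (\<lambda>z. relabel cc (fst (x z))) d) Q z = mat d Q z"
proof -
  have "mat (family (\<lambda>z. relabel cc (fst (x z))) d) Q z
      = (if Q = P \<and> z \<in> Good then relabel cc (fst (x z)) else mat d Q z)"
    using assms(1,2) by (intro mat_family grassmannianD(2))
  then show ?thesis using assms(3) by (simp only: if_False)
qed

text \<open>A given homotopy becomes a conjugating pair with base part \<open>1\<close>. Its inverse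
  has to belong to the ring as well, and inversion is no polynomial operation; for this reason the
  inverses are counted among the initial data.\<close>

lemma sim_of_homotopy:
  assumes x: "\<And>z. z \<in> Good \<Longrightarrow> x z \<in> grassmannian P" "coded (\<lambda>z. fst (x z)) \<in> Dt"
    and x': "\<And>z. z \<in> Good \<Longrightarrow> x' z \<in> grassmannian P" "coded (\<lambda>z. fst (x' z)) \<in> Dt"
    and h: "\<And>z. z \<in> Good \<Longrightarrow> conjugates P (h z) (x' z) (x z)" "coded h \<in> Dt" "coded (\<lambda>z. mat_inv P (h z)) \<in> Dt"
  shows "sim (gfam x') (gfam x)"
proof -
  define H where "H = family (\<lambda>z. relabel cc2 (h z)) 1"
  define H' where "H' = family (\<lambda>z. relabel cc2 (mat_inv P (h z))) 1"
  note c = conjugatesD[OF h(1)]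
  have Psi: "relabel cc2 (h z) \<in> Psi P" "relabel cc2 (mat_inv P (h z)) \<in> Psi P" if "z \<in> Good" for z
    using c(1)[OF that] unfolding relabel_Psi_iff(1)[OF Pp tame_cc2 bij_cc2] by (simp_all add: mat_inverse_def)
  have H: "mat H Q z = (if Q = P \<and> z \<in> Good then relabel cc2 (h z) else mat_one)"
    "mat H' Q z = (if Q = P \<and> z \<in> Good then relabel cc2 (mat_inv P (h z)) else mat_one)"
    if "complete_polymetric Q" for Q z
    unfolding H_def H'_def using that by (simp_all add: mat_family Psi mat_psi_one)
  have C: "H \<in> CC" "H' \<in> CC"
    unfolding H_def H'_def using Psi by (auto intro!: family_CC tame_cc2 bij_cc2 h)
  have one_one: "mat_one \<odot> mat_one = (mat_one :: (nat, nat, 'a unitization) matrix)"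
    using mat_ops(5)[OF P, of 1 1] by (simp add: mat_psi_one[OF P])
  have inv: "relabel cc2 (h z) \<odot> relabel cc2 (mat_inv P (h z)) = mat_one"
    "relabel cc2 (mat_inv P (h z)) \<odot> relabel cc2 (h z) = mat_one" if "z \<in> Good" for z
    using c(1)[OF that] unfolding relabel_bij_mult[OF bij_cc2, symmetric]
    by (simp_all add: mat_inverse_def relabel_bij_ops(3)[OF bij_cc2])
  have HH: "H * H' = 1" "H' * H = 1"
    by (rule psi_eqI; simp add: mat_ops H mat_psi_one inv one_one)+
  have K: "H - 1 \<in> KK"
    unfolding KK_def
  proof (intro CollectI conjI allI impI)
    show "H - 1 \<in> CC" using C one_CC by (intro diff_C)
    fix Q :: "('a \<Rightarrow> real) set" and z :: 'z
    assume Q: "complete_polymetric Q"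
    show "mat (H - 1) Q z \<in> Kmat Q"
    proof (cases "Q = P \<and> z \<in> Good")
      case True
      then have "mat (H - 1) Q z = relabel cc2 (\<lambda>n m. h z n m - mat_one n m)"
        unfolding mat_ops(4)[OF Q] mat_psi_one[OF Q] H(1)[OF Q]
        by (auto simp: relabel_bij[OF bij_cc2] mat_one_def fun_eq_iff inj_eq[OF bij_is_inj[OF bij_imp_bij_inv[OF bij_cc2]]])
      then show ?thesis using c(2)[of z] True relabel_Psi_iff(2)[OF Pp tame_cc2 bij_cc2] by simp
    next
      case False
      then have "mat (H - 1) Q z = mat_zero"
        unfolding mat_ops(4)[OF Q] mat_psi_one[OF Q] H(1)[OF Q] if_not_P[OF False] by (simp add: mat_zero_def)
      then show ?thesis using Q by (simp add: cpm.Kmat_zero[OF cpm.intro])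
    qed
  qed
  \<comment> \<open>Rapid decrease is given for \<open>H - 1\<close> only. This identity passes it
    on to the inverse, since multiplication by \<open>CC\<close> preserves
    \<open>KK\<close>.\<close>
  have "H' - 1 = - ((H - 1) * H')" by (simp add: left_diff_distrib HH)
  then have K': "H' - 1 \<in> KK" using K C by (simp only: uminus_K mult_K)
  have DD: "Dbl H 1 \<in> DD" "Dbl H' 1 \<in> DD" using C K K' one_CC by (simp_all add: DD_iff)
  define l where "l = family (\<lambda>z. relabel cc (fst (x z))) q.e"
  define l' where "l' = family (\<lambda>z. relabel cc (fst (x' z))) q.e"
  have G: "gfam x \<in> Gr" "gfam x' \<in> Gr" using gfam(1) x x' by blast+
  have l: "gfam x = Dbl l q.e" "gfam x' = Dbl l' q.e" by (simp_all add: gfam_def l_def l'_def)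
  have "H * q.blk l' 0 0 q.e * H' = q.blk l 0 0 q.e"
  proof (rule psi_eqI)
    fix Q :: "('a \<Rightarrow> real) set" and z :: 'z
    assume Q: "complete_polymetric Q"
    show "mat (H * q.blk l' 0 0 q.e * H') Q z = mat (q.blk l 0 0 q.e) Q z"
    proof (cases "Q = P \<and> z \<in> Good")
      case True
      then have z: "z \<in> Good" and QP: "Q = P" by auto
      have m: "mat (q.blk l 0 0 q.e) P z = relabel cc2 (block_diag (fst (x z)) base)"
        "mat (q.blk l' 0 0 q.e) P z = relabel cc2 (block_diag (fst (x' z)) base)"
        using mat_dsm_rep[OF gfam(2)[OF x z]] mat_dsm_rep[OF gfam(2)[OF x' z]] by (simp_all add: l)
      show ?thesis
        unfolding QP mat_ops(5)[OF P] m H[OF P] if_P[OF conjI[OF refl z]]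
        by (simp only: relabel_bij_mult[OF bij_cc2, symmetric] c(3)[OF z])
    next
      \<comment> \<open>Here both idempotents have the continuation \<open>q.e\<close>, and the
        conjugating elements are trivial.\<close>
      case False
      have ll: "mat l Q z = mat q.e Q z" "mat l' Q z = mat q.e Q z"
        unfolding l_def l'_def using Q False by (auto intro!: mat_family_outside x(1) x'(1))
      have "mat (q.blk l' 0 0 q.e) Q z = mat (q.blk l 0 0 q.e) Q z"
        unfolding q.blk_def mat_block[OF Q] ll ..
      moreover have "mat (H * q.blk l' 0 0 q.e * H') Q z = mat (1 * q.blk l' 0 0 q.e * 1) Q z"
        unfolding mat_ops(5)[OF Q] H[OF Q] mat_psi_one[OF Q] if_not_P[OF False] ..
      ultimately show ?thesis by simp
    qed
  qed
  then have "Dbl H 1 * blk (gfam x') 0 0 e * Dbl H' 1 = blk (gfam x) 0 0 e"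
    by (simp add: l e_eq_dg)
  then have conj: "conjug (blk (gfam x') 0 0 e) (blk (gfam x) 0 0 e)"
    using DD HH by (intro conjugI[of "Dbl H 1" "Dbl H' 1"]) (simp_all add: one_dbl_def)
  have s: "sim (blk B 0 0 e) B" if "B \<in> Gr" for B
    using Gr_Idm[OF that] by (intro sim_dsm_diag Idm_e \<delta>_e)
  show ?thesis
    using sim_trans[OF sim_sym[OF s[OF G(2)]] sim_trans[OF sim_conjug[OF conj] s[OF G(1)]]] .
qed

end

section \<open>The unit of the coefficient ring as a one-by-one matrix\<close>

definition corner :: "'r::zero \<Rightarrow> (nat, nat, 'r) matrix" where
  "corner a = (\<lambda>k l. if k = 0 \<and> l = 0 then a else 0)"

lemma corner_mult: "corner a \<odot> corner b = corner (a * b :: 'r::{comm_ring, t2_space})"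
proof (intro ext)
  fix k l
  show "(corner a \<odot> corner b) k l = corner (a * b) k l"
    unfolding mat_mult_def by (subst infsum_single[where i = 0]) (auto simp: corner_def)
qed

lemma rpd_corner:
  assumes "q 0 = 0" "0 \<le> q a"
  shows "rpd (\<lambda>n m. q (corner a n m))"
  unfolding rpd_def
proof (intro allI exI)
  fix k n m
  show "wt n ^ k * wt m ^ k * q (corner a n m) \<le> q a"
    using assms by (auto simp: corner_def wt_nat)
qed

lemma corner_Psi:
  fixes a :: "'a::{comm_ring, topological_space} unitization"
  assumes "polymetric P" shows "corner a \<in> Psi P" "scal a = 0 \<Longrightarrow> corner a \<in> Kmat P"
proof -
  have r: "rpd (\<lambda>n m. q (corner a n m))" if "q \<in> seminorm_sums P" for q
    using seminorm_sums_props(1,2)[OF assms that] by (rule rpd_corner[rotated])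
  show "corner a \<in> Psi P"
    unfolding Psi_iff[OF assms] using rpd_imp_psd[OF r] seminorm_sums_props(1)[OF assms] by blast
  show "corner a \<in> Kmat P" if "scal a = 0"
    unfolding Kmat_iff[OF assms] using that r by (auto simp: corner_def)
qed

lemma mat_const_corner:
  assumes "complete_polymetric P" shows "mat (const_psi (corner a)) P z = corner a"
  using assms unfolding const_psi_def by (subst mat_mk_psi) (auto intro!: corner_Psi simp: complete_polymetric_def)

lemma relabel_unit: "relabel r A = (\<lambda>k l. if k = r () \<and> l = r () then A () () else 0)"
proof -
  have "range r = {r ()}" by auto
  then show ?thesis by (auto simp: relabel_def fun_eq_iff)
qed

lemma tame_unit: "tame (id :: unit \<Rightarrow> unit)"
  by (rule tameI[of _ 1 1 1 1]) auto

lemma cmat_unit_id: "cmat (id :: unit \<Rightarrow> unit) = corner 1"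
proof -
  have "range (code :: unit \<Rightarrow> nat) = {0}" by (auto simp: code_unit_def)
  then show ?thesis by (auto simp: cmat_def relabel_matrix_def code_unit_def corner_def fun_eq_iff)
qed

lemma Unitization_unit:
  fixes a :: "'a::comm_ring unitization"
  assumes "\<And>b. u * b = b" "scal a = 0"
  shows "a * Unitization 0 u = a"
proof -
  obtain y where a: "a = Unitization 0 y" using assms(2) by (cases a) auto
  show ?thesis using assms(1)[of y] by (simp add: a times_unitization_def mult.commute)
qed

locale unital_hring_setting = hring_setting P Good Dt \<theta>1 \<theta>2 \<theta>3 left
  for P :: "('a::{comm_ring, topological_ab_group_add, topological_semigroup_mult, t2_space} \<Rightarrow> real) set"
    and Good :: "'z set" and Dt :: "('z \<Rightarrow> (nat, nat, 'a unitization) matrix) set"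
    and \<theta>1 \<theta>2 \<theta>3 left +
  fixes u :: 'a and \<theta>4 :: "unit \<Rightarrow> nat"
  assumes \<theta>4: "relabeling \<theta>4" and u: "u * a = a"
    and u_Dt: "(\<lambda>_. relabel code (fst (pair_one u))) \<in> Dt"
begin

lemma unit_corner: "relabel code (fst (pair_one u)) = corner (Unitization 0 u)"
  by (simp add: relabel_unit pair_one_def corner_def code_unit_def)

lemma tame_\<theta>4: "tame \<theta>4" using \<theta>4 by (rule relabeling_tame)

lemma unital_hring_cuntz_axioms:
  "unital_hring_cuntz CC KK S0 S1 T0 T1 tensor_psi (rel flip_map) (rel assoc_map) (rel' assoc_map)
    (rel \<rho>0) (rel \<rho>1) (rel \<rho>2) (rel \<rho>3) (rel' \<rho>0) (rel' \<rho>1) (rel' \<rho>2) (rel' \<rho>3) prd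
    (rel (id :: unit \<Rightarrow> unit)) (const_psi (corner (Unitization 0 u))) (rel \<theta>4) (rel' \<theta>4) (rel unit_map) (rel' unit_map)"
proof (intro unital_hring_cuntz.intro unital_hring_cuntz_axioms.intro hring_cuntz_axioms)
  let ?q = "rel (id :: unit \<Rightarrow> unit) :: ('z, 'a) psi" and ?v = "const_psi (corner (Unitization 0 u)) :: ('z, 'a) psi"
  have q: "mat ?q Q z = corner 1" if "complete_polymetric Q" for Q z
    using that by (simp add: mat_rel(1)[OF tame_unit] cmat_unit_id)
  have v: "mat ?v Q z = corner (Unitization 0 u)" if "complete_polymetric Q" for Q z
    using that by (rule mat_const_corner)
  have "relabeling (id :: unit \<Rightarrow> unit)" by (intro relabeling_bij tame_unit) simp
  then show "?q \<in> CC" by (intro rel_CC tame_unit assembled_map_relabeling)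
  show v_CC: "?v \<in> CC"
    by (rule CC_I[OF assembled_nat.data[OF u_Dt]]) (simp add: unit_corner v P)
  show "rel \<theta>4 \<in> CC" "rel' \<theta>4 \<in> CC" by (intro rel_CC tame_\<theta>4 assembled_map_relabeling \<theta>4)+
  show "rel unit_map \<in> CC" "rel' unit_map \<in> CC" by (intro rel_CC_bij unit_map)+
  show "?v \<in> KK"
    unfolding KK_def using v_CC by (auto simp: v complete_polymetric_def intro!: corner_Psi(2))
  have uu: "Unitization 0 u * Unitization 0 u = Unitization 0 u"
    by (rule Unitization_unit) (simp_all add: u)
  show "?q * ?q = ?q" "?q * ?v = ?v" "?v * ?q = ?v" "?v * ?v = ?v"
    by (rule psi_eqI; simp add: mat_ops q v corner_mult uu)+
  \<comment> \<open>The source of \<open>\<theta>4\<close> is one point with code 0, so the product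
    is the matrix unit there.\<close>
  show "rel' \<theta>4 * rel \<theta>4 = ?q"
  proof (rule psi_eqI)
    fix Q :: "('a \<Rightarrow> real) set" and z :: 'z
    assume Q: "complete_polymetric Q"
    show "mat (rel' \<theta>4 * rel \<theta>4) Q z = mat ?q Q z"
      unfolding q[OF Q] mat_ops(5)[OF Q] mat_rel[OF tame_\<theta>4 Q]
      by (auto simp: cmat_transp_mult corner_def code_unit_def fun_eq_iff)
  qed
  show "rel' unit_map * rel unit_map = 1" by (intro rel'_rel unit_map)
  \<comment> \<open>\<open>unit_map\<close> places \<open>n\<close> at the code of the pair of
    \<open>n\<close> and 0, which is where a Kronecker product with second factor \<open>?q\<close>
    lives.\<close>
  show "rel unit_map * x * rel' unit_map = tensor_psi x ?q" for x
  proof (rule psi_eqI)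
    fix Q :: "('a \<Rightarrow> real) set" and z :: 'z
    assume Q: "complete_polymetric Q"
    have i: "inj unit_map" using unit_map(1) by (rule tame_inj)
    have n: "code (unit_map n) = prod_encode (n, 0)" for n
      by (simp add: code_prod_def unit_map_def code_nat_def code_unit_def)
    have ic: "inj (code \<circ> unit_map)" by (rule inj_compose[OF inj_code i])
    have iv: "inv (code \<circ> unit_map) (prod_encode (n, 0)) = n" for n
      using inv_f_f[OF ic, of n] by (simp add: n)
    have "relabel code (mat x Q z) = mat x Q z" by (simp add: relabel_def code_nat_def)
    then have "mat (rel unit_map * x * rel' unit_map) Q z = relabel (code \<circ> unit_map) (mat x Q z)"
      using cmat_relabel[OF i, of "mat x Q z"] by (simp add: mat_ops[OF Q] mat_rel[OF unit_map(1) Q])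
    also have "\<dots> = kron_nat (mat x Q z) (corner 1)"
    proof (intro ext)
      fix k l
      obtain a b c d where kl: "k = prod_encode (a, b)" "l = prod_encode (c, d)"
        by (metis prod_decode_inverse surj_pair)
      show "relabel (code \<circ> unit_map) (mat x Q z) k l = kron_nat (mat x Q z) (corner 1) k l"
        unfolding kl by (auto simp: relabel_def kron_nat_apply corner_def image_iff n iv)
    qed
    finally show "mat (rel unit_map * x * rel' unit_map) Q z = mat (tensor_psi x ?q) Q z"
      by (simp only: mat_tensor[OF Q] q[OF Q])
  qed
  \<comment> \<open>The entries of \<open>x\<close> have scalar part 0; on such elements the unit of
    \<AA> acts like the unit of the extension.\<close>
  show "tensor_psi x ?v = tensor_psi x ?q" if "x \<in> KK" for x
  proof (rule psi_eqI)
    fix Q :: "('a \<Rightarrow> real) set" and z :: 'z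
    assume Q: "complete_polymetric Q"
    then have "mat x Q z \<in> Kmat Q" "polymetric Q" using that by (auto simp: KK_def complete_polymetric_def)
    then have s: "scal (mat x Q z n m) = 0" for n m by (simp add: Kmat_iff)
    show "mat (tensor_psi x ?v) Q z = mat (tensor_psi x ?q) Q z"
      unfolding mat_tensor[OF Q] v[OF Q] q[OF Q]
      by (auto simp: kron_nat_apply corner_def fun_eq_iff Unitization_unit[OF u s])
  qed
qed

sublocale unital_hring_cuntz CC KK S0 S1 T0 T1 tensor_psi "rel flip_map" "rel assoc_map" "rel' assoc_map"
    "rel \<rho>0" "rel \<rho>1" "rel \<rho>2" "rel \<rho>3" "rel' \<rho>0" "rel' \<rho>1" "rel' \<rho>2" "rel' \<rho>3" prd
    "rel (id :: unit \<Rightarrow> unit)" "const_psi (corner (Unitization 0 u))" "rel \<theta>4" "rel' \<theta>4" "rel unit_map" "rel' unit_map"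
  by (rule unital_hring_cuntz_axioms)

lemma rep_one: "rep (gr_one \<theta>4 u) oneG z"
  unfolding gr_one_def oneG_def
proof (rule rep_regularize)
  let ?v = "const_psi (corner (Unitization 0 u)) :: ('z, 'a) psi"
  show "dg (rel \<theta>4) * Dbl ?v 0 * dg (rel' \<theta>4) \<in> Idm" by (rule oneG(3))
  have "mat (rel \<theta>4 * ?v * rel' \<theta>4) P z = relabel (code \<circ> \<theta>4) (fst (pair_one u))"
    using cmat_relabel[OF tame_inj[OF tame_\<theta>4], of "fst (pair_one u)"]
    by (simp add: mat_ops[OF P] mat_rel[OF tame_\<theta>4 P] mat_const_corner[OF P] unit_corner)
  moreover have "(code \<circ> \<theta>4) = \<theta>4" by (simp add: code_nat_def)
  ultimately show "nrep (pair_relabel \<theta>4 (pair_one u)) (dg (rel \<theta>4) * Dbl ?v 0 * dg (rel' \<theta>4)) z"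
    by (simp add: nrep_def pair_relabel_def pair_one_def mat_ops P relabel_unit mat_zero_def)
qed

end

section \<open>Identities and congruences for represented families\<close>

context hring_setting
begin

definition represents :: "('z \<Rightarrow> (bool \<times> nat, 'a) mpair) \<Rightarrow> ('z, 'a) psi dbl \<Rightarrow> bool" where
  "represents x B \<longleftrightarrow> B \<in> Gr \<and> (\<forall>z\<in>Good. rep (x z) B z)"

definition homotopic :: "('z \<Rightarrow> (bool \<times> nat, 'a) mpair) \<Rightarrow> ('z \<Rightarrow> (bool \<times> nat, 'a) mpair) \<Rightarrow> bool" where
  "homotopic l r \<longleftrightarrow> l ` Good \<subseteq> grassmannian P \<and> r ` Good \<subseteq> grassmannian P \<and>
     (\<exists>g. assembled Dt g \<and> (\<forall>z\<in>Good. conjugates P (g z) (r z) (l z)))"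

text \<open>The similarity runs from the right side to the left one, as conjugation does in
  \<open>conjugates\<close>; this is why the identities are applied through \<open>sim_sym\<close>
  below.\<close>

lemma homotopicI:
  assumes "represents l L" "represents r R" "sim R L" shows "homotopic l r"
  using assms homotopy_of_sim[of L R l r] rep_grassmannian
  unfolding homotopic_def represents_def by blast

lemma represents_gfam:
  assumes "\<And>z. z \<in> Good \<Longrightarrow> x z \<in> grassmannian P" "coded (\<lambda>z. fst (x z)) \<in> Dt"
  shows "represents x (gfam x)"
  unfolding represents_def using gfam(1)[of x, OF assms] gfam(2)[of x, OF assms] by auto

lemma represents_Idm: "represents x A \<Longrightarrow> A \<in> Idm"
  by (simp add: represents_def Gr_Idm)

lemma represents_add:
  "represents x A \<Longrightarrow> represents y B \<Longrightarrow> represents (\<lambda>z. gr_add \<theta>1 (x z) (y z)) (addG A B)"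
  by (simp add: represents_def rep_add Gr_Idm addG)

lemma represents_neg: "represents x A \<Longrightarrow> represents (\<lambda>z. gr_neg \<theta>2 (x z)) (negG A)"
  by (simp add: represents_def rep_neg Gr_Idm negG)

lemma represents_mult:
  "represents x A \<Longrightarrow> represents y B \<Longrightarrow> represents (\<lambda>z. gr_mult tens_pair \<theta>3 (x z) (y z)) (mulG A B)"
  by (simp add: represents_def rep_mul Gr_Idm mulG)

lemma represents_zero: "represents (\<lambda>z. gr_zero) e"
  by (simp add: represents_def rep_zero e_Gr)

lemmas represents_ops = represents_add represents_neg represents_mult represents_zero

lemma homotopic_identities:
  assumes r: "represents x A" "represents y B" "represents w D"
  shows "homotopic (\<lambda>z. gr_add \<theta>1 (gr_add \<theta>1 (x z) (y z)) (w z)) (\<lambda>z. gr_add \<theta>1 (x z) (gr_add \<theta>1 (y z) (w z)))"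
    "homotopic (\<lambda>z. gr_mult tens_pair \<theta>3 (gr_mult tens_pair \<theta>3 (x z) (y z)) (w z))
      (\<lambda>z. gr_mult tens_pair \<theta>3 (x z) (gr_mult tens_pair \<theta>3 (y z) (w z)))"
    "homotopic (\<lambda>z. gr_mult tens_pair \<theta>3 (x z) (gr_add \<theta>1 (y z) (w z)))
      (\<lambda>z. gr_add \<theta>1 (gr_mult tens_pair \<theta>3 (x z) (y z)) (gr_mult tens_pair \<theta>3 (x z) (w z)))"
    "homotopic (\<lambda>z. gr_mult tens_pair \<theta>3 (gr_add \<theta>1 (x z) (y z)) (w z))
      (\<lambda>z. gr_add \<theta>1 (gr_mult tens_pair \<theta>3 (x z) (w z)) (gr_mult tens_pair \<theta>3 (y z) (w z)))"
    "homotopic (\<lambda>z. gr_add \<theta>1 (x z) (y z)) (\<lambda>z. gr_add \<theta>1 (y z) (x z))"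
    "homotopic (\<lambda>z. gr_mult tens_pair \<theta>3 (x z) (y z)) (\<lambda>z. gr_mult tens_pair \<theta>3 (y z) (x z))"
    "homotopic (\<lambda>z. gr_add \<theta>1 (x z) gr_zero) x"
    "homotopic (\<lambda>z. gr_add \<theta>1 (x z) (gr_neg \<theta>2 (x z))) (\<lambda>z. gr_zero)"
proof -
  note I = r[THEN represents_Idm]
  show "homotopic (\<lambda>z. gr_add \<theta>1 (gr_add \<theta>1 (x z) (y z)) (w z)) (\<lambda>z. gr_add \<theta>1 (x z) (gr_add \<theta>1 (y z) (w z)))"
    by (rule homotopicI[OF _ _ sim_sym[OF addG_assoc[OF I]]]) (intro represents_ops r)+
  show "homotopic (\<lambda>z. gr_mult tens_pair \<theta>3 (gr_mult tens_pair \<theta>3 (x z) (y z)) (w z))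
      (\<lambda>z. gr_mult tens_pair \<theta>3 (x z) (gr_mult tens_pair \<theta>3 (y z) (w z)))"
    by (rule homotopicI[OF _ _ sim_sym[OF mulG_assoc[OF I]]]) (intro represents_ops r)+
  show "homotopic (\<lambda>z. gr_mult tens_pair \<theta>3 (x z) (gr_add \<theta>1 (y z) (w z)))
      (\<lambda>z. gr_add \<theta>1 (gr_mult tens_pair \<theta>3 (x z) (y z)) (gr_mult tens_pair \<theta>3 (x z) (w z)))"
    by (rule homotopicI[OF _ _ sim_sym[OF mulG_distrib_left[OF I]]]) (intro represents_ops r)+
  show "homotopic (\<lambda>z. gr_mult tens_pair \<theta>3 (gr_add \<theta>1 (x z) (y z)) (w z))
      (\<lambda>z. gr_add \<theta>1 (gr_mult tens_pair \<theta>3 (x z) (w z)) (gr_mult tens_pair \<theta>3 (y z) (w z)))"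
    by (rule homotopicI[OF _ _ sim_sym[OF mulG_distrib_right[OF I]]]) (intro represents_ops r)+
  show "homotopic (\<lambda>z. gr_add \<theta>1 (x z) (y z)) (\<lambda>z. gr_add \<theta>1 (y z) (x z))"
    by (rule homotopicI[OF _ _ sim_sym[OF addG_comm[OF I(1,2)]]]) (intro represents_ops r)+
  show "homotopic (\<lambda>z. gr_mult tens_pair \<theta>3 (x z) (y z)) (\<lambda>z. gr_mult tens_pair \<theta>3 (y z) (x z))"
    by (rule homotopicI[OF _ _ sim_sym[OF mulG_comm[OF I(1,2)]]]) (intro represents_ops r)+
  show "homotopic (\<lambda>z. gr_add \<theta>1 (x z) gr_zero) x"
    by (rule homotopicI[OF _ _ sim_sym[OF addG_zero[OF I(1)]]]) (intro represents_ops r)+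
  show "homotopic (\<lambda>z. gr_add \<theta>1 (x z) (gr_neg \<theta>2 (x z))) (\<lambda>z. gr_zero)"
    by (rule homotopicI[OF _ _ sim_sym[OF addG_neg[OF I(1)]]]) (intro represents_ops r)+
qed

lemma homotopic_cong:
  assumes r: "represents x A" "represents x' A'" "represents y B" "represents y' B'" and s: "sim A' A" "sim B' B"
  shows "homotopic (\<lambda>z. gr_add \<theta>1 (x z) (y z)) (\<lambda>z. gr_add \<theta>1 (x' z) (y' z))"
    "homotopic (\<lambda>z. gr_mult tens_pair \<theta>3 (x z) (y z)) (\<lambda>z. gr_mult tens_pair \<theta>3 (x' z) (y' z))"
    "homotopic (\<lambda>z. gr_neg \<theta>2 (x z)) (\<lambda>z. gr_neg \<theta>2 (x' z))"
proof -
  note I = r[THEN represents_Idm]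
  show "homotopic (\<lambda>z. gr_add \<theta>1 (x z) (y z)) (\<lambda>z. gr_add \<theta>1 (x' z) (y' z))"
    by (rule homotopicI[OF _ _ addG_cong[OF I(2,1,4,3) s]]) (intro represents_ops r)+
  show "homotopic (\<lambda>z. gr_mult tens_pair \<theta>3 (x z) (y z)) (\<lambda>z. gr_mult tens_pair \<theta>3 (x' z) (y' z))"
    by (rule homotopicI[OF _ _ mulG_cong[OF I(2,1,4,3) s]]) (intro represents_ops r)+
  show "homotopic (\<lambda>z. gr_neg \<theta>2 (x z)) (\<lambda>z. gr_neg \<theta>2 (x' z))"
    by (rule homotopicI[OF _ _ negG_cong[OF I(2,1) s(1)]]) (intro represents_ops r)+
qed

lemma homotopic_refl: "represents x A \<Longrightarrow> homotopic x x"
  by (rule homotopicI[OF _ _ sim_refl])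

end

context unital_hring_setting
begin

lemma represents_one: "represents (\<lambda>z. gr_one \<theta>4 u) oneG"
  by (simp add: represents_def rep_one oneG)

lemma homotopic_unit:
  assumes r: "represents x A"
  shows "homotopic (\<lambda>z. gr_mult tens_pair \<theta>3 (x z) (gr_one \<theta>4 u)) x"
    "homotopic x (\<lambda>z. gr_mult tens_pair \<theta>3 (gr_one \<theta>4 u) (x z))"
proof -
  note I = r[THEN represents_Idm]
  show "homotopic (\<lambda>z. gr_mult tens_pair \<theta>3 (x z) (gr_one \<theta>4 u)) x"
    by (rule homotopicI[OF _ _ sim_sym[OF mulG_one[OF I]]]) (intro represents_ops represents_one r)+
  show "homotopic x (\<lambda>z. gr_mult tens_pair \<theta>3 (gr_one \<theta>4 u) (x z))"
    by (rule homotopicI[OF _ _ one_mulG[OF I]]) (intro represents_ops represents_one r)+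
qed

end

section \<open>The initial data of identities and compatibilities, and the final assembly\<close>

definition tuple_data :: "(nat, nat, 'a unitization) matrix set \<Rightarrow> nat \<Rightarrow>
    ((bool \<times> nat, 'a::{comm_ring, t2_space}) mpair list \<Rightarrow> (nat, nat, 'a unitization) matrix) set" where
  "tuple_data C n = {coded (\<lambda>v. fst (v!i)) | i. i < n} \<union> {\<lambda>_. c | c. c \<in> C}"

definition homotopies :: "('a::{comm_ring, t2_space} \<Rightarrow> real) set \<Rightarrow> nat \<Rightarrow> ((bool \<times> nat, 'a) mpair list \<times> (bool \<times> nat, 'a) mpair list \<times>
    (bool \<times> bool \<times> nat, bool \<times> bool \<times> nat, 'a unitization) matrix list) set" where
  "homotopies P n = {(v, v', h). v \<in> tuples (grassmannian P) n \<and> v' \<in> tuples (grassmannian P) n \<and>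
     length h = n \<and> (\<forall>i<n. conjugates P (h!i) (v'!i) (v!i))}"

definition homotopy_data :: "('a::{comm_ring, t2_space} \<Rightarrow> real) set \<Rightarrow> (nat, nat, 'a unitization) matrix set \<Rightarrow> nat \<Rightarrow>
    ((bool \<times> nat, 'a) mpair list \<times> (bool \<times> nat, 'a) mpair list \<times>
    (bool \<times> bool \<times> nat, bool \<times> bool \<times> nat, 'a unitization) matrix list \<Rightarrow> (nat, nat, 'a unitization) matrix) set" where
  "homotopy_data P C n =
     {coded (\<lambda>(v, v', h). fst (v!i)) | i. i < n} \<union>
     {coded (\<lambda>(v, v', h). fst (v'!i)) | i. i < n} \<union>
     {coded (\<lambda>(v, v', h). h!i) | i. i < n} \<union>
     {coded (\<lambda>(v, v', h). mat_inv P (h!i)) | i. i < n} \<union>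
     {\<lambda>_. c | c. c \<in> C}"

locale tuple_setting = hring_setting P "tuples (grassmannian P) n" "tuple_data C n" \<theta>1 \<theta>2 \<theta>3 left
  for P :: "('a::{comm_ring, topological_ab_group_add, topological_semigroup_mult, t2_space} \<Rightarrow> real) set"
    and n C \<theta>1 \<theta>2 \<theta>3 left
begin

lemma represents_nth: assumes "i < n" shows "represents (\<lambda>v. v!i) (gfam (\<lambda>v. v!i))"
proof -
  have "v!i \<in> grassmannian P" if "v \<in> tuples (grassmannian P) n" for v
    using that assms by (auto simp: tuples_def)
  moreover have "coded (\<lambda>v. fst (v!i)) \<in> tuple_data C n"
    using assms unfolding tuple_data_def by blast
  ultimately show ?thesis by (intro represents_gfam)
qed

lemma identity_of_homotopic:
  assumes "homotopic l r" shows "sm_alg P (tuples (grassmannian P) n) l r" "poly_identity P C n l r"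
  using assms unfolding homotopic_def sm_alg_def poly_identity_def tuple_data_def[symmetric] by blast+

end

locale homotopy_setting = hring_setting P "homotopies P n" "homotopy_data P C n" \<theta>1 \<theta>2 \<theta>3 left
  for P :: "('a::{comm_ring, topological_ab_group_add, topological_semigroup_mult, t2_space} \<Rightarrow> real) set"
    and n C \<theta>1 \<theta>2 \<theta>3 left
begin

lemma represents_nth:
  assumes i: "i < n"
  shows "represents (\<lambda>z. fst z ! i) (gfam (\<lambda>z. fst z ! i))"
    "represents (\<lambda>z. fst (snd z) ! i) (gfam (\<lambda>z. fst (snd z) ! i))"
    "sim (gfam (\<lambda>z. fst (snd z) ! i)) (gfam (\<lambda>z. fst z ! i))"
proof -
  have G: "fst z ! i \<in> grassmannian P" "fst (snd z) ! i \<in> grassmannian P"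
    "conjugates P (snd (snd z) ! i) (fst (snd z) ! i) (fst z ! i)" if "z \<in> homotopies P n" for z
    using that i by (auto simp: tuples_def homotopies_def)
  have D: "coded (\<lambda>z. fst (fst z ! i)) \<in> homotopy_data P C n"
    "coded (\<lambda>z. fst (fst (snd z) ! i)) \<in> homotopy_data P C n"
    "coded (\<lambda>z. snd (snd z) ! i) \<in> homotopy_data P C n"
    "coded (\<lambda>z. mat_inv P (snd (snd z) ! i)) \<in> homotopy_data P C n"
    using i unfolding homotopy_data_def case_prod_beta' by blast+
  show "represents (\<lambda>z. fst z ! i) (gfam (\<lambda>z. fst z ! i))"
    "represents (\<lambda>z. fst (snd z) ! i) (gfam (\<lambda>z. fst (snd z) ! i))"
    using represents_gfam[of "\<lambda>z. fst z ! i", OF G(1) D(1)]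
      represents_gfam[of "\<lambda>z. fst (snd z) ! i", OF G(2) D(2)] by simp_all
  show "sim (gfam (\<lambda>z. fst (snd z) ! i)) (gfam (\<lambda>z. fst z ! i))"
    using G(1) D(1) G(2) D(2) G(3) D(3,4) by (rule sim_of_homotopy)
qed

lemma compatible_of_homotopic:
  assumes "homotopic (\<lambda>z. Op (fst z)) (\<lambda>z. Op (fst (snd z)))" shows "poly_compatible P C n Op"
proof -
  obtain g where g: "assembled (homotopy_data P C n) g"
    "\<And>z. z \<in> homotopies P n \<Longrightarrow> conjugates P (g z) (Op (fst (snd z))) (Op (fst z))"
    using assms unfolding homotopic_def by blast
  have "conjugates P (g (v, v', h)) (Op v') (Op v)"
    if "v \<in> tuples (grassmannian P) n" "v' \<in> tuples (grassmannian P) n"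
      "length h = n \<and> (\<forall>i<n. conjugates P (h!i) (v'!i) (v!i))" for v v' h
    using g(2)[of "(v, v', h)"] that by (simp add: homotopies_def)
  with g(1) show ?thesis unfolding poly_compatible_def homotopy_data_def by blast
qed

end

text \<open>One map \<open>g\<close> works for all tuples and all conjugating elements, so it may be
  evaluated along arbitrary maps from \<open>X\<close> and homotopies chosen for them.\<close>

lemma respects_of_compatible:
  assumes "Op ` tuples (grassmannian P) n \<subseteq> grassmannian P" "poly_compatible P C n Op"
  shows "respects_sm_alg P X n Op"
  unfolding respects_sm_alg_def
proof (intro allI impI)
  fix f f' assume f: "\<forall>i<n. sm_alg P X (f i) (f' i)"
  obtain g where g: "\<And>v v' h. \<lbrakk>v \<in> tuples (grassmannian P) n; v' \<in> tuples (grassmannian P) n; length h = n;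
      \<forall>i<n. conjugates P (h!i) (v'!i) (v!i)\<rbrakk> \<Longrightarrow> conjugates P (g (v, v', h)) (Op v') (Op v)"
    using assms(2) unfolding poly_compatible_def by blast
  have "\<forall>i. \<exists>h. i < n \<longrightarrow> (\<forall>x\<in>X. conjugates P (h x) (f' i x) (f i x))"
    using f unfolding sm_alg_def by blast
  then obtain h where h: "\<And>i x. i < n \<Longrightarrow> x \<in> X \<Longrightarrow> conjugates P (h i x) (f' i x) (f i x)"
    by metis
  have t: "map (\<lambda>i. f i x) [0..<n] \<in> tuples (grassmannian P) n" "map (\<lambda>i. f' i x) [0..<n] \<in> tuples (grassmannian P) n"
    if "x \<in> X" for x
    using f that unfolding sm_alg_def tuples_def by (auto 0 4)
  have "conjugates P (g (map (\<lambda>i. f i x) [0..<n], map (\<lambda>i. f' i x) [0..<n], map (\<lambda>i. h i x) [0..<n]))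
      (Op (map (\<lambda>i. f' i x) [0..<n])) (Op (map (\<lambda>i. f i x) [0..<n]))" if "x \<in> X" for x
    using that h by (intro g t) auto
  then show "sm_alg P X (\<lambda>x. Op (map (\<lambda>i. f i x) [0..<n])) (\<lambda>x. Op (map (\<lambda>i. f' i x) [0..<n]))"
    unfolding sm_alg_def using t assms(1) by (intro conjI exI[of _ "\<lambda>x. g (map (\<lambda>i. f i x) [0..<n], map (\<lambda>i. f' i x) [0..<n], map (\<lambda>i. h i x) [0..<n])"]) auto
qed

lemma homotopy_hringI:
  assumes "\<And>n Op. (n, Op) \<in> ops \<Longrightarrow> Op ` tuples (grassmannian P) n \<subseteq> grassmannian P \<and> poly_compatible P C n Op"
    and "\<And>n l r. (n, l, r) \<in> ids \<Longrightarrow> sm_alg P (tuples (grassmannian P) n) l r \<and> poly_identity P C n l r"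
  shows "homotopy_hring P X C ops ids"
  unfolding homotopy_hring_def
proof (intro conjI ballI)
  fix x assume "x \<in> ops"
  then obtain n Op where x: "x = (n, Op)" "(n, Op) \<in> ops" by (cases x) auto
  show "case x of (n, Op) \<Rightarrow> Op ` tuples (grassmannian P) n \<subseteq> grassmannian P"
    "case x of (n, Op) \<Rightarrow> poly_compatible P C n Op"
    using assms(1)[OF x(2)] by (auto simp: x(1))
  show "case x of (n, Op) \<Rightarrow> respects_sm_alg P X n Op"
    using assms(1)[OF x(2)] respects_of_compatible[of Op P n C X] by (simp add: x(1))
next
  fix x assume "x \<in> ids"
  then obtain n l r where x: "x = (n, l, r)" "(n, l, r) \<in> ids" by (cases x) auto
  show "case x of (n, l, r) \<Rightarrow> sm_alg P (tuples (grassmannian P) n) l r"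
    "case x of (n, l, r) \<Rightarrow> poly_identity P C n l r"
    using assms(2)[OF x(2)] by (auto simp: x(1))
qed

context tuple_setting
begin

lemma represents_closed:
  assumes "represents Op A" shows "Op ` tuples (grassmannian P) n \<subseteq> grassmannian P"
  using homotopic_refl[OF assms] unfolding homotopic_def by blast

lemma operations_closed:
  assumes "(n, Op) \<in> hring_operations (gr_add \<theta>1) (gr_neg \<theta>2) gr_zero (gr_mult tens_pair \<theta>3)"
  shows "Op ` tuples (grassmannian P) n \<subseteq> grassmannian P"
proof -
  note r = represents_nth
  consider "n = 2" "Op = (\<lambda>v. gr_add \<theta>1 (v!0) (v!1))" | "n = 1" "Op = (\<lambda>v. gr_neg \<theta>2 (v!0))"
    | "n = 0" "Op = (\<lambda>v. gr_zero)" | "n = 2" "Op = (\<lambda>v. gr_mult tens_pair \<theta>3 (v!0) (v!1))"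
    using assms unfolding hring_operations_def by blast
  then show ?thesis
  proof cases
    case 1 then show ?thesis using represents_closed[OF represents_add[OF r[of 0] r[of 1]]] by simp
  next
    case 2 then show ?thesis using represents_closed[OF represents_neg[OF r[of 0]]] by simp
  next
    case 3 then show ?thesis using represents_closed[OF represents_zero] by simp
  next
    case 4 then show ?thesis using represents_closed[OF represents_mult[OF r[of 0] r[of 1]]] by simp
  qed
qed

lemma identities_hold:
  assumes "(n, l, r) \<in> hring_identities (gr_add \<theta>1) (gr_neg \<theta>2) gr_zero (gr_mult tens_pair \<theta>3)"
  shows "homotopic l r"
proof -
  note r = represents_nth
  have 3: "homotopic l r" if "n = 3"
    using assms homotopic_identities(1-4)[OF r[of 0] r[of 1] r[of 2]] that
    unfolding hring_identities_def by auto
  have 2: "homotopic l r" if "n = 2"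
    using assms homotopic_identities(5,6)[OF r[of 0] r[of 1] r[of 1]] that
    unfolding hring_identities_def by auto
  have 1: "homotopic l r" if "n = 1"
    using assms homotopic_identities(7,8)[OF r[of 0] r[of 0] r[of 0]] that
    unfolding hring_identities_def by auto
  have "n = 1 \<or> n = 2 \<or> n = 3" using assms unfolding hring_identities_def by blast
  then show ?thesis using 1 2 3 by blast
qed

end

lemma (in homotopy_setting) operations_compatible:
  assumes "(n, Op) \<in> hring_operations (gr_add \<theta>1) (gr_neg \<theta>2) gr_zero (gr_mult tens_pair \<theta>3)"
  shows "poly_compatible P C n Op"
proof (rule compatible_of_homotopic)
  note r = represents_nth
  consider "n = 2" "Op = (\<lambda>v. gr_add \<theta>1 (v!0) (v!1))" | "n = 1" "Op = (\<lambda>v. gr_neg \<theta>2 (v!0))"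
    | "n = 0" "Op = (\<lambda>v. gr_zero)" | "n = 2" "Op = (\<lambda>v. gr_mult tens_pair \<theta>3 (v!0) (v!1))"
    using assms unfolding hring_operations_def by blast
  then show "homotopic (\<lambda>z. Op (fst z)) (\<lambda>z. Op (fst (snd z)))"
  proof cases
    case 1 then show ?thesis
      using homotopic_cong(1)[OF r(1)[of 0] r(2)[of 0] r(1)[of 1] r(2)[of 1] r(3)[of 0] r(3)[of 1]] by simp
  next
    case 2 then show ?thesis
      using homotopic_cong(3)[OF r(1)[of 0] r(2)[of 0] r(1)[of 0] r(2)[of 0] r(3)[of 0] r(3)[of 0]] by simp
  next
    case 3 then show ?thesis using homotopic_refl[OF represents_zero] by simp
  next
    case 4 then show ?thesis
      using homotopic_cong(2)[OF r(1)[of 0] r(2)[of 0] r(1)[of 1] r(2)[of 1] r(3)[of 0] r(3)[of 1]] by simp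
  qed
qed

theorem theorem4p10:
  fixes P :: "('a::{comm_ring, topological_ab_group_add, topological_semigroup_mult, t2_space} \<Rightarrow> real) set"
    and X :: "'x set"
    and tensor :: "(bool \<times> nat, 'a) mpair \<Rightarrow> (bool \<times> nat, 'a) mpair \<Rightarrow>
                     ((bool \<times> nat) \<times> (bool \<times> nat), 'a) mpair"
    and \<theta>1 :: "(bool \<times> nat) + (bool \<times> nat) \<Rightarrow> nat"
    and \<theta>2 :: "bool \<times> nat \<Rightarrow> nat"
    and \<theta>3 :: "(bool \<times> nat) \<times> (bool \<times> nat) \<Rightarrow> nat"
    and \<theta>4 :: "unit \<Rightarrow> nat"
  assumes "polymetric P"
    and "sequentially_complete TYPE('a)"
    and "relabeling \<theta>1" and "relabeling \<theta>2" and "relabeling \<theta>3" and "relabeling \<theta>4"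
    and "tensor = pair_tensor_left \<or> tensor = pair_tensor_right"
  shows "homotopy_hring P X {}
           (hring_operations (gr_add \<theta>1) (gr_neg \<theta>2) gr_zero (gr_mult tensor \<theta>3))
           (hring_identities (gr_add \<theta>1) (gr_neg \<theta>2) gr_zero (gr_mult tensor \<theta>3)) \<and>
         (\<forall>u. (\<forall>a. u * a = a) \<longrightarrow>
           homotopy_hring P X {relabel code (fst (pair_one u))}
             {(0, \<lambda>v. gr_one \<theta>4 u)}
             (hring_unit_identities (gr_mult tensor \<theta>3) (gr_one \<theta>4 u)))"
proof (intro conjI allI impI)
  define left where "left = (tensor = pair_tensor_left)"
  have complete: "complete_polymetric P" using assms(1,2) by (simp add: complete_polymetric_def)
  \<comment> \<open>This is a statement about \<open>P\<close> and the relabelings alone, so the one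
    fact serves tuples of every length as well as triples with conjugating elements.\<close>
  have s: "hring_setting P \<theta>1 \<theta>2 \<theta>3" using complete assms(3-5) by (rule hring_setting.intro)
  have tensor: "tensor = hring_setting.tens_pair left"
    using assms(7) by (auto simp: hring_setting.tens_pair_def[OF s] left_def)
  have t: "tuple_setting P \<theta>1 \<theta>2 \<theta>3" and h: "homotopy_setting P \<theta>1 \<theta>2 \<theta>3"
    by (rule tuple_setting.intro[OF s], rule homotopy_setting.intro[OF s])
  show "homotopy_hring P X {}
           (hring_operations (gr_add \<theta>1) (gr_neg \<theta>2) gr_zero (gr_mult tensor \<theta>3))
           (hring_identities (gr_add \<theta>1) (gr_neg \<theta>2) gr_zero (gr_mult tensor \<theta>3))"
    unfolding tensor
    by (intro homotopy_hringI conjI tuple_setting.operations_closed[OF t] homotopy_setting.operations_compatible[OF h]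
        tuple_setting.identity_of_homotopic[OF t] tuple_setting.identities_hold[OF t])
  fix u :: 'a assume u: "\<forall>a. u * a = a"
  let ?C = "{relabel code (fst (pair_one u))} :: (nat, nat, 'a unitization) matrix set"
  have C: "(\<lambda>_. relabel code (fst (pair_one u))) \<in> tuple_data ?C n"
    "(\<lambda>_. relabel code (fst (pair_one u))) \<in> homotopy_data P ?C n" for n
    unfolding tuple_data_def homotopy_data_def by blast+
  \<comment> \<open>The unital setting requires the matrix of \<open>u\<close> as an initial datum,
    which \<open>?C\<close> provides for every arity.\<close>
  have tu: "unital_hring_setting P (tuple_data ?C n) \<theta>1 \<theta>2 \<theta>3 u \<theta>4" for n
    using s assms(6) u C(1) by (intro unital_hring_setting.intro unital_hring_setting_axioms.intro) auto
  have hu: "unital_hring_setting P (homotopy_data P ?C n) \<theta>1 \<theta>2 \<theta>3 u \<theta>4" for n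
    using s assms(6) u C(2) by (intro unital_hring_setting.intro unital_hring_setting_axioms.intro) auto
  show "homotopy_hring P X ?C {(0, \<lambda>v. gr_one \<theta>4 u)}
      (hring_unit_identities (gr_mult tensor \<theta>3) (gr_one \<theta>4 u))"
    unfolding tensor
  proof (rule homotopy_hringI)
    fix n Op assume "(n, Op) \<in> {(0 :: nat, \<lambda>v :: (bool \<times> nat, 'a) mpair list. gr_one \<theta>4 u)}"
    then have Op: "Op = (\<lambda>v. gr_one \<theta>4 u)" by simp
    show "Op ` tuples (grassmannian P) n \<subseteq> grassmannian P \<and> poly_compatible P ?C n Op"
      unfolding Op
      using tuple_setting.represents_closed[OF t unital_hring_setting.represents_one[OF tu]]
        homotopy_setting.compatible_of_homotopic[OF h hring_setting.homotopic_refl[OF s unital_hring_setting.represents_one[OF hu]]]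
      by blast
  next
    fix n l r assume "(n, l, r) \<in> hring_unit_identities (gr_mult (hring_setting.tens_pair left) \<theta>3) (gr_one \<theta>4 u)"
    then have "hring_setting.homotopic P (tuples (grassmannian P) n) (tuple_data ?C n) l r"
      using unital_hring_setting.homotopic_unit[OF tu tuple_setting.represents_nth[OF t], of 0 n]
      unfolding hring_unit_identities_def by auto
    then show "sm_alg P (tuples (grassmannian P) n) l r \<and> poly_identity P ?C n l r"
      using tuple_setting.identity_of_homotopic[OF t] by blast
  qed
qed

end
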